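(* Fix $\beta\in[0,\frac12)$, constants $0<\underline{c}\le\overline{c}$, and a constant $c_0>0$. There exist constants $C_0,c,C>0$ depending only on $\beta,\underline{c},\overline{c},c_0$ such that for every integer $K\ge 2$, every $\sigma>0$ with $\sigma^2\ge c_0K^{1-2\beta}$, and every integer $N\ge C_0K^{6\beta}\sigma^6\log K$, $$c\,\frac{K^{4\beta}\sigma^6}{N}\;\le\;\inf_{\hat\theta}\,\sup_{\theta^*\in\Theta_\beta}\mathbb{E}_{\theta^*}\big[L(\hat\theta,\theta^* )\big]\;\le\; C\,\frac{K^{4\beta}\sigma^6}{N},$$ where the infimum is over all estimators $\hat\theta=\hat\theta(y^{(1)},\dots,y^{(N)})\in\mathbb{R}^{2K}$.
   Context: Let $K\ge2$, $N\ge1$ be integers and $\sigma>0$ known. For $\theta=(\theta_{1,1},\theta_{1,2},\dots,\theta_{K,1},\theta_{K,2})\in\mathbb{R}^{2K}$ let $r_k(\theta)=(\theta_{k,1}^2+\theta_{k,2}^2)^{1/2}$ for $k=1,\dots,K$. For $\alpha\in\mathcal{A}=[-\pi,\pi)$ let $g(\alpha)\in\mathbb{R}^{2K\times 2K}$ be the block-diagonal orthogonal matrix whose $k$-th $2\times2$ block is $\begin{pmatrix}\cos k\alpha&-\sin k\alpha\\ \sin k\alpha&\cos k\alpha\end{pmatrix}$, acting on $(\theta_{k,1},\theta_{k,2})$. Multi-reference alignment model with true parameter $\theta^*\in\mathbb{R}^{2K}$: one observes $y^{(m)}=g(\alpha^{(m)})\theta^*+\sigma\varepsilon^{(m)}\in\mathbb{R}^{2K}$,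 $m=1,\dots,N$, where $\alpha^{(1)},\dots,\alpha^{(N)}$ are i.i.d. uniform on $[-\pi,\pi)$, $\varepsilon^{(1)},\dots,\varepsilon^{(N)}$ are i.i.d. $\mathcal{N}(0,I_{2K})$, and these are independent. $\mathbb{E}_{\theta^*}$ is the expectation over these $N$ samples. The loss is $L(\hat\theta,\theta)=\min_{\alpha\in\mathcal{A}}\|\hat\theta-g(\alpha)\theta\|^2$ (Euclidean norm). The parameter space is $\Theta_\beta=\{\theta^*\in\mathbb{R}^{2K}:\ \underline{c}\,k^{-\beta}\le r_k(\theta^* )\le\overline{c}\,k^{-\beta}\ \text{for all }k=1,\dots,K\}$. *)

theory Defs
  imports "HOL-Probability.Probability"
begin

text \<open>
  Since \<open>K\<close> varies inside the statement (the constants must not depend on it), a vector of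
  \<open>\<real>\<^sup>2\<^sup>K\<close> is an extensional real function on the index set \<open>coords K\<close>, whose element \<open>(k, j)\<close>
  is the index of the coordinate \<open>\<theta>\<^sub>k\<^sub>,\<^sub>j\<close>; the Euclidean norm is \<^const>\<open>L2_set\<close> over \<open>coords K\<close>.
\<close>

type_synonym rvec = "nat \<times> nat \<Rightarrow> real"

definition coords :: "nat \<Rightarrow> (nat \<times> nat) set" where
  "coords K = {1..K} \<times> {1, 2}"

definition vec_space :: "nat \<Rightarrow> rvec measure" where
  "vec_space K = (\<Pi>\<^sub>M i\<in>coords K. borel)"

definition amplitude :: "rvec \<Rightarrow> nat \<Rightarrow> real" where
  "amplitude \<theta> k = sqrt ((\<theta> (k, 1))\<^sup>2 + (\<theta> (k, 2))\<^sup>2)"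

text \<open>\<open>rot K \<alpha> \<theta>\<close> is the matrix-vector product \<open>g(\<alpha>) \<theta>\<close>, written out blockwise.\<close>

definition rot :: "nat \<Rightarrow> real \<Rightarrow> rvec \<Rightarrow> rvec" where
  "rot K \<alpha> \<theta> = (\<lambda>(k, j)\<in>coords K.
     if j = 1 then cos (real k * \<alpha>) * \<theta> (k, 1) - sin (real k * \<alpha>) * \<theta> (k, 2)
     else sin (real k * \<alpha>) * \<theta> (k, 1) + cos (real k * \<alpha>) * \<theta> (k, 2))"

definition angles :: "real set" where
  "angles = {-pi..<pi}"

text \<open>
  The infimum is a minimum (see \<open>loss_attained\<close> below), because the distance is continuous and
  \<open>2\<pi>\<close>-periodic in \<open>\<alpha>\<close>.
\<close>

definition loss :: "nat \<Rightarrow> rvec \<Rightarrow> rvec \<Rightarrow> real" where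
  "loss K \<theta>' \<theta> = (INF \<alpha>\<in>angles. (L2_set (\<lambda>i. \<theta>' i - rot K \<alpha> \<theta> i) (coords K))\<^sup>2)"

definition gaussian_noise :: "nat \<Rightarrow> rvec measure" where
  "gaussian_noise K = (\<Pi>\<^sub>M i\<in>coords K. std_normal_distribution)"

text \<open>The law of one observation \<open>g(\<alpha>) \<theta> + \<sigma> \<epsilon>\<close>.\<close>

definition obs_law :: "nat \<Rightarrow> real \<Rightarrow> rvec \<Rightarrow> rvec measure" where
  "obs_law K \<sigma> \<theta> =
     distr (uniform_measure lborel angles \<Otimes>\<^sub>M gaussian_noise K) (vec_space K)
       (\<lambda>(\<alpha>, \<epsilon>). \<lambda>i\<in>coords K. rot K \<alpha> \<theta> i + \<sigma> * \<epsilon> i)"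

definition sample_law :: "nat \<Rightarrow> nat \<Rightarrow> real \<Rightarrow> rvec \<Rightarrow> (nat \<Rightarrow> rvec) measure" where
  "sample_law K N \<sigma> \<theta> = (\<Pi>\<^sub>M m\<in>{1..N}. obs_law K \<sigma> \<theta>)"

definition estimators :: "nat \<Rightarrow> nat \<Rightarrow> ((nat \<Rightarrow> rvec) \<Rightarrow> rvec) set" where
  "estimators K N = (\<Pi>\<^sub>M m\<in>{1..N}. vec_space K) \<rightarrow>\<^sub>M vec_space K"

text \<open>The expectation of the nonnegative loss is taken in \<open>[0, \<infinity>]\<close>.\<close>

definition risk :: "nat \<Rightarrow> nat \<Rightarrow> real \<Rightarrow> ((nat \<Rightarrow> rvec) \<Rightarrow> rvec) \<Rightarrow> rvec \<Rightarrow> ennreal" where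
  "risk K N \<sigma> est \<theta> = (\<integral>\<^sup>+ y. ennreal (loss K (est y) \<theta>) \<partial>sample_law K N \<sigma> \<theta>)"

definition param_space :: "nat \<Rightarrow> real \<Rightarrow> real \<Rightarrow> real \<Rightarrow> rvec set" where
  "param_space K \<beta> c_lo c_hi =
     {\<theta> \<in> coords K \<rightarrow>\<^sub>E UNIV. \<forall>k\<in>{1..K}.
        c_lo * real k powr (- \<beta>) \<le> amplitude \<theta> k \<and> amplitude \<theta> k \<le> c_hi * real k powr (- \<beta>)}"

definition minimax_risk :: "nat \<Rightarrow> nat \<Rightarrow> real \<Rightarrow> rvec set \<Rightarrow> ennreal" where
  "minimax_risk K N \<sigma> \<Theta> = (INF est\<in>estimators K N. SUP \<theta>\<in>\<Theta>. risk K N \<sigma> est \<theta>)"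

lemma loss_attained:
  "\<exists>\<alpha>\<in>angles. loss K \<theta>' \<theta> = (L2_set (\<lambda>i. \<theta>' i - rot K \<alpha> \<theta> i) (coords K))\<^sup>2"
proof -
  define f where "f \<alpha> = (L2_set (\<lambda>i. \<theta>' i - rot K \<alpha> \<theta> i) (coords K))\<^sup>2" for \<alpha>
  have fin: "finite (coords K)"
    by (simp add: coords_def)
  have f_eq: "f \<alpha> = (\<Sum>(k, j)\<in>coords K. (\<theta>' (k, j) -
     (if j = 1 then cos (real k * \<alpha>) * \<theta> (k, 1) - sin (real k * \<alpha>) * \<theta> (k, 2)
     else sin (real k * \<alpha>) * \<theta> (k, 1) + cos (real k * \<alpha>) * \<theta> (k, 2)))\<^sup>2)" for \<alpha>
    unfolding f_def L2_set_def rot_def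
    by (subst real_sqrt_pow2) (auto intro!: sum_nonneg sum.cong)
  have cont: "continuous_on {-pi..pi} f"
    unfolding f_eq case_prod_unfold
  proof (intro continuous_on_sum continuous_intros)
    fix i :: "nat \<times> nat"
    show "continuous_on {-pi..pi} (\<lambda>\<alpha>. if snd i = 1
       then cos (real (fst i) * \<alpha>) * \<theta> (fst i, 1) - sin (real (fst i) * \<alpha>) * \<theta> (fst i, 2)
       else sin (real (fst i) * \<alpha>) * \<theta> (fst i, 1) + cos (real (fst i) * \<alpha>) * \<theta> (fst i, 2))"
      by (cases "snd i = 1") (auto intro!: continuous_intros)
  qed
  obtain a where a: "a \<in> {-pi..pi}" "\<And>x. x \<in> {-pi..pi} \<Longrightarrow> f a \<le> f x"
    using continuous_attains_inf[OF compact_Icc _ cont] by (auto simp: pi_ge_zero)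
  have per: "f pi = f (-pi)"
    unfolding f_eq by (intro sum.cong) auto
  obtain b where b: "b \<in> angles" "f b = f a"
  proof (cases "a = pi")
    case True
    then show ?thesis using that[of "-pi"] per by (simp add: angles_def)
  next
    case False
    then show ?thesis using that[of a] a(1) by (simp add: angles_def)
  qed
  have "loss K \<theta>' \<theta> = f b"
    unfolding loss_def f_def[symmetric]
  proof (rule cInf_eq_minimum)
    show "f b \<in> f ` angles"
      using b(1) by (rule imageI)
  qed (use b(2) a(2) in \<open>auto simp: angles_def\<close>)
  with b(1) show ?thesis by (auto simp: f_def)
qed

lemma prob_space_obs_law: "prob_space (obs_law K \<sigma> \<theta>)"
proof -
  interpret U: prob_space "uniform_measure lborel angles"
    by (rule prob_space_uniform_measure) (auto simp: angles_def)
  interpret Z: prob_space "gaussian_noise K"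
    unfolding gaussian_noise_def
    by (rule prob_space_PiM) (rule real_distribution.axioms(1)[OF real_dist_normal_dist])
  interpret UZ: pair_prob_space "uniform_measure lborel angles" "gaussian_noise K" ..
  have sets_eq: "sets (uniform_measure lborel angles \<Otimes>\<^sub>M gaussian_noise K)
      = sets (borel \<Otimes>\<^sub>M (\<Pi>\<^sub>M i\<in>coords K. borel))"
    unfolding gaussian_noise_def
    by (intro sets_pair_measure_cong sets_PiM_cong) auto
  show ?thesis
    unfolding obs_law_def
  proof (rule UZ.prob_space_distr)
    have "(\<lambda>(\<alpha>, \<epsilon>). \<lambda>i\<in>coords K. rot K \<alpha> \<theta> i + \<sigma> * \<epsilon> i)
        \<in> (borel \<Otimes>\<^sub>M (\<Pi>\<^sub>M i\<in>coords K. borel)) \<rightarrow>\<^sub>M vec_space K"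
      unfolding vec_space_def case_prod_unfold
    proof (rule measurable_restrict)
      fix i assume i: "i \<in> coords K"
      have "(\<lambda>\<alpha>. rot K \<alpha> \<theta> i) \<in> borel_measurable borel"
        using i by (cases i; cases "snd i = 1") (auto simp: rot_def)
      then show "(\<lambda>x. rot K (fst x) \<theta> i + \<sigma> * snd x i)
          \<in> borel_measurable (borel \<Otimes>\<^sub>M (\<Pi>\<^sub>M i\<in>coords K. borel))"
        using i by measurable
    qed
    then show "(\<lambda>(\<alpha>, \<epsilon>). \<lambda>i\<in>coords K. rot K \<alpha> \<theta> i + \<sigma> * \<epsilon> i)
        \<in> (uniform_measure lborel angles \<Otimes>\<^sub>M gaussian_noise K) \<rightarrow>\<^sub>M vec_space K"
      using measurable_cong_sets[OF sets_eq refl] by blast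
  qed
qed

end

theory Submission
  imports Defs
begin

text \<open>
  Upper bound. One block of the sample serves as a pilot: a majority vote over sub-blocks on the phases of the
  empirical bispectrum, whose entries \<open>(k, l)\<close> estimate \<open>\<theta>\<^sub>k \<theta>\<^sub>l cnj \<theta>\<^sub>k\<^sub>+\<^sub>l\<close>, confines the phases up to a
  rotation to a neighbourhood in which the coboundary \<open>u \<mapsto> u\<^sub>k + u\<^sub>l - u\<^sub>k\<^sub>+\<^sub>l\<close> is injective modulo \<open>k \<mapsto> k s\<close>. On the
  remaining sample one minimises a weighted sum of cosines of the bispectrum phases over the pairs with \<open>k + l > K / 4\<close>;
  a spectral gap of the coboundary on these pairs turns the criterion's noise, of variance \<open>\<sigma>\<^sup>6 / N\<close>, into the rate.

  Lower bound. Assouad's lemma over phase perturbations of the high frequencies. The second moments of the likelihood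
  ratio are rotation averages \<open>E exp (\<Sum> a\<^sub>k cos (k t + u\<^sub>k))\<close>. A shift of the single phase \<open>u\<^sub>k\<close> by \<open>d\<close> changes such an
  average only through the \<open>k\<close>-th Fourier coefficient of the exponential of the other modes, so the chi-square
  distance of one observation is of order \<open>d\<^sup>2 K \<kappa>\<^sub>K\<^sup>6 / \<sigma>\<^sup>6\<close>, where \<open>\<kappa>\<^sub>k = k powr (- \<beta>)\<close>.
\<close>

text \<open>The obstacle of the upper bound is dimension: about \<open>K^2\<close> bispectrum
  entries serve \<open>2 * K\<close> unknowns, and the spectral gap is only of order
  \<open>K (\<kappa> K)^4\<close>. Bounding the noise entry by entry would lose a factor
  \<open>K\<close>. It is therefore paired with the coboundary by summation by parts; the resulting
  \<open>score\<close> has only \<open>K\<close> coordinates, each a sum of nearly orthogonal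
  entries, and the gap is used twice. Only the amplitude errors, of variance of order
  \<open>\<sigma>^4\<close>, can be afforded pair by pair; there and in the moment bounds the
  condition that \<open>K (\<kappa> K)^2\<close> is at most of order \<open>\<sigma>^2\<close>
  removes the remaining powers of \<open>K\<close>. The bispectrum enters the criterion linearly and
  the cosines carry clamped amplitudes, so strong convexity holds on every sample. A cubic in
  Gaussians has no exponential moments; the votes make up for them, so that the failure probability
  survives a union over all pairs. In the lower bound the power \<open>\<sigma>^6\<close> arises
  because the perturbed frequency is absent from the terms of order zero and one in the exponential
  of the other modes.\<close>

section \<open>Spectral gap of the coboundary on pairs with large sum\<close>

definition high_pairs :: "nat => (nat \<times> nat) set" where "high_pairs K = {(k, l). 1 \<le> k \<and> 1 \<le> l \<and> k + l \<le> K \<and> K < 4 * (k + l)}"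

lemma finite_high_pairs [simp]: "finite (high_pairs K)"
  by (rule finite_subset[of _ "{..K} \<times> {..K}"]) (auto simp: high_pairs_def)

lemma sum_high_pairs_diagonals:
  fixes f :: "nat => nat => real"
  shows "(\<Sum>(k, l)\<in>high_pairs K. f k l) = (\<Sum>j\<in>{j. K < 4 * j \<and> j \<le> K}. \<Sum>i=1..<j. f i (j - i))"
proof -
  have fin: "finite {j. K < 4 * j \<and> j \<le> K}" by (rule finite_subset[of _ "{..K}"]) auto
  have "(\<Sum>j\<in>{j. K < 4 * j \<and> j \<le> K}. \<Sum>i=1..<j. f i (j - i)) = (\<Sum>(j, i)\<in>(SIGMA j:{j. K < 4 * j \<and> j \<le> K}. {1..<j}). f i (j - i))"
    using fin by (subst sum.Sigma) auto
  also have "... = (\<Sum>(k, l)\<in>high_pairs K. f k l)"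
    by (rule sum.reindex_bij_witness[where i="\<lambda>(k, l). (k + l, k)" and j="\<lambda>(j, i). (i, j - i)"]) (auto simp: high_pairs_def)
  finally show ?thesis by simp
qed

lemma power2_sum3_le: "(x + y + z)^2 \<le> 3 * (x^2 + y^2 + z^2)" for x y z :: real
proof -
  have "0 \<le> (x - y)^2 + (y - z)^2 + (x - z)^2" by simp
  then show ?thesis by (simp add: power2_eq_square algebra_simps)
qed

lemma power2_sum2_le: "(x + y)^2 \<le> 2 * (x^2 + y^2)" for x y :: real
proof -
  have "0 \<le> (x - y)^2" by simp
  then show ?thesis by (simp add: power2_eq_square algebra_simps)
qed

text \<open>The block between \<open>K / 4\<close> and \<open>K / 2\<close> supplies the second
  indices over which low frequencies are averaged. The estimate of the two floors suffices from
  \<open>K = 6\<close> on; the smaller values are checked one by one.\<close>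

lemma card_middle_block:
  assumes "2 \<le> K"
  shows "real K \<le> 6 * real (card {l. K < 4 * l \<and> 2 * l \<le> K})"
proof -
  have "{l. K < 4 * l \<and> 2 * l \<le> K} = {K div 4 + 1..K div 2}" by auto
  then have "card {l. K < 4 * l \<and> 2 * l \<le> K} = K div 2 - K div 4" by simp
  moreover have "K \<le> 6 * (K div 2 - K div 4)"
  proof (cases "K < 6")
    case True
    then have "K = 2 \<or> K = 3 \<or> K = 4 \<or> K = 5" using assms by linarith
    then show ?thesis by auto
  next
    case False
    have "K \<le> 2 * (K div 2) + 1" "4 * (K div 4) \<le> K" by simp_all
    then show ?thesis using False by linarith
  qed
  ultimately have "K \<le> 6 * card {l. K < 4 * l \<and> 2 * l \<le> K}" by simp
  then have "real K \<le> real (6 * card {l. K < 4 * l \<and> 2 * l \<le> K})" by (rule of_nat_mono)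
  then show ?thesis by simp
qed

text \<open>The sum of the coboundary over the antidiagonal \<open>k + l = j\<close> is a
  combination of \<open>h j\<close> and the partial sum of the smaller indices. Divided by
  \<open>j (j + 1)\<close>, the partial sums of a linear sequence are constant, so in general their
  increments consist of coboundary terms alone. They telescope down from the partial sum at
  \<open>K\<close>, which is zero.\<close>

lemma telescoped_tail_bound:
  fixes h :: "nat => real"
  assumes zero: "(\<Sum>i=1..K. h i) = 0"
  defines "R \<equiv> (\<Sum>(k, l)\<in>high_pairs K. (h k + h l - h (k + l))^2)"
  assumes j: "2 \<le> j" "K < 4 * j" "j \<le> K"
  shows "(\<Sum>i=1..<j. h i)^2 * (real j)^2 \<le> 8 * R * (real j - 1)^2"
proof -
  define T where "T j = (\<Sum>i=1..j. h i)" for j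
  define \<alpha> where "\<alpha> j = (\<Sum>i=1..<j. h i + h (j - i) - h j)" for j
  define Q where "Q j = (\<Sum>i=1..<j. (h i + h (j - i) - h (i + (j - i)))^2)" for j
  have R: "R = (\<Sum>j\<in>{j. K < 4 * j \<and> j \<le> K}. Q j)" unfolding R_def Q_def by (rule sum_high_pairs_diagonals)
  have Q_nonneg: "0 \<le> Q i" for i unfolding Q_def by (intro sum_nonneg) auto
  have fin: "finite {j. K < 4 * j \<and> j \<le> K}" by (rule finite_subset[of _ "{..K}"]) auto
  have alpha_sq: "(\<alpha> i)^2 \<le> real (i - 1) * Q i" for i
  proof -
    have "(\<alpha> i)^2 \<le> (\<Sum>m=1..<i. (1::real)^2) * Q i" unfolding \<alpha>_def Q_def
      using Cauchy_Schwarz_ineq_sum[of "\<lambda>_. 1" "\<lambda>m. h m + h (i - m) - h i" "{1..<i}"] by simp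
    then show ?thesis by simp
  qed
  have rev: "(\<Sum>i=1..<j. h (j - i)) = (\<Sum>i=1..<j. h i)" for j
    by (rule sum.reindex_bij_witness[where i="\<lambda>i. j - i" and j="\<lambda>i. j - i"]) auto
  have T_less: "(\<Sum>i=1..<Suc j. h i) = T j" for j unfolding T_def by (simp add: atLeastLessThanSuc_atLeastAtMost)
  have alpha_eq: "\<alpha> (Suc j) = 2 * T j - real j * h (Suc j)" for j unfolding \<alpha>_def using rev[of "Suc j"] T_less[of j]
    by (simp add: sum.distrib sum_subtractf del: sum.op_ivl_Suc)
  have T_Suc: "T (Suc j) = T j + h (Suc j)" for j by (simp add: T_def)
  \<comment> \<open>For linear \<open>h\<close> the quotient \<open>c\<close> is constant. The
    denominators are those for which \<open>T\<close> drops out of the recursion, so that the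
    decrement \<open>d\<close> contains only \<open>\<alpha>\<close>.\<close>
  define c where "c j = T j / (real j * (real j + 1))" for j
  define d where "d j = \<alpha> j / ((real j - 1) * real j * (real j + 1))" for j
  have c_step: "c j = c (Suc j) + d (Suc j)" if "1 \<le> j" for j
  proof -
    have j0: "real j > 0" using that by simp
    have "real j * T (Suc j) = (real j + 2) * T j - \<alpha> (Suc j)" unfolding T_Suc alpha_eq by (simp add: algebra_simps)
    then have e: "real j * T (Suc j) + \<alpha> (Suc j) = (real j + 2) * T j" by simp
    have "c (Suc j) + d (Suc j) = (real j * T (Suc j) + \<alpha> (Suc j)) / (real j * (real j + 1) * (real j + 2))"
      using j0 unfolding c_def d_def by (simp add: divide_simps) (simp add: algebra_simps)
    also have "... = c j" unfolding e c_def using j0 by simp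
    finally show ?thesis by simp
  qed
  have c_sum: "c (K - m) = (\<Sum>i=K-m+1..K. d i)" if "m < K" for m using that
  proof (induction m)
    case 0
    then show ?case using zero by (simp add: c_def T_def)
  next
    case (Suc m)
    have e: "Suc (K - Suc m) = K - m" using Suc by simp
    have "c (K - Suc m) = c (K - m) + d (K - m)" using c_step[of "K - Suc m"] Suc e by simp
    also have "... = (\<Sum>i=K-m+1..K. d i) + d (K - m)" using Suc by simp
    also have "... = (\<Sum>i=K-m..K. d i)" using sum.atLeast_Suc_atMost[of "K - m" K d] unfolding Suc_eq_plus1 by linarith
    also have "K - m = K - Suc m + 1" using Suc.prems by simp
    finally show ?case .
  qed
  have "c (j - 1) = (\<Sum>i=j..K. d i)" using c_sum[of "K - (j - 1)"] j by simp
  then have "(c (j - 1))^2 = (\<Sum>i=j..K. d i)^2" by simp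
  also have "... \<le> (\<Sum>i=j..K. (1::real)^2) * (\<Sum>i=j..K. (d i)^2)" using Cauchy_Schwarz_ineq_sum[of "\<lambda>_. 1" d "{j..K}"] by simp
  \<comment> \<open>From \<open>j\<close> to \<open>K\<close> there are at most \<open>4 * j\<close>
    terms, because \<open>K < 4 * j\<close>. Each of them is estimated at the smallest index, with
    \<open>i - 1\<close> at least \<open>j / 2\<close>.\<close>
  also have "... \<le> real (4 * j) * (\<Sum>i=j..K. 2 * Q i / (real j)^5)"
  proof (intro mult_mono sum_mono sum_nonneg)
    fix i assume i: "i \<in> {j..K}"
    have i2: "real i \<ge> 2" "real j \<le> real i" "real j \<ge> 2" using i j by auto
    have "(d i)^2 = (\<alpha> i)^2 / ((real i - 1) * real i * (real i + 1))^2" unfolding d_def by (simp add: power_divide)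
    also have "... \<le> ((real i - 1) * Q i) / ((real i - 1) * real i * (real i + 1))^2"
      using alpha_sq[of i] i2 by (intro divide_right_mono) (auto simp: of_nat_diff)
    also have "... = Q i / ((real i - 1) * (real i)^2 * (real i + 1)^2)"
      using i2 by (simp add: power_mult_distrib power2_eq_square divide_simps)
    also have "... \<le> Q i / ((real j)^5 / 2)"
    proof (rule divide_left_mono)
      have "(real j) ^ 5 / 2 = (real j / 2) * (real j)^2 * (real j)^2" by (simp add: eval_nat_numeral)
      also have "... \<le> (real i - 1) * (real i)^2 * (real i + 1)^2" using i2 by (intro mult_mono power_mono) auto
      finally show "(real j) ^ 5 / 2 \<le> (real i - 1) * (real i)^2 * (real i + 1)^2" .
    qed (use Q_nonneg i2 in auto)
    finally show "(d i)^2 \<le> 2 * Q i / (real j)^5" by (simp add: mult.commute)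
  qed (use j Q_nonneg in \<open>auto simp: sum_nonneg\<close>)
  also have "(\<Sum>i=j..K. 2 * Q i / (real j)^5) = 2 * (\<Sum>i=j..K. Q i) / (real j)^5" by (simp add: sum_divide_distrib sum_distrib_left)
  also have "real (4 * j) * (2 * (\<Sum>i=j..K. Q i) / (real j)^5) = 8 * (\<Sum>i=j..K. Q i) / (real j)^4"
    using j by (simp add: field_simps eval_nat_numeral)
  also have "... \<le> 8 * R / (real j)^4" unfolding R using j Q_nonneg fin by (intro divide_right_mono mult_left_mono sum_mono2) auto
  finally have cj: "(c (j - 1))^2 \<le> 8 * R / (real j)^4" .
  have "T (j - 1) = c (j - 1) * ((real j - 1) * real j)" unfolding c_def using j by (simp add: of_nat_diff)
  then have "(T (j - 1))^2 * (real j)^2 = (c (j - 1))^2 * ((real j - 1)^2 * (real j)^4)"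
    by (simp add: power_mult_distrib eval_nat_numeral)
  also have "... \<le> 8 * R / (real j)^4 * ((real j - 1)^2 * (real j)^4)" by (intro mult_right_mono cj) auto
  also have "... = 8 * R * (real j - 1)^2" using j by simp
  finally show ?thesis using T_less[of "j - 1"] j by simp
qed

text \<open>An antidiagonal sum expresses \<open>h j\<close> through the partial sum of the smaller
  indices and coboundary terms. The telescoped bound controls the former and Cauchy-Schwarz on the
  antidiagonal the latter.\<close>

lemma high_frequency_gap:
  fixes h :: "nat => real"
  assumes K: "2 \<le> K" and zero: "(\<Sum>i=1..K. h i) = 0"
  shows "(\<Sum>j\<in>{j. K < 4 * j \<and> j \<le> K}. (h j)^2) \<le> 1100 / real K * (\<Sum>(k, l)\<in>high_pairs K. (h k + h l - h (k + l))^2)"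
proof -
  define R where "R = (\<Sum>(k, l)\<in>high_pairs K. (h k + h l - h (k + l))^2)"
  define Q where "Q j = (\<Sum>i=1..<j. (h i + h (j - i) - h (i + (j - i)))^2)" for j
  let ?J = "{j. K < 4 * j \<and> j \<le> K}"
  have R: "R = (\<Sum>j\<in>?J. Q j)" unfolding R_def Q_def by (rule sum_high_pairs_diagonals)
  have Q_nonneg: "0 \<le> Q i" for i unfolding Q_def by (intro sum_nonneg) auto
  have R_nonneg: "0 \<le> R" unfolding R by (intro sum_nonneg Q_nonneg)
  have tail: "(\<Sum>i=1..<j. h i)^2 * (real j)^2 \<le> 8 * R * (real j - 1)^2" if "2 \<le> j" "K < 4 * j" "j \<le> K" for j
    unfolding R_def by (rule telescoped_tail_bound[OF zero that])
  have hj: "(h j)^2 \<le> 1030 / (real K)^2 * R + 16 / real K * Q j" if j: "j \<in> ?J" for j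
  proof (cases "j = 1")
    \<comment> \<open>The antidiagonal of \<open>j = 1\<close> is empty and yields no formula for
      \<open>h 1\<close>. This index is high only for \<open>K \<le> 3\<close>, and there
      \<open>h 1\<close> is itself the partial sum that the tail bound controls at index 2.\<close>
    case True
    then have K3: "K \<le> 3" using j by auto
    have "(h 1)^2 \<le> 2 * R" using tail[of 2] K K3 by (simp add: numeral_2_eq_2)
    also have "... \<le> 1030 / (real K)^2 * R"
    proof (rule mult_right_mono)
      have "(real K)^2 \<le> 3^2" using K3 by (intro power_mono) auto
      then show "2 \<le> 1030 / (real K)^2" using K by (simp add: field_simps)
    qed (rule R_nonneg)
    finally show ?thesis using True Q_nonneg[of 1] by (simp add: add_increasing2)
  next
    case False
    then have j2: "2 \<le> j" "K < 4 * j" "j \<le> K" using j K by auto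
    define T where "T = (\<Sum>i=1..<j. h i)"
    define \<alpha> where "\<alpha> = (\<Sum>i=1..<j. h i + h (j - i) - h j)"
    have rj: "real j \<ge> 2" "real K \<le> 4 * real j" "real K > 0" using j2 by auto
    have rev: "(\<Sum>i=1..<j. h (j - i)) = (\<Sum>i=1..<j. h i)"
      by (rule sum.reindex_bij_witness[where i="\<lambda>i. j - i" and j="\<lambda>i. j - i"]) auto
    have "\<alpha> = 2 * T - (real j - 1) * h j" unfolding \<alpha>_def T_def using rev j2 by (simp add: sum.distrib sum_subtractf of_nat_diff)
    then have "h j = (2 * T - \<alpha>) / (real j - 1)" using rj by (simp add: field_simps)
    then have "(h j)^2 = (2 * T + (- \<alpha>))^2 / (real j - 1)^2" by (simp add: power_divide)
    also have "... \<le> 2 * ((2 * T)^2 + (-\<alpha>)^2) / (real j - 1)^2" by (intro divide_right_mono power2_sum2_le) auto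
    also have "... = 8 * (T^2 / (real j - 1)^2) + 2 * (\<alpha>^2 / (real j - 1)^2)" by (simp add: add_divide_distrib power_mult_distrib)
    also have "... \<le> 8 * (8 * R / (real j)^2) + 2 * (2 * Q j / real j)"
    proof (intro add_mono mult_left_mono)
      show "T^2 / (real j - 1)^2 \<le> 8 * R / (real j)^2"
        using tail[OF j2] rj unfolding T_def by (simp add: divide_simps mult.commute)
      have "\<alpha>^2 \<le> (\<Sum>m=1..<j. (1::real)^2) * Q j" unfolding \<alpha>_def Q_def
        using Cauchy_Schwarz_ineq_sum[of "\<lambda>_. 1" "\<lambda>m. h m + h (j - m) - h j" "{1..<j}"] by simp
      then have "\<alpha>^2 / (real j - 1)^2 \<le> (real j - 1) * Q j / (real j - 1)^2"
        using j2 by (intro divide_right_mono) (auto simp: of_nat_diff)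
      also have "... = Q j / (real j - 1)" using rj by (simp add: power2_eq_square)
      also have "... \<le> Q j / (real j / 2)" using rj Q_nonneg by (intro divide_left_mono) auto
      finally show "\<alpha>^2 / (real j - 1)^2 \<le> 2 * Q j / real j" by (simp add: mult.commute)
    qed auto
    also have "... = 64 * R * (1 / real j)^2 + 4 * Q j * (1 / real j)" by (simp add: power_divide)
    also have "... \<le> 64 * R * (4 / real K)^2 + 4 * Q j * (4 / real K)"
      using rj R_nonneg Q_nonneg by (intro add_mono mult_left_mono power_mono) (auto simp: field_simps)
    \<comment> \<open>Here 1030 rounds up 64 times 16.\<close>
    also have "... \<le> 1030 / (real K)^2 * R + 16 / real K * Q j" using R_nonneg by (simp add: power_divide divide_right_mono)
    finally show ?thesis .
  qed
  have cardJ: "real (card ?J) \<le> real K"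
  proof -
    have "card ?J \<le> card {1..K}" by (rule card_mono) auto
    then show ?thesis by simp
  qed
  have "(\<Sum>j\<in>?J. (h j)^2) \<le> (\<Sum>j\<in>?J. 1030 / (real K)^2 * R + 16 / real K * Q j)" by (intro sum_mono hj)
  also have "... = real (card ?J) * (1030 / (real K)^2 * R) + 16 / real K * R"
    unfolding R by (simp add: sum.distrib sum_distrib_left)
  also have "... \<le> real K * (1030 / (real K)^2 * R) + 16 / real K * R"
    by (intro add_right_mono mult_right_mono cardJ) (use R_nonneg in auto)
  also have "... = 1046 / real K * R" using K by (simp add: field_simps power2_eq_square)
  also have "... \<le> 1100 / real K * R" using R_nonneg by (intro mult_right_mono divide_right_mono) auto
  finally show ?thesis unfolding R_def .
qed

text \<open>Linear sequences are the kernel of the coboundary, and \<open>s\<close> removes them by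
  centring. High frequencies have comparable weights, so the unweighted gap applies to them. A low
  frequency is recovered from \<open>h k = A k l + h (k + l) - h l\<close>, averaged over
  \<open>l\<close> in the middle block: \<open>l\<close> and \<open>k + l\<close> are then both
  high, so that only \<open>A k l\<close> has to carry the weight \<open>w k\<close>, while the two
  other terms cost the total weight, which is what \<open>S\<close> controls.\<close>

lemma weighted_phase_gap:
  fixes v w :: "nat => real"
  assumes K: "2 \<le> K"
    and w_pos: "0 < w K" and w_min: "\<And>k. 1 \<le> k ==> k \<le> K ==> w K \<le> w k"
    and w_high: "\<And>k. K < 4 * k ==> k \<le> K ==> w k \<le> 4 * w K"
    and w_sum: "(\<Sum>k=1..K. w k) \<le> S * real K * w K"
  shows "\<exists>s. (\<Sum>k=1..K. w k * (v k - real k * s)^2)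
    \<le> 40000 * (S + 1) / real K * (\<Sum>(k, l)\<in>high_pairs K. w k * (v k + v l - v (k + l))^2)"
proof -
  \<comment> \<open>With this slope the values \<open>h k\<close> sum to zero, since the indices add
    up to \<open>K (K + 1) / 2\<close>; the telescoping argument ends at that sum.\<close>
  define s where "s = 2 * (\<Sum>i=1..K. v i) / (real K * (real K + 1))"
  define h where "h k = v k - real k * s" for k
  define A where "A k l = v k + v l - v (k + l)" for k l
  have A: "A k l = h k + h l - h (k + l)" for k l by (simp add: A_def h_def algebra_simps)
  have gauss: "(\<Sum>i=1..K. real i) = real K * (real K + 1) / 2" by (induction K) (auto simp: field_simps)
  have zero: "(\<Sum>i=1..K. h i) = 0" using K unfolding h_def sum_subtractf sum_distrib_right[symmetric] gauss by (simp add: s_def)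
  define R where "R = (\<Sum>(k, l)\<in>high_pairs K. (A k l)^2)"
  define Q where "Q = (\<Sum>(k, l)\<in>high_pairs K. w k * (A k l)^2)"
  let ?J = "{j. K < 4 * j \<and> j \<le> K}" and ?L = "{l. K < 4 * l \<and> 2 * l \<le> K}" and ?I = "{k. 1 \<le> k \<and> 4 * k \<le> K}"
  define H where "H = (\<Sum>j\<in>?J. (h j)^2)"
  have finJ: "finite ?J" and finL: "finite ?L" and finI: "finite ?I" by (rule finite_subset[of _ "{..K}"]; force)+
  have w0: "0 \<le> w k" if "1 \<le> k" "k \<le> K" for k using w_min[OF that] w_pos by simp
  have H: "H \<le> 1100 / real K * R" unfolding H_def R_def A by (rule high_frequency_gap[OF K zero])
  have H0: "0 \<le> H" unfolding H_def by (intro sum_nonneg) auto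
  have RQ: "w K * R \<le> Q" unfolding R_def Q_def sum_distrib_left
    by (rule sum_mono) (auto simp: high_pairs_def intro!: mult_right_mono w_min)
  have wH: "w K * H \<le> 1100 / real K * Q"
  proof -
    have "w K * H \<le> w K * (1100 / real K * R)" using H w_pos by (intro mult_left_mono) auto
    also have "... = 1100 / real K * (w K * R)" by simp
    also have "... \<le> 1100 / real K * Q" by (intro mult_left_mono RQ) auto
    finally show ?thesis .
  qed
  have Q0: "0 \<le> Q" unfolding Q_def by (intro sum_nonneg) (auto simp: high_pairs_def intro!: mult_nonneg_nonneg w0)
  define n where "n = real (card ?L)"
  have n: "real K \<le> 6 * n" unfolding n_def by (rule card_middle_block[OF K])
  have low: "n * (h k)^2 \<le> 3 * (\<Sum>l\<in>?L. (A k l)^2) + 6 * H" if k: "k \<in> ?I" for k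
  proof -
    have "n * (h k)^2 = (\<Sum>l\<in>?L. (A k l + h (k + l) + - h l)^2)" by (simp add: A n_def)
    also have "... \<le> (\<Sum>l\<in>?L. 3 * ((A k l)^2 + (h (k + l))^2 + (- h l)^2))" by (intro sum_mono power2_sum3_le)
    also have "... = 3 * (\<Sum>l\<in>?L. (A k l)^2) + 3 * (\<Sum>l\<in>?L. (h (k + l))^2) + 3 * (\<Sum>l\<in>?L. (h l)^2)"
      by (simp add: sum.distrib sum_distrib_left)
    also have "(\<Sum>l\<in>?L. (h (k + l))^2) \<le> H"
    proof -
      have "(\<Sum>l\<in>?L. (h (k + l))^2) = (\<Sum>j\<in>(+) k ` ?L. (h j)^2)" by (subst sum.reindex) auto
      also have "... \<le> H" unfolding H_def using k by (intro sum_mono2 finJ) auto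
      finally show ?thesis .
    qed
    also have "(\<Sum>l\<in>?L. (h l)^2) \<le> H" unfolding H_def by (intro sum_mono2 finJ) auto
    finally show ?thesis by simp
  qed
  \<comment> \<open>An index of the middle block already exceeds \<open>K / 4\<close>, and adding an
    index of at most \<open>K / 4\<close> stays below \<open>K\<close>; so the product set lies in
    \<open>high_pairs K\<close>.\<close>
  have pairs: "(\<Sum>k\<in>?I. w k * (\<Sum>l\<in>?L. (A k l)^2)) \<le> Q"
  proof -
    have "(\<Sum>k\<in>?I. w k * (\<Sum>l\<in>?L. (A k l)^2)) = (\<Sum>(k, l)\<in>?I \<times> ?L. w k * (A k l)^2)"
      by (simp add: sum_distrib_left sum.cartesian_product)
    also have "... \<le> Q" unfolding Q_def by (rule sum_mono2[OF finite_high_pairs])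
        (auto simp: high_pairs_def intro!: mult_nonneg_nonneg w0)
    finally show ?thesis .
  qed
  have "(\<Sum>k\<in>?I. w k) \<le> (\<Sum>k=1..K. w k)" by (rule sum_mono2) (auto intro: w0)
  then have wI: "(\<Sum>k\<in>?I. w k) \<le> S * real K * w K" using w_sum by simp
  have S0: "0 \<le> S"
  proof -
    have "0 \<le> (\<Sum>k=1..K. w k)" by (intro sum_nonneg w0) auto
    then have "0 \<le> S * (real K * w K)" using w_sum by (simp add: mult.assoc)
    moreover have "0 < real K * w K" using w_pos K by simp
    ultimately show ?thesis by (simp only: zero_le_mult_iff) linarith
  qed
  have "n * (\<Sum>k\<in>?I. w k * (h k)^2) = (\<Sum>k\<in>?I. w k * (n * (h k)^2))" by (simp add: sum_distrib_left mult.left_commute)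
  also have "... \<le> (\<Sum>k\<in>?I. w k * (3 * (\<Sum>l\<in>?L. (A k l)^2) + 6 * H))" by (intro sum_mono mult_left_mono low w0) auto
  also have "... = 3 * (\<Sum>k\<in>?I. w k * (\<Sum>l\<in>?L. (A k l)^2)) + 6 * H * (\<Sum>k\<in>?I. w k)"
    by (simp add: algebra_simps sum.distrib sum_distrib_left)
  also have "... \<le> 3 * Q + 6 * H * (S * real K * w K)" using pairs wI H0 by (intro add_mono mult_left_mono) auto
  also have "... = 3 * Q + 6 * S * real K * (w K * H)" by simp
  also have "... \<le> 3 * Q + 6 * S * real K * (1100 / real K * Q)" using S0 by (intro add_left_mono mult_left_mono wH) auto
  also have "... = (3 + 6600 * S) * Q" using K by (simp add: algebra_simps)
  finally have "n * (\<Sum>k\<in>?I. w k * (h k)^2) \<le> (3 + 6600 * S) * Q" .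
  moreover have "real K / 6 * (\<Sum>k\<in>?I. w k * (h k)^2) \<le> n * (\<Sum>k\<in>?I. w k * (h k)^2)"
    using n by (intro mult_right_mono sum_nonneg mult_nonneg_nonneg w0) auto
  ultimately have "real K / 6 * (\<Sum>k\<in>?I. w k * (h k)^2) \<le> (3 + 6600 * S) * Q" by linarith
  then have lowsum: "(\<Sum>k\<in>?I. w k * (h k)^2) \<le> (18 + 39600 * S) * Q / real K" using K by (simp add: field_simps)
  have "(\<Sum>k\<in>?J. w k * (h k)^2) \<le> (\<Sum>k\<in>?J. 4 * w K * (h k)^2)" by (intro sum_mono mult_right_mono w_high) auto
  also have "... = 4 * (w K * H)" unfolding H_def by (simp add: sum_distrib_left mult.assoc)
  also have "... \<le> 4 * (1100 / real K * Q)" by (intro mult_left_mono wH) auto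
  finally have highsum: "(\<Sum>k\<in>?J. w k * (h k)^2) \<le> 4400 * Q / real K" by simp
  have "{1..K} = ?I \<union> ?J" using K by auto
  then have "(\<Sum>k=1..K. w k * (h k)^2) = (\<Sum>k\<in>?I. w k * (h k)^2) + (\<Sum>k\<in>?J. w k * (h k)^2)"
    using finI finJ by (simp only:) (subst sum.union_disjoint, auto)
  also have "... \<le> (18 + 39600 * S) * Q / real K + 4400 * Q / real K" using lowsum highsum by linarith
  also have "... = (4418 + 39600 * S) * Q / real K" by (simp add: add_divide_distrib[symmetric] algebra_simps)
  \<comment> \<open>The low frequencies contribute \<open>18 + 39600 * S\<close>, where 39600 is 36
    times 1100, and the high ones 4400, which is 4 times 1100.\<close>
  also have "... \<le> 40000 * (S + 1) * Q / real K" using S0 Q0 by (intro divide_right_mono mult_right_mono) auto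
  finally show ?thesis unfolding h_def Q_def A_def by (intro exI[of _ s]) simp
qed

section \<open>From phases modulo \<open>2 * pi\<close> to real sequences\<close>

text \<open>Rounding to the nearest multiple of \<open>2 * pi\<close> leaves a remainder
  \<open>y\<close> in \<open>[-pi, pi]\<close>. There the chord has length
  \<open>2 * \<bar>sin (y / 2)\<bar>\<close> and sine is monotone, so it is enough that
  \<open>sin (1 / 20)\<close> exceeds \<open>1 / 40\<close>.\<close>

lemma abs_le_of_cis_near_one:
  assumes "cmod (cis x - 1) \<le> 1 / 20"
  shows "\<exists>n :: int. \<bar>x - 2 * pi * of_int n\<bar> \<le> 1 / 10"
proof -
  define n where "n = round (x / (2 * pi))"
  define y where "y = x - 2 * pi * of_int n"
  have "\<bar>of_int n - x / (2 * pi)\<bar> \<le> 1 / 2" unfolding n_def by (rule of_int_round_abs_le)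
  moreover have "\<bar>y\<bar> = 2 * pi * \<bar>of_int n - x / (2 * pi)\<bar>"
  proof -
    have "y = - (2 * pi * (of_int n - x / (2 * pi)))" by (simp add: y_def field_simps)
    then show ?thesis by (simp add: abs_mult)
  qed
  ultimately have y_pi: "\<bar>y\<bar> \<le> pi" by (simp add: field_simps)
  have "cis x = cis y" unfolding y_def by (simp add: cis.ctr complex_eq_iff cos_diff sin_diff sin_int_2pin cos_int_2pin)
  then have "cmod (cis y - 1) \<le> 1 / 20" using assms by simp
  moreover {
    have "(cmod (cis y - 1))^2 = (2 * sin (y / 2))^2"
  proof -
    have "(cmod (cis y - 1))^2 = (cos y - 1)^2 + (sin y)^2" by (simp add: cmod_power2)
    also have "... = 2 - 2 * cos y" by (simp add: sin_squared_eq power2_eq_square algebra_simps)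
    also have "cos y = 1 - 2 * (sin (y / 2))^2" using cos_double_sin[of "y / 2"] by simp
    finally show ?thesis by (simp add: power_mult_distrib)
  qed
  then have "cmod (cis y - 1) = \<bar>2 * sin (y / 2)\<bar>" by (subst power2_eq_iff_nonneg[symmetric]) auto
  }
  ultimately have sin_small: "\<bar>sin (y / 2)\<bar> \<le> 1 / 40" by (simp add: abs_mult)
  have "\<bar>y\<bar> \<le> 1 / 10"
  proof (rule ccontr)
    assume "\<not> \<bar>y\<bar> \<le> 1 / 10"
    then have "sin (1 / 20 :: real) \<le> sin (\<bar>y\<bar> / 2)" using y_pi by (intro sin_monotone_2pi_le) auto
    also have "... \<le> \<bar>sin (y / 2)\<bar>" by (cases "0 \<le> y") auto
    finally have "sin (1 / 20 :: real) \<le> 1 / 40" using sin_small by simp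
    moreover have "\<bar>sin (1 / 20 :: real) - (\<Sum>m<3. sin_coeff m * (1 / 20) ^ m)\<bar> \<le> inverse (fact 3) * \<bar>1 / 20\<bar> ^ 3"
      by (rule Maclaurin_sin_bound)
    ultimately show False by (simp add: eval_nat_numeral sin_coeff_def)
  qed
  then show ?thesis unfolding y_def by blast
qed

text \<open>Stability of the Cauchy functional equation on a bounded range. Subtracting the line
  through the last value makes \<open>g K = 0\<close>. Let \<open>k\<close> maximise
  \<open>\<bar>g\<bar>\<close>, with maximum \<open>M\<close>. If \<open>2 * k \<le> K\<close>,
  doubling gives \<open>M \<le> h\<close>. Otherwise the reflected index \<open>K - k\<close>
  carries at least \<open>M - h\<close> and can be doubled, which gives
  \<open>M \<le> 3 * h\<close>.\<close>

lemma quasi_additive_near_linear: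
  fixes f :: "nat => real"
  assumes add: "\<And>k l. 1 \<le> k ==> 1 \<le> l ==> k + l \<le> K ==> \<bar>f k + f l - f (k + l)\<bar> \<le> h"
    and h: "0 \<le> h" and j: "1 \<le> j" "j \<le> K"
  shows "\<bar>f j - real j * (f K / real K)\<bar> \<le> 3 * h"
proof -
  define g where "g k = f k - real k * (f K / real K)" for k
  have gK: "g K = 0" using j by (simp add: g_def)
  have add_g: "\<bar>g k + g l - g (k + l)\<bar> \<le> h" if "1 \<le> k" "1 \<le> l" "k + l \<le> K" for k l
    using add[OF that] by (simp add: g_def algebra_simps add_divide_distrib)
  define M where "M = Max ((\<lambda>k. \<bar>g k\<bar>) ` {1..K})"
  have M_ge: "\<bar>g k\<bar> \<le> M" if "1 \<le> k" "k \<le> K" for k unfolding M_def using that by (intro Max_ge) auto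
  have "M \<in> (\<lambda>k. \<bar>g k\<bar>) ` {1..K}" unfolding M_def using j by (intro Max_in) auto
  then obtain k where k: "1 \<le> k" "k \<le> K" "M = \<bar>g k\<bar>" by auto
  have "M \<le> 3 * h"
  proof (cases "2 * k \<le> K")
    case True
    then show ?thesis using add_g[of k k] M_ge[of "k + k"] k h by linarith
  next
    case False
    show ?thesis
    proof (cases "k = K")
      case True
      then show ?thesis using gK k h by simp
    next
      case k_less: False
      define l where "l = K - k"
      have l: "1 \<le> l" "k + l = K" "2 * l \<le> K" using False k k_less by (auto simp: l_def)
      have "\<bar>g k + g l - g K\<bar> \<le> h" using add_g[of k l] k l by simp
      moreover have "\<bar>g l + g l - g (l + l)\<bar> \<le> h" using add_g[of l l] l by simp
      moreover have "\<bar>g (l + l)\<bar> \<le> M" using M_ge[of "l + l"] l by simp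
      ultimately show ?thesis using gK k by linarith
    qed
  qed
  then show ?thesis using M_ge[of j] j by (simp add: g_def)
qed

text \<open>The pairs \<open>(k, 1)\<close> alone determine the integers. For larger
  \<open>l\<close>, three defects of size \<open>h\<close> add up in the induction step, but the
  result differs from a defect of size \<open>h\<close> by a multiple of \<open>2 * pi\<close>. As
  \<open>4 * h < 2 * pi\<close>, this multiple is zero: every step restores the bound
  \<open>h\<close>, and errors do not accumulate.\<close>

lemma phase_lifting:
  fixes d :: "nat => real"
  assumes near: "\<And>k l. 1 \<le> k ==> 1 \<le> l ==> k + l \<le> K ==> \<exists>n :: int. \<bar>d k + d l - d (k + l) - 2 * pi * of_int n\<bar> \<le> h"
    and h: "h \<le> 1 / 10"
  shows "\<exists>m :: nat => int. \<forall>k l. 1 \<le> k \<longrightarrow> 1 \<le> l \<longrightarrow> k + l \<le> K \<longrightarrow>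
    \<bar>(d k + 2 * pi * m k) + (d l + 2 * pi * m l) - (d (k + l) + 2 * pi * m (k + l))\<bar> \<le> h"
proof -
  define n :: "nat => int" where "n k = (SOME n. \<bar>d k + d 1 - d (k + 1) - 2 * pi * of_int n\<bar> \<le> h)" for k
  define m where "m k = (\<Sum>i=1..<k. n i)" for k
  define v where "v k = d k + 2 * pi * m k" for k
  have n: "\<bar>d k + d 1 - d (k + 1) - 2 * pi * of_int (n k)\<bar> \<le> h" if "1 \<le> k" "k + 1 \<le> K" for k
    unfolding n_def by (rule someI_ex) (use near[of k 1] that in auto)
  have v_step: "\<bar>v k + v 1 - v (k + 1)\<bar> \<le> h" if "1 \<le> k" "k + 1 \<le> K" for k
  proof -
    have "m (k + 1) = m k + n k" "m 1 = 0" using that by (auto simp: m_def)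
    then have "v k + v 1 - v (k + 1) = d k + d 1 - d (k + 1) - 2 * pi * of_int (n k)" by (simp add: v_def algebra_simps)
    then show ?thesis using n[OF that] by simp
  qed
  have "\<bar>v k + v l - v (k + l)\<bar> \<le> h" if kl: "1 \<le> k" "1 \<le> l" "k + l \<le> K" for k l using kl(2,3)
  proof (induction l rule: dec_induct)
    case base
    then show ?case using v_step[of k] that by simp
  next
    case (step l)
    have IH: "\<bar>v k + v l - v (k + l)\<bar> \<le> h" using step by simp
    have s1: "\<bar>v l + v 1 - v (l + 1)\<bar> \<le> h" using v_step[of l] step that by simp
    have s2: "\<bar>v (k + l) + v 1 - v (k + l + 1)\<bar> \<le> h" using v_step[of "k + l"] step that by simp
    have b: "\<bar>v k + v (Suc l) - v (k + Suc l)\<bar> \<le> 3 * h" using IH s1 s2 by simp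
    obtain z :: int where z: "\<bar>d k + d (Suc l) - d (k + Suc l) - 2 * pi * of_int z\<bar> \<le> h"
      using near[of k "Suc l"] step kl(1) by auto
    define q where "q = z + m k + m (Suc l) - m (k + Suc l)"
    have q: "v k + v (Suc l) - v (k + Suc l) = (d k + d (Suc l) - d (k + Suc l) - 2 * pi * of_int z) + 2 * pi * of_int q"
      by (simp add: v_def q_def algebra_simps)
    have "\<bar>2 * pi * of_int q\<bar> \<le> 4 * h" using b z q by linarith
    also have "... < 2 * pi" using h pi_gt3 by linarith
    finally have "\<bar>of_int q :: real\<bar> < 1" by (simp add: abs_mult)
    then have "q = 0" by linarith
    then show ?case using q z by simp
  qed
  then show ?thesis unfolding v_def by blast
qed

text \<open>The tolerance grows from \<open>1 / 20\<close> on the circle to \<open>1 / 10\<close>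
  after lifting and to \<open>3 / 10\<close> after removal of the linear part, whose slope becomes
  the rotation. The last value is small enough to keep the sum of three corrections below 1, where
  minus cosine is strongly convex.\<close>

lemma phase_alignment:
  fixes d :: "nat => real"
  assumes near: "\<And>k l. 1 \<le> k ==> 1 \<le> l ==> k + l \<le> K ==> cmod (cis (d k + d l - d (k + l)) - 1) \<le> 1 / 20"
  shows "\<exists>\<alpha> u. \<forall>k\<in>{1..K}. \<bar>u k\<bar> \<le> 3 / 10 \<and> cis (u k) = cis (d k + real k * \<alpha>)"
proof -
  have "\<exists>m :: nat => int. \<forall>k l. 1 \<le> k \<longrightarrow> 1 \<le> l \<longrightarrow> k + l \<le> K \<longrightarrow>
    \<bar>(d k + 2 * pi * m k) + (d l + 2 * pi * m l) - (d (k + l) + 2 * pi * m (k + l))\<bar> \<le> 1 / 10"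
    by (rule phase_lifting) (use abs_le_of_cis_near_one[OF near] in auto)
  then obtain m :: "nat => int" where m: "\<And>k l. 1 \<le> k ==> 1 \<le> l ==> k + l \<le> K ==>
    \<bar>(d k + 2 * pi * m k) + (d l + 2 * pi * m l) - (d (k + l) + 2 * pi * m (k + l))\<bar> \<le> 1 / 10" by blast
  define v where "v k = d k + 2 * pi * m k" for k
  have "\<bar>v k - real k * (v K / real K)\<bar> \<le> 3 * (1 / 10)" if "1 \<le> k" "k \<le> K" for k
    by (rule quasi_additive_near_linear[where K=K]) (use m that in \<open>auto simp: v_def\<close>)
  moreover have "cis (v k - real k * (v K / real K)) = cis (d k + real k * (- (v K / real K)))" for k
  proof -
    have "v k - real k * (v K / real K) = (d k + real k * (- (v K / real K))) + 2 * pi * of_int (m k)" by (simp add: v_def)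
    then show ?thesis by (simp only:) (simp add: cis.ctr complex_eq_iff cos_add sin_add sin_int_2pin cos_int_2pin)
  qed
  ultimately show ?thesis by (intro exI[of _ "- (v K / real K)"] exI[of _ "\<lambda>k. v k - real k * (v K / real K)"]) auto
qed

section \<open>Alignment of phases from their coboundary\<close>

definition coboundary :: "(nat => real) => nat \<times> nat => real" where "coboundary v p = v (fst p) + v (snd p) - v (fst p + snd p)"

abbreviation "cob1 j \<equiv> coboundary (\<lambda>i. of_bool (i = j))"

text \<open>The functions \<open>cob1 j\<close> are the columns of the coboundary. Expanding in them
  turns a sum over pairs into a sum over frequencies, the summation by parts behind
  \<open>score\<close>.\<close>

lemma coboundary_expand:
  assumes "p \<in> high_pairs K"
  shows "coboundary v p = (\<Sum>j=1..K. v j * cob1 j p)"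
proof -
  have *: "(\<Sum>j=1..K. v j * of_bool (i = j)) = v i" if "1 \<le> i" "i \<le> K" for i
    using that by (simp add: of_bool_def if_distrib[of "(*) _"] cong: if_cong)
  show ?thesis using assms *[of "fst p"] *[of "snd p"] *[of "fst p + snd p"]
    by (auto simp: coboundary_def high_pairs_def algebra_simps sum.distrib sum_subtractf)
qed

text \<open>The right-hand side is the Bregman divergence of minus cosine. Its second derivative is
  at least \<open>1 / 2\<close> on \<open>[-1, 1]\<close>, whence the modulus
  \<open>1 / 4\<close>.\<close>

lemma cos_Bregman_lower:
  fixes a b :: real
  assumes a: "\<bar>a\<bar> \<le> 1" and b: "\<bar>b\<bar> \<le> 1"
  shows "(b - a)^2 / 4 \<le> cos a - cos b - sin a * (b - a)"
proof -
  have cos_half: "1 / 2 \<le> cos x" if "\<bar>x\<bar> \<le> 1" for x :: real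
  proof -
    have "cos (pi / 3) \<le> cos \<bar>x\<bar>" using that pi_gt3 by (intro cos_monotone_0_pi_le) auto
    then show ?thesis by (simp add: cos_60)
  qed
  define f where "f x = cos a - cos x - sin a * (x - a) - (x - a)^2 / 4" for x
  define f' where "f' x = sin x - sin a - (x - a) / 2" for x
  have der: "(f has_real_derivative f' x) (at x)" for x
    unfolding f_def f'_def by (auto intro!: derivative_eq_intros simp: field_simps)
  have f'_mono: "f' x \<le> f' y" if "x \<le> y" "\<bar>x\<bar> \<le> 1" "\<bar>y\<bar> \<le> 1" for x y
  proof (rule DERIV_nonneg_imp_nondecreasing[OF that(1)])
    fix z assume "x \<le> z" "z \<le> y"
    then have "\<bar>z\<bar> \<le> 1" using that by auto
    then show "\<exists>d. (f' has_real_derivative d) (at z) \<and> 0 \<le> d" unfolding f'_def using cos_half[of z]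
      by (intro exI[of _ "cos z - 1 / 2"]) (auto intro!: derivative_eq_intros)
  qed
  have f'a: "f' a = 0" by (simp add: f'_def)
  have "f a \<le> f b"
  proof (cases "a \<le> b")
    case True
    show ?thesis
    proof (rule DERIV_nonneg_imp_nondecreasing[OF True])
      fix x assume "a \<le> x" "x \<le> b"
      then show "\<exists>d. (f has_real_derivative d) (at x) \<and> 0 \<le> d" using der[of x] f'_mono[of a x] f'a a b by force
    qed
  next
    case False
    then have "b \<le> a" by simp
    then show ?thesis
    proof (rule DERIV_nonpos_imp_nonincreasing)
      fix x assume "b \<le> x" "x \<le> a"
      then show "\<exists>d. (f has_real_derivative d) (at x) \<and> d \<le> 0" using der[of x] f'_mono[of x a] f'a a b by force
    qed
  qed
  then show ?thesis by (simp add: f_def)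
qed

lemma abs_coboundary_le_one:
  assumes "\<And>k. k \<in> {1..K} ==> \<bar>u k\<bar> \<le> 3 / 10" and "p \<in> high_pairs K"
  shows "\<bar>coboundary u p\<bar> \<le> 1"
  using assms(1)[of "fst p"] assms(1)[of "snd p"] assms(1)[of "fst p + snd p"] assms(2)
  by (auto simp: coboundary_def high_pairs_def)

text \<open>The adjoint of the coboundary, applied to the weighted noise and evaluated at
  \<open>j\<close>.\<close>

definition score :: "nat => (nat \<times> nat => real) => (nat \<times> nat => real) => nat => real" where
  "score K \<omega> n j = (\<Sum>p\<in>high_pairs K. \<omega> p * n p * cob1 j p)"

text \<open>The data \<open>D\<close> consist of a mean \<open>m\<close> and noise \<open>n\<close>,
  and \<open>u0\<close> is the point of comparison. Strong convexity turns
  \<open>\<Phi> u \<le> \<Phi> u0\<close> into a bound of the quadratic form \<open>q\<close> by two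
  linear terms. The noise term becomes the score tested against \<open>u - u0\<close> modulo linear
  sequences, hence at most \<open>sqrt (X * J)\<close> with \<open>X \<le> G * q\<close> from the
  gap. The bias, which is the mismatch of the gradient at \<open>u0\<close>, is treated by
  Cauchy-Schwarz over pairs. Dividing by \<open>sqrt q\<close> and applying the gap once more gives
  the claim.\<close>

lemma phase_minimizer_error:
  fixes K :: nat and \<kappa> u0 u :: "nat => real" and \<omega> \<rho> m n D :: "nat \<times> nat => real"
  defines "\<Phi> \<equiv> \<lambda>u. \<Sum>p\<in>high_pairs K. \<omega> p * (- \<rho> p * cos (coboundary u p) - D p * coboundary u p)"
  assumes gap: "\<And>v :: nat => real. \<exists>s. (\<Sum>k=1..K. (\<kappa> k)^2 * (v k - real k * s)^2)
      \<le> G * (\<Sum>p\<in>high_pairs K. (\<omega> p)^2 * (coboundary v p)^2)"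
    and G: "0 \<le> G" and c: "0 < c"
    and \<rho>: "\<And>p. p \<in> high_pairs K ==> c * \<omega> p \<le> \<rho> p"
    and \<omega>: "\<And>p. p \<in> high_pairs K ==> 0 \<le> \<omega> p"
    and \<kappa>: "\<And>k. k \<in> {1..K} ==> 0 < \<kappa> k"
    and u: "\<And>k. k \<in> {1..K} ==> \<bar>u k\<bar> \<le> 3 / 10"
    and u0: "\<And>k. k \<in> {1..K} ==> \<bar>u0 k\<bar> \<le> 3 / 10"
    and min: "\<Phi> u \<le> \<Phi> u0"
    and D: "\<And>p. p \<in> high_pairs K ==> D p = m p + n p"
  shows "\<exists>s. (\<Sum>k=1..K. (\<kappa> k)^2 * (u k - u0 k - real k * s)^2) \<le> 32 * G / c^2 * (G * (\<Sum>j=1..K. (score K \<omega> n j)^2 / (\<kappa> j)^2)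
        + (\<Sum>p\<in>high_pairs K. (m p - \<rho> p * sin (coboundary u0 p))^2))"
proof -
  let ?P = "high_pairs K"
  define v where "v k = u k - u0 k" for k
  obtain s where s: "(\<Sum>k=1..K. (\<kappa> k)^2 * (v k - real k * s)^2) \<le> G * (\<Sum>p\<in>?P. (\<omega> p)^2 * (coboundary v p)^2)" using gap by blast
  define v' where "v' k = v k - real k * s" for k
  define X where "X = (\<Sum>k=1..K. (\<kappa> k)^2 * (v' k)^2)"
  define q where "q = (\<Sum>p\<in>?P. (\<omega> p)^2 * (coboundary v p)^2)"
  define J where "J = (\<Sum>j=1..K. (score K \<omega> n j)^2 / (\<kappa> j)^2)"
  define E where "E = (\<Sum>p\<in>?P. (m p - \<rho> p * sin (coboundary u0 p))^2)"
  have q0: "0 \<le> q" and X0: "0 \<le> X" and J0: "0 \<le> J" and E0: "0 \<le> E" unfolding q_def X_def J_def E_def by (intro sum_nonneg; simp)+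
  have Xq: "X \<le> G * q" using s by (simp add: X_def q_def v'_def)
  have cob_v: "coboundary v p = coboundary u p - coboundary u0 p" for p by (simp add: coboundary_def v_def)
  have cob_v': "coboundary v p = coboundary v' p" for p by (simp add: coboundary_def v'_def algebra_simps)
  have "c / 4 * q \<le> (\<Sum>p\<in>?P. \<omega> p * n p * coboundary v p) + (\<Sum>p\<in>?P. (\<omega> p * coboundary v p) * (m p - \<rho> p * sin (coboundary u0 p)))"
  proof -
    have "0 \<le> \<Phi> u0 - \<Phi> u" using min by simp
    also have "\<Phi> u0 - \<Phi> u = (\<Sum>p\<in>?P. \<omega> p * (D p * coboundary v p - \<rho> p * (cos (coboundary u0 p) - cos (coboundary u p))))"
      unfolding \<Phi>_def sum_subtractf[symmetric] cob_v by (intro sum.cong) (auto simp: algebra_simps)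
    also have "... \<le> (\<Sum>p\<in>?P. \<omega> p * (D p * coboundary v p
        - \<rho> p * (sin (coboundary u0 p) * coboundary v p + (coboundary v p)^2 / 4)))"
    proof (intro sum_mono mult_left_mono diff_left_mono)
      fix p assume p: "p \<in> ?P"
      have "\<bar>coboundary u0 p\<bar> \<le> 1" "\<bar>coboundary u p\<bar> \<le> 1" by (rule abs_coboundary_le_one[OF _ p]; use u u0 in blast)+
      from cos_Bregman_lower[OF this]
      show "sin (coboundary u0 p) * coboundary v p + (coboundary v p)^2 / 4
          \<le> cos (coboundary u0 p) - cos (coboundary u p)" by (simp add: cob_v)
      have "0 \<le> c * \<omega> p" using c \<omega>[OF p] by simp
      then show "0 \<le> \<rho> p" using \<rho>[OF p] by linarith
    qed (use \<omega> in auto)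
    also have "... = (\<Sum>p\<in>?P. \<omega> p * n p * coboundary v p) + (\<Sum>p\<in>?P. (\<omega> p * coboundary v p) * (m p - \<rho> p * sin (coboundary u0 p)))
      - (\<Sum>p\<in>?P. \<omega> p * \<rho> p * (coboundary v p)^2 / 4)" unfolding sum.distrib[symmetric] sum_subtractf[symmetric]
      by (intro sum.cong) (auto simp: D algebra_simps)
    finally have "(\<Sum>p\<in>?P. \<omega> p * \<rho> p * (coboundary v p)^2 / 4) \<le> (\<Sum>p\<in>?P. \<omega> p * n p * coboundary v p)
      + (\<Sum>p\<in>?P. (\<omega> p * coboundary v p) * (m p - \<rho> p * sin (coboundary u0 p)))" by simp
    moreover have "c / 4 * q \<le> (\<Sum>p\<in>?P. \<omega> p * \<rho> p * (coboundary v p)^2 / 4)" unfolding q_def sum_distrib_left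
    proof (intro sum_mono)
      fix p assume p: "p \<in> ?P"
      have "\<omega> p * (c * \<omega> p) * (coboundary v p)^2 \<le> \<omega> p * \<rho> p * (coboundary v p)^2"
        using p by (intro mult_right_mono mult_left_mono \<rho> \<omega>) auto
      then show "c / 4 * ((\<omega> p)^2 * (coboundary v p)^2) \<le> \<omega> p * \<rho> p * (coboundary v p)^2 / 4"
        by (simp add: power2_eq_square algebra_simps)
    qed
    ultimately show ?thesis by linarith
  qed
  moreover have "(\<Sum>p\<in>?P. \<omega> p * n p * coboundary v p) \<le> sqrt (X * J)"
  proof -
    \<comment> \<open>Linear sequences have zero coboundary, so \<open>v'\<close> may replace
      \<open>v\<close>; the noise is then tested against exactly the sequence that the gap
      controls.\<close>
    have "(\<Sum>p\<in>?P. \<omega> p * n p * coboundary v p) = (\<Sum>p\<in>?P. \<Sum>j=1..K. \<omega> p * n p * (v' j * cob1 j p))"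
      unfolding cob_v' by (intro sum.cong refl) (simp add: coboundary_expand[of _ K v'] sum_distrib_left)
    also have "... = (\<Sum>j=1..K. v' j * score K \<omega> n j)"
      unfolding score_def by (subst sum.swap) (simp add: sum_distrib_left algebra_simps)
    also have "... = (\<Sum>j=1..K. (\<kappa> j * v' j) * (score K \<omega> n j / \<kappa> j))"
      using \<kappa> by (intro sum.cong) (auto simp: less_imp_neq[symmetric])
    also have "... \<le> sqrt ((\<Sum>j=1..K. (\<kappa> j * v' j)^2) * (\<Sum>j=1..K. (score K \<omega> n j / \<kappa> j)^2))"
      by (intro real_le_rsqrt Cauchy_Schwarz_ineq_sum)
    finally show ?thesis by (simp add: X_def J_def power_mult_distrib power_divide)
  qed
  moreover have "(\<Sum>p\<in>?P. (\<omega> p * coboundary v p) * (m p - \<rho> p * sin (coboundary u0 p))) \<le> sqrt (q * E)"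
    unfolding q_def E_def power_mult_distrib[symmetric] by (intro real_le_rsqrt Cauchy_Schwarz_ineq_sum)
  moreover have "sqrt (X * J) \<le> sqrt (q * (G * J))" using mult_right_mono[OF Xq J0] by (simp add: mult_ac)
  ultimately have "c / 4 * q \<le> sqrt (q * (G * J)) + sqrt (q * E)" by linarith
  then have "c / 4 * (sqrt q * sqrt q) \<le> sqrt q * (sqrt (G * J) + sqrt E)" using q0 by (simp add: real_sqrt_mult algebra_simps)
  then have "sqrt q * (c / 4 * sqrt q) \<le> sqrt q * (sqrt (G * J) + sqrt E)" by (simp add: algebra_simps)
  then have "c / 4 * sqrt q \<le> sqrt (G * J) + sqrt E" using q0 G J0 E0 by (cases "q = 0") (auto simp: mult_le_cancel_left)
  then have "(c / 4 * sqrt q)^2 \<le> (sqrt (G * J) + sqrt E)^2" using c q0 by (intro power_mono) auto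
  also have "... \<le> 2 * ((sqrt (G * J))^2 + (sqrt E)^2)" by (rule power2_sum2_le)
  finally have "c^2 * q / 16 \<le> 2 * (G * J + E)" using q0 G J0 E0 by (simp add: power_mult_distrib power_divide)
  then have "q \<le> 32 / c^2 * (G * J + E)" using c by (simp add: field_simps)
  then have "G * q \<le> G * (32 / c^2 * (G * J + E))" by (rule mult_left_mono[OF _ G])
  then have "X \<le> 32 * G / c^2 * (G * J + E)" using Xq by (simp add: field_simps)
  then show ?thesis unfolding X_def v'_def v_def J_def E_def by blast
qed

section \<open>Variances of averages of independent observations\<close>

lemma indep_vars_PiM_coordinates:
  assumes M: "\<And>i. i \<in> I ==> prob_space (M i)"
  shows "prob_space.indep_vars (PiM I M) M (\<lambda>i x. x i) I"
proof (cases "I = {}")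
  case True
  interpret prob_space "PiM I M" by (rule prob_space_PiM) (use M in auto)
  show ?thesis unfolding indep_vars_def indep_sets_def using True by blast
next
  case False
  interpret prob_space "PiM I M" by (rule prob_space_PiM) (use M in auto)
  have "distr (PiM I M) (PiM I M) (\<lambda>x. restrict x I) = PiM I M" by (rule distr_cong[THEN trans, OF refl refl _ distr_id2])
      (auto simp: space_PiM PiE_restrict)
  moreover have "PiM I (\<lambda>i. distr (PiM I M) (M i) (\<lambda>x. x i)) = PiM I M" by (intro PiM_cong refl distr_PiM_component M) auto
  ultimately show ?thesis by (subst indep_vars_iff_distr_eq_PiM'[OF False]) auto
qed

text \<open>Variances of independent centred terms add up: the cross term vanishes in the integral
  over the newly inserted coordinate. The nonnegative integral spares any integrability claim on the
  product space.\<close>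

lemma nn_integral_PiM_sum_square_le:
  fixes g :: "'a => real"
  assumes M: "prob_space M" and I: "finite I"
    and int: "integrable M g" and zero: "integral\<^sup>L M g = 0"
    and sq: "(\<integral>\<^sup>+x. ennreal ((g x)^2) \<partial>M) \<le> ennreal V" and V: "0 \<le> V"
  shows "(\<integral>\<^sup>+x. ennreal ((\<Sum>m\<in>I. g (x m))^2) \<partial>PiM I (\<lambda>_. M)) \<le> ennreal (real (card I) * V)"
proof -
  interpret prob_space M by fact
  interpret product_sigma_finite "\<lambda>_ :: 'b. M" by standard
  have [measurable]: "g \<in> borel_measurable M" using int by simp
  have int_sq: "integrable M (\<lambda>x. (g x)^2)" by (rule integrableI_nonneg) (use sq in \<open>auto simp: less_top[symmetric] top_unique\<close>)
  then have sq': "(\<integral>x. (g x)^2 \<partial>M) \<le> V" using sq V by (subst (asm) nn_integral_eq_integral) auto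
  show ?thesis using I
  proof (induction I rule: finite_induct)
    case empty
    then show ?case by simp
  next
    case (insert i I)
    have inner: "(\<integral>\<^sup>+y. ennreal ((s + g y)^2) \<partial>M) \<le> ennreal (s^2) + ennreal V" for s
    proof -
      have e: "(s + g y)^2 = s^2 + 2 * s * g y + (g y)^2" for y by (simp add: power2_eq_square algebra_simps)
      have int': "integrable M (\<lambda>y. (s + g y)^2)" unfolding e using int int_sq by simp
      have "(\<integral>\<^sup>+y. ennreal ((s + g y)^2) \<partial>M) = ennreal (\<integral>y. (s + g y)^2 \<partial>M)" by (rule nn_integral_eq_integral[OF int']) simp
      also have "(\<integral>y. (s + g y)^2 \<partial>M) = s^2 + (\<integral>x. (g x)^2 \<partial>M)" unfolding e using int int_sq zero by (simp add: prob_space)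
      also have "ennreal ... \<le> ennreal (s^2 + V)" using sq' by (intro ennreal_leI) simp
      finally show ?thesis using V by simp
    qed
    have "(\<integral>\<^sup>+x. ennreal ((\<Sum>m\<in>insert i I. g (x m))^2) \<partial>PiM (insert i I) (\<lambda>_. M))
      = (\<integral>\<^sup>+x. (\<integral>\<^sup>+y. ennreal ((\<Sum>m\<in>insert i I. g ((x(i := y)) m))^2) \<partial>M) \<partial>PiM I (\<lambda>_. M))"
      using insert by (subst product_nn_integral_insert) (auto intro!: measurable_compose[OF measurable_component_singleton])
    also have "... = (\<integral>\<^sup>+x. (\<integral>\<^sup>+y. ennreal (((\<Sum>m\<in>I. g (x m)) + g y)^2) \<partial>M) \<partial>PiM I (\<lambda>_. M))"
    proof (intro nn_integral_cong)
      fix x y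
      have "(\<Sum>m\<in>I. g ((x(i := y)) m)) = (\<Sum>m\<in>I. g (x m))" using insert by (intro sum.cong) auto
      then show "ennreal ((\<Sum>m\<in>insert i I. g ((x(i := y)) m))^2) = ennreal (((\<Sum>m\<in>I. g (x m)) + g y)^2)"
        using insert by (simp add: add.commute)
    qed
    also have "... \<le> (\<integral>\<^sup>+x. ennreal ((\<Sum>m\<in>I. g (x m))^2) + ennreal V \<partial>PiM I (\<lambda>_. M))" by (intro nn_integral_mono inner)
    also have "... = (\<integral>\<^sup>+x. ennreal ((\<Sum>m\<in>I. g (x m))^2) \<partial>PiM I (\<lambda>_. M)) + ennreal V"
    proof -
      interpret P: prob_space "PiM I (\<lambda>_. M)" by (rule prob_space_PiM) unfold_locales
      have "(\<lambda>x. ennreal ((\<Sum>m\<in>I. g (x m))^2)) \<in> borel_measurable (PiM I (\<lambda>_. M))"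
        by (auto intro!: measurable_compose[OF measurable_component_singleton] borel_measurable_sum
            measurable_compose[OF _ measurable_ennreal] borel_measurable_power)
      then show ?thesis by (subst nn_integral_add) (auto simp: P.emeasure_space_1)
    qed
    also have "... \<le> ennreal (real (card I) * V) + ennreal V" by (intro add_right_mono insert.IH)
    also have "... = ennreal (real (card (insert i I)) * V)"
      using insert V by (simp add: ennreal_plus[symmetric] algebra_simps del: ennreal_plus)
    finally show ?case .
  qed
qed

lemma nn_integral_PiM_average_error_le:
  fixes f :: "'a => real"
  assumes M: "prob_space M" and I: "finite I" "I \<noteq> {}"
    and f[measurable]: "f \<in> borel_measurable M" and mean: "integral\<^sup>L M f = \<mu>"
    and sq: "(\<integral>\<^sup>+x. ennreal ((f x)^2) \<partial>M) \<le> ennreal V" and V: "0 \<le> V"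
  shows "(\<integral>\<^sup>+x. ennreal (((\<Sum>m\<in>I. f (x m)) / real (card I) - \<mu>)^2) \<partial>PiM I (\<lambda>_. M)) \<le> ennreal (V / real (card I))"
proof -
  interpret prob_space M by fact
  have int_sq: "integrable M (\<lambda>x. (f x)^2)" by (rule integrableI_nonneg) (use sq in \<open>auto simp: less_top[symmetric] top_unique\<close>)
  then have sq': "(\<integral>x. (f x)^2 \<partial>M) \<le> V" using sq V by (subst (asm) nn_integral_eq_integral) auto
  have int: "integrable M f" by (rule square_integrable_imp_integrable[OF f int_sq])
  define g where "g x = f x - \<mu>" for x
  have "integral\<^sup>L M g = 0" unfolding g_def using int mean by (simp add: prob_space)
  have g_sq: "(g x)^2 = (f x)^2 - 2 * \<mu> * f x + \<mu>^2" for x by (simp add: g_def power2_eq_square algebra_simps)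
  have int_g: "integrable M (\<lambda>x. (g x)^2)" unfolding g_sq using int int_sq by simp
  have "(\<integral>\<^sup>+x. ennreal ((g x)^2) \<partial>M) = ennreal (\<integral>x. (g x)^2 \<partial>M)" by (rule nn_integral_eq_integral[OF int_g]) simp
  also have "(\<integral>x. (g x)^2 \<partial>M) = (\<integral>x. (f x)^2 \<partial>M) - \<mu>^2"
    unfolding g_sq using int int_sq mean by (simp add: prob_space power2_eq_square)
  also have "ennreal ... \<le> ennreal V" using sq' by (intro ennreal_leI) (smt (verit) zero_le_power2)
  finally have g_V: "(\<integral>\<^sup>+x. ennreal ((g x)^2) \<partial>M) \<le> ennreal V" .
  define n where "n = real (card I)"
  have n: "0 < n" unfolding n_def using I by (simp add: card_gt_0_iff)
  have "(\<Sum>m\<in>I. f (x m)) / n - \<mu> = (\<Sum>m\<in>I. g (x m)) / n" for x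
    using n by (simp add: g_def sum_subtractf n_def[symmetric] field_simps)
  then have "(\<integral>\<^sup>+x. ennreal (((\<Sum>m\<in>I. f (x m)) / n - \<mu>)^2) \<partial>PiM I (\<lambda>_. M))
      = (\<integral>\<^sup>+x. ennreal (1 / n^2) * ennreal ((\<Sum>m\<in>I. g (x m))^2) \<partial>PiM I (\<lambda>_. M))"
    by (intro nn_integral_cong) (simp add: power_divide ennreal_mult'[symmetric] field_simps)
  also have "... = ennreal (1 / n^2) * (\<integral>\<^sup>+x. ennreal ((\<Sum>m\<in>I. g (x m))^2) \<partial>PiM I (\<lambda>_. M))" by (rule nn_integral_cmult)
      (auto simp: g_def intro!: measurable_compose[OF measurable_component_singleton] borel_measurable_sum
            measurable_compose[OF _ measurable_ennreal] borel_measurable_power borel_measurable_diff)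
  also have "... \<le> ennreal (1 / n^2) * ennreal (n * V)" unfolding n_def
    by (intro mult_left_mono nn_integral_PiM_sum_square_le M I g_V V \<open>integral\<^sup>L M g = 0\<close>) (use int in \<open>auto simp: g_def\<close>)
  also have "... = ennreal (V / n)" using n V by (simp add: ennreal_mult'[symmetric] power2_eq_square)
  finally show ?thesis unfolding n_def .
qed

section \<open>Moments of noisy Fourier coefficients\<close>

definition cplx :: "rvec => nat => complex" where "cplx z k = Complex (z (k, 1)) (z (k, 2))"

lemma finite_coords [simp]: "finite (coords K)"
  by (simp add: coords_def)

lemma prob_space_std_normal: "prob_space std_normal_distribution"
  by (rule real_distribution.axioms(1)[OF real_dist_normal_dist])

abbreviation "gint K \<equiv> integrable (gaussian_noise K)"
abbreviation "gmean K \<equiv> lebesgue_integral (gaussian_noise K)"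

lemma prob_space_gaussian_noise: "prob_space (gaussian_noise K)"
  unfolding gaussian_noise_def by (intro prob_space_PiM prob_space_std_normal)

lemma measurable_gaussian_coordinate: "i \<in> coords K ==> (\<lambda>z. z i) \<in> borel_measurable (gaussian_noise K)"
  unfolding gaussian_noise_def using measurable_component_singleton[of i "coords K" "\<lambda>_. std_normal_distribution"] by simp

lemma borel_measurable_Complex [measurable (raw)]:
  assumes "f \<in> borel_measurable M" "g \<in> borel_measurable M"
  shows "(\<lambda>x. Complex (f x) (g x)) \<in> borel_measurable M"
  unfolding Complex_eq using assms by measurable

lemma measurable_cplx [measurable]:
  assumes "k \<in> {1..K}"
  shows "(\<lambda>z. cplx z k) \<in> borel_measurable (gaussian_noise K)"
  unfolding cplx_def using assms by (intro borel_measurable_Complex measurable_gaussian_coordinate) (auto simp: coords_def)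

lemma indep_vars_cplx: "prob_space.indep_vars (gaussian_noise K) (\<lambda>_. borel) (\<lambda>k z. cplx z k) {1..K}"
proof -
  interpret prob_space "gaussian_noise K" by (rule prob_space_gaussian_noise)
  have "indep_vars (\<lambda>_. std_normal_distribution) (\<lambda>i z. z i) (coords K)"
    unfolding gaussian_noise_def by (rule indep_vars_PiM_coordinates) (rule prob_space_std_normal)
  then have "indep_vars (\<lambda>k. PiM {(k, 1::nat), (k, 2::nat)} (\<lambda>_. std_normal_distribution))
      (\<lambda>k z. restrict (\<lambda>i. z i) {(k, 1::nat), (k, 2::nat)}) {1..K}"
    by (rule indep_vars_restrict) (auto simp: coords_def disjoint_family_on_def)
  then have "indep_vars (\<lambda>_. borel) (\<lambda>k z. (\<lambda>w. Complex (w (k, 1)) (w (k, 2)))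
      (restrict (\<lambda>i. z i) {(k, 1::nat), (k, 2::nat)})) {1..K}"
  proof (rule indep_vars_compose2)
    fix k :: nat
    have "(\<lambda>w. w (k, j)) \<in> borel_measurable (PiM {(k, 1::nat), (k, 2::nat)} (\<lambda>_. std_normal_distribution))"
      if "j = 1 \<or> j = 2" for j :: nat
      using measurable_component_singleton[of "(k, j)" "{(k, 1::nat), (k, 2::nat)}" "\<lambda>_. std_normal_distribution"] that by auto
    then show "(\<lambda>w. Complex (w (k, 1)) (w (k, 2)))
        \<in> borel_measurable (PiM {(k, 1::nat), (k, 2::nat)} (\<lambda>_. std_normal_distribution))"
      by (intro borel_measurable_Complex) auto
  qed
  then show ?thesis by (simp add: cplx_def)
qed

lemma gaussian_coordinate_moments:
  assumes i: "i \<in> coords K"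
  shows "gint K (\<lambda>z. (z i) ^ p)"
    and "gmean K (\<lambda>z. z i) = 0"
    and "gmean K (\<lambda>z. (z i)^2) = 1"
    and "gmean K (\<lambda>z. (z i) ^ 4) = 3"
proof -
  have d: "distr (gaussian_noise K) std_normal_distribution (\<lambda>z. z i) = std_normal_distribution"
    unfolding gaussian_noise_def by (rule distr_PiM_component[OF _ i]) (rule prob_space_std_normal)
  have m: "(\<lambda>z. z i) \<in> measurable (gaussian_noise K) std_normal_distribution" using measurable_gaussian_coordinate[OF i] by simp
  have int: "integrable std_normal_distribution (\<lambda>x. x ^ p)" for p by (subst integrable_density)
      (use integrable_std_normal_moment[of p] in \<open>auto simp: mult.commute\<close>)
  have val: "(\<integral>x. x ^ p \<partial>std_normal_distribution) = (\<integral>x. std_normal_density x * x ^ p \<partial>lborel)" for p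
    by (subst integral_density) auto
  show "gint K (\<lambda>z. (z i) ^ p)"
  proof -
    have "integrable (distr (gaussian_noise K) std_normal_distribution (\<lambda>z. z i)) (\<lambda>x. x ^ p)" unfolding d by (rule int)
    then show ?thesis using m by (subst (asm) integrable_distr_eq) auto
  qed
  have eq: "gmean K (\<lambda>z. (z i) ^ p) = (\<integral>x. std_normal_density x * x ^ p \<partial>lborel)" for p
  proof -
    have "gmean K (\<lambda>z. (z i) ^ p) = (\<integral>x. x ^ p \<partial>distr (gaussian_noise K) std_normal_distribution (\<lambda>z. z i))"
      by (rule integral_distr[OF m, symmetric]) simp
    then show ?thesis unfolding d val .
  qed
  show "gmean K (\<lambda>z. z i) = 0" using eq[of 1] integral_std_normal_moment_odd[of 0] by simp
  show "gmean K (\<lambda>z. (z i)^2) = 1" using eq[of 2] integral_std_normal_moment_even[of 1] by (simp add: eval_nat_numeral)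
  show "gmean K (\<lambda>z. (z i) ^ 4) = 3" using eq[of 4] integral_std_normal_moment_even[of 2] by (simp add: fact_numeral)
qed

lemma gaussian_coordinate_product:
  assumes k: "k \<in> {1..K}"
  shows "gint K (\<lambda>z. z (k, 1) * z (k, 2))"
    and "gmean K (\<lambda>z. z (k, 1) * z (k, 2)) = 0"
proof -
  interpret prob_space "gaussian_noise K" by (rule prob_space_gaussian_noise)
  have "indep_vars (\<lambda>_. std_normal_distribution) (\<lambda>i z. z i) (coords K)"
    unfolding gaussian_noise_def by (rule indep_vars_PiM_coordinates) (rule prob_space_std_normal)
  then have "indep_vars (\<lambda>_. borel) (\<lambda>i z. z i) (coords K)" by (simp add: indep_vars_def)
  then have ind: "indep_vars (\<lambda>_. borel) (\<lambda>i z. z i) {(k, 1::nat), (k, 2::nat)}"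
    by (rule indep_vars_subset) (use k in \<open>auto simp: coords_def\<close>)
  have int: "gint K (\<lambda>z. z i)" if "i \<in> {(k, 1::nat), (k, 2::nat)}" for i
    using gaussian_coordinate_moments(1)[of i K 1] that k by (auto simp: coords_def)
  show "gint K (\<lambda>z. z (k, 1) * z (k, 2))" using indep_vars_integrable[OF _ ind int] by simp
  show "gmean K (\<lambda>z. z (k, 1) * z (k, 2)) = 0"
    using indep_vars_lebesgue_integral[OF _ ind int] gaussian_coordinate_moments(2)[of "(k, 1)" K] k by (simp add: coords_def)
qed

text \<open>The noise is circular: the square of a coefficient has mean zero. This leaves entries
  with a repeated frequency unbiased. The bound 12 comes from the squared modulus being a sum of two
  squares, whose square is at most twice the sum of the fourth powers, each of mean 3.\<close>

lemma cplx_moments: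
  assumes k: "k \<in> {1..K}"
  shows "gint K (\<lambda>z. cplx z k)"
    and "gmean K (\<lambda>z. cplx z k) = 0"
    and "gint K (\<lambda>z. cplx z k * cplx z k)"
    and "gmean K (\<lambda>z. cplx z k * cplx z k) = 0"
    and "gint K (\<lambda>z. (cmod (cplx z k))^2)"
    and "gmean K (\<lambda>z. (cmod (cplx z k))^2) = 2"
    and "gint K (\<lambda>z. (cmod (cplx z k)) ^ 4)"
    and "gmean K (\<lambda>z. (cmod (cplx z k)) ^ 4) \<le> 12"
proof -
  have c: "(k, 1) \<in> coords K" "(k, 2) \<in> coords K" using k by (auto simp: coords_def)
  note g1 = gaussian_coordinate_moments[OF c(1)] and g2 = gaussian_coordinate_moments[OF c(2)]
  note gp = gaussian_coordinate_product[OF k]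
  have i1: "gint K (\<lambda>z. z (k, 1))" "gint K (\<lambda>z. z (k, 2))" using g1(1)[of 1] g2(1)[of 1] by simp_all
  have e1: "cplx z k = of_real (z (k, 1)) + \<i> * of_real (z (k, 2))" for z by (simp add: cplx_def Complex_eq)
  show "gint K (\<lambda>z. cplx z k)" unfolding e1 using i1 by simp
  show "gmean K (\<lambda>z. cplx z k) = 0" unfolding e1 using i1 g1(2) g2(2) by simp
  have e2: "cplx z k * cplx z k = of_real ((z (k, 1))^2 - (z (k, 2))^2) + \<i> * of_real (2 * (z (k, 1) * z (k, 2)))" for z
    by (simp add: cplx_def complex_eq_iff power2_eq_square)
  have i2: "gint K (\<lambda>z. (z (k, 1))^2 - (z (k, 2))^2)" "gint K (\<lambda>z. 2 * (z (k, 1) * z (k, 2)))" using g1(1) g2(1) gp by auto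
  show "gint K (\<lambda>z. cplx z k * cplx z k)"
    unfolding e2 by (intro Bochner_Integration.integrable_add Bochner_Integration.integrable_mult_right integrable_of_real i2)
  have z2: "gmean K (\<lambda>z. (z (k, 1))^2 - (z (k, 2))^2) = 0" "gmean K (\<lambda>z. 2 * (z (k, 1) * z (k, 2))) = 0"
    using g1(1,3) g2(1,3) gp by simp_all
  show "gmean K (\<lambda>z. cplx z k * cplx z k) = 0" unfolding e2 by (subst Bochner_Integration.integral_add)
      (use i2 z2 in \<open>auto intro!: Bochner_Integration.integrable_mult_right integrable_of_real simp del: of_real_diff of_real_mult of_real_power\<close>)
  have e3: "(cmod (cplx z k))^2 = (z (k, 1))^2 + (z (k, 2))^2" for z by (simp add: cplx_def cmod_power2)
  show "gint K (\<lambda>z. (cmod (cplx z k))^2)" unfolding e3 using g1(1) g2(1) by simp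
  show "gmean K (\<lambda>z. (cmod (cplx z k))^2) = 2" unfolding e3 using g1(1,3) g2(1,3) by simp
  have e4: "(cmod (cplx z k)) ^ 4 \<le> 2 * (z (k, 1)) ^ 4 + 2 * (z (k, 2)) ^ 4" for z
  proof -
    have "(cmod (cplx z k)) ^ 4 = ((cmod (cplx z k))^2)^2" by simp
    also have "... \<le> 2 * (((z (k, 1))^2)^2 + ((z (k, 2))^2)^2)" unfolding e3 by (rule power2_sum2_le)
    finally show ?thesis by simp
  qed
  have i4: "gint K (\<lambda>z. 2 * (z (k, 1)) ^ 4 + 2 * (z (k, 2)) ^ 4)" using g1(1) g2(1) by simp
  show int4: "gint K (\<lambda>z. (cmod (cplx z k)) ^ 4)" by (rule Bochner_Integration.integrable_bound[OF i4])
      (use k e4 in \<open>auto intro!: borel_measurable_power borel_measurable_norm measurable_cplx intro: order_trans[OF _ abs_ge_self]\<close>)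
  have "gmean K (\<lambda>z. (cmod (cplx z k)) ^ 4) \<le> gmean K (\<lambda>z. 2 * (z (k, 1)) ^ 4 + 2 * (z (k, 2)) ^ 4)"
    by (intro integral_mono int4 i4 e4)
  also have "... = 12" using g1(1,4) g2(1,4) by simp
  finally show "gmean K (\<lambda>z. (cmod (cplx z k)) ^ 4) \<le> 12" .
qed

definition noisy :: "real => (nat => complex) => rvec => nat => complex" where "noisy \<sigma> x z k = x k + of_real \<sigma> * cplx z k"

lemma measurable_noisy [measurable]: "k \<in> {1..K} ==> (\<lambda>z. noisy \<sigma> x z k) \<in> borel_measurable (gaussian_noise K)"
  unfolding noisy_def by (intro borel_measurable_add borel_measurable_times measurable_cplx) auto

lemma noisy_moments:
  assumes k: "k \<in> {1..K}"
  shows "gint K (\<lambda>z. noisy \<sigma> x z k)"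
    and "gmean K (\<lambda>z. noisy \<sigma> x z k) = x k"
    and "gint K (\<lambda>z. noisy \<sigma> x z k * noisy \<sigma> x z k)"
    and "gmean K (\<lambda>z. noisy \<sigma> x z k * noisy \<sigma> x z k) = x k * x k"
    and "gint K (\<lambda>z. (cmod (noisy \<sigma> x z k))^2)"
    and "gmean K (\<lambda>z. (cmod (noisy \<sigma> x z k))^2) = (cmod (x k))^2 + 2 * \<sigma>^2"
    and "gint K (\<lambda>z. (cmod (noisy \<sigma> x z k)) ^ 4)"
    and "gmean K (\<lambda>z. (cmod (noisy \<sigma> x z k)) ^ 4) \<le> 8 * (cmod (x k)) ^ 4 + 96 * \<sigma> ^ 4"
proof -
  interpret prob_space "gaussian_noise K" by (rule prob_space_gaussian_noise)
  note m = cplx_moments[OF k]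
  show "gint K (\<lambda>z. noisy \<sigma> x z k)" unfolding noisy_def using m(1) by simp
  show "gmean K (\<lambda>z. noisy \<sigma> x z k) = x k" unfolding noisy_def using m(1,2) by (simp add: prob_space)
  have e2: "noisy \<sigma> x z k * noisy \<sigma> x z k = x k * x k + (2 * x k * of_real \<sigma>) * cplx z k
      + of_real (\<sigma>^2) * (cplx z k * cplx z k)" for z by (simp add: noisy_def power2_eq_square algebra_simps)
  show "gint K (\<lambda>z. noisy \<sigma> x z k * noisy \<sigma> x z k)"
    unfolding e2 by (intro Bochner_Integration.integrable_add Bochner_Integration.integrable_mult_right m) auto
  have "gmean K (\<lambda>z. noisy \<sigma> x z k * noisy \<sigma> x z k) = x k * x k + (2 * x k * of_real \<sigma>) * gmean K (\<lambda>z. cplx z k)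
        + of_real (\<sigma>^2) * gmean K (\<lambda>z. cplx z k * cplx z k)" unfolding e2 using m(1,3)
    by (subst Bochner_Integration.integral_add, simp, simp, subst Bochner_Integration.integral_add) (simp_all add: prob_space)
  then show "gmean K (\<lambda>z. noisy \<sigma> x z k * noisy \<sigma> x z k) = x k * x k" using m(2,4) by simp
  have e3: "(cmod (noisy \<sigma> x z k))^2 = (cmod (x k))^2 + 2 * \<sigma> * Re (cnj (x k) * cplx z k) + \<sigma>^2 * (cmod (cplx z k))^2" for z
    unfolding noisy_def cmod_power2 by (simp add: power2_eq_square algebra_simps)
  have iR: "gint K (\<lambda>z. Re (cnj (x k) * cplx z k))" by (intro integrable_Re Bochner_Integration.integrable_mult_right m)
  have zR: "gmean K (\<lambda>z. Re (cnj (x k) * cplx z k)) = 0" by (subst integral_Re) (use m(1,2) in auto)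
  show "gint K (\<lambda>z. (cmod (noisy \<sigma> x z k))^2)"
    unfolding e3 using iR m(5) by (intro Bochner_Integration.integrable_add Bochner_Integration.integrable_mult_right) auto
  show "gmean K (\<lambda>z. (cmod (noisy \<sigma> x z k))^2) = (cmod (x k))^2 + 2 * \<sigma>^2" unfolding e3 using iR zR m(5,6)
    by (subst Bochner_Integration.integral_add, simp del: times_complex.sel, simp, subst Bochner_Integration.integral_add)
      (simp_all add: prob_space del: times_complex.sel)
  have e4: "(cmod (noisy \<sigma> x z k)) ^ 4 \<le> 8 * (cmod (x k)) ^ 4 + 8 * \<sigma> ^ 4 * (cmod (cplx z k)) ^ 4" for z
  proof -
    define a b where "a = cmod (x k)" and "b = \<bar>\<sigma>\<bar> * cmod (cplx z k)"
    have "cmod (noisy \<sigma> x z k) \<le> a + b"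
      unfolding noisy_def a_def b_def by (rule order_trans[OF norm_triangle_ineq]) (simp add: norm_mult)
    then have "(cmod (noisy \<sigma> x z k)) ^ 4 \<le> ((a + b)^2)^2" using power_mono[of "cmod (noisy \<sigma> x z k)" "a + b" 4] by simp
    also have "... \<le> (2 * (a^2 + b^2))^2" by (intro power_mono power2_sum2_le) simp
    also have "... = 4 * (a^2 + b^2)^2" by (simp only: power_mult_distrib) simp
    also have "... \<le> 4 * (2 * ((a^2)^2 + (b^2)^2))" by (intro mult_left_mono power2_sum2_le) simp
    also have "... = 8 * a ^ 4 + 8 * b ^ 4" by simp
    finally show ?thesis by (simp add: a_def b_def power_mult_distrib)
  qed
  have i4: "gint K (\<lambda>z. 8 * (cmod (x k)) ^ 4 + 8 * \<sigma> ^ 4 * (cmod (cplx z k)) ^ 4)" using m(7) by simp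
  show int4: "gint K (\<lambda>z. (cmod (noisy \<sigma> x z k)) ^ 4)" by (rule Bochner_Integration.integrable_bound[OF i4])
      (use k e4 in \<open>auto intro!: borel_measurable_power borel_measurable_norm measurable_noisy intro: order_trans[OF _ abs_ge_self]\<close>)
  have "gmean K (\<lambda>z. (cmod (noisy \<sigma> x z k)) ^ 4) \<le> gmean K (\<lambda>z. 8 * (cmod (x k)) ^ 4 + 8 * \<sigma> ^ 4 * (cmod (cplx z k)) ^ 4)"
    by (intro integral_mono int4 i4 e4)
  also have "... = 8 * (cmod (x k)) ^ 4 + 8 * \<sigma> ^ 4 * gmean K (\<lambda>z. (cmod (cplx z k)) ^ 4)" using m(7) by (simp add: prob_space)
  also have "... \<le> 8 * (cmod (x k)) ^ 4 + 8 * \<sigma> ^ 4 * 12" by (intro add_left_mono mult_left_mono m) auto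
  finally show "gmean K (\<lambda>z. (cmod (noisy \<sigma> x z k)) ^ 4) \<le> 8 * (cmod (x k)) ^ 4 + 96 * \<sigma> ^ 4" by simp
qed

text \<open>Taking \<open>f k\<close> constantly 1 at the frequencies that do not occur, this
  evaluates the mean of any monomial in the coefficients and their conjugates.\<close>

lemma noisy_product_expectation:
  fixes f :: "nat => complex => 'b::{real_normed_field, banach, second_countable_topology}"
  assumes meas: "\<And>k. k \<in> {1..K} ==> f k \<in> borel_measurable borel"
    and int: "\<And>k. k \<in> {1..K} ==> gint K (\<lambda>z. f k (noisy \<sigma> x z k))"
  shows "gint K (\<lambda>z. \<Prod>k=1..K. f k (noisy \<sigma> x z k))"
    and "gmean K (\<lambda>z. (\<Prod>k=1..K. f k (noisy \<sigma> x z k))) = (\<Prod>k=1..K. gmean K (\<lambda>z. f k (noisy \<sigma> x z k)))"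
proof -
  interpret prob_space "gaussian_noise K" by (rule prob_space_gaussian_noise)
  have "indep_vars (\<lambda>_. borel) (\<lambda>k z. (\<lambda>w. f k (x k + of_real \<sigma> * w)) (cplx z k)) {1..K}"
    by (rule indep_vars_compose2[OF indep_vars_cplx])
      (intro measurable_compose[OF _ meas] borel_measurable_add borel_measurable_times; simp)
  then have ind: "indep_vars (\<lambda>_. borel) (\<lambda>k z. f k (noisy \<sigma> x z k)) {1..K}" by (simp add: noisy_def)
  show "gint K (\<lambda>z. \<Prod>k=1..K. f k (noisy \<sigma> x z k))" by (rule indep_vars_integrable[OF _ ind int]) auto
  show "gmean K (\<lambda>z. (\<Prod>k=1..K. f k (noisy \<sigma> x z k))) = (\<Prod>k=1..K. gmean K (\<lambda>z. f k (noisy \<sigma> x z k)))"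
    by (rule indep_vars_lebesgue_integral[OF _ ind int]) auto
qed

lemma complex_norm_square_real: "of_real ((cmod z)^2) = z * cnj z"
  by (rule complex_norm_square)

lemma noisy_cnj_moments:
  assumes k: "k \<in> {1..K}"
  shows "gint K (\<lambda>z. noisy \<sigma> x z k * cnj (noisy \<sigma> x z k))"
    and "gmean K (\<lambda>z. noisy \<sigma> x z k * cnj (noisy \<sigma> x z k)) = of_real ((cmod (x k))^2 + 2 * \<sigma>^2)"
    and "gint K (\<lambda>z. cnj (noisy \<sigma> x z k) * cnj (noisy \<sigma> x z k))"
    and "gmean K (\<lambda>z. cnj (noisy \<sigma> x z k) * cnj (noisy \<sigma> x z k)) = cnj (x k) * cnj (x k)"
proof -
  note m = noisy_moments[OF k]
  show "gint K (\<lambda>z. noisy \<sigma> x z k * cnj (noisy \<sigma> x z k))"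
    unfolding complex_norm_square_real[symmetric] by (intro integrable_of_real m)
  show "gmean K (\<lambda>z. noisy \<sigma> x z k * cnj (noisy \<sigma> x z k)) = of_real ((cmod (x k))^2 + 2 * \<sigma>^2)"
    unfolding complex_norm_square_real[symmetric] integral_complex_of_real m(6) ..
  show "gint K (\<lambda>z. cnj (noisy \<sigma> x z k) * cnj (noisy \<sigma> x z k))" unfolding complex_cnj_mult[symmetric] by (intro integrable_cnj m)
  show "gmean K (\<lambda>z. cnj (noisy \<sigma> x z k) * cnj (noisy \<sigma> x z k)) = cnj (x k) * cnj (x k)"
    unfolding complex_cnj_mult[symmetric] Bochner_Integration.integral_cnj m(4) ..
qed

lemma noisy_sixth_order_moment:
  fixes \<sigma> :: real and x :: "nat => complex"
  assumes ind: "a \<in> {1..K}" "b \<in> {1..K}" "c \<in> {1..K}" "d \<in> {1..K}" "j \<in> {1..K}"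
    and dist: "a \<noteq> c" "a \<noteq> d" "b \<noteq> c" "b \<noteq> d" "j \<noteq> a" "j \<noteq> b" "j \<noteq> c" "j \<noteq> d"
  defines "Y \<equiv> noisy \<sigma> x"
  shows "gint K (\<lambda>z. Y z j * cnj (Y z j) * Y z a * Y z b * cnj (Y z c) * cnj (Y z d))"
    and "gmean K (\<lambda>z. Y z j * cnj (Y z j) * Y z a * Y z b * cnj (Y z c) * cnj (Y z d))
      = of_real ((cmod (x j))^2 + 2 * \<sigma>^2) * x a * x b * cnj (x c) * cnj (x d)"
proof -
  interpret prob_space "gaussian_noise K" by (rule prob_space_gaussian_noise)
  \<comment> \<open>Every factor of the monomial has a conditional of its own. Coinciding indices
    then simply multiply, and the product over all frequencies rebuilds the monomial.\<close>
  define f where "f k y = (if k = j then y * cnj y else 1) * (if k = a then y else 1)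
    * (if k = b then y else 1) * (if k = c then cnj y else 1) * (if k = d then cnj y else 1)" for k y
  define g where "g k = (if k = j then of_real ((cmod (x j))^2 + 2 * \<sigma>^2) else 1) * (if k = a then x k else 1)
    * (if k = b then x k else 1) * (if k = c then cnj (x k) else 1) * (if k = d then cnj (x k) else 1)" for k
  have meas: "f k \<in> borel_measurable borel" for k unfolding f_def
    by (cases "k = j"; cases "k = a"; cases "k = b"; cases "k = c"; cases "k = d")
      (auto intro!: borel_measurable_continuous_onI continuous_intros)
  have *: "gint K (\<lambda>z. f k (Y z k)) \<and> gmean K (\<lambda>z. f k (Y z k)) = g k" if k: "k \<in> {1..K}" for k
  proof -
    note m1 = noisy_moments(1-4)[OF k, of \<sigma> x] and m2 = noisy_cnj_moments[OF k, of \<sigma> x]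
    consider (1) "k = j"
      | (2) "k \<noteq> j" "k = a" "k = b"
      | (3) "k \<noteq> j" "(k = a) \<noteq> (k = b)"
      | (5) "k \<noteq> j" "k = c" "k = d"
      | (6) "k \<noteq> j" "(k = c) \<noteq> (k = d)"
      | (8) "k \<noteq> j" "k \<noteq> a" "k \<noteq> b" "k \<noteq> c" "k \<noteq> d" by blast
    then show ?thesis
    proof cases
      case 1
      then have "f k = (\<lambda>y. y * cnj y)" "g k = of_real ((cmod (x k))^2 + 2 * \<sigma>^2)" using dist by (auto simp: f_def g_def fun_eq_iff)
      then show ?thesis using m2(1,2) by (simp add: Y_def prob_space)
    next
      case 2
      then have "f k = (\<lambda>y. y * y)" "g k = x k * x k" using dist by (auto simp: f_def g_def fun_eq_iff)
      then show ?thesis using m1(3,4) by (simp add: Y_def prob_space)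
    next
      case 3
      then have "f k = (\<lambda>y. y)" "g k = x k" using dist by (auto simp: f_def g_def fun_eq_iff)
      then show ?thesis using m1(1,2) by (simp add: Y_def prob_space)
    next
      case 5
      then have "f k = (\<lambda>y. cnj y * cnj y)" "g k = cnj (x k) * cnj (x k)" using dist by (auto simp: f_def g_def fun_eq_iff)
      then show ?thesis using m2(3,4) by (simp add: Y_def prob_space)
    next
      case 6
      then have "f k = (\<lambda>y. cnj y)" "g k = cnj (x k)" using dist by (auto simp: f_def g_def fun_eq_iff)
      then show ?thesis using m1(1,2) by (simp add: Y_def prob_space)
    next
      case 8
      then have "f k = (\<lambda>y. 1)" "g k = 1" using dist by (auto simp: f_def g_def fun_eq_iff)
      then show ?thesis using m1(1) by (simp add: Y_def prob_space)
    qed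
  qed
  have pf: "(\<Prod>k=1..K. f k (Y z k)) = Y z j * cnj (Y z j) * Y z a * Y z b * cnj (Y z c) * cnj (Y z d)" for z
    unfolding f_def prod.distrib using ind by (simp add: prod.delta)
  have pg: "(\<Prod>k=1..K. g k) = of_real ((cmod (x j))^2 + 2 * \<sigma>^2) * x a * x b * cnj (x c) * cnj (x d)"
    unfolding g_def prod.distrib using ind by (simp add: prod.delta)
  show "gint K (\<lambda>z. Y z j * cnj (Y z j) * Y z a * Y z b * cnj (Y z c) * cnj (Y z d))" unfolding pf[symmetric] unfolding Y_def
    by (rule noisy_product_expectation(1)) (use meas * in \<open>auto simp: Y_def\<close>)
  have "gmean K (\<lambda>z. (\<Prod>k=1..K. f k (Y z k))) = (\<Prod>k=1..K. gmean K (\<lambda>z. f k (Y z k)))"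
    unfolding Y_def by (rule noisy_product_expectation(2)) (use meas * in \<open>auto simp: Y_def\<close>)
  also have "... = (\<Prod>k=1..K. g k)" using * by (intro prod.cong) auto
  finally show "gmean K (\<lambda>z. Y z j * cnj (Y z j) * Y z a * Y z b * cnj (Y z c) * cnj (Y z d))
      = of_real ((cmod (x j))^2 + 2 * \<sigma>^2) * x a * x b * cnj (x c) * cnj (x d)" unfolding pf pg .
qed

text \<open>The entry is unbiased since the conjugated frequency differs from the other two, and for
  \<open>a = b\<close> the square of the coefficient has the right mean. In the second moment,
  \<open>a = b\<close> is the case that calls for a fourth moment.\<close>

lemma noisy_bispectrum:
  fixes \<sigma> :: real and x :: "nat => complex"
  assumes ind: "a \<in> {1..K}" "b \<in> {1..K}" "c \<in> {1..K}" and dist: "a \<noteq> c" "b \<noteq> c"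
  defines "Y \<equiv> noisy \<sigma> x"
  shows "gint K (\<lambda>z. Y z a * Y z b * cnj (Y z c))"
    and "gmean K (\<lambda>z. Y z a * Y z b * cnj (Y z c)) = x a * x b * cnj (x c)"
    and "gint K (\<lambda>z. (cmod (Y z a * Y z b * cnj (Y z c)))^2)"
    and "(\<And>k. k \<in> {1..K} ==> (cmod (x k))^2 \<le> A) ==> gmean K (\<lambda>z. (cmod (Y z a * Y z b * cnj (Y z c)))^2)
        \<le> (8 * A^2 + 96 * \<sigma> ^ 4) * (A + 2 * \<sigma>^2)"
proof -
  interpret prob_space "gaussian_noise K" by (rule prob_space_gaussian_noise)
  {
    define f where "f k y = (if k = a then y else 1) * (if k = b then y else 1) * (if k = c then cnj y else 1)" for k y
    define g where "g k = (if k = a then x k else 1) * (if k = b then x k else 1) * (if k = c then cnj (x k) else 1)" for k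
    have meas: "f k \<in> borel_measurable borel" for k unfolding f_def
      by (cases "k = a"; cases "k = b"; cases "k = c") (auto intro!: borel_measurable_continuous_onI continuous_intros)
    have *: "gint K (\<lambda>z. f k (Y z k)) \<and> gmean K (\<lambda>z. f k (Y z k)) = g k" if k: "k \<in> {1..K}" for k
      using noisy_moments(1-4)[OF k, of \<sigma> x] dist unfolding f_def g_def Y_def
      by (cases "k = a"; cases "k = b"; cases "k = c") (simp_all add: prob_space)
    have pf: "(\<Prod>k=1..K. f k (Y z k)) = Y z a * Y z b * cnj (Y z c)" for z
      unfolding f_def prod.distrib using ind by (simp add: prod.delta)
    have pg: "(\<Prod>k=1..K. g k) = x a * x b * cnj (x c)" unfolding g_def prod.distrib using ind by (simp add: prod.delta)
    show "gint K (\<lambda>z. Y z a * Y z b * cnj (Y z c))" unfolding pf[symmetric] unfolding Y_def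
      by (rule noisy_product_expectation(1)) (use meas * in \<open>auto simp: Y_def\<close>)
    have "gmean K (\<lambda>z. (\<Prod>k=1..K. f k (Y z k))) = (\<Prod>k=1..K. gmean K (\<lambda>z. f k (Y z k)))"
      unfolding Y_def by (rule noisy_product_expectation(2)) (use meas * in \<open>auto simp: Y_def\<close>)
    also have "... = (\<Prod>k=1..K. g k)" using * by (intro prod.cong) auto
    finally show "gmean K (\<lambda>z. Y z a * Y z b * cnj (Y z c)) = x a * x b * cnj (x c)" unfolding pf pg .
  }
  define f where "f k y = (if k = a then (cmod y)^2 else 1) * (if k = b then (cmod y)^2 else 1) * (if k = c then (cmod y)^2 else 1)"
    for k y
  have meas: "f k \<in> borel_measurable borel" for k unfolding f_def
    by (cases "k = a"; cases "k = b"; cases "k = c") (auto intro!: borel_measurable_continuous_onI continuous_intros)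
  have int: "gint K (\<lambda>z. f k (Y z k))" if k: "k \<in> {1..K}" for k using noisy_moments(5,7)[OF k, of \<sigma> x] dist unfolding f_def Y_def
    by (cases "k = a"; cases "k = b"; cases "k = c") (simp_all add: power_add[symmetric])
  have pf: "(\<Prod>k=1..K. f k (Y z k)) = (cmod (Y z a * Y z b * cnj (Y z c)))^2" for z
    unfolding f_def prod.distrib using ind by (simp add: prod.delta norm_mult power_mult_distrib)
  show "gint K (\<lambda>z. (cmod (Y z a * Y z b * cnj (Y z c)))^2)" unfolding pf[symmetric] unfolding Y_def
    by (rule noisy_product_expectation(1)) (use meas int in \<open>auto simp: Y_def\<close>)
  assume A: "\<And>k. k \<in> {1..K} ==> (cmod (x k))^2 \<le> A"
  have A0: "0 \<le> A" using A[OF ind(1)] zero_le_power2 order_trans by blast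
  have eq: "gmean K (\<lambda>z. (cmod (Y z a * Y z b * cnj (Y z c)))^2) = (\<Prod>k=1..K. gmean K (\<lambda>z. f k (Y z k)))"
    unfolding pf[symmetric] unfolding Y_def by (rule noisy_product_expectation(2)) (use meas int in \<open>auto simp: Y_def\<close>)
  have m2: "gmean K (\<lambda>z. (cmod (Y z k))^2) \<le> A + 2 * \<sigma>^2" if "k \<in> {1..K}" for k
    using noisy_moments(6)[OF that, of \<sigma> x] A[OF that] by (simp add: Y_def)
  have m2_0: "0 \<le> gmean K (\<lambda>z. (cmod (Y z k))^2)" for k by simp
  have m4: "gmean K (\<lambda>z. (cmod (Y z k)) ^ 4) \<le> 8 * A^2 + 96 * \<sigma> ^ 4" if "k \<in> {1..K}" for k
  proof -
    have "((cmod (x k))^2)^2 \<le> A^2" using A[OF that] by (intro power_mono) auto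
    then have "(cmod (x k)) ^ 4 \<le> A^2" by simp
    then show ?thesis using noisy_moments(8)[OF that, of \<sigma> x] unfolding Y_def by linarith
  qed
  show "gmean K (\<lambda>z. (cmod (Y z a * Y z b * cnj (Y z c)))^2) \<le> (8 * A^2 + 96 * \<sigma> ^ 4) * (A + 2 * \<sigma>^2)"
  proof (cases "a = b")
    case True
    have "gmean K (\<lambda>z. f k (Y z k)) = (if k = a then gmean K (\<lambda>z. (cmod (Y z k)) ^ 4) else 1)
        * (if k = c then gmean K (\<lambda>z. (cmod (Y z k))^2) else 1)" for k using True dist unfolding f_def
      by (cases "k = a"; cases "k = c") (simp_all add: prob_space power_add[symmetric])
    then have "(\<Prod>k=1..K. gmean K (\<lambda>z. f k (Y z k))) = gmean K (\<lambda>z. (cmod (Y z a)) ^ 4) * gmean K (\<lambda>z. (cmod (Y z c))^2)"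
      using ind by (simp add: prod.distrib prod.delta)
    also have "... \<le> (8 * A^2 + 96 * \<sigma> ^ 4) * (A + 2 * \<sigma>^2)" by (intro mult_mono m2 m4 ind m2_0) (use A0 in auto)
    finally show ?thesis unfolding eq .
  next
    case False
    have "gmean K (\<lambda>z. f k (Y z k)) = (if k = a then gmean K (\<lambda>z. (cmod (Y z k))^2) else 1)
        * (if k = b then gmean K (\<lambda>z. (cmod (Y z k))^2) else 1) * (if k = c then gmean K (\<lambda>z. (cmod (Y z k))^2) else 1)" for k
      using False dist unfolding f_def by (cases "k = a"; cases "k = b"; cases "k = c") (simp_all add: prob_space)
    then have "(\<Prod>k=1..K. gmean K (\<lambda>z. f k (Y z k))) = gmean K (\<lambda>z. (cmod (Y z a))^2) * gmean K (\<lambda>z. (cmod (Y z b))^2)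
        * gmean K (\<lambda>z. (cmod (Y z c))^2)" using ind by (simp add: prod.distrib prod.delta)
    also have "... \<le> (A + 2 * \<sigma>^2) * (A + 2 * \<sigma>^2) * (A + 2 * \<sigma>^2)"
      by (intro mult_mono m2 ind m2_0 mult_nonneg_nonneg) (use A0 in auto)
    also have "... \<le> (8 * A^2 + 96 * \<sigma> ^ 4) * (A + 2 * \<sigma>^2)"
    proof (rule mult_right_mono)
      have "(A + 2 * \<sigma>^2)^2 \<le> 2 * (A^2 + (2 * \<sigma>^2)^2)" by (rule power2_sum2_le)
      also have "... = 2 * A^2 + 8 * \<sigma> ^ 4" by (simp add: power_mult_distrib)
      also have "... \<le> 8 * A^2 + 96 * \<sigma> ^ 4" by (intro add_mono mult_right_mono) auto
      finally show "(A + 2 * \<sigma>^2) * (A + 2 * \<sigma>^2) \<le> 8 * A^2 + 96 * \<sigma> ^ 4" by (simp add: power2_eq_square)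
    qed (use A0 in auto)
    finally show ?thesis unfolding eq .
  qed
qed

section \<open>Second moments of linear combinations of bispectrum entries\<close>

text \<open>Off the diagonal the Gram matrix is the rank one matrix of \<open>m\<close>. Completing
  the diagonal of that matrix leaves a diagonal remainder with entries at most \<open>V\<close>. The
  family thus behaves like an orthogonal one apart from a single deterministic direction.\<close>

lemma quasi_orthogonal_second_moment:
  fixes f :: "'t => 'a => complex"
  assumes T: "finite T"
    and off: "\<And>s t. s \<in> T ==> t \<in> T ==> s \<noteq> t ==> integrable M (\<lambda>x. f s x * cnj (f t x))"
      "\<And>s t. s \<in> T ==> t \<in> T ==> s \<noteq> t ==> (\<integral>x. f s x * cnj (f t x) \<partial>M) = m s * cnj (m t)"
    and diag: "\<And>t. t \<in> T ==> integrable M (\<lambda>x. (cmod (f t x))^2)" "\<And>t. t \<in> T ==> (\<integral>x. (cmod (f t x))^2 \<partial>M) \<le> V"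
  shows "integrable M (\<lambda>x. (cmod (\<Sum>t\<in>T. c t * f t x))^2)"
    and "(\<integral>x. (cmod (\<Sum>t\<in>T. c t * f t x))^2 \<partial>M) \<le> (cmod (\<Sum>t\<in>T. c t * m t))^2 + V * (\<Sum>t\<in>T. (cmod (c t))^2)"
proof -
  have sq: "(cmod (\<Sum>t\<in>T. c t * g t))^2 = Re (\<Sum>s\<in>T. \<Sum>t\<in>T. c s * cnj (c t) * (g s * cnj (g t)))" for g :: "'t => complex"
  proof -
    have "of_real ((cmod (\<Sum>t\<in>T. c t * g t))^2) = (\<Sum>s\<in>T. \<Sum>t\<in>T. c s * cnj (c t) * (g s * cnj (g t)))"
      unfolding complex_norm_square_real cnj_sum sum_product by (intro sum.cong refl) (simp add: mult_ac)
    then show ?thesis by (metis Re_complex_of_real)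
  qed
  have int: "integrable M (\<lambda>x. f s x * cnj (f t x))" if "s \<in> T" "t \<in> T" for s t
  proof (cases "s = t")
    case True
    have "integrable M (\<lambda>x. complex_of_real ((cmod (f t x))^2))" using diag(1)[OF that(2)] by (rule integrable_of_real)
    then show ?thesis using True by (simp only: complex_norm_square_real)
  qed (use off that in auto)
  have int2: "integrable M (\<lambda>x. \<Sum>s\<in>T. \<Sum>t\<in>T. c s * cnj (c t) * (f s x * cnj (f t x)))"
    by (intro Bochner_Integration.integrable_sum Bochner_Integration.integrable_mult_right int)
  show "integrable M (\<lambda>x. (cmod (\<Sum>t\<in>T. c t * f t x))^2)" unfolding sq by (intro integrable_Re int2)
  define d where "d t = (\<integral>x. (cmod (f t x))^2 \<partial>M)" for t
  have I: "(\<integral>x. f s x * cnj (f t x) \<partial>M) = m s * cnj (m t) + (if s = t then of_real (d t - (cmod (m t))^2) else 0)"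
    if "s \<in> T" "t \<in> T" for s t
  proof (cases "s = t")
    case True
    have "(\<integral>x. f t x * cnj (f t x) \<partial>M) = of_real (d t)"
      unfolding d_def complex_norm_square_real[symmetric] integral_complex_of_real ..
    then show ?thesis using True complex_norm_square_real[of "m t"] by simp
  qed (use off that in auto)
  have "(\<integral>x. (cmod (\<Sum>t\<in>T. c t * f t x))^2 \<partial>M) = Re (\<integral>x. (\<Sum>s\<in>T. \<Sum>t\<in>T. c s * cnj (c t) * (f s x * cnj (f t x))) \<partial>M)"
    unfolding sq by (rule integral_Re[OF int2])
  also have "(\<integral>x. (\<Sum>s\<in>T. \<Sum>t\<in>T. c s * cnj (c t) * (f s x * cnj (f t x))) \<partial>M)
      = (\<Sum>s\<in>T. \<Sum>t\<in>T. c s * cnj (c t) * (\<integral>x. f s x * cnj (f t x) \<partial>M))"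
  proof (subst Bochner_Integration.integral_sum)
    show "(\<Sum>s\<in>T. \<integral>x. (\<Sum>t\<in>T. c s * cnj (c t) * (f s x * cnj (f t x))) \<partial>M)
        = (\<Sum>s\<in>T. \<Sum>t\<in>T. c s * cnj (c t) * (\<integral>x. f s x * cnj (f t x) \<partial>M))"
    proof (intro sum.cong refl)
      fix s assume s: "s \<in> T"
      have "(\<integral>x. (\<Sum>t\<in>T. c s * cnj (c t) * (f s x * cnj (f t x))) \<partial>M) = (\<Sum>t\<in>T. \<integral>x. c s * cnj (c t) * (f s x * cnj (f t x)) \<partial>M)"
        by (intro Bochner_Integration.integral_sum Bochner_Integration.integrable_mult_right int s)
      then show "(\<integral>x. (\<Sum>t\<in>T. c s * cnj (c t) * (f s x * cnj (f t x))) \<partial>M)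
        = (\<Sum>t\<in>T. c s * cnj (c t) * (\<integral>x. f s x * cnj (f t x) \<partial>M))" by simp
    qed
  qed (intro Bochner_Integration.integrable_sum Bochner_Integration.integrable_mult_right int)
  also have "... = (\<Sum>s\<in>T. \<Sum>t\<in>T. c s * cnj (c t) * (m s * cnj (m t))
      + (if s = t then of_real ((cmod (c t))^2 * (d t - (cmod (m t))^2)) else 0))"
    by (intro sum.cong refl) (auto simp: I distrib_left complex_norm_square_real[symmetric])
  also have "... = (\<Sum>s\<in>T. \<Sum>t\<in>T. c s * cnj (c t) * (m s * cnj (m t))) + (\<Sum>t\<in>T. of_real ((cmod (c t))^2 * (d t - (cmod (m t))^2)))"
    unfolding sum.distrib using T by simp
  also have "Re ... = (cmod (\<Sum>t\<in>T. c t * m t))^2 + (\<Sum>t\<in>T. (cmod (c t))^2 * (d t - (cmod (m t))^2))"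
    unfolding sq by (simp del: of_real_mult of_real_diff of_real_power)
  also have "... \<le> (cmod (\<Sum>t\<in>T. c t * m t))^2 + V * (\<Sum>t\<in>T. (cmod (c t))^2)"
  proof -
    have "(\<Sum>t\<in>T. (cmod (c t))^2 * (d t - (cmod (m t))^2)) \<le> (\<Sum>t\<in>T. (cmod (c t))^2 * V)"
    proof (intro sum_mono mult_left_mono)
      fix t assume "t \<in> T"
      then show "d t - (cmod (m t))^2 \<le> V" using diag(2)[of t] zero_le_power2[of "cmod (m t)"] unfolding d_def by linarith
    qed auto
    then show ?thesis by (simp add: sum_distrib_left mult.commute)
  qed
  finally show "(\<integral>x. (cmod (\<Sum>t\<in>T. c t * f t x))^2 \<partial>M) \<le> (cmod (\<Sum>t\<in>T. c t * m t))^2 + V * (\<Sum>t\<in>T. (cmod (c t))^2)" .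
qed

lemma cmod_sum_mult_square_le: "(cmod (\<Sum>t\<in>T. c t * g t))^2 \<le> (\<Sum>t\<in>T. (cmod (c t))^2) * (\<Sum>t\<in>T. (cmod (g t))^2)"
proof -
  have "cmod (\<Sum>t\<in>T. c t * g t) \<le> (\<Sum>t\<in>T. cmod (c t) * cmod (g t))" by (rule order_trans[OF norm_sum]) (simp add: norm_mult)
  then have "(cmod (\<Sum>t\<in>T. c t * g t))^2 \<le> (\<Sum>t\<in>T. cmod (c t) * cmod (g t))^2" by (intro power_mono) auto
  also have "... \<le> (\<Sum>t\<in>T. (cmod (c t))^2) * (\<Sum>t\<in>T. (cmod (g t))^2)" by (rule Cauchy_Schwarz_ineq_sum)
  finally show ?thesis .
qed

lemma cmod_add_square_le: "(cmod (x + y))^2 \<le> 2 * (cmod x)^2 + 2 * (cmod y)^2"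
proof -
  have "(cmod (x + y))^2 \<le> (cmod x + cmod y)^2" by (intro power_mono norm_triangle_ineq) auto
  also have "... \<le> 2 * ((cmod x)^2 + (cmod y)^2)" by (rule power2_sum2_le)
  finally show ?thesis by simp
qed

definition triple :: "(nat => complex) => nat \<times> nat => complex" where
  "triple Y p = Y (fst p) * Y (snd p) * cnj (Y (fst p + snd p))"

text \<open>The first summand bounds the second moment of one triple. The second one is the
  deterministic direction of a family sharing one frequency, with \<open>A * B\<close> bounding the
  energy of the products of the two other coefficients.\<close>

definition chaos_bound :: "real => real => real => real" where
  "chaos_bound \<sigma> A B = (8 * A^2 + 96 * \<sigma> ^ 4) * (A + 2 * \<sigma>^2) + (A + 2 * \<sigma>^2) * (A * B)"

context
  fixes K :: nat and \<sigma> A B :: real and x :: "nat => complex"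
  assumes A: "\<And>k. k \<in> {1..K} ==> (cmod (x k))^2 \<le> A"
    and B: "(\<Sum>k=1..K. (cmod (x k))^2) \<le> B"
    and A0: "0 \<le> A"
begin

lemma B0: "0 \<le> B"
  using B sum_nonneg[of "{1..K}" "\<lambda>k. (cmod (x k))^2"] by (auto intro: order_trans)

lemma triple_second_moment:
  assumes "1 \<le> k" "1 \<le> l" "k + l \<le> K"
  shows "gint K (\<lambda>z. (cmod (triple (noisy \<sigma> x z) (k, l)))^2)"
    and "gmean K (\<lambda>z. (cmod (triple (noisy \<sigma> x z) (k, l)))^2) \<le> (8 * A^2 + 96 * \<sigma> ^ 4) * (A + 2 * \<sigma>^2)"
  unfolding triple_def fst_conv snd_conv
  by (rule noisy_bispectrum(3); use assms in simp) (rule noisy_bispectrum(4); use assms A in simp)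

lemma chaos_bound_ge: "(8 * A^2 + 96 * \<sigma> ^ 4) * (A + 2 * \<sigma>^2) \<le> chaos_bound \<sigma> A B" "0 \<le> chaos_bound \<sigma> A B"
  unfolding chaos_bound_def using A0 B0 by auto

text \<open>The common factor \<open>(cmod (x j))^2 + 2 * \<sigma>^2\<close> is distributed by its
  square root to both sides, which exhibits the rank one form. Cauchy-Schwarz then bounds the
  deterministic direction by the energy of \<open>g\<close>.\<close>

lemma quasi_orthogonal_triples:
  assumes T: "finite T"
    and t: "\<And>t. t \<in> T ==> 1 \<le> fst (p t) \<and> 1 \<le> snd (p t) \<and> fst (p t) + snd (p t) \<le> K"
    and j: "j \<in> {1..K}"
    and g: "(\<Sum>t\<in>T. (cmod (g t))^2) \<le> A * B"
    and off: "\<And>s t. s \<in> T ==> t \<in> T ==> s \<noteq> t ==> gint K (\<lambda>z. triple (noisy \<sigma> x z) (p s) * cnj (triple (noisy \<sigma> x z) (p t)))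
      \<and> gmean K (\<lambda>z. triple (noisy \<sigma> x z) (p s) * cnj (triple (noisy \<sigma> x z) (p t)))
        = of_real ((cmod (x j))^2 + 2 * \<sigma>^2) * (g s * cnj (g t))"
  shows "gint K (\<lambda>z. (cmod (\<Sum>t\<in>T. c t * triple (noisy \<sigma> x z) (p t)))^2)"
    and "gmean K (\<lambda>z. (cmod (\<Sum>t\<in>T. c t * triple (noisy \<sigma> x z) (p t)))^2) \<le> chaos_bound \<sigma> A B * (\<Sum>t\<in>T. (cmod (c t))^2)"
proof -
  define s where "s = (cmod (x j))^2 + 2 * \<sigma>^2"
  have s: "0 \<le> s" "s \<le> A + 2 * \<sigma>^2" using A[OF j] by (auto simp: s_def)
  define m where "m t = of_real (sqrt s) * g t" for t
  have mm: "m u * cnj (m t) = of_real s * (g u * cnj (g t))" for u t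
  proof -
    have "m u * cnj (m t) = of_real (sqrt s * sqrt s) * (g u * cnj (g t))" unfolding m_def of_real_mult by simp
    then show ?thesis using s by simp
  qed
  have o1: "gint K (\<lambda>z. triple (noisy \<sigma> x z) (p u) * cnj (triple (noisy \<sigma> x z) (p t)))"
    and o2: "gmean K (\<lambda>z. triple (noisy \<sigma> x z) (p u) * cnj (triple (noisy \<sigma> x z) (p t)))
        = m u * cnj (m t)" if "u \<in> T" "t \<in> T" "u \<noteq> t" for u t using off[OF that] unfolding mm s_def by auto
  have d1: "gint K (\<lambda>z. (cmod (triple (noisy \<sigma> x z) (p u)))^2)"
    and d2: "gmean K (\<lambda>z. (cmod (triple (noisy \<sigma> x z) (p u)))^2) \<le> (8 * A^2 + 96 * \<sigma> ^ 4) * (A + 2 * \<sigma>^2)" if "u \<in> T" for u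
    using triple_second_moment[of "fst (p u)" "snd (p u)"] t[OF that] by simp_all
  show "gint K (\<lambda>z. (cmod (\<Sum>t\<in>T. c t * triple (noisy \<sigma> x z) (p t)))^2)"
    by (rule quasi_orthogonal_second_moment(1)[OF T o1 o2 d1 d2])
  have "gmean K (\<lambda>z. (cmod (\<Sum>t\<in>T. c t * triple (noisy \<sigma> x z) (p t)))^2)
     \<le> (cmod (\<Sum>t\<in>T. c t * m t))^2 + (8 * A^2 + 96 * \<sigma> ^ 4) * (A + 2 * \<sigma>^2) * (\<Sum>t\<in>T. (cmod (c t))^2)"
    by (rule quasi_orthogonal_second_moment(2)[OF T o1 o2 d1 d2])
  note le = this
  have "(\<Sum>t\<in>T. (cmod (m t))^2) = s * (\<Sum>t\<in>T. (cmod (g t))^2)"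
    using s by (simp add: m_def norm_mult power_mult_distrib sum_distrib_left)
  also have "... \<le> (A + 2 * \<sigma>^2) * (A * B)" using s g A0 by (intro mult_mono) (auto intro: sum_nonneg)
  finally have "(\<Sum>t\<in>T. (cmod (c t))^2) * (\<Sum>t\<in>T. (cmod (m t))^2) \<le> (\<Sum>t\<in>T. (cmod (c t))^2) * ((A + 2 * \<sigma>^2) * (A * B))"
    by (intro mult_left_mono sum_nonneg) auto
  with cmod_sum_mult_square_le[of c m T]
  have "(cmod (\<Sum>t\<in>T. c t * m t))^2 \<le> (A + 2 * \<sigma>^2) * (A * B) * (\<Sum>t\<in>T. (cmod (c t))^2)" by (simp add: mult.commute)
  with le show "gmean K (\<lambda>z. (cmod (\<Sum>t\<in>T. c t * triple (noisy \<sigma> x z) (p t)))^2) \<le> chaos_bound \<sigma> A B * (\<Sum>t\<in>T. (cmod (c t))^2)"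
    unfolding chaos_bound_def distrib_right by linarith
qed

lemma sum_shifted_products_le:
  assumes "finite T" "inj_on a T" "a ` T \<subseteq> {1..K}" "b ` T \<subseteq> {1..K}"
    and h: "\<And>t. t \<in> T ==> cmod (h t) = cmod (x (a t)) * cmod (x (b t))"
  shows "(\<Sum>t\<in>T. (cmod (h t))^2) \<le> A * B"
proof -
  have "(\<Sum>t\<in>T. (cmod (h t))^2) \<le> (\<Sum>t\<in>T. A * (cmod (x (a t)))^2)"
  proof (rule sum_mono)
    fix t assume t: "t \<in> T"
    have "(cmod (x (a t)))^2 * (cmod (x (b t)))^2 \<le> (cmod (x (a t)))^2 * A" using assms t by (intro mult_left_mono A) auto
    then show "(cmod (h t))^2 \<le> A * (cmod (x (a t)))^2" unfolding h[OF t] power_mult_distrib by (simp add: mult.commute)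
  qed
  also have "... = A * (\<Sum>k\<in>a ` T. (cmod (x k))^2)" using assms by (simp add: sum_distrib_left sum.reindex)
  also have "... \<le> A * (\<Sum>k=1..K. (cmod (x k))^2)" using assms A0 by (intro mult_left_mono sum_mono2) auto
  also have "... \<le> A * B" by (intro mult_left_mono B A0)
  finally show ?thesis .
qed

text \<open>Two triples of a row share \<open>j\<close>, once plain and once conjugated. The column
  \<open>l = j\<close> is left out because \<open>j\<close> would occur there as a square. A match
  such as \<open>j + s = t\<close> does no harm: both coefficients are conjugated in the
  product.\<close>

lemma row_second_moment:
  assumes j: "j \<in> {1..K}" and T: "T \<subseteq> {1..K - j}" "j \<notin> T"
  shows "gint K (\<lambda>z. (cmod (\<Sum>l\<in>T. c l * triple (noisy \<sigma> x z) (j, l)))^2)"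
    and "gmean K (\<lambda>z. (cmod (\<Sum>l\<in>T. c l * triple (noisy \<sigma> x z) (j, l)))^2) \<le> chaos_bound \<sigma> A B * (\<Sum>l\<in>T. (cmod (c l))^2)"
proof -
  have fin: "finite T" using T finite_subset by blast
  have mem: "l \<in> {1..K - j}" if "l \<in> T" for l using T that by blast
  have t: "1 \<le> fst (j, l) \<and> 1 \<le> snd (j, l) \<and> fst (j, l) + snd (j, l) \<le> K" if "l \<in> T" for l using mem[OF that] j by auto
  have g: "(\<Sum>l\<in>T. (cmod (x l * cnj (x (j + l))))^2) \<le> A * B" by (rule sum_shifted_products_le[where a="\<lambda>l. l" and b="\<lambda>l. j + l"])
      (use mem j fin in \<open>force simp: norm_mult\<close>)+
  have off: "gint K (\<lambda>z. triple (noisy \<sigma> x z) (j, s) * cnj (triple (noisy \<sigma> x z) (j, t)))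
      \<and> gmean K (\<lambda>z. triple (noisy \<sigma> x z) (j, s) * cnj (triple (noisy \<sigma> x z) (j, t)))
        = of_real ((cmod (x j))^2 + 2 * \<sigma>^2) * ((x s * cnj (x (j + s))) * cnj (x t * cnj (x (j + t))))"
    if "s \<in> T" "t \<in> T" "s \<noteq> t" for s t
  proof -
    have h: "s \<in> {1..K}" "j + t \<in> {1..K}" "j + s \<in> {1..K}" "t \<in> {1..K}" "j \<in> {1..K}"
      "s \<noteq> j + s" "s \<noteq> t" "j + t \<noteq> j + s" "j + t \<noteq> t" "j \<noteq> s" "j \<noteq> j + t" "j \<noteq> j + s" "j \<noteq> t"
      using mem[OF that(1)] mem[OF that(2)] T j that by auto
    have e: "triple (noisy \<sigma> x z) (j, s) * cnj (triple (noisy \<sigma> x z) (j, t))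
      = noisy \<sigma> x z j * cnj (noisy \<sigma> x z j) * noisy \<sigma> x z s * noisy \<sigma> x z (j + t)
        * cnj (noisy \<sigma> x z (j + s)) * cnj (noisy \<sigma> x z t)" for z by (simp add: triple_def)
    show ?thesis unfolding e using noisy_sixth_order_moment[OF h, of \<sigma> x] by simp
  qed
  show "gint K (\<lambda>z. (cmod (\<Sum>l\<in>T. c l * triple (noisy \<sigma> x z) (j, l)))^2)" by (rule quasi_orthogonal_triples(1)[OF fin t j g off])
  show "gmean K (\<lambda>z. (cmod (\<Sum>l\<in>T. c l * triple (noisy \<sigma> x z) (j, l)))^2) \<le> chaos_bound \<sigma> A B * (\<Sum>l\<in>T. (cmod (c l))^2)"
    by (rule quasi_orthogonal_triples(2)[OF fin t j g off])
qed

text \<open>The pairs \<open>(k, j - k)\<close> and \<open>(j - k, k)\<close> give the same triple,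
  so quasi-orthogonality holds only on one half of the antidiagonal. Its midpoint
  \<open>2 * k = j\<close> is a repeated plain index and admissible.\<close>

lemma diagonal_second_moment:
  assumes j: "j \<in> {1..K}" and T: "T \<subseteq> {1..<j}" and half: "\<And>k. k \<in> T ==> 2 * k \<le> j"
  shows "gint K (\<lambda>z. (cmod (\<Sum>k\<in>T. c k * triple (noisy \<sigma> x z) (k, j - k)))^2)"
    and "gmean K (\<lambda>z. (cmod (\<Sum>k\<in>T. c k * triple (noisy \<sigma> x z) (k, j - k)))^2) \<le> chaos_bound \<sigma> A B * (\<Sum>k\<in>T. (cmod (c k))^2)"
proof -
  have fin: "finite T" using T finite_subset by blast
  have mem: "k \<in> {1..<j}" if "k \<in> T" for k using T that by blast
  have t: "1 \<le> fst (k, j - k) \<and> 1 \<le> snd (k, j - k) \<and> fst (k, j - k) + snd (k, j - k) \<le> K" if "k \<in> T" for k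
    using mem[OF that] j by auto
  have g: "(\<Sum>k\<in>T. (cmod (x k * x (j - k)))^2) \<le> A * B" by (rule sum_shifted_products_le[where a="\<lambda>k. k" and b="\<lambda>k. j - k"])
      (use mem j fin in \<open>force simp: norm_mult\<close>)+
  have off: "gint K (\<lambda>z. triple (noisy \<sigma> x z) (s, j - s) * cnj (triple (noisy \<sigma> x z) (t, j - t)))
      \<and> gmean K (\<lambda>z. triple (noisy \<sigma> x z) (s, j - s) * cnj (triple (noisy \<sigma> x z) (t, j - t)))
        = of_real ((cmod (x j))^2 + 2 * \<sigma>^2) * ((x s * x (j - s)) * cnj (x t * x (j - t)))" if st: "s \<in> T" "t \<in> T" "s \<noteq> t" for s t
  proof -
    have "2 * s \<le> j" "2 * t \<le> j" "1 \<le> s" "s < j" "1 \<le> t" "t < j" using half mem[OF st(1)] mem[OF st(2)] st by auto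
    then have h: "s \<in> {1..K}" "j - s \<in> {1..K}" "t \<in> {1..K}" "j - t \<in> {1..K}" "j \<in> {1..K}"
      "s \<noteq> t" "s \<noteq> j - t" "j - s \<noteq> t" "j - s \<noteq> j - t" "j \<noteq> s" "j \<noteq> j - s" "j \<noteq> t" "j \<noteq> j - t"
      and sj: "s + (j - s) = j" "t + (j - t) = j" using j st(3) by auto
    have e: "triple (noisy \<sigma> x z) (s, j - s) * cnj (triple (noisy \<sigma> x z) (t, j - t))
      = noisy \<sigma> x z j * cnj (noisy \<sigma> x z j) * noisy \<sigma> x z s * noisy \<sigma> x z (j - s)
        * cnj (noisy \<sigma> x z t) * cnj (noisy \<sigma> x z (j - t))" for z using sj by (simp add: triple_def)
    show ?thesis unfolding e using noisy_sixth_order_moment[OF h, of \<sigma> x] by simp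
  qed
  show "gint K (\<lambda>z. (cmod (\<Sum>k\<in>T. c k * triple (noisy \<sigma> x z) (k, j - k)))^2)"
    by (rule quasi_orthogonal_triples(1)[OF fin t j g off])
  show "gmean K (\<lambda>z. (cmod (\<Sum>k\<in>T. c k * triple (noisy \<sigma> x z) (k, j - k)))^2) \<le> chaos_bound \<sigma> A B * (\<Sum>k\<in>T. (cmod (c k))^2)"
    by (rule quasi_orthogonal_triples(2)[OF fin t j g off])
qed

end

lemma integrable_cmod_add_square:
  fixes f g :: "'a => complex"
  assumes meas: "f \<in> borel_measurable M" "g \<in> borel_measurable M"
    and int: "integrable M (\<lambda>x. (cmod (f x))^2)" "integrable M (\<lambda>x. (cmod (g x))^2)"
  shows "integrable M (\<lambda>x. (cmod (f x + g x))^2)"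
    and "(\<integral>x. (cmod (f x + g x))^2 \<partial>M) \<le> 2 * (\<integral>x. (cmod (f x))^2 \<partial>M) + 2 * (\<integral>x. (cmod (g x))^2 \<partial>M)"
proof -
  have i: "integrable M (\<lambda>x. 2 * (cmod (f x))^2 + 2 * (cmod (g x))^2)" using int by simp
  show i': "integrable M (\<lambda>x. (cmod (f x + g x))^2)" by (rule Bochner_Integration.integrable_bound[OF i])
      (use meas cmod_add_square_le in \<open>auto intro!: borel_measurable_power borel_measurable_norm borel_measurable_add intro: order_trans[OF _ abs_ge_self]\<close>)
  have "(\<integral>x. (cmod (f x + g x))^2 \<partial>M) \<le> (\<integral>x. 2 * (cmod (f x))^2 + 2 * (cmod (g x))^2 \<partial>M)"
    by (intro integral_mono i i' cmod_add_square_le)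
  then show "(\<integral>x. (cmod (f x + g x))^2 \<partial>M) \<le> 2 * (\<integral>x. (cmod (f x))^2 \<partial>M) + 2 * (\<integral>x. (cmod (g x))^2 \<partial>M)" using int by simp
qed

lemma triple_commute: "triple Y (l, k) = triple Y (k, l)"
  by (simp add: triple_def add.commute)

lemma coboundary_unit: "cob1 j p = of_bool (fst p = j) + of_bool (snd p = j) - of_bool (fst p + snd p = j)"
  by (simp add: coboundary_def)

definition row :: "nat => nat => nat set" where "row K j = {l. (j, l) \<in> high_pairs K}"
definition diagonal :: "nat => nat => nat set" where "diagonal K j = {k. k < j \<and> (k, j - k) \<in> high_pairs K}"

lemma finite_row [simp]: "finite (row K j)" and finite_diagonal [simp]: "finite (diagonal K j)"
  by (rule finite_subset[of _ "{..K}"]; auto simp: row_def diagonal_def high_pairs_def)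
    (rule finite_subset[of _ "{..<j}"]; auto simp: diagonal_def)

text \<open>The frequency \<open>j\<close> occurs in a pair as one of the two members, which by
  symmetry of the triple gives a row read from both sides, or as the sum, which gives an
  antidiagonal. Each of these families is close to orthogonal.\<close>

lemma sum_coboundary_unit:
  fixes c :: "nat \<times> nat => complex"
  shows "(\<Sum>p\<in>high_pairs K. c p * of_real (cob1 j p) * triple Y p)
    = (\<Sum>l\<in>row K j. (c (j, l) + c (l, j)) * triple Y (j, l)) - (\<Sum>k\<in>diagonal K j. c (k, j - k) * triple Y (k, j - k))"
proof -
  let ?P = "high_pairs K"
  have a: "(\<Sum>p\<in>?P. of_bool (fst p = j) * (c p * triple Y p)) = (\<Sum>l\<in>row K j. c (j, l) * triple Y (j, l))"
  proof -
    have "(\<Sum>p\<in>?P. of_bool (fst p = j) * (c p * triple Y p)) = (\<Sum>p\<in>{p\<in>?P. fst p = j}. c p * triple Y p)"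
      by (intro sum.mono_neutral_cong_right) auto
    also have "... = (\<Sum>l\<in>row K j. c (j, l) * triple Y (j, l))"
      by (rule sum.reindex_bij_witness[where i="\<lambda>l. (j, l)" and j=snd]) (auto simp: row_def)
    finally show ?thesis .
  qed
  have b: "(\<Sum>p\<in>?P. of_bool (snd p = j) * (c p * triple Y p)) = (\<Sum>l\<in>row K j. c (l, j) * triple Y (j, l))"
  proof -
    have "(\<Sum>p\<in>?P. of_bool (snd p = j) * (c p * triple Y p)) = (\<Sum>p\<in>{p\<in>?P. snd p = j}. c p * triple Y p)"
      by (intro sum.mono_neutral_cong_right) auto
    also have "... = (\<Sum>l\<in>row K j. c (l, j) * triple Y (j, l))" by (rule sum.reindex_bij_witness[where i="\<lambda>l. (l, j)" and j=fst])
        (auto simp: row_def high_pairs_def triple_commute)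
    finally show ?thesis .
  qed
  have d: "(\<Sum>p\<in>?P. of_bool (fst p + snd p = j) * (c p * triple Y p)) = (\<Sum>k\<in>diagonal K j. c (k, j - k) * triple Y (k, j - k))"
  proof -
    have "(\<Sum>p\<in>?P. of_bool (fst p + snd p = j) * (c p * triple Y p)) = (\<Sum>p\<in>{p\<in>?P. fst p + snd p = j}. c p * triple Y p)"
      by (intro sum.mono_neutral_cong_right) auto
    also have "... = (\<Sum>k\<in>diagonal K j. c (k, j - k) * triple Y (k, j - k))"
      by (rule sum.reindex_bij_witness[where i="\<lambda>k. (k, j - k)" and j=fst]) (auto simp: diagonal_def high_pairs_def)
    finally show ?thesis .
  qed
  have "(\<Sum>p\<in>?P. c p * of_real (cob1 j p) * triple Y p)
    = (\<Sum>p\<in>?P. of_bool (fst p = j) * (c p * triple Y p)) + (\<Sum>p\<in>?P. of_bool (snd p = j) * (c p * triple Y p))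
      - (\<Sum>p\<in>?P. of_bool (fst p + snd p = j) * (c p * triple Y p))"
    unfolding sum.distrib[symmetric] sum_subtractf[symmetric] coboundary_unit by (intro sum.cong refl) (simp add: algebra_simps)
  then show ?thesis unfolding a b d by (simp add: sum.distrib distrib_right)
qed

lemma borel_measurable_cnj [measurable (raw)]: "f \<in> borel_measurable M ==> (\<lambda>x. cnj (f x)) \<in> borel_measurable M"
  by (rule measurable_compose[OF _ borel_measurable_continuous_onI]) (auto intro!: continuous_intros)

lemma measurable_triple_noisy [measurable]:
  assumes "1 \<le> fst p" "1 \<le> snd p" "fst p + snd p \<le> K"
  shows "(\<lambda>z. triple (noisy \<sigma> x z) p) \<in> borel_measurable (gaussian_noise K)"
  unfolding triple_def by (intro borel_measurable_times measurable_noisy borel_measurable_cnj) (use assms in auto)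

context
  fixes K :: nat and \<sigma> A B :: real and x :: "nat => complex"
  assumes A: "\<And>k. k \<in> {1..K} ==> (cmod (x k))^2 \<le> A"
    and B: "(\<Sum>k=1..K. (cmod (x k))^2) \<le> B"
    and A0: "0 \<le> A"
begin

text \<open>The column \<open>l = j\<close>, which quasi-orthogonality does not cover, is split off
  and bounded by the second moment of a single triple; the splitting costs the factor 2.\<close>

lemma score_row_second_moment:
  assumes j: "j \<in> {1..K}"
  shows "gint K (\<lambda>z. (cmod (\<Sum>l\<in>row K j. c l * triple (noisy \<sigma> x z) (j, l)))^2)"
    and "gmean K (\<lambda>z. (cmod (\<Sum>l\<in>row K j. c l * triple (noisy \<sigma> x z) (j, l)))^2)
      \<le> 2 * chaos_bound \<sigma> A B * (\<Sum>l\<in>row K j. (cmod (c l))^2)"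
proof -
  let ?T = "row K j - {j}" and ?S = "row K j \<inter> {j}"
  have T: "?T \<subseteq> {1..K - j}" "j \<notin> ?T" by (auto simp: row_def high_pairs_def)
  note r = row_second_moment[OF A B A0 j T]
  have split: "(\<Sum>l\<in>row K j. g l) = (\<Sum>l\<in>?T. g l) + (\<Sum>l\<in>?S. g l)" for g :: "nat => 'b::comm_monoid_add"
    by (subst sum.union_disjoint[symmetric]) (auto intro: sum.cong)
  have s: "gint K (\<lambda>z. (cmod (\<Sum>l\<in>?S. c l * triple (noisy \<sigma> x z) (j, l)))^2)"
    "gmean K (\<lambda>z. (cmod (\<Sum>l\<in>?S. c l * triple (noisy \<sigma> x z) (j, l)))^2) \<le> chaos_bound \<sigma> A B * (\<Sum>l\<in>?S. (cmod (c l))^2)"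
  proof (atomize (full), cases "j \<in> row K j")
    case True
    then have jj: "1 \<le> j" "j + j \<le> K" "?S = {j}" by (auto simp: row_def high_pairs_def)
    note t = triple_second_moment[OF A B A0 jj(1) jj(1) jj(2), of \<sigma>] and cb = chaos_bound_ge[OF A B A0, of \<sigma>]
    have "(cmod (c j))^2 * gmean K (\<lambda>z. (cmod (triple (noisy \<sigma> x z) (j, j)))^2) \<le> (cmod (c j))^2 * chaos_bound \<sigma> A B"
      using t cb by (intro mult_left_mono) auto
    then show "gint K (\<lambda>z. (cmod (\<Sum>l\<in>?S. c l * triple (noisy \<sigma> x z) (j, l)))^2) \<and>
      gmean K (\<lambda>z. (cmod (\<Sum>l\<in>?S. c l * triple (noisy \<sigma> x z) (j, l)))^2) \<le> chaos_bound \<sigma> A B * (\<Sum>l\<in>?S. (cmod (c l))^2)"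
      using t jj(3) by (simp add: norm_mult power_mult_distrib mult.commute)
  qed simp
  have m: "(\<lambda>z. \<Sum>l\<in>U. c l * triple (noisy \<sigma> x z) (j, l)) \<in> borel_measurable (gaussian_noise K)" if "U \<subseteq> row K j" for U
    using that by (intro borel_measurable_sum borel_measurable_times measurable_triple_noisy) (auto simp: row_def high_pairs_def)
  note c = integrable_cmod_add_square[OF m m r(1) s(1)]
  show "gint K (\<lambda>z. (cmod (\<Sum>l\<in>row K j. c l * triple (noisy \<sigma> x z) (j, l)))^2)" unfolding split by (rule c(1)) auto
  have "gmean K (\<lambda>z. (cmod (\<Sum>l\<in>row K j. c l * triple (noisy \<sigma> x z) (j, l)))^2)
    \<le> 2 * (chaos_bound \<sigma> A B * (\<Sum>l\<in>?T. (cmod (c l))^2)) + 2 * (chaos_bound \<sigma> A B * (\<Sum>l\<in>?S. (cmod (c l))^2))"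
    unfolding split[of "\<lambda>l. c l * triple (noisy \<sigma> x _) (j, l)"]
    by (rule order_trans[OF c(2)]) (use r(2) s(2) in \<open>auto intro!: add_mono\<close>)
  then show "gmean K (\<lambda>z. (cmod (\<Sum>l\<in>row K j. c l * triple (noisy \<sigma> x z) (j, l)))^2)
      \<le> 2 * chaos_bound \<sigma> A B * (\<Sum>l\<in>row K j. (cmod (c l))^2)"
    unfolding split[of "\<lambda>l. (cmod (c l))^2"] by (simp add: algebra_simps)
qed

text \<open>The upper half of the antidiagonal is folded onto the lower one by
  \<open>k \<mapsto> j - k\<close>, and each half is quasi-orthogonal.\<close>

lemma score_diagonal_second_moment:
  assumes j: "j \<in> {1..K}"
  shows "gint K (\<lambda>z. (cmod (\<Sum>k\<in>diagonal K j. c k * triple (noisy \<sigma> x z) (k, j - k)))^2)"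
    and "gmean K (\<lambda>z. (cmod (\<Sum>k\<in>diagonal K j. c k * triple (noisy \<sigma> x z) (k, j - k)))^2)
      \<le> 2 * chaos_bound \<sigma> A B * (\<Sum>k\<in>diagonal K j. (cmod (c k))^2)"
proof -
  let ?T = "diagonal K j \<inter> {k. 2 * k \<le> j}" and ?S = "diagonal K j \<inter> {k. \<not> 2 * k \<le> j}"
  let ?R = "(\<lambda>k. j - k) ` ?S"
  have T: "?T \<subseteq> {1..<j}" "\<And>k. k \<in> ?T ==> 2 * k \<le> j" by (auto simp: diagonal_def high_pairs_def)
  have R: "?R \<subseteq> {1..<j}" "\<And>k. k \<in> ?R ==> 2 * k \<le> j" by (auto simp: diagonal_def high_pairs_def)
  note r = diagonal_second_moment[OF A B A0 j T] and r' = diagonal_second_moment[OF A B A0 j R]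
  have split: "(\<Sum>l\<in>diagonal K j. g l) = (\<Sum>l\<in>?T. g l) + (\<Sum>l\<in>?S. g l)" for g :: "nat => 'b::comm_monoid_add"
    by (subst sum.union_disjoint[symmetric]) (auto intro: sum.cong)
  have inj: "inj_on (\<lambda>k. j - k) ?S" by (auto simp: inj_on_def diagonal_def)
  have jk: "k < j" if "k \<in> ?S" for k using that by (auto simp: diagonal_def)
  have jj: "j - (j - k) = k" if "k \<in> ?S" for k using jk[OF that] by simp
  have refl1: "(\<Sum>k\<in>?R. c (j - k) * triple Y (k, j - k)) = (\<Sum>k\<in>?S. c k * triple Y (k, j - k))" for Y
  proof (subst sum.reindex[OF inj], rule sum.cong[OF refl])
    fix k assume "k \<in> ?S"
    then show "((\<lambda>k. c (j - k) * triple Y (k, j - k)) \<circ> (\<lambda>k. j - k)) k = c k * triple Y (k, j - k)"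
      using triple_commute[of Y k "j - k"] by (simp only: jj comp_def)
  qed
  have refl2: "(\<Sum>k\<in>?R. (cmod (c (j - k)))^2) = (\<Sum>k\<in>?S. (cmod (c k))^2)"
    by (subst sum.reindex[OF inj], rule sum.cong) (simp_all only: jj comp_def)
  note s = r'[of "\<lambda>k. c (j - k)" \<sigma>, unfolded refl1 refl2]
  have m: "(\<lambda>z. \<Sum>k\<in>U. c k * triple (noisy \<sigma> x z) (k, j - k)) \<in> borel_measurable (gaussian_noise K)" if "U \<subseteq> diagonal K j" for U
    using that by (intro borel_measurable_sum borel_measurable_times measurable_triple_noisy)
      (auto simp: diagonal_def high_pairs_def)
  note c = integrable_cmod_add_square[OF m m r(1) s(1)]
  show "gint K (\<lambda>z. (cmod (\<Sum>k\<in>diagonal K j. c k * triple (noisy \<sigma> x z) (k, j - k)))^2)" unfolding split by (rule c(1)) auto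
  have "gmean K (\<lambda>z. (cmod (\<Sum>k\<in>diagonal K j. c k * triple (noisy \<sigma> x z) (k, j - k)))^2)
    \<le> 2 * (chaos_bound \<sigma> A B * (\<Sum>l\<in>?T. (cmod (c l))^2)) + 2 * (chaos_bound \<sigma> A B * (\<Sum>l\<in>?S. (cmod (c l))^2))"
    unfolding split[of "\<lambda>k. c k * triple (noisy \<sigma> x _) (k, j - k)"]
    by (rule order_trans[OF c(2)]) (use r(2)[of c \<sigma>] s(2) in \<open>auto intro!: add_mono\<close>)
  then show "gmean K (\<lambda>z. (cmod (\<Sum>k\<in>diagonal K j. c k * triple (noisy \<sigma> x z) (k, j - k)))^2)
      \<le> 2 * chaos_bound \<sigma> A B * (\<Sum>k\<in>diagonal K j. (cmod (c k))^2)"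
    unfolding split[of "\<lambda>l. (cmod (c l))^2"] by (simp add: algebra_simps)
qed

lemma score_second_moment:
  fixes c :: "nat \<times> nat => complex"
  assumes j: "j \<in> {1..K}"
  defines "F \<equiv> \<lambda>z. \<Sum>p\<in>high_pairs K. c p * of_real (cob1 j p) * triple (noisy \<sigma> x z) p"
  shows "gint K (\<lambda>z. (cmod (F z))^2)"
    and "gmean K (\<lambda>z. (cmod (F z))^2) \<le> 4 * chaos_bound \<sigma> A B * ((\<Sum>l\<in>row K j. (cmod (c (j, l) + c (l, j)))^2)
        + (\<Sum>k\<in>diagonal K j. (cmod (c (k, j - k)))^2))"
proof -
  have F: "F z = (\<Sum>l\<in>row K j. (c (j, l) + c (l, j)) * triple (noisy \<sigma> x z) (j, l))
      + (\<Sum>k\<in>diagonal K j. (- c (k, j - k)) * triple (noisy \<sigma> x z) (k, j - k))" for z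
    unfolding F_def sum_coboundary_unit by (simp add: sum_negf)
  note r = score_row_second_moment[OF j, of "\<lambda>l. c (j, l) + c (l, j)"]
    and d = score_diagonal_second_moment[OF j, of "\<lambda>k. - c (k, j - k)"]
  have m1: "(\<lambda>z. \<Sum>l\<in>row K j. (c (j, l) + c (l, j)) * triple (noisy \<sigma> x z) (j, l)) \<in> borel_measurable (gaussian_noise K)"
    by (intro borel_measurable_sum borel_measurable_times measurable_triple_noisy) (auto simp: row_def high_pairs_def)
  have m2: "(\<lambda>z. \<Sum>k\<in>diagonal K j. (- c (k, j - k)) * triple (noisy \<sigma> x z) (k, j - k)) \<in> borel_measurable (gaussian_noise K)"
    by (intro borel_measurable_sum borel_measurable_times measurable_triple_noisy) (auto simp: diagonal_def high_pairs_def)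
  note i = integrable_cmod_add_square[OF m1 m2 r(1) d(1)]
  show "gint K (\<lambda>z. (cmod (F z))^2)" unfolding F by (rule i(1))
  have "gmean K (\<lambda>z. (cmod (F z))^2) \<le> 2 * (2 * chaos_bound \<sigma> A B * (\<Sum>l\<in>row K j. (cmod (c (j, l) + c (l, j)))^2))
      + 2 * (2 * chaos_bound \<sigma> A B * (\<Sum>k\<in>diagonal K j. (cmod (- c (k, j - k)))^2))"
    unfolding F by (rule order_trans[OF i(2)]) (intro add_mono mult_left_mono r d; simp)
  then show "gmean K (\<lambda>z. (cmod (F z))^2) \<le> 4 * chaos_bound \<sigma> A B * ((\<Sum>l\<in>row K j. (cmod (c (j, l) + c (l, j)))^2)
        + (\<Sum>k\<in>diagonal K j. (cmod (c (k, j - k)))^2))" by (simp add: algebra_simps)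
qed

end

section \<open>From Gaussian noise to the law of one observation\<close>

definition obs_map :: "nat => real => rvec => real => rvec => rvec" where
  "obs_map K \<sigma> \<theta> \<alpha> z = (\<lambda>i\<in>coords K. rot K \<alpha> \<theta> i + \<sigma> * z i)"

abbreviation "uniform_angle \<equiv> uniform_measure lborel angles"

lemma prob_space_uniform_angles: "prob_space (uniform_angle)"
  by (rule prob_space_uniform_measure) (auto simp: angles_def)

lemma sets_gaussian_noise [measurable_cong]: "sets (gaussian_noise K) = sets (vec_space K)"
  unfolding gaussian_noise_def vec_space_def by (intro sets_PiM_cong) auto

lemma borel_measurable_rot: "(\<lambda>\<alpha>. rot K \<alpha> \<theta> i) \<in> borel_measurable borel"
proof (cases "i \<in> coords K")
  case True
  then show ?thesis by (cases i; cases "snd i = 1") (auto simp: rot_def)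
qed (simp add: rot_def)

lemma measurable_obs_map: "(\<lambda>(\<alpha>, z). obs_map K \<sigma> \<theta> \<alpha> z) \<in> uniform_angle \<Otimes>\<^sub>M gaussian_noise K \<rightarrow>\<^sub>M vec_space K"
proof -
  have "sets (uniform_angle \<Otimes>\<^sub>M gaussian_noise K) = sets (borel \<Otimes>\<^sub>M vec_space K)"
    by (intro sets_pair_measure_cong) (auto simp: sets_gaussian_noise)
  moreover have "(\<lambda>(\<alpha>, z). obs_map K \<sigma> \<theta> \<alpha> z) \<in> borel \<Otimes>\<^sub>M vec_space K \<rightarrow>\<^sub>M vec_space K"
    unfolding vec_space_def obs_map_def case_prod_unfold
  proof (rule measurable_restrict)
    fix i assume [measurable]: "i \<in> coords K"
    note borel_measurable_rot[measurable]
    show "(\<lambda>x. rot K (fst x) \<theta> i + \<sigma> * snd x i) \<in> borel_measurable (borel \<Otimes>\<^sub>M (\<Pi>\<^sub>M i\<in>coords K. borel))" by measurable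
  qed
  ultimately show ?thesis using measurable_cong_sets by blast
qed

lemma obs_law_eq_distr: "obs_law K \<sigma> \<theta> = distr (uniform_angle \<Otimes>\<^sub>M gaussian_noise K) (vec_space K) (\<lambda>(\<alpha>, z). obs_map K \<sigma> \<theta> \<alpha> z)"
  unfolding obs_law_def obs_map_def ..

lemma sets_obs_law [measurable_cong]: "sets (obs_law K \<sigma> \<theta>) = sets (vec_space K)"
  by (simp add: obs_law_eq_distr)

lemma nn_integral_obs_law:
  assumes f[measurable]: "f \<in> borel_measurable (vec_space K)"
  shows "(\<integral>\<^sup>+y. f y \<partial>obs_law K \<sigma> \<theta>) = (\<integral>\<^sup>+\<alpha>. \<integral>\<^sup>+z. f (obs_map K \<sigma> \<theta> \<alpha> z) \<partial>gaussian_noise K \<partial>uniform_angle)"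
proof -
  interpret G: prob_space "gaussian_noise K" by (rule prob_space_gaussian_noise)
  have "(\<lambda>x. f (case x of (\<alpha>, z) => obs_map K \<sigma> \<theta> \<alpha> z)) \<in> borel_measurable (uniform_angle \<Otimes>\<^sub>M gaussian_noise K)"
    by (rule measurable_compose[OF measurable_obs_map f])
  from G.nn_integral_fst[OF this] show ?thesis
    unfolding obs_law_eq_distr by (subst nn_integral_distr[OF measurable_obs_map]) simp_all
qed

text \<open>A bound valid for each fixed rotation passes to the mixture. The moment bounds above
  depend on the signal only through its moduli, which rotations preserve, so the constant is the
  same for all angles.\<close>

lemma nn_integral_obs_law_le:
  fixes f :: "rvec => real"
  assumes f: "f \<in> borel_measurable (vec_space K)" and nonneg: "\<And>y. 0 \<le> f y"
    and int: "\<And>\<alpha>. gint K (\<lambda>z. f (obs_map K \<sigma> \<theta> \<alpha> z))"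
    and le: "\<And>\<alpha>. gmean K (\<lambda>z. f (obs_map K \<sigma> \<theta> \<alpha> z)) \<le> C"
  shows "(\<integral>\<^sup>+y. ennreal (f y) \<partial>obs_law K \<sigma> \<theta>) \<le> ennreal C"
proof -
  interpret U: prob_space "uniform_angle" by (rule prob_space_uniform_angles)
  have "(\<integral>\<^sup>+y. ennreal (f y) \<partial>obs_law K \<sigma> \<theta>) = (\<integral>\<^sup>+\<alpha>. \<integral>\<^sup>+z. ennreal (f (obs_map K \<sigma> \<theta> \<alpha> z)) \<partial>gaussian_noise K \<partial>uniform_angle)"
    by (intro nn_integral_obs_law measurable_compose[OF f measurable_ennreal])
  also have "... \<le> (\<integral>\<^sup>+\<alpha>. ennreal C \<partial>uniform_angle)"
    by (intro nn_integral_mono) (use nonneg le in \<open>auto simp: nn_integral_eq_integral[OF int] intro!: ennreal_leI\<close>)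
  also have "... = ennreal C" using U.emeasure_space_1 by simp
  finally show ?thesis .
qed

lemma integral_obs_law_const:
  fixes f :: "rvec => 'b::{banach, second_countable_topology}"
  assumes int: "integrable (obs_law K \<sigma> \<theta>) f"
    and eq: "\<And>\<alpha>. gmean K (\<lambda>z. f (obs_map K \<sigma> \<theta> \<alpha> z)) = \<mu>"
  shows "(\<integral>y. f y \<partial>obs_law K \<sigma> \<theta>) = \<mu>"
proof -
  interpret U: prob_space "uniform_angle" by (rule prob_space_uniform_angles)
  interpret G: prob_space "gaussian_noise K" by (rule prob_space_gaussian_noise)
  interpret UG: pair_prob_space "uniform_angle" "gaussian_noise K" ..
  have f: "f \<in> borel_measurable (vec_space K)" using int by (auto simp: obs_law_eq_distr dest: borel_measurable_integrable)
  have i: "integrable (uniform_angle \<Otimes>\<^sub>M gaussian_noise K) (\<lambda>x. f (case x of (\<alpha>, z) => obs_map K \<sigma> \<theta> \<alpha> z))"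
    using int unfolding obs_law_eq_distr by (subst (asm) integrable_distr_eq[OF measurable_obs_map f])
  have "(\<integral>y. f y \<partial>obs_law K \<sigma> \<theta>) = (\<integral>x. f (case x of (\<alpha>, z) => obs_map K \<sigma> \<theta> \<alpha> z) \<partial>(uniform_angle \<Otimes>\<^sub>M gaussian_noise K))"
    unfolding obs_law_eq_distr by (rule integral_distr[OF measurable_obs_map f])
  also have "... = (\<integral>\<alpha>. gmean K (\<lambda>z. f (obs_map K \<sigma> \<theta> \<alpha> z)) \<partial>uniform_angle)" using UG.integral_fst'[OF i] by simp
  also have "... = \<mu>" unfolding eq using U.prob_space by simp
  finally show ?thesis .
qed

definition rotated :: "real => rvec => nat => complex" where "rotated \<alpha> \<theta> k = cis (real k * \<alpha>) * cplx \<theta> k"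

lemma cmod_rotated [simp]: "cmod (rotated \<alpha> \<theta> k) = cmod (cplx \<theta> k)"
  by (simp add: rotated_def norm_mult)

lemma cmod_cplx: "cmod (cplx \<theta> k) = amplitude \<theta> k"
  by (simp add: cplx_def amplitude_def cmod_def)

lemma cplx_rot:
  assumes "k \<in> {1..K}"
  shows "cplx (rot K \<alpha> \<theta>) k = rotated \<alpha> \<theta> k"
proof -
  have "(k, 1) \<in> coords K" "(k, 2) \<in> coords K" using assms by (auto simp: coords_def)
  then show ?thesis by (simp add: cplx_def rotated_def rot_def complex_eq_iff)
qed

lemma cplx_obs_map: "k \<in> {1..K} ==> cplx (obs_map K \<sigma> \<theta> \<alpha> z) k = noisy \<sigma> (rotated \<alpha> \<theta>) z k"
  unfolding noisy_def cplx_rot[symmetric] by (simp add: cplx_def obs_map_def coords_def complex_eq_iff)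

text \<open>The angle cancels because the frequencies \<open>k\<close>, \<open>l\<close> and
  \<open>- (k + l)\<close> add up to zero.\<close>

lemma triple_rotated: "triple (rotated \<alpha> \<theta>) p = triple (cplx \<theta>) p"
proof -
  have "cis (real (fst p) * \<alpha>) * cis (real (snd p) * \<alpha>) * cnj (cis (real (fst p + snd p) * \<alpha>)) = 1"
    by (simp add: cis_mult cis_cnj distrib_right)
  moreover have "triple (rotated \<alpha> \<theta>) p = (cis (real (fst p) * \<alpha>) * cis (real (snd p) * \<alpha>) * cnj (cis (real (fst p + snd p) * \<alpha>)))
      * triple (cplx \<theta>) p" unfolding triple_def rotated_def complex_cnj_mult by (simp only: mult_ac)
  ultimately show ?thesis by simp
qed

lemma triple_obs_map:
  assumes "1 \<le> fst p" "1 \<le> snd p" "fst p + snd p \<le> K"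
  shows "triple (cplx (obs_map K \<sigma> \<theta> \<alpha> z)) p = triple (noisy \<sigma> (rotated \<alpha> \<theta>) z) p"
  using assms by (simp add: triple_def cplx_obs_map)

lemma measurable_cplx_vec [measurable]:
  assumes "k \<in> {1..K}"
  shows "(\<lambda>y. cplx y k) \<in> borel_measurable (vec_space K)"
proof -
  have "(k, 1) \<in> coords K" "(k, 2) \<in> coords K" using assms by (auto simp: coords_def)
  then show ?thesis unfolding cplx_def vec_space_def by (intro borel_measurable_Complex measurable_component_singleton)
qed

lemma measurable_triple_vec [measurable]:
  assumes "1 \<le> fst p" "1 \<le> snd p" "fst p + snd p \<le> K"
  shows "(\<lambda>y. triple (cplx y) p) \<in> borel_measurable (vec_space K)"
  unfolding triple_def by (intro borel_measurable_times measurable_cplx_vec borel_measurable_cnj) (use assms in auto)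

lemma integrable_of_nn_integral_square:
  fixes f :: "'a => 'b::{banach, second_countable_topology}"
  assumes M: "prob_space M" and f[measurable]: "f \<in> borel_measurable M"
    and sq: "(\<integral>\<^sup>+x. ennreal ((norm (f x))^2) \<partial>M) \<le> ennreal C"
  shows "integrable M f"
proof -
  interpret prob_space M by fact
  have "integrable M (\<lambda>x. (norm (f x))^2)" by (rule integrableI_nonneg) (use sq in \<open>auto simp: less_top[symmetric] top_unique\<close>)
  then have "integrable M (\<lambda>x. norm (f x))" by (rule square_integrable_imp_integrable[rotated]) measurable
  then show ?thesis by (rule integrable_norm_cancel) simp
qed

context
  fixes K :: nat and \<sigma> A B :: real and \<theta> :: rvec
  assumes A: "\<And>k. k \<in> {1..K} ==> (cmod (cplx \<theta> k))^2 \<le> A"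
    and B: "(\<Sum>k=1..K. (cmod (cplx \<theta> k))^2) \<le> B"
    and A0: "0 \<le> A"
begin

lemma rotated_bounds: "k \<in> {1..K} ==> (cmod (rotated \<alpha> \<theta> k))^2 \<le> A" "(\<Sum>k=1..K. (cmod (rotated \<alpha> \<theta> k))^2) \<le> B"
  using A B by simp_all

lemma obs_triple:
  assumes p: "1 \<le> fst p" "1 \<le> snd p" "fst p + snd p \<le> K"
  shows "(\<integral>\<^sup>+y. ennreal ((cmod (triple (cplx y) p))^2) \<partial>obs_law K \<sigma> \<theta>) \<le> ennreal (chaos_bound \<sigma> A B)"
    and "integrable (obs_law K \<sigma> \<theta>) (\<lambda>y. triple (cplx y) p)"
    and "(\<integral>y. triple (cplx y) p \<partial>obs_law K \<sigma> \<theta>) = triple (cplx \<theta>) p"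
proof -
  have m: "(\<lambda>y. triple (cplx y) p) \<in> borel_measurable (vec_space K)" by (rule measurable_triple_vec[OF p])
  note s = triple_second_moment[OF rotated_bounds A0 p, unfolded prod.collapse] and cb = chaos_bound_ge[OF rotated_bounds A0]
  show sq: "(\<integral>\<^sup>+y. ennreal ((cmod (triple (cplx y) p))^2) \<partial>obs_law K \<sigma> \<theta>) \<le> ennreal (chaos_bound \<sigma> A B)"
  proof (rule nn_integral_obs_law_le)
    show "(\<lambda>y. (cmod (triple (cplx y) p))^2) \<in> borel_measurable (vec_space K)" using m by measurable
    show "gint K (\<lambda>z. (cmod (triple (cplx (obs_map K \<sigma> \<theta> \<alpha> z)) p))^2)" for \<alpha> unfolding triple_obs_map[OF p] by (rule s(1))
    show "gmean K (\<lambda>z. (cmod (triple (cplx (obs_map K \<sigma> \<theta> \<alpha> z)) p))^2) \<le> chaos_bound \<sigma> A B" for \<alpha>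
      unfolding triple_obs_map[OF p] by (rule order_trans[OF s(2) cb(1)])
  qed simp
  show int: "integrable (obs_law K \<sigma> \<theta>) (\<lambda>y. triple (cplx y) p)"
    by (rule integrable_of_nn_integral_square[OF prob_space_obs_law _ sq]) (use m in measurable)
  show "(\<integral>y. triple (cplx y) p \<partial>obs_law K \<sigma> \<theta>) = triple (cplx \<theta>) p"
  proof (rule integral_obs_law_const[OF int])
    show "gmean K (\<lambda>z. triple (cplx (obs_map K \<sigma> \<theta> \<alpha> z)) p) = triple (cplx \<theta>) p" for \<alpha>
    proof -
      have i: "fst p \<in> {1..K}" "snd p \<in> {1..K}" "fst p + snd p \<in> {1..K}"
        "fst p \<noteq> fst p + snd p" "snd p \<noteq> fst p + snd p" using p by auto
      have "gmean K (\<lambda>z. triple (noisy \<sigma> (rotated \<alpha> \<theta>) z) p) = triple (rotated \<alpha> \<theta>) p"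
        unfolding triple_def by (rule noisy_bispectrum(2)[OF i])
      then show ?thesis unfolding triple_obs_map[OF p] triple_rotated .
    qed
  qed
qed

lemma obs_score_second_moment:
  assumes j: "j \<in> {1..K}"
  shows "(\<integral>\<^sup>+y. ennreal ((cmod (\<Sum>p\<in>high_pairs K. c p * of_real (cob1 j p) * triple (cplx y) p))^2) \<partial>obs_law K \<sigma> \<theta>)
    \<le> ennreal (4 * chaos_bound \<sigma> A B * ((\<Sum>l\<in>row K j. (cmod (c (j, l) + c (l, j)))^2)
        + (\<Sum>k\<in>diagonal K j. (cmod (c (k, j - k)))^2)))"
proof (rule nn_integral_obs_law_le)
  have eq: "(\<Sum>p\<in>high_pairs K. c p * of_real (cob1 j p) * triple (cplx (obs_map K \<sigma> \<theta> \<alpha> z)) p)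
     = (\<Sum>p\<in>high_pairs K. c p * of_real (cob1 j p) * triple (noisy \<sigma> (rotated \<alpha> \<theta>) z) p)" for \<alpha> z
    by (intro sum.cong refl arg_cong2[where f="(*)"] triple_obs_map) (auto simp: high_pairs_def)
  note s = score_second_moment[OF rotated_bounds A0 j]
  show "(\<lambda>y. (cmod (\<Sum>p\<in>high_pairs K. c p * of_real (cob1 j p) * triple (cplx y) p))^2) \<in> borel_measurable (vec_space K)"
    by (intro borel_measurable_power measurable_compose[OF _ borel_measurable_norm] borel_measurable_sum
        borel_measurable_times measurable_triple_vec) (auto simp: high_pairs_def)
  show "gint K (\<lambda>z. (cmod (\<Sum>p\<in>high_pairs K. c p * of_real (cob1 j p) * triple (cplx (obs_map K \<sigma> \<theta> \<alpha> z)) p))^2)" for \<alpha>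
    unfolding eq by (rule s(1))
  show "gmean K (\<lambda>z. (cmod (\<Sum>p\<in>high_pairs K. c p * of_real (cob1 j p) * triple (cplx (obs_map K \<sigma> \<theta> \<alpha> z)) p))^2)
    \<le> 4 * chaos_bound \<sigma> A B * ((\<Sum>l\<in>row K j. (cmod (c (j, l) + c (l, j)))^2) + (\<Sum>k\<in>diagonal K j. (cmod (c (k, j - k)))^2))" for \<alpha>
    unfolding eq by (rule s(2))
qed simp

lemma obs_power:
  assumes k: "k \<in> {1..K}"
  shows "(\<integral>\<^sup>+y. ennreal (((cmod (cplx y k))^2)^2) \<partial>obs_law K \<sigma> \<theta>) \<le> ennreal (8 * A^2 + 96 * \<sigma> ^ 4)"
    and "(\<integral>y. (cmod (cplx y k))^2 \<partial>obs_law K \<sigma> \<theta>) = (cmod (cplx \<theta> k))^2 + 2 * \<sigma>^2"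
proof -
  note n = noisy_moments[OF k, of \<sigma> "rotated _ \<theta>"]
  have e: "((cmod z)^2)^2 = (cmod z) ^ 4" for z by simp
  show sq: "(\<integral>\<^sup>+y. ennreal (((cmod (cplx y k))^2)^2) \<partial>obs_law K \<sigma> \<theta>) \<le> ennreal (8 * A^2 + 96 * \<sigma> ^ 4)" unfolding e
  proof (rule nn_integral_obs_law_le)
    show "(\<lambda>y. (cmod (cplx y k)) ^ 4) \<in> borel_measurable (vec_space K)"
      using k by (intro borel_measurable_power measurable_compose[OF _ borel_measurable_norm] measurable_cplx_vec)
    show "gint K (\<lambda>w. (cmod (cplx (obs_map K \<sigma> \<theta> \<alpha> w) k)) ^ 4)" for \<alpha> unfolding cplx_obs_map[OF k] by (rule n)
    have "((cmod (cplx \<theta> k))^2)^2 \<le> A^2" using A[OF k] by (intro power_mono) auto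
    then have "(cmod (cplx \<theta> k)) ^ 4 \<le> A^2" by simp
    then show "gmean K (\<lambda>w. (cmod (cplx (obs_map K \<sigma> \<theta> \<alpha> w) k)) ^ 4) \<le> 8 * A^2 + 96 * \<sigma> ^ 4" for \<alpha>
      unfolding cplx_obs_map[OF k] using n(8)[of \<alpha>] by simp
  qed simp
  have sq': "(\<integral>\<^sup>+y. ennreal ((norm ((cmod (cplx y k))^2))^2) \<partial>obs_law K \<sigma> \<theta>) \<le> ennreal (8 * A^2 + 96 * \<sigma> ^ 4)" using sq by simp
  have int: "integrable (obs_law K \<sigma> \<theta>) (\<lambda>y. (cmod (cplx y k))^2)"
    by (rule integrable_of_nn_integral_square[OF prob_space_obs_law _ sq']) (use measurable_cplx_vec[OF k] in measurable)
  show "(\<integral>y. (cmod (cplx y k))^2 \<partial>obs_law K \<sigma> \<theta>) = (cmod (cplx \<theta> k))^2 + 2 * \<sigma>^2"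
    by (rule integral_obs_law_const[OF int]) (use n(6) in \<open>simp add: cplx_obs_map[OF k]\<close>)
qed

end

lemma cmod_cis_diff_le: "cmod (cis a - cis b) \<le> \<bar>a - b\<bar>"
proof -
  have "(cmod (cis a - cis b))^2 = (cos a - cos b)^2 + (sin a - sin b)^2" by (simp add: cmod_power2)
  also have "... = 2 - 2 * cos (a - b)" by (simp add: power2_diff cos_diff sin_squared_eq algebra_simps)
  also have "... = (2 * sin ((a - b) / 2))^2"
  proof -
    have e: "2 * ((a - b) / 2) = a - b" by simp
    show ?thesis using cos_double_sin[of "(a - b) / 2"] unfolding e by (simp add: power_mult_distrib)
  qed
  also have "... = (2 * \<bar>sin ((a - b) / 2)\<bar>)^2" by (simp add: power_mult_distrib)
  also have "... \<le> (2 * \<bar>(a - b) / 2\<bar>)^2" by (intro power_mono mult_left_mono abs_sin_x_le_abs_x) auto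
  finally have "(cmod (cis a - cis b))^2 \<le> \<bar>a - b\<bar>^2" by simp
  then show ?thesis by (rule power2_le_imp_le) simp
qed

section \<open>Refinement of a pilot estimate\<close>

text \<open>The scale \<open>\<kappa> k\<close> stands for \<open>k powr (- \<beta>)\<close>. The
  condition \<open>\<beta> < 1 / 2\<close> is present in three forms:
  \<open>4 powr \<beta> \<le> 2\<close> in \<open>\<kappa>_high\<close>, the sum bound with
  \<open>S = 1 / (1 - 2 * \<beta>)\<close>, and \<open>1 \<le> real K * (\<kappa> K)^2\<close>,
  which together with \<open>noise\<close> keeps the noise level above \<open>c0\<close>.\<close>

locale mra_scales =
  fixes K :: nat and \<kappa> :: "nat => real" and c_lo c_hi c0 S \<sigma> :: real
  assumes K: "2 \<le> K"
    and \<kappa>_pos: "\<And>k. 1 \<le> k ==> 0 < \<kappa> k"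
    and \<kappa>_antimono: "\<And>k l. 1 \<le> k ==> k \<le> l ==> \<kappa> l \<le> \<kappa> k"
    and \<kappa>_le_1: "\<And>k. 1 \<le> k ==> \<kappa> k \<le> 1"
    and \<kappa>_high: "\<And>k. K < 4 * k ==> k \<le> K ==> \<kappa> k \<le> 2 * \<kappa> K"
    and \<kappa>_sum: "(\<Sum>k=1..K. (\<kappa> k)^2) \<le> S * real K * (\<kappa> K)^2"
    and \<kappa>_K: "1 \<le> real K * (\<kappa> K)^2"
    and c_lo: "0 < c_lo" and c_hi: "c_lo \<le> c_hi" and c0: "0 < c0"
    and \<sigma>: "0 < \<sigma>" and noise: "c0 * (real K * (\<kappa> K)^2) \<le> \<sigma>^2"
begin

lemma \<kappa>K_pos: "0 < \<kappa> K" using \<kappa>_pos K by simp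

lemma \<kappa>_ge: "1 \<le> k ==> k \<le> K ==> \<kappa> K \<le> \<kappa> k" by (rule \<kappa>_antimono)

lemma S_ge_1: "1 \<le> S"
proof -
  have "real K * (\<kappa> K)^2 = (\<Sum>k=1..K. (\<kappa> K)^2)" by simp
  also have "... \<le> (\<Sum>k=1..K. (\<kappa> k)^2)" by (intro sum_mono power_mono \<kappa>_ge) (use \<kappa>K_pos in auto)
  also have "... \<le> S * (real K * (\<kappa> K)^2)" using \<kappa>_sum by (simp add: mult.assoc)
  finally have "1 * (real K * (\<kappa> K)^2) \<le> S * (real K * (\<kappa> K)^2)" by simp
  moreover have "0 < real K * (\<kappa> K)^2" using \<kappa>_K by simp
  ultimately show ?thesis by (simp only: mult_le_cancel_right_pos)
qed

lemma c0_le_noise: "c0 \<le> \<sigma>^2"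
proof -
  have "c0 * 1 \<le> c0 * (real K * (\<kappa> K)^2)" using \<kappa>_K c0 by (intro mult_left_mono) auto
  then show ?thesis using noise by simp
qed

text \<open>The order of magnitude of the bispectrum entry at \<open>p\<close>.\<close>

definition \<omega> :: "nat \<times> nat => real" where "\<omega> p = \<kappa> (fst p) * \<kappa> (snd p) * \<kappa> (fst p + snd p)"

text \<open>Passing from the weight \<open>(\<kappa> k)^2\<close> to \<open>(\<omega> p)^2\<close>
  is paid by the two other scales, each of them at least \<open>\<kappa> K\<close>; this is the
  fourth power in the denominator.\<close>

definition gap_const :: real where "gap_const = 40000 * (S + 1) / (real K * (\<kappa> K) ^ 4)"

lemma gap_const_nonneg: "0 \<le> gap_const"
  unfolding gap_const_def using S_ge_1 by simp

lemma high_pairs_valid: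
  assumes "p \<in> high_pairs K"
  shows "1 \<le> fst p" "1 \<le> snd p" "fst p + snd p \<le> K" "1 \<le> fst p + snd p" "fst p \<le> K" "snd p \<le> K" "K < 4 * (fst p + snd p)"
  using assms by (auto simp: high_pairs_def)

lemma \<omega>_pos: "p \<in> high_pairs K ==> 0 < \<omega> p"
  unfolding \<omega>_def by (intro mult_pos_pos \<kappa>_pos) (auto dest: high_pairs_valid)

lemma phase_gap: "\<exists>s. (\<Sum>k=1..K. (\<kappa> k)^2 * (v k - real k * s)^2) \<le> gap_const * (\<Sum>p\<in>high_pairs K. (\<omega> p)^2 * (coboundary v p)^2)"
proof -
  have "\<exists>s. (\<Sum>k=1..K. (\<kappa> k)^2 * (v k - real k * s)^2)
    \<le> 40000 * (S + 1) / real K * (\<Sum>(k, l)\<in>high_pairs K. (\<kappa> k)^2 * (v k + v l - v (k + l))^2)"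
  proof (rule weighted_phase_gap[OF K])
    show "0 < (\<kappa> K)^2" using \<kappa>K_pos by simp
    show "(\<kappa> K)^2 \<le> (\<kappa> k)^2" if "1 \<le> k" "k \<le> K" for k using \<kappa>_ge[OF that] \<kappa>K_pos by (intro power_mono) auto
    show "(\<kappa> k)^2 \<le> 4 * (\<kappa> K)^2" if "K < 4 * k" "k \<le> K" for k
    proof -
      have "(\<kappa> k)^2 \<le> (2 * \<kappa> K)^2" using \<kappa>_high[OF that] \<kappa>_pos[of k] that K by (intro power_mono) (auto simp: less_imp_le)
      then show ?thesis by (simp add: power_mult_distrib)
    qed
  qed (rule \<kappa>_sum)
  then obtain s where s: "(\<Sum>k=1..K. (\<kappa> k)^2 * (v k - real k * s)^2)
    \<le> 40000 * (S + 1) / real K * (\<Sum>(k, l)\<in>high_pairs K. (\<kappa> k)^2 * (v k + v l - v (k + l))^2)" by blast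
  have le: "(\<Sum>(k, l)\<in>high_pairs K. (\<kappa> k)^2 * (v k + v l - v (k + l))^2)
      \<le> (\<Sum>p\<in>high_pairs K. 1 / (\<kappa> K) ^ 4 * ((\<omega> p)^2 * (coboundary v p)^2))"
  proof (rule sum_mono, clarify)
    fix k l assume p: "(k, l) \<in> high_pairs K"
    have "(\<kappa> K)^2 * (\<kappa> K)^2 \<le> (\<kappa> l)^2 * (\<kappa> (k + l))^2"
      using high_pairs_valid[OF p] \<kappa>K_pos by (intro mult_mono power_mono \<kappa>_ge) auto
    then have "(\<kappa> k)^2 * (\<kappa> K) ^ 4 \<le> (\<omega> (k, l))^2"
      unfolding \<omega>_def by (simp add: power_mult_distrib mult.assoc mult_left_mono power_add[symmetric])
    then have "(\<kappa> k)^2 \<le> 1 / (\<kappa> K) ^ 4 * (\<omega> (k, l))^2" using \<kappa>K_pos by (simp add: field_simps)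
    then have "(\<kappa> k)^2 * (coboundary v (k, l))^2 \<le> 1 / (\<kappa> K) ^ 4 * (\<omega> (k, l))^2 * (coboundary v (k, l))^2"
      by (rule mult_right_mono) simp
    then show "(\<kappa> k)^2 * (v k + v l - v (k + l))^2 \<le> 1 / (\<kappa> K) ^ 4 * ((\<omega> (k, l))^2 * (coboundary v (k, l))^2)"
      by (simp add: coboundary_def)
  qed
  have "0 \<le> 40000 * (S + 1) / real K" using S_ge_1 by simp
  from order_trans[OF s mult_left_mono[OF le this]]
  have "(\<Sum>k=1..K. (\<kappa> k)^2 * (v k - real k * s)^2) \<le> 40000 * (S + 1) / real K
      * (\<Sum>p\<in>high_pairs K. 1 / (\<kappa> K) ^ 4 * ((\<omega> p)^2 * (coboundary v p)^2))" .
  then show ?thesis unfolding sum_distrib_left[symmetric] gap_const_def by (intro exI[of _ s]) (simp add: mult.assoc)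
qed

definition bhat :: "nat set => (nat => rvec) => nat \<times> nat => complex" where
  "bhat J y p = (\<Sum>m\<in>J. triple (cplx (y m)) p) / of_nat (card J)"

definition phat :: "nat set => (nat => rvec) => nat => real" where "phat J y k = (\<Sum>m\<in>J. (cmod (cplx (y m) k))^2) / real (card J)"

text \<open>The empirical power exceeds the squared amplitude by \<open>2 * \<sigma>^2\<close> in
  the mean. Clamping to the range of the parameter space bounds the curvature of the criterion from
  below, and the loss from above, on every sample.\<close>

definition rhat :: "nat set => (nat => rvec) => nat => real" where
  "rhat J y k = sqrt (max ((c_lo * \<kappa> k)^2) (min ((c_hi * \<kappa> k)^2) (phat J y k - 2 * \<sigma>^2)))"

definition ampl_triple :: "(nat => real) => nat \<times> nat => real" where "ampl_triple r p = r (fst p) * r (snd p) * r (fst p + snd p)"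

text \<open>The candidates are the phases \<open>\<psi> + u\<close> for a pilot
  \<open>\<psi>\<close>. The empirical bispectrum, turned back by the pilot, enters through a term
  linear in \<open>u\<close>: its noise affects the gradient of the criterion and leaves the
  curvature unchanged.\<close>

definition phase_criterion :: "nat set => (nat => rvec) => (nat => real) => (nat => real) => real" where
  "phase_criterion J y \<psi> u = (\<Sum>p\<in>high_pairs K. \<omega> p * (- ampl_triple (rhat J y) p * cos (coboundary u p)
     - Im (bhat J y p * cnj (cis (coboundary \<psi> p))) * coboundary u p))"

lemma rhat_bounds:
  assumes "1 \<le> k"
  shows "c_lo * \<kappa> k \<le> rhat J y k" "rhat J y k \<le> c_hi * \<kappa> k"
proof -
  have k: "0 < \<kappa> k" by (rule \<kappa>_pos[OF assms])
  have le: "(c_lo * \<kappa> k)^2 \<le> (c_hi * \<kappa> k)^2" using k c_lo c_hi by (intro power_mono mult_right_mono) auto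
  have "c_lo * \<kappa> k = sqrt ((c_lo * \<kappa> k)^2)" using k c_lo by simp
  also have "... \<le> rhat J y k" unfolding rhat_def by (intro real_sqrt_le_mono) simp
  finally show "c_lo * \<kappa> k \<le> rhat J y k" .
  have "rhat J y k \<le> sqrt ((c_hi * \<kappa> k)^2)" unfolding rhat_def using le by (intro real_sqrt_le_mono) simp
  also have "... = c_hi * \<kappa> k" using k c_lo c_hi by simp
  finally show "rhat J y k \<le> c_hi * \<kappa> k" .
qed

text \<open>Clamping cannot increase the distance to a point of the range, and the difference of the
  squares is divided by the sum of the two amplitudes, which is at least
  \<open>2 * (c_lo * \<kappa> k)\<close>.\<close>

lemma rhat_error:
  assumes k: "1 \<le> k" and r: "c_lo * \<kappa> k \<le> r" "r \<le> c_hi * \<kappa> k"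
  shows "(rhat J y k - r)^2 \<le> (phat J y k - (r^2 + 2 * \<sigma>^2))^2 / (4 * c_lo^2 * (\<kappa> k)^2)"
proof -
  have k0: "0 < \<kappa> k" by (rule \<kappa>_pos[OF k])
  have pos: "0 < c_lo * \<kappa> k" using k0 c_lo by simp
  have r0: "0 < r" and rh0: "0 < rhat J y k" using r pos rhat_bounds[OF k, of J y] by linarith+
  define q where "q = phat J y k - 2 * \<sigma>^2"
  have rsq: "(c_lo * \<kappa> k)^2 \<le> r^2" "r^2 \<le> (c_hi * \<kappa> k)^2" using r pos by (auto intro!: power_mono)
  have "(rhat J y k)^2 = max ((c_lo * \<kappa> k)^2) (min ((c_hi * \<kappa> k)^2) q)"
    unfolding rhat_def q_def by (rule real_sqrt_pow2) (simp add: le_max_iff_disj)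
  then have "\<bar>(rhat J y k)\<^sup>2 - r^2\<bar> \<le> \<bar>q - r^2\<bar>" using rsq by (simp add: max_def min_def abs_if)
  moreover have "(rhat J y k)^2 - r^2 = (rhat J y k - r) * (rhat J y k + r)" by (simp add: power2_eq_square algebra_simps)
  ultimately have "\<bar>rhat J y k - r\<bar> * (rhat J y k + r) \<le> \<bar>q - r^2\<bar>" using r0 rh0 by (simp add: abs_mult)
  moreover have "\<bar>rhat J y k - r\<bar> * (2 * (c_lo * \<kappa> k)) \<le> \<bar>rhat J y k - r\<bar> * (rhat J y k + r)"
    using r rhat_bounds[OF k, of J y] by (intro mult_left_mono) auto
  ultimately have "\<bar>rhat J y k - r\<bar> * (2 * (c_lo * \<kappa> k)) \<le> \<bar>q - r^2\<bar>" by linarith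
  then have "\<bar>rhat J y k - r\<bar> \<le> \<bar>q - r^2\<bar> / (2 * (c_lo * \<kappa> k))" using pos by (simp add: pos_le_divide_eq)
  then have "\<bar>rhat J y k - r\<bar>^2 \<le> (\<bar>q - r^2\<bar> / (2 * (c_lo * \<kappa> k)))^2" by (intro power_mono) auto
  then show ?thesis by (simp add: q_def power_divide power_mult_distrib algebra_simps)
qed

text \<open>The three factors are exchanged one at a time; the two factors not being exchanged are
  bounded by their scales.\<close>

lemma ampl_triple_diff:
  assumes p: "p \<in> high_pairs K"
    and r: "\<And>k. k \<in> {1..K} ==> 0 \<le> r k \<and> r k \<le> c_hi * \<kappa> k"
    and r': "\<And>k. k \<in> {1..K} ==> 0 \<le> r' k \<and> r' k \<le> c_hi * \<kappa> k"
  shows "(ampl_triple r p - ampl_triple r' p)^2 \<le> 3 * c_hi ^ 4 * ((\<kappa> (snd p) * \<kappa> (fst p + snd p))^2 * (r' (fst p) - r (fst p))^2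
      + (\<kappa> (fst p) * \<kappa> (fst p + snd p))^2 * (r' (snd p) - r (snd p))^2
      + (\<kappa> (fst p) * \<kappa> (snd p))^2 * (r' (fst p + snd p) - r (fst p + snd p))^2)"
proof -
  obtain k l where kl: "p = (k, l)" by (cases p)
  have v: "k \<in> {1..K}" "l \<in> {1..K}" "k + l \<in> {1..K}" using high_pairs_valid[OF p] by (auto simp: kl)
  have sq: "(a * b * d)^2 \<le> c_hi ^ 4 * ((\<kappa> i * \<kappa> j)^2 * d^2)" if "0 \<le> a" "a \<le> c_hi * \<kappa> i" "0 \<le> b" "b \<le> c_hi * \<kappa> j" for a b d i j
  proof -
    have "(a * b)^2 \<le> ((c_hi * \<kappa> i) * (c_hi * \<kappa> j))^2" using that by (intro power_mono mult_mono) auto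
    then have "(a * b)^2 * d^2 \<le> ((c_hi * \<kappa> i) * (c_hi * \<kappa> j))^2 * d^2" by (rule mult_right_mono) simp
    moreover have "((c_hi * \<kappa> i) * (c_hi * \<kappa> j))^2 * d^2 = c_hi ^ 4 * ((\<kappa> i * \<kappa> j)^2 * d^2)"
      by (simp add: eval_nat_numeral mult_ac)
    ultimately show ?thesis unfolding power_mult_distrib[of "a * b" d] by linarith
  qed
  have "ampl_triple r p - ampl_triple r' p
      = r l * r (k + l) * (r k - r' k) + r' k * r (k + l) * (r l - r' l) + r' k * r' l * (r (k + l) - r' (k + l))"
    by (simp add: ampl_triple_def kl algebra_simps)
  then have "(ampl_triple r p - ampl_triple r' p)^2 \<le> 3 * ((r l * r (k + l) * (r k - r' k))^2
      + (r' k * r (k + l) * (r l - r' l))^2 + (r' k * r' l * (r (k + l) - r' (k + l)))^2)" by (simp only: power2_sum3_le)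
  also have "... \<le> 3 * (c_hi ^ 4 * ((\<kappa> l * \<kappa> (k + l))^2 * (r k - r' k)^2)
      + c_hi ^ 4 * ((\<kappa> k * \<kappa> (k + l))^2 * (r l - r' l)^2) + c_hi ^ 4 * ((\<kappa> k * \<kappa> l)^2 * (r (k + l) - r' (k + l))^2))"
    using r[OF v(1)] r[OF v(2)] r[OF v(3)] r'[OF v(1)] r'[OF v(2)] r'[OF v(3)] by (intro mult_left_mono add_mono sq) auto
  finally show ?thesis unfolding kl fst_conv snd_conv by (simp add: power2_commute[of "r' _" "r _"] algebra_simps)
qed

definition score_error :: "nat set => (nat => rvec) => (nat => real) => rvec => nat => real" where
  "score_error J y \<psi> \<theta> j = score K \<omega> (\<lambda>p. Im ((bhat J y p - triple (cplx \<theta>) p) * cnj (cis (coboundary \<psi> p)))) j"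

text \<open>An inequality on each single sample. The true correction of the pilot is
  \<open>u'\<close>, a grid point near it is \<open>u0\<close>, and \<open>u\<close> is the grid
  point chosen by the criterion. The bias in \<open>phase_minimizer_error\<close> splits into the
  error of the amplitudes and the mesh \<open>h\<close>.\<close>

lemma refinement_error:
  fixes \<theta> :: rvec
  defines "r \<equiv> amplitude \<theta>"
  assumes \<theta>: "\<And>k. k \<in> {1..K} ==> c_lo * \<kappa> k \<le> r k \<and> r k \<le> c_hi * \<kappa> k"
    and align: "\<And>k. k \<in> {1..K} ==> rotated \<alpha> \<theta> k = of_real (r k) * cis (\<psi> k + u' k)"
    and u': "\<And>k. k \<in> {1..K} ==> \<bar>u' k\<bar> \<le> 3 / 10"
    and u: "\<And>k. k \<in> {1..K} ==> \<bar>u k\<bar> \<le> 3 / 10"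
    and u0: "\<And>k. k \<in> {1..K} ==> \<bar>u0 k\<bar> \<le> 3 / 10"
    and mesh: "\<And>k. k \<in> {1..K} ==> \<bar>u0 k - u' k\<bar> \<le> h"
    and min: "phase_criterion J y \<psi> u \<le> phase_criterion J y \<psi> u0"
  shows "\<exists>t. (\<Sum>k=1..K. (cmod (of_real (rhat J y k) * cis (\<psi> k + u k) - rotated t \<theta> k))^2) \<le> 3 * (\<Sum>k=1..K. (rhat J y k - r k)^2)
      + 3 * c_hi^2 * (32 * gap_const / c_lo ^ 6 * (gap_const * (\<Sum>j=1..K. (score_error J y \<psi> \<theta> j)^2 / (\<kappa> j)^2)
          + 2 * (\<Sum>p\<in>high_pairs K. (ampl_triple r p - ampl_triple (rhat J y) p)^2)
          + 18 * c_hi ^ 6 * (real K)^2 * h^2) + real K * h^2)"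
proof -
  let ?P = "high_pairs K" and ?\<rho> = "ampl_triple (rhat J y)"
  have chi: "0 < c_hi" using c_lo c_hi by simp
  have h0: "0 \<le> h" using mesh[of 1] K by (auto intro: order_trans[OF abs_ge_zero])
  have r0: "0 \<le> r k" "r k \<le> c_hi * \<kappa> k" "r k \<le> c_hi" if "k \<in> {1..K}" for k
  proof -
    have "0 < \<kappa> k" "\<kappa> k \<le> 1" using \<kappa>_pos \<kappa>_le_1 that by auto
    then show "0 \<le> r k" "r k \<le> c_hi * \<kappa> k" using \<theta>[OF that] c_lo by (auto intro: order_trans[of 0 "c_lo * \<kappa> k"])
    have "c_hi * \<kappa> k \<le> c_hi * 1" using \<open>\<kappa> k \<le> 1\<close> chi by (intro mult_left_mono) auto
    then show "r k \<le> c_hi" using \<theta>[OF that] by simp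
  qed
  have rh: "0 \<le> rhat J y k" "rhat J y k \<le> c_hi * \<kappa> k" "c_lo * \<kappa> k \<le> rhat J y k" if "k \<in> {1..K}" for k
    using rhat_bounds[of k J y] that \<kappa>_pos[of k] c_lo by (auto intro: order_trans[of 0 "c_lo * \<kappa> k"])
  define n where "n p = Im ((bhat J y p - triple (cplx \<theta>) p) * cnj (cis (coboundary \<psi> p)))" for p
  define m where "m p = ampl_triple r p * sin (coboundary u' p)" for p
  \<comment> \<open>After alignment the true entry, turned back by the pilot, has phase
    \<open>coboundary u' p\<close>; its imaginary part is the amplitude times a sine, which is the
    gradient expected at \<open>u'\<close>.\<close>
  have m_eq: "Im (triple (cplx \<theta>) p * cnj (cis (coboundary \<psi> p))) = m p" if p: "p \<in> ?P" for p
  proof -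
    note v = high_pairs_valid[OF p]
    have "triple (cplx \<theta>) p = triple (rotated \<alpha> \<theta>) p" by (simp add: triple_rotated)
    also have "... = of_real (ampl_triple r p) * (cis (\<psi> (fst p) + u' (fst p)) * cis (\<psi> (snd p) + u' (snd p))
        * cis (- (\<psi> (fst p + snd p) + u' (fst p + snd p))))" using v by (simp add: triple_def align ampl_triple_def cis_cnj)
    also have "... = of_real (ampl_triple r p) * cis (coboundary \<psi> p + coboundary u' p)"
      by (simp add: cis_mult coboundary_def algebra_simps)
    finally have "triple (cplx \<theta>) p * cnj (cis (coboundary \<psi> p)) = of_real (ampl_triple r p) * cis (coboundary u' p)"
      by (simp add: cis_mult cis_cnj)
    then show ?thesis by (simp add: m_def)
  qed
  have rho_ge: "c_lo ^ 3 * \<omega> p \<le> ?\<rho> p" if p: "p \<in> ?P" for p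
  proof -
    note v = high_pairs_valid[OF p]
    have k: "0 < \<kappa> (fst p)" "0 < \<kappa> (snd p)" "0 < \<kappa> (fst p + snd p)" using v \<kappa>_pos by auto
    have "c_lo ^ 3 * \<omega> p = (c_lo * \<kappa> (fst p)) * (c_lo * \<kappa> (snd p)) * (c_lo * \<kappa> (fst p + snd p))"
      by (simp add: \<omega>_def eval_nat_numeral)
    also have "... \<le> ?\<rho> p" unfolding ampl_triple_def using k c_lo v rh by (intro mult_mono) auto
    finally show ?thesis .
  qed
  have rho_le: "0 \<le> ?\<rho> p" "?\<rho> p \<le> c_hi ^ 3" if p: "p \<in> ?P" for p
  proof -
    note v = high_pairs_valid[OF p]
    have b: "0 \<le> rhat J y k" "rhat J y k \<le> c_hi" if "k \<in> {1..K}" for k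
    proof -
      have "c_hi * \<kappa> k \<le> c_hi * 1" using \<kappa>_le_1[of k] that chi by (intro mult_left_mono) auto
      then show "0 \<le> rhat J y k" "rhat J y k \<le> c_hi" using rh[OF that] by auto
    qed
    show "0 \<le> ?\<rho> p" unfolding ampl_triple_def using v b by (intro mult_nonneg_nonneg) auto
    have "?\<rho> p \<le> c_hi * c_hi * c_hi" unfolding ampl_triple_def using v b chi by (intro mult_mono mult_nonneg_nonneg) auto
    then show "?\<rho> p \<le> c_hi ^ 3" by (simp add: eval_nat_numeral)
  qed
  have "\<exists>s. (\<Sum>k=1..K. (\<kappa> k)^2 * (u k - u0 k - real k * s)^2)
    \<le> 32 * gap_const / (c_lo ^ 3)^2 * (gap_const * (\<Sum>j=1..K. (score K \<omega> n j)^2 / (\<kappa> j)^2)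
        + (\<Sum>p\<in>?P. (m p - ?\<rho> p * sin (coboundary u0 p))^2))"
  proof (rule phase_minimizer_error[OF phase_gap gap_const_nonneg])
    show "(\<Sum>p\<in>?P. \<omega> p * (- ?\<rho> p * cos (coboundary u p) - Im (bhat J y p * cnj (cis (coboundary \<psi> p))) * coboundary u p))
        \<le> (\<Sum>p\<in>?P. \<omega> p * (- ?\<rho> p * cos (coboundary u0 p) - Im (bhat J y p * cnj (cis (coboundary \<psi> p))) * coboundary u0 p))"
      using min unfolding phase_criterion_def .
    show "Im (bhat J y p * cnj (cis (coboundary \<psi> p))) = m p + n p" if "p \<in> ?P" for p
    proof -
      have "bhat J y p * cnj (cis (coboundary \<psi> p)) = triple (cplx \<theta>) p * cnj (cis (coboundary \<psi> p))
        + (bhat J y p - triple (cplx \<theta>) p) * cnj (cis (coboundary \<psi> p))" by (simp add: algebra_simps)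
      then show ?thesis unfolding m_eq[OF that, symmetric] n_def by (metis plus_complex.sel(2))
    qed
    show "0 < c_lo ^ 3" using c_lo by simp
    show "0 \<le> \<omega> p" if "p \<in> ?P" for p using \<omega>_pos[OF that] by simp
  qed (use \<kappa>_pos u u0 rho_ge in auto)
  then obtain s where s: "(\<Sum>k=1..K. (\<kappa> k)^2 * (u k - u0 k - real k * s)^2)
    \<le> 32 * gap_const / (c_lo ^ 3)^2 * (gap_const * (\<Sum>j=1..K. (score K \<omega> n j)^2 / (\<kappa> j)^2)
        + (\<Sum>p\<in>?P. (m p - ?\<rho> p * sin (coboundary u0 p))^2))" by blast
  \<comment> \<open>The gradient is computed with estimated amplitudes and at a grid point. The
    three phases in a coboundary make the mesh error \<open>3 * h\<close>, and 18 is twice its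
    square.\<close>
  have E2: "(\<Sum>p\<in>?P. (m p - ?\<rho> p * sin (coboundary u0 p))^2)
      \<le> 2 * (\<Sum>p\<in>?P. (ampl_triple r p - ?\<rho> p)^2) + 18 * c_hi ^ 6 * (real K)^2 * h^2"
  proof -
    have each: "(m p - ?\<rho> p * sin (coboundary u0 p))^2 \<le> 2 * (ampl_triple r p - ?\<rho> p)^2 + 18 * c_hi ^ 6 * h^2"
      if p: "p \<in> ?P" for p
    proof -
      note v = high_pairs_valid[OF p]
      have "\<bar>sin (coboundary u' p) - sin (coboundary u0 p)\<bar> \<le> \<bar>coboundary u' p - coboundary u0 p\<bar>"
      proof -
        have "sin (coboundary u' p) - sin (coboundary u0 p)
          = 2 * sin ((coboundary u' p - coboundary u0 p) / 2) * cos ((coboundary u' p + coboundary u0 p) / 2)"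
          by (rule sin_diff_sin)
        then have "\<bar>sin (coboundary u' p) - sin (coboundary u0 p)\<bar>
          = 2 * \<bar>sin ((coboundary u' p - coboundary u0 p) / 2)\<bar> * \<bar>cos ((coboundary u' p + coboundary u0 p) / 2)\<bar>"
          by (simp add: abs_mult)
        also have "... \<le> 2 * \<bar>(coboundary u' p - coboundary u0 p) / 2\<bar> * 1"
          by (intro mult_mono mult_left_mono abs_sin_le_one abs_cos_le_one abs_sin_x_le_abs_x) auto
        finally show ?thesis by simp
      qed
      also have "... \<le> 3 * h" using mesh[of "fst p"] mesh[of "snd p"] mesh[of "fst p + snd p"] v unfolding coboundary_def by auto
      finally have sd: "\<bar>sin (coboundary u' p) - sin (coboundary u0 p)\<bar> \<le> 3 * h" .
      have "m p - ?\<rho> p * sin (coboundary u0 p) = (ampl_triple r p - ?\<rho> p) * sin (coboundary u' p)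
          + ?\<rho> p * (sin (coboundary u' p) - sin (coboundary u0 p))" by (simp add: m_def algebra_simps)
      then have "(m p - ?\<rho> p * sin (coboundary u0 p))^2 \<le> 2 * (((ampl_triple r p - ?\<rho> p) * sin (coboundary u' p))^2
          + (?\<rho> p * (sin (coboundary u' p) - sin (coboundary u0 p)))^2)" by (simp only: power2_sum2_le)
      also have "... \<le> 2 * ((ampl_triple r p - ?\<rho> p)^2 + (c_hi ^ 3 * (3 * h))^2)"
      proof (intro mult_left_mono add_mono)
        have "(sin (coboundary u' p))^2 \<le> 1" by (simp add: abs_square_le_1)
        then show "((ampl_triple r p - ?\<rho> p) * sin (coboundary u' p))^2 \<le> (ampl_triple r p - ?\<rho> p)^2"
          unfolding power_mult_distrib by (rule mult_left_le) simp
        have "\<bar>?\<rho> p * (sin (coboundary u' p) - sin (coboundary u0 p))\<bar> \<le> c_hi ^ 3 * (3 * h)"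
          unfolding abs_mult using rho_le[OF p] sd chi by (intro mult_mono) auto
        then show "(?\<rho> p * (sin (coboundary u' p) - sin (coboundary u0 p)))^2 \<le> (c_hi ^ 3 * (3 * h))^2"
          by (rule abs_le_square_iff[THEN iffD1, OF order_trans[OF _ abs_ge_self]])
      qed simp
      also have "... = 2 * (ampl_triple r p - ?\<rho> p)^2 + 18 * c_hi ^ 6 * h^2" by (simp add: power_mult_distrib algebra_simps)
      finally show ?thesis .
    qed
    have "card ?P \<le> card ({1..K} \<times> {1..K})" by (rule card_mono) (auto simp: high_pairs_def)
    then have card: "real (card ?P) \<le> (real K)^2" by (simp add: power2_eq_square flip: of_nat_mult)
    have "(\<Sum>p\<in>?P. (m p - ?\<rho> p * sin (coboundary u0 p))^2)
      \<le> (\<Sum>p\<in>?P. 2 * (ampl_triple r p - ?\<rho> p)^2 + 18 * c_hi ^ 6 * h^2)" by (intro sum_mono each)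
    also have "... = 2 * (\<Sum>p\<in>?P. (ampl_triple r p - ?\<rho> p)^2) + real (card ?P) * (18 * c_hi ^ 6 * h^2)"
      by (simp add: sum.distrib sum_distrib_left)
    also have "real (card ?P) * (18 * c_hi ^ 6 * h^2) \<le> (real K)^2 * (18 * c_hi ^ 6 * h^2)"
      using chi by (intro mult_right_mono card) auto
    finally show ?thesis by (simp add: algebra_simps)
  qed
  define X where "X = (\<Sum>k=1..K. (\<kappa> k)^2 * (u k - u0 k - real k * s)^2)"
  have X: "X \<le> 32 * gap_const / c_lo ^ 6 * (gap_const * (\<Sum>j=1..K. (score_error J y \<psi> \<theta> j)^2 / (\<kappa> j)^2)
      + 2 * (\<Sum>p\<in>?P. (ampl_triple r p - ?\<rho> p)^2) + 18 * c_hi ^ 6 * (real K)^2 * h^2)"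
  proof -
    have "X \<le> 32 * gap_const / (c_lo ^ 3)^2 * (gap_const * (\<Sum>j=1..K. (score K \<omega> n j)^2 / (\<kappa> j)^2)
      + (2 * (\<Sum>p\<in>?P. (ampl_triple r p - ?\<rho> p)^2) + 18 * c_hi ^ 6 * (real K)^2 * h^2))" unfolding X_def
      by (rule order_trans[OF s], intro mult_left_mono add_left_mono E2) (use gap_const_nonneg in auto)
    moreover have "score K \<omega> n j = score_error J y \<psi> \<theta> j" for j unfolding score_error_def n_def ..
    ultimately show ?thesis by (simp add: add.assoc)
  qed
  \<comment> \<open>The linear part that the gap leaves free is taken up by the rotation:
    \<open>\<alpha> + s\<close> replaces \<open>\<alpha>\<close>.\<close>
  have each: "(cmod (of_real (rhat J y k) * cis (\<psi> k + u k) - rotated (\<alpha> + s) \<theta> k))^2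
      \<le> 3 * (rhat J y k - r k)^2 + 3 * c_hi^2 * ((\<kappa> k)^2 * (u k - u0 k - real k * s)^2) + 3 * c_hi^2 * h^2"
    if k: "k \<in> {1..K}" for k
  proof -
    define w where "w = \<bar>u k - u0 k - real k * s\<bar>"
    have "rotated (\<alpha> + s) \<theta> k = cis (real k * s) * rotated \<alpha> \<theta> k"
    proof -
      have e: "real k * (\<alpha> + s) = real k * s + real k * \<alpha>" by (simp add: algebra_simps)
      show ?thesis unfolding rotated_def e cis_mult[symmetric] by (simp only: mult.assoc)
    qed
    also have "... = of_real (r k) * cis (\<psi> k + u' k + real k * s)"
      unfolding align[OF k] cis_mult[symmetric] by (simp only: mult_ac)
    finally have "of_real (rhat J y k) * cis (\<psi> k + u k) - rotated (\<alpha> + s) \<theta> k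
      = of_real (rhat J y k - r k) * cis (\<psi> k + u k) + of_real (r k) * (cis (\<psi> k + u k) - cis (\<psi> k + u' k + real k * s))"
      by (simp add: algebra_simps)
    then have "cmod (of_real (rhat J y k) * cis (\<psi> k + u k) - rotated (\<alpha> + s) \<theta> k)
      \<le> \<bar>rhat J y k - r k\<bar> + r k * \<bar>(\<psi> k + u k) - (\<psi> k + u' k + real k * s)\<bar>"
      using norm_triangle_ineq[of "of_real (rhat J y k - r k) * cis (\<psi> k + u k)"
          "of_real (r k) * (cis (\<psi> k + u k) - cis (\<psi> k + u' k + real k * s))"]
        mult_left_mono[OF cmod_cis_diff_le[of "\<psi> k + u k" "\<psi> k + u' k + real k * s"] r0(1)[OF k]]
      by (simp add: norm_mult r0(1)[OF k] del: of_real_diff)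
    also have "... \<le> \<bar>rhat J y k - r k\<bar> + r k * (w + h)"
      using mesh[OF k] r0(1)[OF k] unfolding w_def by (intro add_left_mono mult_left_mono) auto
    also have "... \<le> \<bar>rhat J y k - r k\<bar> + (c_hi * \<kappa> k) * w + c_hi * h"
      using r0[OF k] h0 by (simp add: distrib_left add_mono mult_right_mono w_def)
    finally have "(cmod (of_real (rhat J y k) * cis (\<psi> k + u k) - rotated (\<alpha> + s) \<theta> k))^2
      \<le> (\<bar>rhat J y k - r k\<bar> + (c_hi * \<kappa> k) * w + c_hi * h)^2" by (rule power_mono) simp
    also have "... \<le> 3 * (\<bar>rhat J y k - r k\<bar>\<^sup>2 + ((c_hi * \<kappa> k) * w)^2 + (c_hi * h)^2)" by (rule power2_sum3_le)
    finally show ?thesis by (simp add: w_def power_mult_distrib algebra_simps)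
  qed
  have "(\<Sum>k=1..K. (cmod (of_real (rhat J y k) * cis (\<psi> k + u k) - rotated (\<alpha> + s) \<theta> k))^2)
      \<le> (\<Sum>k=1..K. 3 * (rhat J y k - r k)^2 + 3 * c_hi^2 * ((\<kappa> k)^2 * (u k - u0 k - real k * s)^2) + 3 * c_hi^2 * h^2)"
    by (intro sum_mono each)
  also have "... = 3 * (\<Sum>k=1..K. (rhat J y k - r k)^2) + 3 * c_hi^2 * (X + real K * h^2)"
    unfolding X_def by (simp add: sum.distrib sum_distrib_left algebra_simps)
  also have "... \<le> 3 * (\<Sum>k=1..K. (rhat J y k - r k)^2)
      + 3 * c_hi^2 * (32 * gap_const / c_lo ^ 6 * (gap_const * (\<Sum>j=1..K. (score_error J y \<psi> \<theta> j)^2 / (\<kappa> j)^2)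
          + 2 * (\<Sum>p\<in>?P. (ampl_triple r p - ?\<rho> p)^2) + 18 * c_hi ^ 6 * (real K)^2 * h^2) + real K * h^2)"
    by (intro add_left_mono mult_left_mono add_right_mono X) simp
  finally show ?thesis by blast
qed

end

section \<open>Expected error of the refinement\<close>

lemma nn_integral_lincomb_le:
  fixes f :: "'i => 'a => real"
  assumes I: "finite I"
    and f: "\<And>i. i \<in> I ==> f i \<in> borel_measurable M" "\<And>i x. i \<in> I ==> 0 \<le> f i x"
    and c: "\<And>i. i \<in> I ==> 0 \<le> c i" and b: "\<And>i. i \<in> I ==> 0 \<le> b i"
    and le: "\<And>i. i \<in> I ==> (\<integral>\<^sup>+x. ennreal (f i x) \<partial>M) \<le> ennreal (b i)"
  shows "(\<integral>\<^sup>+x. ennreal (\<Sum>i\<in>I. c i * f i x) \<partial>M) \<le> ennreal (\<Sum>i\<in>I. c i * b i)"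
proof -
  have "(\<integral>\<^sup>+x. ennreal (\<Sum>i\<in>I. c i * f i x) \<partial>M) = (\<integral>\<^sup>+x. (\<Sum>i\<in>I. ennreal (c i) * ennreal (f i x)) \<partial>M)"
    using c f by (intro nn_integral_cong) (simp add: sum_ennreal[symmetric] ennreal_mult')
  also have "... = (\<Sum>i\<in>I. \<integral>\<^sup>+x. ennreal (c i) * ennreal (f i x) \<partial>M)" by (rule nn_integral_sum) (use f in measurable)
  also have "... = (\<Sum>i\<in>I. ennreal (c i) * (\<integral>\<^sup>+x. ennreal (f i x) \<partial>M))"
    by (intro sum.cong refl nn_integral_cmult measurable_compose[OF f(1) measurable_ennreal])
  also have "... \<le> (\<Sum>i\<in>I. ennreal (c i) * ennreal (b i))" by (intro sum_mono mult_left_mono le) auto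
  also have "... = ennreal (\<Sum>i\<in>I. c i * b i)" using c b by (simp add: sum_ennreal[symmetric] ennreal_mult')
  finally show ?thesis .
qed

lemma chaos_bound_le:
  assumes "0 \<le> a" "0 \<le> A" "A \<le> a * \<sigma>^2" "0 \<le> B" "B \<le> b * \<sigma>^2"
  shows "chaos_bound \<sigma> A B \<le> ((8 * a^2 + 96) * (a + 2) + (a + 2) * (a * b)) * \<sigma> ^ 6"
proof -
  have "A^2 \<le> (a * \<sigma>^2)^2" using assms by (intro power_mono) auto
  then have "8 * A^2 + 96 * \<sigma> ^ 4 \<le> (8 * a^2 + 96) * \<sigma> ^ 4" by (simp add: power_mult_distrib algebra_simps)
  moreover have A2: "A + 2 * \<sigma>^2 \<le> (a + 2) * \<sigma>^2" using assms by (simp add: algebra_simps)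
  ultimately have "(8 * A^2 + 96 * \<sigma> ^ 4) * (A + 2 * \<sigma>^2) \<le> ((8 * a^2 + 96) * \<sigma> ^ 4) * ((a + 2) * \<sigma>^2)"
    using assms by (intro mult_mono) auto
  moreover have "(A + 2 * \<sigma>^2) * (A * B) \<le> ((a + 2) * \<sigma>^2) * ((a * \<sigma>^2) * (b * \<sigma>^2))"
    using assms A2 by (intro mult_mono) (auto intro: mult_nonneg_nonneg order_trans)
  ultimately have "chaos_bound \<sigma> A B \<le> ((8 * a^2 + 96) * \<sigma> ^ 4) * ((a + 2) * \<sigma>^2) + ((a + 2) * \<sigma>^2) * ((a * \<sigma>^2) * (b * \<sigma>^2))"
    unfolding chaos_bound_def by linarith
  also have "... = ((8 * a^2 + 96) * (a + 2) + (a + 2) * (a * b)) * \<sigma> ^ 6" by (simp add: eval_nat_numeral algebra_simps)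
  finally show ?thesis .
qed

text \<open>In units of \<open>\<sigma>^2\<close>, the number \<open>a\<close> bounds each squared
  amplitude and \<open>a * S\<close> the total energy.\<close>

definition moment_const :: "real => real => real => real" where
  "moment_const c_hi c0 S = (let a = c_hi^2 / c0 in (8 * a^2 + 96) * (a + 2) + (a + 2) * (a * (a * S)))"

definition power_const :: "real => real => real" where "power_const c_hi c0 = 8 * (c_hi^2 / c0)^2 + 96"

text \<open>The summands account, in this order, for the amplitudes, the score, the products of
  three amplitudes, and twice for the mesh.\<close>

definition refine_const :: "real => real => real => real => real" where
  "refine_const c_lo c_hi c0 S = 3 * (power_const c_hi c0 / (4 * c_lo^2 * c0))
    + 3 * c_hi^2 * (32 / c_lo ^ 6 * ((40000 * (S + 1))^2 * (32 * moment_const c_hi c0 S * S^2)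
      + 2 * (40000 * (S + 1) * (9 * S^2 * c_hi ^ 4 * power_const c_hi c0 / (4 * c_lo^2 * c0)))
      + 18 * c_hi ^ 6 * (40000 * (S + 1))) + 1)"

locale mra_truth = mra_scales +
  fixes \<theta> :: rvec
  assumes \<theta>: "\<And>k. k \<in> {1..K} ==> c_lo * \<kappa> k \<le> amplitude \<theta> k \<and> amplitude \<theta> k \<le> c_hi * \<kappa> k"
begin

abbreviation PJ :: "nat set => (nat => rvec) measure" where "PJ J \<equiv> PiM J (\<lambda>_. obs_law K \<sigma> \<theta>)"

lemma c_hi_pos: "0 < c_hi" using c_lo c_hi by simp

lemma ampl_nonneg: "0 \<le> amplitude \<theta> k" by (simp add: amplitude_def)

lemma A_bound: "k \<in> {1..K} ==> (cmod (cplx \<theta> k))^2 \<le> c_hi^2"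
proof -
  assume k: "k \<in> {1..K}"
  have "c_hi * \<kappa> k \<le> c_hi * 1" using \<kappa>_le_1[of k] k c_hi_pos by (intro mult_left_mono) auto
  then show ?thesis unfolding cmod_cplx using \<theta>[OF k] ampl_nonneg by (intro power_mono) auto
qed

lemma B_bound: "(\<Sum>k=1..K. (cmod (cplx \<theta> k))^2) \<le> c_hi^2 * (S * (real K * (\<kappa> K)^2))"
proof -
  have "(\<Sum>k=1..K. (cmod (cplx \<theta> k))^2) \<le> (\<Sum>k=1..K. c_hi^2 * (\<kappa> k)^2)" unfolding cmod_cplx power_mult_distrib[symmetric]
    by (intro sum_mono power_mono) (use \<theta> ampl_nonneg in auto)
  also have "... = c_hi^2 * (\<Sum>k=1..K. (\<kappa> k)^2)" by (simp add: sum_distrib_left)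
  also have "... \<le> c_hi^2 * (S * (real K * (\<kappa> K)^2))" using \<kappa>_sum by (intro mult_left_mono) (auto simp: mult.assoc)
  finally show ?thesis .
qed

abbreviation "chaos \<equiv> chaos_bound \<sigma> (c_hi^2) (c_hi^2 * (S * (real K * (\<kappa> K)^2)))"

text \<open>The total energy is of order \<open>real K * (\<kappa> K)^2\<close>, hence at most of
  order \<open>\<sigma>^2\<close> by the noise condition; this is why no power of \<open>K\<close>
  remains.\<close>

lemma chaos_le: "chaos \<le> moment_const c_hi c0 S * \<sigma> ^ 6"
  unfolding moment_const_def Let_def
proof (rule chaos_bound_le)
  show "c_hi^2 \<le> c_hi^2 / c0 * \<sigma>^2" using mult_left_mono[OF c0_le_noise, of "c_hi^2"] c0 by (simp add: field_simps)
  have "c_hi^2 * S * (c0 * (real K * (\<kappa> K)^2)) \<le> c_hi^2 * S * \<sigma>^2" using S_ge_1 by (intro mult_left_mono noise) auto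
  then show "c_hi^2 * (S * (real K * (\<kappa> K)^2)) \<le> c_hi^2 / c0 * S * \<sigma>^2" using c0 by (simp add: field_simps)
qed (use c0 S_ge_1 in auto)

lemma chaos_nonneg: "0 \<le> chaos"
  by (rule chaos_bound_ge(2)[OF A_bound B_bound]) auto

lemma moment_const_nonneg: "0 \<le> moment_const c_hi c0 S"
  unfolding moment_const_def Let_def using c0 S_ge_1 by (intro add_nonneg_nonneg mult_nonneg_nonneg) auto

lemma power_const_nonneg: "0 \<le> power_const c_hi c0"
  unfolding power_const_def by simp

lemma power_variance_le: "8 * (c_hi^2)^2 + 96 * \<sigma> ^ 4 \<le> power_const c_hi c0 * \<sigma> ^ 4"
proof -
  have "c_hi^2 \<le> c_hi^2 / c0 * \<sigma>^2" using mult_left_mono[OF c0_le_noise, of "c_hi^2"] c0 by (simp add: field_simps)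
  then have "(c_hi^2)^2 \<le> (c_hi^2 / c0 * \<sigma>^2)^2" by (intro power_mono) auto
  also have "... = (c_hi^2 / c0)^2 * \<sigma> ^ 4" unfolding power_mult_distrib by simp
  finally show ?thesis unfolding power_const_def distrib_right by linarith
qed

text \<open>The power has variance of order \<open>\<sigma> ^ 4\<close>, and passing from squares to
  amplitudes divides it by the squared scale.\<close>

lemma amplitude_expectation:
  assumes J: "finite J" "J \<noteq> {}" and k: "k \<in> {1..K}"
  shows "(\<integral>\<^sup>+y. ennreal ((rhat J y k - amplitude \<theta> k)^2) \<partial>PJ J)
    \<le> ennreal (power_const c_hi c0 * \<sigma> ^ 4 / (4 * c_lo^2 * real (card J)) / (\<kappa> k)^2)"
proof -
  define V where "V = power_const c_hi c0 * \<sigma> ^ 4"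
  have V: "0 \<le> V" unfolding V_def using power_const_nonneg by simp
  define c where "c = 1 / (4 * c_lo^2 * (\<kappa> k)^2)"
  have c: "0 \<le> c" unfolding c_def by simp
  note op = obs_power[OF A_bound B_bound _ k, of \<sigma>]
  have avg: "(\<integral>\<^sup>+y. ennreal (((\<Sum>m\<in>J. (cmod (cplx (y m) k))^2) / real (card J) - ((amplitude \<theta> k)^2 + 2 * \<sigma>^2))^2)
      \<partial>PJ J) \<le> ennreal (V / real (card J))"
  proof (rule nn_integral_PiM_average_error_le[OF prob_space_obs_law J])
    show "(\<lambda>y. (cmod (cplx y k))^2) \<in> borel_measurable (obs_law K \<sigma> \<theta>)"
      using measurable_cplx_vec[OF k] by (simp add: measurable_cong_sets[OF sets_obs_law refl])
    show "(\<integral>\<^sup>+y. ennreal (((cmod (cplx y k))^2)^2) \<partial>obs_law K \<sigma> \<theta>) \<le> ennreal V"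
      unfolding V_def by (rule order_trans[OF op(1) ennreal_leI[OF power_variance_le]]) simp_all
    show "(\<integral>y. (cmod (cplx y k))^2 \<partial>obs_law K \<sigma> \<theta>) = (amplitude \<theta> k)^2 + 2 * \<sigma>^2" using op(2) by (simp add: cmod_cplx)
  qed (rule V)
  have "(\<integral>\<^sup>+y. ennreal ((rhat J y k - amplitude \<theta> k)^2) \<partial>PJ J)
    \<le> (\<integral>\<^sup>+y. ennreal c * ennreal (((\<Sum>m\<in>J. (cmod (cplx (y m) k))^2) / real (card J) - ((amplitude \<theta> k)^2 + 2 * \<sigma>^2))^2) \<partial>PJ J)"
  proof (rule nn_integral_mono)
    fix y
    have "(rhat J y k - amplitude \<theta> k)^2 \<le> c * (phat J y k - ((amplitude \<theta> k)^2 + 2 * \<sigma>^2))^2"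
      using rhat_error[of k "amplitude \<theta> k" J y] \<theta>[OF k] k by (simp add: c_def)
    then show "ennreal ((rhat J y k - amplitude \<theta> k)^2) \<le> ennreal c * ennreal (((\<Sum>m\<in>J. (cmod (cplx (y m) k))^2) / real (card J) - ((amplitude \<theta> k)^2 + 2 * \<sigma>^2))^2)"
      using c unfolding phat_def by (simp add: ennreal_mult'[symmetric] ennreal_leI)
  qed
  also have "... = ennreal c * (\<integral>\<^sup>+y. ennreal (((\<Sum>m\<in>J. (cmod (cplx (y m) k))^2) / real (card J) - ((amplitude \<theta> k)^2 + 2 * \<sigma>^2))^2)
      \<partial>PJ J)"
  proof (rule nn_integral_cmult)
    have [measurable]: "(\<lambda>y. cplx y k) \<in> borel_measurable (obs_law K \<sigma> \<theta>)"
      using measurable_cplx_vec[OF k] by (simp add: measurable_cong_sets[OF sets_obs_law refl])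
    show "(\<lambda>y. ennreal (((\<Sum>m\<in>J. (cmod (cplx (y m) k))^2) / real (card J) - ((amplitude \<theta> k)^2 + 2 * \<sigma>^2))^2))
       \<in> borel_measurable (PJ J)" by measurable
  qed
  also have "... \<le> ennreal c * ennreal (V / real (card J))" by (intro mult_left_mono avg) simp
  also have "... = ennreal (V / (4 * c_lo^2 * real (card J)) / (\<kappa> k)^2)"
    using c V by (subst ennreal_mult'[symmetric]) (auto simp: c_def field_simps)
  finally show ?thesis unfolding V_def .
qed

text \<open>For a fixed \<open>\<psi>\<close> the score error is the deviation of an empirical mean
  from its expectation. It is to be applied with a pilot from other observations, which makes
  \<open>\<psi>\<close> a constant here. The coefficients are symmetric, so a row is counted with
  the factor 2; squared, this turns the factor 4 of the chaos bound into 16.\<close>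

lemma score_expectation:
  assumes J: "finite J" "J \<noteq> {}" and j: "j \<in> {1..K}"
  shows "(\<integral>\<^sup>+y. ennreal ((score_error J y \<psi> \<theta> j)^2) \<partial>PJ J)
    \<le> ennreal (16 * chaos * ((\<Sum>l\<in>row K j. (\<omega> (j, l))^2) + (\<Sum>k\<in>diagonal K j. (\<omega> (k, j - k))^2)) / real (card J))"
proof -
  define c where "c p = of_real (\<omega> p) * cnj (cis (coboundary \<psi> p))" for p
  define H where "H y = (\<Sum>p\<in>high_pairs K. c p * of_real (cob1 j p) * triple (cplx y) p)" for y
  define V where "V = 16 * chaos * ((\<Sum>l\<in>row K j. (\<omega> (j, l))^2) + (\<Sum>k\<in>diagonal K j. (\<omega> (k, j - k))^2))"
  have V0: "0 \<le> V" unfolding V_def using chaos_nonneg by (intro mult_nonneg_nonneg add_nonneg_nonneg sum_nonneg) auto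
  have sym: "c (j, l) + c (l, j) = 2 * c (j, l)" for l by (simp add: c_def \<omega>_def coboundary_def add.commute mult.commute)
  have norm_c: "cmod (c p) = \<bar>\<omega> p\<bar>" for p by (simp add: c_def norm_mult)
  have sq: "(\<integral>\<^sup>+y. ennreal ((cmod (H y))^2) \<partial>obs_law K \<sigma> \<theta>) \<le> ennreal V"
  proof -
    have "(\<integral>\<^sup>+y. ennreal ((cmod (H y))^2) \<partial>obs_law K \<sigma> \<theta>) \<le> ennreal (4 * chaos *
        ((\<Sum>l\<in>row K j. (cmod (c (j, l) + c (l, j)))^2) + (\<Sum>k\<in>diagonal K j. (cmod (c (k, j - k)))^2)))"
      unfolding H_def by (rule obs_score_second_moment[OF A_bound B_bound _ j]) auto
    also have "... \<le> ennreal V"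
    proof (rule ennreal_leI)
      have le: "(\<Sum>l\<in>row K j. (cmod (c (j, l) + c (l, j)))^2) + (\<Sum>k\<in>diagonal K j. (cmod (c (k, j - k)))^2)
        \<le> 4 * ((\<Sum>l\<in>row K j. (\<omega> (j, l))^2) + (\<Sum>k\<in>diagonal K j. (\<omega> (k, j - k))^2))"
        unfolding sym by (simp add: norm_mult norm_c power_mult_distrib sum_distrib_left[symmetric] sum_nonneg)
      have aux: "4 * chaos * (4 * D) = 16 * chaos * D" for D by simp
      have "0 \<le> 4 * chaos" using chaos_nonneg by simp
      from mult_left_mono[OF le this]
      show "4 * chaos * ((\<Sum>l\<in>row K j. (cmod (c (j, l) + c (l, j)))^2) + (\<Sum>k\<in>diagonal K j. (cmod (c (k, j - k)))^2)) \<le> V"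
        unfolding V_def aux .
    qed
    finally show ?thesis .
  qed
  have Hm: "H \<in> borel_measurable (vec_space K)" unfolding H_def[abs_def]
    by (intro borel_measurable_sum borel_measurable_times measurable_triple_vec) (auto simp: high_pairs_def)
  have Him: "(\<lambda>y. Im (H y)) \<in> borel_measurable (obs_law K \<sigma> \<theta>)"
    using measurable_compose[OF Hm borel_measurable_Im] by (simp add: measurable_cong_sets[OF sets_obs_law refl])
  have Hint: "integrable (obs_law K \<sigma> \<theta>) H" and Hval: "(\<integral>y. H y \<partial>obs_law K \<sigma> \<theta>)
      = (\<Sum>p\<in>high_pairs K. c p * of_real (cob1 j p) * triple (cplx \<theta>) p)"
  proof -
    have t: "integrable (obs_law K \<sigma> \<theta>) (\<lambda>y. triple (cplx y) p)"
      "(\<integral>y. triple (cplx y) p \<partial>obs_law K \<sigma> \<theta>) = triple (cplx \<theta>) p" if "p \<in> high_pairs K" for p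
      using obs_triple(2,3)[OF A_bound B_bound, of p \<sigma>] high_pairs_valid[OF that] by auto
    show "integrable (obs_law K \<sigma> \<theta>) H"
      unfolding H_def[abs_def] by (intro Bochner_Integration.integrable_sum Bochner_Integration.integrable_mult_right t)
    show "(\<integral>y. H y \<partial>obs_law K \<sigma> \<theta>) = (\<Sum>p\<in>high_pairs K. c p * of_real (cob1 j p) * triple (cplx \<theta>) p)"
      unfolding H_def using t by (subst Bochner_Integration.integral_sum) auto
  qed
  define \<mu> where "\<mu> = Im (\<Sum>p\<in>high_pairs K. c p * of_real (cob1 j p) * triple (cplx \<theta>) p)"
  have "(\<integral>\<^sup>+y. ennreal (((\<Sum>m\<in>J. Im (H (y m))) / real (card J) - \<mu>)^2) \<partial>PJ J) \<le> ennreal (V / real (card J))"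
  proof (rule nn_integral_PiM_average_error_le[OF prob_space_obs_law J Him _ _ V0])
    show "(\<integral>y. Im (H y) \<partial>obs_law K \<sigma> \<theta>) = \<mu>" unfolding \<mu>_def Hval[symmetric] by (rule integral_Im[OF Hint])
    have "(Im (H y))^2 \<le> (cmod (H y))^2" for y unfolding cmod_power2 by simp
    then show "(\<integral>\<^sup>+y. ennreal ((Im (H y))^2) \<partial>obs_law K \<sigma> \<theta>) \<le> ennreal V"
      by (intro order_trans[OF nn_integral_mono sq] ennreal_leI)
  qed
  moreover have "score_error J y \<psi> \<theta> j = (\<Sum>m\<in>J. Im (H (y m))) / real (card J) - \<mu>" for y
  proof -
    have "(\<Sum>m\<in>J. H (y m)) = (\<Sum>p\<in>high_pairs K. c p * of_real (cob1 j p) * (\<Sum>m\<in>J. triple (cplx (y m)) p))"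
      unfolding H_def by (subst sum.swap) (simp add: sum_distrib_left)
    then have e: "(\<Sum>m\<in>J. H (y m)) / of_nat (card J) = (\<Sum>p\<in>high_pairs K. c p * of_real (cob1 j p) * bhat J y p)"
      by (simp only: bhat_def times_divide_eq_right sum_divide_distrib[symmetric])
    have "(\<Sum>m\<in>J. Im (H (y m))) / real (card J) - \<mu> = Im ((\<Sum>m\<in>J. H (y m)) / of_nat (card J)) - \<mu>"
    proof -
      have "(\<Sum>m\<in>J. H (y m)) / of_nat (card J) = (\<Sum>m\<in>J. H (y m)) / complex_of_real (real (card J))" by simp
      then show ?thesis by (simp only: Im_divide_of_real Im_sum)
    qed
    also have "... = Im (\<Sum>p\<in>high_pairs K. c p * of_real (cob1 j p) * (bhat J y p - triple (cplx \<theta>) p))"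
      unfolding e \<mu>_def by (simp only: right_diff_distrib sum_subtractf minus_complex.sel)
    also have "... = score_error J y \<psi> \<theta> j" unfolding score_error_def score_def Im_sum
    proof (intro sum.cong refl)
      fix p
      let ?d = "cob1 j p" and ?e = "bhat J y p - triple (cplx \<theta>) p"
      have "c p * of_real ?d * ?e = of_real (\<omega> p * ?d) * (?e * cnj (cis (coboundary \<psi> p)))" by (simp add: c_def mult_ac)
      then have "Im (c p * of_real ?d * ?e) = \<omega> p * ?d * Im (?e * cnj (cis (coboundary \<psi> p)))"
        by (simp only: Re_complex_of_real Im_complex_of_real times_complex.sel)
      then show "Im (c p * of_real ?d * ?e) = \<omega> p * Im (?e * cnj (cis (coboundary \<psi> p))) * ?d" by (simp add: mult_ac)
    qed
    finally show ?thesis by simp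
  qed
  ultimately show ?thesis unfolding V_def by simp
qed

lemma measurable_obs_law_cplx [measurable]: "k \<in> {1..K} ==> (\<lambda>y. cplx y k) \<in> borel_measurable (obs_law K \<sigma> \<theta>)"
  using measurable_cplx_vec by (simp add: measurable_cong_sets[OF sets_obs_law refl])

lemma measurable_rhat:
  assumes "k \<in> {1..K}"
  shows "(\<lambda>y. rhat J y k) \<in> borel_measurable (PJ J)"
  using assms unfolding rhat_def phat_def by measurable

lemma measurable_score_error: "(\<lambda>y. score_error J y \<psi> \<theta> j) \<in> borel_measurable (PJ J)"
proof -
  have [measurable]: "(\<lambda>y. triple (cplx y) p) \<in> borel_measurable (obs_law K \<sigma> \<theta>)" if "p \<in> high_pairs K" for p
    using measurable_triple_vec[of p K] high_pairs_valid[OF that] by (simp add: measurable_cong_sets[OF sets_obs_law refl])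
  show ?thesis unfolding score_error_def score_def bhat_def
    by (intro borel_measurable_sum borel_measurable_times borel_measurable_const
        measurable_compose[OF _ borel_measurable_Im] borel_measurable_diff borel_measurable_divide) measurable
qed

text \<open>The \<open>K\<close> amplitudes together cost
  \<open>K * \<sigma> ^ 4 / (\<kappa> K)^2\<close> per observation. Trading
  \<open>K * (\<kappa> K)^2\<close> for \<open>\<sigma>^2 / c0\<close> gives the order of the
  rate.\<close>

lemma sum_amplitude_expectation:
  assumes J: "finite J" "J \<noteq> {}"
  shows "(\<integral>\<^sup>+y. ennreal (\<Sum>k=1..K. (rhat J y k - amplitude \<theta> k)^2) \<partial>PJ J)
    \<le> ennreal (power_const c_hi c0 / (4 * c_lo^2 * c0) * (\<sigma> ^ 6 / (real (card J) * (\<kappa> K) ^ 4)))"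
proof -
  define V where "V = power_const c_hi c0 * \<sigma> ^ 4 / (4 * c_lo^2 * real (card J))"
  have V: "0 \<le> V" unfolding V_def using power_const_nonneg by simp
  have n: "0 < real (card J)" using J by (simp add: card_gt_0_iff)
  have "(\<integral>\<^sup>+y. ennreal (\<Sum>k=1..K. 1 * (rhat J y k - amplitude \<theta> k)^2) \<partial>PJ J) \<le> ennreal (\<Sum>k=1..K. 1 * (V / (\<kappa> k)^2))"
  proof (rule nn_integral_lincomb_le)
    fix k assume k: "k \<in> {1..K}"
    show "(\<lambda>y. (rhat J y k - amplitude \<theta> k)^2) \<in> borel_measurable (PJ J)"
      by (intro borel_measurable_power borel_measurable_diff measurable_rhat k borel_measurable_const)
    show "(\<integral>\<^sup>+y. ennreal ((rhat J y k - amplitude \<theta> k)^2) \<partial>PJ J) \<le> ennreal (V / (\<kappa> k)^2)"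
      unfolding V_def by (rule amplitude_expectation[OF J k])
    show "0 \<le> V / (\<kappa> k)^2" using V by (intro divide_nonneg_nonneg) auto
  qed auto
  also have "(\<Sum>k=1..K. 1 * (V / (\<kappa> k)^2)) \<le> (\<Sum>k=1..K. V / (\<kappa> K)^2)"
  proof (rule sum_mono)
    fix k assume k: "k \<in> {1..K}"
    have "(\<kappa> K)^2 \<le> (\<kappa> k)^2" using k \<kappa>K_pos by (intro power_mono \<kappa>_ge) auto
    then show "1 * (V / (\<kappa> k)^2) \<le> V / (\<kappa> K)^2" using V \<kappa>K_pos \<kappa>_pos[of k] k by (simp add: divide_left_mono)
  qed
  also have "... = power_const c_hi c0 / (4 * c_lo^2) * \<sigma> ^ 4 / (real (card J) * (\<kappa> K) ^ 4) * (real K * (\<kappa> K)^2)"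
    using n \<kappa>K_pos c_lo by (simp add: V_def field_simps eval_nat_numeral)
  also have "... \<le> power_const c_hi c0 / (4 * c_lo^2) * \<sigma> ^ 4 / (real (card J) * (\<kappa> K) ^ 4) * (\<sigma>^2 / c0)"
    using noise c0 power_const_nonneg by (intro mult_left_mono) (auto simp: field_simps)
  also have "... = power_const c_hi c0 / (4 * c_lo^2 * c0) * (\<sigma> ^ 6 / (real (card J) * (\<kappa> K) ^ 4))"
    using n \<kappa>K_pos c_lo c0 by (simp add: field_simps eval_nat_numeral)
  finally show ?thesis by (simp add: ennreal_leI)
qed

lemma sum_kappa_nonneg: "0 \<le> S * (real K * (\<kappa> K)^2)"
  using S_ge_1 by simp

lemma sum_kappa_pairs:
  assumes "\<And>p. p \<in> P ==> fst p \<in> {1..K} \<and> snd p \<in> {1..K}" "finite P"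
  shows "(\<Sum>p\<in>P. (\<kappa> (fst p))^2 * (\<kappa> (snd p))^2) \<le> (S * (real K * (\<kappa> K)^2))^2"
proof -
  have "(\<Sum>p\<in>P. (\<kappa> (fst p))^2 * (\<kappa> (snd p))^2) \<le> (\<Sum>p\<in>{1..K} \<times> {1..K}. (\<kappa> (fst p))^2 * (\<kappa> (snd p))^2)"
    using assms by (intro sum_mono2) (auto simp: mem_Times_iff)
  also have "... = (\<Sum>k=1..K. (\<kappa> k)^2) * (\<Sum>k=1..K. (\<kappa> k)^2)" by (simp add: sum_product sum.cartesian_product case_prod_unfold)
  also have "... \<le> (S * (real K * (\<kappa> K)^2)) * (S * (real K * (\<kappa> K)^2))"
    using \<kappa>_sum by (intro mult_mono sum_nonneg) (auto simp: mult.assoc intro: order_trans[OF sum_nonneg] sum_kappa_nonneg)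
  finally show ?thesis by (simp add: power2_eq_square)
qed

text \<open>Division by \<open>(\<kappa> j)^2\<close> removes one of the three scales in
  \<open>\<omega>\<close>. The two that remain sum over all pairs to at most the square of the sum
  of the squared scales.\<close>

lemma sum_score_expectation:
  assumes J: "finite J" "J \<noteq> {}"
  shows "(\<integral>\<^sup>+y. ennreal (\<Sum>j=1..K. (score_error J y \<psi> \<theta> j)^2 / (\<kappa> j)^2) \<partial>PJ J)
    \<le> ennreal (32 * moment_const c_hi c0 S * S^2 * (\<sigma> ^ 6 * (real K * (\<kappa> K)^2)^2 / real (card J)))"
proof -
  define n where "n = real (card J)"
  have n: "0 < n" unfolding n_def using J by (simp add: card_gt_0_iff)
  define b where "b j = 16 * chaos * ((\<Sum>l\<in>row K j. (\<omega> (j, l))^2) + (\<Sum>k\<in>diagonal K j. (\<omega> (k, j - k))^2)) / n" for j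
  have b0: "0 \<le> b j" for j unfolding b_def using chaos_nonneg n
    by (intro divide_nonneg_nonneg mult_nonneg_nonneg add_nonneg_nonneg sum_nonneg) auto
  have "(\<integral>\<^sup>+y. ennreal (\<Sum>j=1..K. 1 / (\<kappa> j)^2 * (score_error J y \<psi> \<theta> j)^2) \<partial>PJ J) \<le> ennreal (\<Sum>j=1..K. 1 / (\<kappa> j)^2 * b j)"
  proof (rule nn_integral_lincomb_le)
    fix j assume j: "j \<in> {1..K}"
    show "(\<lambda>y. (score_error J y \<psi> \<theta> j)^2) \<in> borel_measurable (PJ J)" by (intro borel_measurable_power measurable_score_error)
    show "(\<integral>\<^sup>+y. ennreal ((score_error J y \<psi> \<theta> j)^2) \<partial>PJ J) \<le> ennreal (b j)"
      unfolding b_def n_def by (rule score_expectation[OF J j])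
  qed (use b0 in auto)
  also have "(\<Sum>j=1..K. 1 / (\<kappa> j)^2 * b j) = 16 * chaos / n *
      ((\<Sum>j=1..K. \<Sum>l\<in>row K j. 1 / (\<kappa> j)^2 * (\<omega> (j, l))^2) + (\<Sum>j=1..K. \<Sum>k\<in>diagonal K j. 1 / (\<kappa> j)^2 * (\<omega> (k, j - k))^2))"
  proof -
    have aux: "x * (16 * c * (a + b) / n) = 16 * c / n * (x * a + x * b)" for x a b c :: real by (simp add: algebra_simps)
    show ?thesis unfolding b_def aux sum_distrib_left[symmetric] sum.distrib by (simp only: sum_distrib_left[symmetric])
  qed
  also have "... \<le> 16 * chaos / n * ((S * (real K * (\<kappa> K)^2))^2 + (S * (real K * (\<kappa> K)^2))^2)"
  proof (intro mult_left_mono add_mono)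
    have "(\<Sum>j=1..K. \<Sum>l\<in>row K j. 1 / (\<kappa> j)^2 * (\<omega> (j, l))^2) \<le> (\<Sum>j=1..K. \<Sum>l\<in>row K j. (\<kappa> j)^2 * (\<kappa> l)^2)"
    proof (intro sum_mono)
      fix j l assume j: "j \<in> {1..K}" and l: "l \<in> row K j"
      have jl: "1 \<le> j" "1 \<le> l" using j l by (auto simp: row_def high_pairs_def)
      have p: "0 < \<kappa> j" "0 < \<kappa> l" "0 < \<kappa> (j + l)" "\<kappa> (j + l) \<le> \<kappa> j" using jl \<kappa>_pos \<kappa>_antimono by auto
      \<comment> \<open>In a row the scale of \<open>j\<close> itself cancels, and the scale of the
        larger index \<open>j + l\<close> is raised to that of \<open>j\<close>. On an antidiagonal,
        below, the scale of the sum cancels exactly.\<close>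
      have "1 / (\<kappa> j)^2 * (\<omega> (j, l))^2 = (\<kappa> (j + l))^2 * (\<kappa> l)^2" using p by (simp add: \<omega>_def power_mult_distrib)
      also have "... \<le> (\<kappa> j)^2 * (\<kappa> l)^2" using p by (intro mult_right_mono power_mono) auto
      finally show "1 / (\<kappa> j)^2 * (\<omega> (j, l))^2 \<le> (\<kappa> j)^2 * (\<kappa> l)^2" .
    qed
    also have "... = (\<Sum>p\<in>(SIGMA j:{1..K}. row K j). (\<kappa> (fst p))^2 * (\<kappa> (snd p))^2)"
      by (subst sum.Sigma) (auto simp: case_prod_unfold)
    also have "... \<le> (S * (real K * (\<kappa> K)^2))^2"
    proof (rule sum_kappa_pairs)
      show "finite (SIGMA j:{1..K}. row K j)" by (intro finite_SigmaI) auto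
    qed (auto simp: row_def high_pairs_def)
    finally show "(\<Sum>j=1..K. \<Sum>l\<in>row K j. 1 / (\<kappa> j)^2 * (\<omega> (j, l))^2) \<le> (S * (real K * (\<kappa> K)^2))^2" .
    have "(\<Sum>j=1..K. \<Sum>k\<in>diagonal K j. 1 / (\<kappa> j)^2 * (\<omega> (k, j - k))^2) = (\<Sum>j=1..K. \<Sum>k\<in>diagonal K j. (\<kappa> k)^2 * (\<kappa> (j - k))^2)"
    proof (intro sum.cong refl)
      fix j k assume k: "k \<in> diagonal K j" and j: "j \<in> {1..K}"
      have "0 < \<kappa> j" using \<kappa>_pos j by auto
      moreover have "k + (j - k) = j" using k by (auto simp: diagonal_def)
      ultimately show "1 / (\<kappa> j)^2 * (\<omega> (k, j - k))^2 = (\<kappa> k)^2 * (\<kappa> (j - k))^2" by (simp add: \<omega>_def power_mult_distrib)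
    qed
    also have "... = (\<Sum>q\<in>(SIGMA j:{1..K}. diagonal K j). (\<kappa> (snd q))^2 * (\<kappa> (fst q - snd q))^2)"
      by (subst sum.Sigma) (auto simp: case_prod_unfold)
    also have "... = (\<Sum>p\<in>(\<lambda>q. (snd q, fst q - snd q)) ` (SIGMA j:{1..K}. diagonal K j). (\<kappa> (fst p))^2 * (\<kappa> (snd p))^2)"
      by (subst sum.reindex) (auto simp: inj_on_def diagonal_def)
    also have "... \<le> (S * (real K * (\<kappa> K)^2))^2"
    proof (rule sum_kappa_pairs)
      show "finite ((\<lambda>q. (snd q, fst q - snd q)) ` (SIGMA j:{1..K}. diagonal K j))" by (intro finite_imageI finite_SigmaI) auto
    qed (auto simp: diagonal_def high_pairs_def)
    finally show "(\<Sum>j=1..K. \<Sum>k\<in>diagonal K j. 1 / (\<kappa> j)^2 * (\<omega> (k, j - k))^2) \<le> (S * (real K * (\<kappa> K)^2))^2" .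
  qed (use chaos_nonneg n in auto)
  also have "... \<le> 16 * (moment_const c_hi c0 S * \<sigma> ^ 6) / n * ((S * (real K * (\<kappa> K)^2))^2 + (S * (real K * (\<kappa> K)^2))^2)"
    using n by (intro mult_right_mono divide_right_mono mult_left_mono chaos_le) auto
  also have "... = 32 * moment_const c_hi c0 S * S^2 * (\<sigma> ^ 6 * (real K * (\<kappa> K)^2)^2 / n)" by (simp add: power_mult_distrib)
  finally show ?thesis unfolding n_def by (simp add: ennreal_leI)
qed

text \<open>Exchanging the amplitude at a frequency costs its variance, which carries the inverse
  squared scale. At \<open>k\<close> and at \<open>l\<close> this is absorbed by the larger scales;
  at \<open>k + l\<close> it leaves the denominator \<open>(\<kappa> K)^2\<close>, compensated by
  the product of two summable scales.\<close>

lemma sum_triple_expectation: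
  assumes J: "finite J" "J \<noteq> {}"
  shows "(\<integral>\<^sup>+y. ennreal (\<Sum>p\<in>high_pairs K. (ampl_triple (amplitude \<theta>) p - ampl_triple (rhat J y) p)^2) \<partial>PJ J)
    \<le> ennreal (9 * S^2 * c_hi ^ 4 * power_const c_hi c0 / (4 * c_lo^2) * (\<sigma> ^ 4 * (real K)^2 * (\<kappa> K)^2 / real (card J)))"
proof -
  let ?P = "high_pairs K" and ?M = "PJ J"
  define W where "W = power_const c_hi c0 * \<sigma> ^ 4 / (4 * c_lo^2 * real (card J))"
  have W: "0 \<le> W" unfolding W_def using power_const_nonneg by simp
  define e where "e y k = (rhat J y k - amplitude \<theta> k)^2" for y k
  define a where "a p = (\<kappa> (snd p) * \<kappa> (fst p + snd p))^2" for p
  define b where "b p = (\<kappa> (fst p) * \<kappa> (fst p + snd p))^2" for p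
  define g where "g p = (\<kappa> (fst p) * \<kappa> (snd p))^2" for p
  define f where "f p y = a p * e y (fst p) + b p * e y (snd p) + g p * e y (fst p + snd p)" for p y
  define B where "B p = W * ((\<kappa> (snd p))^2 + (\<kappa> (fst p))^2 + (\<kappa> (fst p))^2 * (\<kappa> (snd p))^2 / (\<kappa> K)^2)" for p
  have e_meas: "(\<lambda>y. e y k) \<in> borel_measurable ?M" if "k \<in> {1..K}" for k
    unfolding e_def by (intro borel_measurable_power borel_measurable_diff measurable_rhat that borel_measurable_const)
  have e_int: "(\<integral>\<^sup>+y. ennreal (e y k) \<partial>?M) \<le> ennreal (W / (\<kappa> k)^2)" if "k \<in> {1..K}" for k
    unfolding e_def W_def by (rule amplitude_expectation[OF J that])
  have e0: "0 \<le> e y k" for y k by (simp add: e_def)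
  have f0: "0 \<le> f p y" for p y unfolding f_def a_def b_def g_def using e0 by auto
  have B0: "0 \<le> B p" for p unfolding B_def using W by simp
  have valid: "fst p \<in> {1..K}" "snd p \<in> {1..K}" "fst p + snd p \<in> {1..K}" if "p \<in> ?P" for p using high_pairs_valid[OF that] by auto
  have f_meas: "f p \<in> borel_measurable ?M" if "p \<in> ?P" for p unfolding f_def[abs_def]
    by (intro borel_measurable_add borel_measurable_times borel_measurable_const e_meas valid that)
  have f_int: "(\<integral>\<^sup>+y. ennreal (f p y) \<partial>?M) \<le> ennreal (B p)" if p: "p \<in> ?P" for p
  proof -
    note v = valid[OF p]
    define idx where "idx i = (if i = 0 then fst p else if i = 1 then snd p else fst p + snd p)" for i :: nat
    define c where "c i = (if i = 0 then a p else if i = 1 then b p else g p)" for i :: nat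
    have "(\<integral>\<^sup>+y. ennreal (\<Sum>i\<in>{0,1,2::nat}. c i * e y (idx i)) \<partial>?M) \<le> ennreal (\<Sum>i\<in>{0,1,2}. c i * (W / (\<kappa> (idx i))^2))"
    proof (rule nn_integral_lincomb_le)
      fix i :: nat
      have i: "idx i \<in> {1..K}" using v by (auto simp: idx_def)
      show "(\<lambda>y. e y (idx i)) \<in> borel_measurable ?M" by (rule e_meas[OF i])
      show "(\<integral>\<^sup>+y. ennreal (e y (idx i)) \<partial>?M) \<le> ennreal (W / (\<kappa> (idx i))^2)" by (rule e_int[OF i])
      show "0 \<le> c i" by (simp add: c_def a_def b_def g_def)
      show "0 \<le> W / (\<kappa> (idx i))^2" using W by simp
    qed (use e0 in auto)
    then have "(\<integral>\<^sup>+y. ennreal (f p y) \<partial>?M) \<le> ennreal (a p * (W / (\<kappa> (fst p))^2) + (b p * (W / (\<kappa> (snd p))^2)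
        + g p * (W / (\<kappa> (fst p + snd p))^2)))" by (simp add: c_def idx_def f_def add.assoc)
    also have "... \<le> ennreal (B p)"
    proof (rule ennreal_leI)
      have k: "0 < \<kappa> (fst p)" "0 < \<kappa> (snd p)" "0 < \<kappa> (fst p + snd p)" "\<kappa> (fst p + snd p) \<le> \<kappa> (fst p)"
        "\<kappa> (fst p + snd p) \<le> \<kappa> (snd p)" "\<kappa> K \<le> \<kappa> (fst p + snd p)" using v \<kappa>_pos \<kappa>_antimono by auto
      have "a p * (1 / (\<kappa> (fst p))^2) \<le> (\<kappa> (snd p))^2"
      proof -
        have "(\<kappa> (fst p + snd p))^2 \<le> (\<kappa> (fst p))^2" using k by (intro power_mono) auto
        then have "(\<kappa> (snd p))^2 * (\<kappa> (fst p + snd p))^2 \<le> (\<kappa> (snd p))^2 * (\<kappa> (fst p))^2" by (intro mult_left_mono) auto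
        then show ?thesis using k by (simp add: a_def power_mult_distrib field_simps)
      qed
      moreover have "b p * (1 / (\<kappa> (snd p))^2) \<le> (\<kappa> (fst p))^2"
      proof -
        have "(\<kappa> (fst p + snd p))^2 \<le> (\<kappa> (snd p))^2" using k by (intro power_mono) auto
        then have "(\<kappa> (fst p))^2 * (\<kappa> (fst p + snd p))^2 \<le> (\<kappa> (fst p))^2 * (\<kappa> (snd p))^2" by (intro mult_left_mono) auto
        then show ?thesis using k by (simp add: b_def power_mult_distrib field_simps)
      qed
      moreover have "g p * (1 / (\<kappa> (fst p + snd p))^2) \<le> (\<kappa> (fst p))^2 * (\<kappa> (snd p))^2 / (\<kappa> K)^2"
      proof -
        have "(\<kappa> K)^2 \<le> (\<kappa> (fst p + snd p))^2" using k \<kappa>K_pos by (intro power_mono) auto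
        then have "g p / (\<kappa> (fst p + snd p))^2 \<le> g p / (\<kappa> K)^2" using \<kappa>K_pos k by (intro divide_left_mono) (auto simp: g_def)
        then show ?thesis by (simp add: g_def power_mult_distrib)
      qed
      ultimately have "W * (a p * (1 / (\<kappa> (fst p))^2) + (b p * (1 / (\<kappa> (snd p))^2) + g p * (1 / (\<kappa> (fst p + snd p))^2))) \<le> B p"
        unfolding B_def by (intro mult_left_mono W) linarith
      then show "a p * (W / (\<kappa> (fst p))^2) + (b p * (W / (\<kappa> (snd p))^2) + g p * (W / (\<kappa> (fst p + snd p))^2)) \<le> B p"
        by (simp add: algebra_simps)
    qed
    finally show ?thesis .
  qed
  have "(\<integral>\<^sup>+y. ennreal (\<Sum>p\<in>?P. (ampl_triple (amplitude \<theta>) p - ampl_triple (rhat J y) p)^2) \<partial>?M)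
      \<le> (\<integral>\<^sup>+y. ennreal (\<Sum>p\<in>?P. (3 * c_hi ^ 4) * f p y) \<partial>?M)"
  proof (intro nn_integral_mono ennreal_leI sum_mono)
    fix y p assume p: "p \<in> ?P"
    show "(ampl_triple (amplitude \<theta>) p - ampl_triple (rhat J y) p)^2 \<le> (3 * c_hi ^ 4) * f p y"
      unfolding f_def a_def b_def g_def e_def
    proof (rule ampl_triple_diff[OF p])
      show "0 \<le> rhat J y k \<and> rhat J y k \<le> c_hi * \<kappa> k" if "k \<in> {1..K}" for k
        using rhat_bounds[of k J y] that \<kappa>_pos[of k] c_lo by (auto intro: order_trans[of 0 "c_lo * \<kappa> k"])
    qed (use \<theta> ampl_nonneg in auto)
  qed
  also have "... \<le> ennreal (\<Sum>p\<in>?P. (3 * c_hi ^ 4) * B p)"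
    by (rule nn_integral_lincomb_le) (use f_meas f0 f_int B0 c_hi_pos in auto)
  also have "(\<Sum>p\<in>?P. (3 * c_hi ^ 4) * B p) \<le> 9 * S^2 * c_hi ^ 4 * (W * ((real K)^2 * (\<kappa> K)^2))"
  proof -
    define s where "s = S * (real K * (\<kappa> K)^2)"
    have sub: "?P \<subseteq> {1..K} \<times> {1..K}" by (auto simp: high_pairs_def)
    have k2: "(\<Sum>k=1..K. (\<kappa> k)^2) \<le> s" using \<kappa>_sum by (simp add: s_def mult.assoc)
    have s1: "(\<Sum>p\<in>?P. (\<kappa> (snd p))^2) \<le> real K * s"
    proof -
      have "(\<Sum>p\<in>?P. (\<kappa> (snd p))^2) \<le> (\<Sum>p\<in>{1..K} \<times> {1..K}. (\<kappa> (snd p))^2)" by (intro sum_mono2 sub) auto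
      also have "... = (\<Sum>k=1..K. \<Sum>l=1..K. (\<kappa> l)^2)" unfolding sum.cartesian_product by (simp add: case_prod_unfold)
      also have "... \<le> (\<Sum>k=1..K. s)" by (intro sum_mono k2)
      finally show ?thesis by simp
    qed
    have s2: "(\<Sum>p\<in>?P. (\<kappa> (fst p))^2) \<le> real K * s"
    proof -
      have "(\<Sum>p\<in>?P. (\<kappa> (fst p))^2) \<le> (\<Sum>p\<in>{1..K} \<times> {1..K}. (\<kappa> (fst p))^2)" by (intro sum_mono2 sub) auto
      also have "... = (\<Sum>k=1..K. \<Sum>l=1..K. (\<kappa> k)^2)" unfolding sum.cartesian_product by (simp add: case_prod_unfold)
      also have "... = real K * (\<Sum>k=1..K. (\<kappa> k)^2)" by (simp add: sum_distrib_left)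
      also have "... \<le> real K * s" by (intro mult_left_mono k2) auto
      finally show ?thesis .
    qed
    have s3: "(\<Sum>p\<in>?P. (\<kappa> (fst p))^2 * (\<kappa> (snd p))^2 / (\<kappa> K)^2) \<le> s^2 / (\<kappa> K)^2" unfolding sum_divide_distrib[symmetric] s_def
      by (intro divide_right_mono sum_kappa_pairs) (use valid in auto)
    have "(\<Sum>p\<in>?P. (3 * c_hi ^ 4) * B p) = 3 * c_hi ^ 4 * (W * ((\<Sum>p\<in>?P. (\<kappa> (snd p))^2) + (\<Sum>p\<in>?P. (\<kappa> (fst p))^2)
        + (\<Sum>p\<in>?P. (\<kappa> (fst p))^2 * (\<kappa> (snd p))^2 / (\<kappa> K)^2)))"
      unfolding B_def sum_distrib_left[symmetric] sum.distrib[symmetric] ..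
    also have "... \<le> 3 * c_hi ^ 4 * (W * (real K * s + real K * s + s^2 / (\<kappa> K)^2))"
      using W c_hi_pos by (intro mult_left_mono add_mono s1 s2 s3) auto
    also have "real K * s + real K * s + s^2 / (\<kappa> K)^2 = (2 * S + S^2) * ((real K)^2 * (\<kappa> K)^2)"
      using \<kappa>K_pos by (simp add: s_def power2_eq_square field_simps)
    also have "3 * c_hi ^ 4 * (W * ((2 * S + S^2) * ((real K)^2 * (\<kappa> K)^2)))
        \<le> 3 * c_hi ^ 4 * (W * ((3 * S^2) * ((real K)^2 * (\<kappa> K)^2)))"
    proof -
      have "S \<le> S^2" using S_ge_1 by (simp add: power2_eq_square)
      then have "2 * S + S^2 \<le> 3 * S^2" by simp
      then show ?thesis using W c_hi_pos by (intro mult_left_mono mult_right_mono) auto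
    qed
    finally show ?thesis by (simp add: mult_ac)
  qed
  finally show ?thesis by (simp add: W_def mult_ac ennreal_leI)
qed

theorem refinement_risk:
  assumes J: "finite J" "J \<noteq> {}" and mesh: "real K * h^2 \<le> \<sigma> ^ 6 / real (card J)"
  shows "(\<integral>\<^sup>+y. ennreal (3 * (\<Sum>k=1..K. (rhat J y k - amplitude \<theta> k)^2)
      + 3 * c_hi^2 * (32 * gap_const / c_lo ^ 6 * (gap_const * (\<Sum>j=1..K. (score_error J y \<psi> \<theta> j)^2 / (\<kappa> j)^2)
          + 2 * (\<Sum>p\<in>high_pairs K. (ampl_triple (amplitude \<theta>) p - ampl_triple (rhat J y) p)^2)
          + 18 * c_hi ^ 6 * (real K)^2 * h^2) + real K * h^2)) \<partial>PJ J)
    \<le> ennreal (refine_const c_lo c_hi c0 S * (\<sigma> ^ 6 / (real (card J) * (\<kappa> K) ^ 4)))"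
proof -
  let ?M = "PJ J"
  interpret M: prob_space ?M by (intro prob_space_PiM prob_space_obs_law)
  define n where "n = real (card J)"
  have n: "0 < n" unfolding n_def using J by (simp add: card_gt_0_iff)
  define Q where "Q = \<sigma> ^ 6 / (n * (\<kappa> K) ^ 4)"
  have Q0: "0 \<le> Q" unfolding Q_def using n by simp
  define T1 where "T1 y = (\<Sum>k=1..K. (rhat J y k - amplitude \<theta> k)^2)" for y
  define T2 where "T2 y = (\<Sum>j=1..K. (score_error J y \<psi> \<theta> j)^2 / (\<kappa> j)^2)" for y
  define T3 where "T3 y = (\<Sum>p\<in>high_pairs K. (ampl_triple (amplitude \<theta>) p - ampl_triple (rhat J y) p)^2)" for y
  define E1 where "E1 = power_const c_hi c0 / (4 * c_lo^2 * c0) * Q"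
  define E2 where "E2 = 32 * moment_const c_hi c0 S * S^2 * (\<sigma> ^ 6 * (real K * (\<kappa> K)^2)^2 / n)"
  define E3 where "E3 = 9 * S^2 * c_hi ^ 4 * power_const c_hi c0 / (4 * c_lo^2) * (\<sigma> ^ 4 * (real K)^2 * (\<kappa> K)^2 / n)"
  have E0: "0 \<le> E1" "0 \<le> E2" "0 \<le> E3"
    unfolding E1_def E2_def E3_def using Q0 n power_const_nonneg moment_const_nonneg c_lo c0 by auto
  \<comment> \<open>The fourth function is the constant 1; it collects the mesh terms, so that the
    whole bound is a single linear combination.\<close>
  define T where "T i y = (if i = 0 then T1 y else if i = 1 then T2 y else if i = 2 then T3 y else 1)" for i :: nat and y
  define E where "E i = (if i = 0 then E1 else if i = 1 then E2 else if i = 2 then E3 else 1)" for i :: nat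
  define d where "d = 3 * c_hi^2 * (32 * gap_const / c_lo ^ 6)"
  have d0: "0 \<le> d" unfolding d_def using gap_const_nonneg by simp
  define c where "c i = (if i = 0 then 3 else if i = 1 then d * gap_const else if i = 2 then d * 2
      else d * (18 * c_hi ^ 6 * (real K)^2 * h^2) + 3 * c_hi^2 * (real K * h^2))" for i :: nat
  have meas: "T i \<in> borel_measurable ?M" for i
  proof -
    have "T1 \<in> borel_measurable ?M" unfolding T1_def[abs_def]
      by (intro borel_measurable_sum borel_measurable_power borel_measurable_diff measurable_rhat borel_measurable_const)
    moreover have "T2 \<in> borel_measurable ?M" unfolding T2_def[abs_def]
      by (intro borel_measurable_sum borel_measurable_divide borel_measurable_power measurable_score_error borel_measurable_const)
    moreover have "T3 \<in> borel_measurable ?M" unfolding T3_def[abs_def] ampl_triple_def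
      by (intro borel_measurable_sum borel_measurable_power borel_measurable_diff borel_measurable_times
          measurable_rhat borel_measurable_const) (auto simp: high_pairs_def)
    ultimately show ?thesis unfolding T_def[abs_def] by simp
  qed
  have "(\<integral>\<^sup>+y. ennreal (\<Sum>i\<in>{0,1,2,3::nat}. c i * T i y) \<partial>?M) \<le> ennreal (\<Sum>i\<in>{0,1,2,3}. c i * E i)"
  proof (rule nn_integral_lincomb_le)
    fix i :: nat
    show "T i \<in> borel_measurable ?M" by (rule meas)
    show "0 \<le> c i" unfolding c_def using d0 gap_const_nonneg by auto
    show "0 \<le> E i" unfolding E_def using E0 by auto
    show "0 \<le> T i y" for y unfolding T_def T1_def T2_def T3_def by (auto intro!: sum_nonneg)
    have "(\<integral>\<^sup>+y. ennreal (T1 y) \<partial>?M) \<le> ennreal E1" unfolding T1_def E1_def Q_def n_def by (rule sum_amplitude_expectation[OF J])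
    moreover have "(\<integral>\<^sup>+y. ennreal (T2 y) \<partial>?M) \<le> ennreal E2" unfolding T2_def E2_def n_def by (rule sum_score_expectation[OF J])
    moreover have "(\<integral>\<^sup>+y. ennreal (T3 y) \<partial>?M) \<le> ennreal E3" unfolding T3_def E3_def n_def by (rule sum_triple_expectation[OF J])
    ultimately show "(\<integral>\<^sup>+y. ennreal (T i y) \<partial>?M) \<le> ennreal (E i)" unfolding T_def E_def by (simp add: M.emeasure_space_1)
  qed simp
  also have "(\<Sum>i\<in>{0,1,2,3}. c i * E i) \<le> refine_const c_lo c_hi c0 S * Q"
  proof -
    define g where "g = 40000 * (S + 1)"
    have g0: "0 \<le> g" using S_ge_1 by (simp add: g_def)
    have G: "gap_const = g / (real K * (\<kappa> K) ^ 4)" by (simp add: gap_const_def g_def)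
    have Kp: "0 < real K" using K by simp
    \<comment> \<open>The scale is at most 1, so the mesh condition is stronger than a bound by the
      rate.\<close>
    have h1: "real K * h^2 \<le> Q"
    proof -
      have "(\<kappa> K) ^ 4 \<le> 1" using \<kappa>K_pos \<kappa>_le_1[of K] K by (intro power_le_one) auto
      then have "\<sigma> ^ 6 / n \<le> Q" unfolding Q_def using n \<kappa>K_pos by (simp add: field_simps mult_left_le)
      then show ?thesis using mesh by (simp add: n_def)
    qed
    have h2: "gap_const * (18 * c_hi ^ 6 * (real K)^2 * h^2) \<le> 18 * c_hi ^ 6 * g * Q"
    proof -
      have "gap_const * (18 * c_hi ^ 6 * (real K)^2 * h^2) = 18 * c_hi ^ 6 * g / (\<kappa> K) ^ 4 * (real K * h^2)"
        unfolding G using Kp \<kappa>K_pos by (simp add: field_simps power2_eq_square)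
      also have "... \<le> 18 * c_hi ^ 6 * g / (\<kappa> K) ^ 4 * (\<sigma> ^ 6 / n)" using mesh g0 by (intro mult_left_mono) (auto simp: n_def)
      also have "... = 18 * c_hi ^ 6 * g * Q" using n \<kappa>K_pos by (simp add: Q_def field_simps)
      finally show ?thesis .
    qed
    have e2: "gap_const * (gap_const * E2) = g^2 * (32 * moment_const c_hi c0 S * S^2) * Q"
      unfolding G E2_def Q_def using n Kp \<kappa>K_pos by (simp add: field_simps eval_nat_numeral)
    have e3: "gap_const * E3 \<le> g * (9 * S^2 * c_hi ^ 4 * power_const c_hi c0 / (4 * c_lo^2 * c0)) * Q"
    proof -
      have "gap_const * E3 = g * (9 * S^2 * c_hi ^ 4 * power_const c_hi c0 / (4 * c_lo^2)) * (\<sigma> ^ 4 / (n * (\<kappa> K) ^ 4)) * (real K * (\<kappa> K)^2)"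
        unfolding G E3_def using n Kp \<kappa>K_pos c_lo by (simp add: field_simps eval_nat_numeral)
      also have "... \<le> g * (9 * S^2 * c_hi ^ 4 * power_const c_hi c0 / (4 * c_lo^2)) * (\<sigma> ^ 4 / (n * (\<kappa> K) ^ 4)) * (\<sigma>^2 / c0)"
        using noise c0 g0 n power_const_nonneg by (intro mult_left_mono) (auto simp: field_simps)
      also have "... = g * (9 * S^2 * c_hi ^ 4 * power_const c_hi c0 / (4 * c_lo^2 * c0)) * Q"
        unfolding Q_def using n c0 c_lo \<kappa>K_pos by (simp add: field_simps eval_nat_numeral)
      finally show ?thesis .
    qed
    have "(\<Sum>i\<in>{0,1,2,3}. c i * E i) = 3 * E1 + 3 * c_hi^2 * (32 / c_lo ^ 6 * (gap_const * (gap_const * E2) + 2 * (gap_const * E3)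
        + gap_const * (18 * c_hi ^ 6 * (real K)^2 * h^2)) + real K * h^2)" by (simp add: c_def E_def d_def algebra_simps)
    also have "... \<le> 3 * E1 + 3 * c_hi^2 * (32 / c_lo ^ 6 * (g^2 * (32 * moment_const c_hi c0 S * S^2) * Q
        + 2 * (g * (9 * S^2 * c_hi ^ 4 * power_const c_hi c0 / (4 * c_lo^2 * c0)) * Q) + 18 * c_hi ^ 6 * g * Q) + Q)"
      unfolding e2 using c_lo by (intro add_left_mono mult_left_mono add_mono h1 h2 e3 order_refl) auto
    also have "... = refine_const c_lo c_hi c0 S * Q"
      unfolding E1_def refine_const_def g_def[symmetric] by (simp add: algebra_simps)
    finally show ?thesis .
  qed
  finally have "(\<integral>\<^sup>+y. ennreal (\<Sum>i\<in>{0,1,2,3::nat}. c i * T i y) \<partial>?M) \<le> ennreal (refine_const c_lo c_hi c0 S * Q)"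
    by (simp add: ennreal_leI)
  moreover have "(\<Sum>i\<in>{0,1,2,3::nat}. c i * T i y) = 3 * T1 y + 3 * c_hi^2 * (32 * gap_const / c_lo ^ 6 * (gap_const * T2 y
      + 2 * T3 y + 18 * c_hi ^ 6 * (real K)^2 * h^2) + real K * h^2)" for y by (simp add: c_def T_def d_def algebra_simps)
  ultimately show ?thesis unfolding T1_def T2_def T3_def Q_def n_def by (simp only:)
qed

end

section \<open>Failure probability of the majority vote\<close>

text \<open>One part of the error changes the length of \<open>a\<close> to that of
  \<open>b\<close>, the other the vector; each is at most the distance divided by the length of
  \<open>b\<close>.\<close>

lemma cmod_sgn_diff_le:
  fixes a b :: complex
  assumes "b \<noteq> 0"
  shows "cmod (sgn a - sgn b) \<le> 2 * cmod (a - b) / cmod b"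
proof (cases "a = 0")
  case True
  then show ?thesis using assms by (simp add: norm_sgn)
next
  case False
  have b0: "0 < cmod b" using assms by simp
  have "sgn a - sgn b = of_real ((cmod b - cmod a) / cmod b) * sgn a + (a - b) / of_real (cmod b)"
    using False assms by (simp add: sgn_eq field_simps)
  then have "cmod (sgn a - sgn b) \<le> cmod (of_real ((cmod b - cmod a) / cmod b) * sgn a) + cmod ((a - b) / of_real (cmod b))"
    by (simp only: norm_triangle_ineq)
  also have "cmod (of_real ((cmod b - cmod a) / cmod b) * sgn a) = \<bar>cmod b - cmod a\<bar> / cmod b"
    unfolding norm_mult norm_of_real using False b0 by (simp add: norm_sgn)
  also have "cmod ((a - b) / of_real (cmod b)) = cmod (a - b) / cmod b" by (simp add: norm_divide)
  also have "\<bar>cmod b - cmod a\<bar> / cmod b \<le> cmod (a - b) / cmod b"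
    using norm_triangle_ineq3[of b a] b0 by (intro divide_right_mono) (auto simp: norm_minus_commute)
  finally show ?thesis by simp
qed

text \<open>Lifting the phases needs the coboundary at every pair, including those with a small
  sum.\<close>

definition all_pairs :: "nat => (nat \<times> nat) set" where "all_pairs K = {(k, l). 1 \<le> k \<and> 1 \<le> l \<and> k + l \<le> K}"

lemma finite_all_pairs [simp]: "finite (all_pairs K)"
  by (rule finite_subset[of _ "{..K} \<times> {..K}"]) (auto simp: all_pairs_def)

lemma card_all_pairs: "card (all_pairs K) \<le> K^2"
proof -
  have "card (all_pairs K) \<le> card ({1..K} \<times> {1..K})" by (rule card_mono) (auto simp: all_pairs_def)
  then show ?thesis by (simp add: power2_eq_square)
qed

lemma all_pairs_valid: "p \<in> all_pairs K ==> 1 \<le> fst p \<and> 1 \<le> snd p \<and> fst p + snd p \<le> K"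
  by (auto simp: all_pairs_def)

definition block :: "nat => nat => nat set" where "block n j = {j * n + 1..j * n + n}"

lemma block_props: "finite (block n j)" "card (block n j) = n"
  by (simp_all add: block_def)

lemma block_subset: "j < b ==> block n j \<subseteq> {1..b * n}"
proof -
  assume "j < b"
  then have "Suc j * n \<le> b * n" by (intro mult_right_mono) auto
  then show ?thesis by (auto simp: block_def)
qed

lemma disjoint_blocks: "disjoint_family_on (block n) {..<b}"
proof -
  have "block n j \<inter> block n \<gamma> = {}" if "j < \<gamma>" for j \<gamma>
  proof -
    have "Suc j * n \<le> \<gamma> * n" using that by (intro mult_right_mono) auto
    then show ?thesis by (auto simp: block_def)
  qed
  then show ?thesis unfolding disjoint_family_on_def by (metis Int_commute linorder_neqE_nat)
qed

text \<open>Markov's inequality for a product of independent weights, 16 for a bad block and 1 for a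
  good one. Each weight has mean at most \<open>1 + 15 / 16\<close>, below 2, whereas half of the
  blocks being bad makes the product at least \<open>4 ^ b\<close>. In this way the constant
  probability that Chebyshev's inequality gives per block becomes exponentially small.\<close>

lemma majority_of_independent_blocks:
  fixes bad :: "nat => (nat => 'a) => bool"
  assumes M: "prob_space M" and n: "1 \<le> n"
    and meas: "\<And>j. j < b ==> Measurable.pred (PiM (block n j) (\<lambda>_. M)) (bad j)"
    and local: "\<And>j x. j < b ==> bad j (restrict x (block n j)) = bad j x"
    and prob: "\<And>j. j < b ==> emeasure (PiM (block n j) (\<lambda>_. M)) {x \<in> space (PiM (block n j) (\<lambda>_. M)). bad j x} \<le> ennreal (1 / 16)"
  defines "P \<equiv> PiM {1..b * n} (\<lambda>_. M)"
  shows "{x \<in> space P. b \<le> 2 * card {j \<in> {..<b}. bad j x}} \<in> sets P"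
    and "emeasure P {x \<in> space P. b \<le> 2 * card {j \<in> {..<b}. bad j x}} \<le> ennreal ((1 / 2) ^ b)"
proof -
  interpret M: prob_space M by fact
  interpret P: prob_space P unfolding P_def by (rule prob_space_PiM) (rule M)
  interpret pp: product_prob_space "\<lambda>_. M" "{1..b * n}" by unfold_locales
  let ?B = "\<lambda>j. PiM (block n j) (\<lambda>_. M)"
  define f :: "nat => (nat => 'a) => real" where "f j x = (if bad j x then 16 else 1)" for j x
  have f_meas: "f j \<in> borel_measurable (?B j)" if "j < b" for j using meas[OF that] unfolding f_def[abs_def] by measurable
  have restr: "(\<lambda>x. restrict x (block n j)) \<in> P \<rightarrow>\<^sub>M ?B j" if "j < b" for j
    unfolding P_def by (rule measurable_restrict_subset[OF block_subset[OF that]])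
  have f_local: "f j (restrict x (block n j)) = f j x" if "j < b" for j x using local[OF that] by (simp add: f_def)
  have f_measP: "f j \<in> borel_measurable P" if "j < b" for j
    using measurable_compose[OF restr[OF that] f_meas[OF that]] f_local[OF that] by simp
  have bad_measP: "Measurable.pred P (bad j)" if "j < b" for j
    using measurable_compose[OF restr[OF that] meas[OF that]] local[OF that] by simp
  have "P.indep_vars (\<lambda>_. M) (\<lambda>i x. x i) {1..b * n}" unfolding P_def by (rule indep_vars_PiM_coordinates) (rule M)
  then have "P.indep_vars ?B (\<lambda>j x. restrict (\<lambda>i. x i) (block n j)) {..<b}"
    by (rule P.indep_vars_restrict) (use block_subset disjoint_blocks in auto)
  then have "P.indep_vars (\<lambda>_. borel) (\<lambda>j x. f j (restrict (\<lambda>i. x i) (block n j))) {..<b}"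
    by (rule P.indep_vars_compose2) (use f_meas in auto)
  then have "P.indep_vars (\<lambda>_. borel) (\<lambda>j x. ennreal (f j (restrict (\<lambda>i. x i) (block n j)))) {..<b}"
    by (rule P.indep_vars_compose2) auto
  then have "(\<integral>\<^sup>+x. (\<Prod>j<b. ennreal (f j (restrict (\<lambda>i. x i) (block n j)))) \<partial>P)
      = (\<Prod>j<b. \<integral>\<^sup>+x. ennreal (f j (restrict (\<lambda>i. x i) (block n j))) \<partial>P)" by (intro P.indep_vars_nn_integral) auto
  also have "... \<le> (\<Prod>j<b. ennreal 2)"
  proof (rule prod_mono_ennreal)
    fix j assume "j \<in> {..<b}"
    then have j: "j < b" by simp
    interpret B: prob_space "?B j" by (rule prob_space_PiM) (rule M)
    have "(\<integral>\<^sup>+x. ennreal (f j (restrict (\<lambda>i. x i) (block n j))) \<partial>P)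
        = (\<integral>\<^sup>+x. ennreal (f j x) \<partial>distr P (?B j) (\<lambda>x. restrict x (block n j)))"
      using f_meas[OF j] restr[OF j] by (subst nn_integral_distr) auto
    also have "distr P (?B j) (\<lambda>x. restrict x (block n j)) = ?B j"
      unfolding P_def using pp.distr_restrict[OF block_subset[OF j]] by simp
    also have "(\<integral>\<^sup>+x. ennreal (f j x) \<partial>?B j) = (\<integral>\<^sup>+x. 1 + 15 * indicator {x \<in> space (?B j). bad j x} x \<partial>?B j)"
      by (intro nn_integral_cong) (auto simp: f_def indicator_def)
    also have "... = 1 + 15 * emeasure (?B j) {x \<in> space (?B j). bad j x}"
      using meas[OF j] by (subst nn_integral_add) (auto simp: nn_integral_cmult B.emeasure_space_1)
    also have "... \<le> 1 + 15 * ennreal (1 / 16)" by (intro add_left_mono mult_left_mono prob[OF j]) auto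
    also have "... = ennreal (1 + 15 * (1 / 16))" by (simp only: ennreal_plus ennreal_mult' ennreal_1 ennreal_numeral)
    also have "... \<le> ennreal 2" by (rule ennreal_leI) simp
    finally show "(\<integral>\<^sup>+x. ennreal (f j (restrict (\<lambda>i. x i) (block n j))) \<partial>P) \<le> ennreal 2" .
  qed
  also have "... = ennreal (2 ^ b)" by (simp only: prod_constant card_lessThan) (rule ennreal_power, simp)
  finally have prod: "(\<integral>\<^sup>+x. (\<Prod>j<b. ennreal (f j x)) \<partial>P) \<le> ennreal (2 ^ b)" using f_local by simp
  let ?E = "{x \<in> space P. b \<le> 2 * card {j \<in> {..<b}. bad j x}}"
  have card_eq: "card {j \<in> {..<b}. bad j x} = (\<Sum>j<b. of_bool (bad j x))" for x by (simp add: of_bool_def sum.If_cases Int_def)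
  have "(\<lambda>x. \<Sum>j<b. of_bool (bad j x) :: nat) \<in> P \<rightarrow>\<^sub>M count_space UNIV"
    unfolding of_bool_def by (intro measurable_sum_nat measurable_If) (use bad_measP in \<open>auto simp: pred_def\<close>)
  from measurable_sets[OF this, of "{m. b \<le> 2 * m}"]
  have "(\<lambda>x. \<Sum>j<b. of_bool (bad j x) :: nat) -` {m. b \<le> 2 * m} \<inter> space P \<in> sets P" by simp
  moreover have "(\<lambda>x. \<Sum>j<b. of_bool (bad j x) :: nat) -` {m. b \<le> 2 * m} \<inter> space P = ?E" unfolding card_eq by blast
  ultimately show E: "?E \<in> sets P" by (simp only:)
  have "emeasure P ?E \<le> (\<integral>\<^sup>+x. ennreal ((1 / 4) ^ b) * (\<Prod>j<b. ennreal (f j x)) \<partial>P)"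
  proof -
    have "emeasure P ?E = (\<integral>\<^sup>+x. indicator ?E x \<partial>P)" by (rule nn_integral_indicator[OF E, symmetric])
    also have "... \<le> (\<integral>\<^sup>+x. ennreal ((1 / 4) ^ b) * (\<Prod>j<b. ennreal (f j x)) \<partial>P)"
    proof (intro nn_integral_mono)
      fix x assume "x \<in> space P"
      show "indicator ?E x \<le> ennreal ((1 / 4) ^ b) * (\<Prod>j<b. ennreal (f j x))"
      proof (cases "x \<in> ?E")
        case True
        have "(\<Prod>j<b. f j x) = 16 ^ card {j \<in> {..<b}. bad j x}" unfolding f_def by (simp add: prod.If_cases Int_def)
        also have "... = (4 :: real) ^ (2 * card {j \<in> {..<b}. bad j x})" by (simp add: power_mult)
        finally have "(4 :: real) ^ b \<le> (\<Prod>j<b. f j x)" using True by (simp add: power_increasing)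
        then have "1 \<le> (1 / 4) ^ b * (\<Prod>j<b. f j x)" by (simp add: power_divide field_simps)
        then have "ennreal 1 \<le> ennreal ((1 / 4) ^ b * (\<Prod>j<b. f j x))" by (rule ennreal_leI)
        also have "... = ennreal ((1 / 4) ^ b) * (\<Prod>j<b. ennreal (f j x))" by (subst ennreal_mult') (auto simp: prod_ennreal f_def)
        finally show ?thesis using True by simp
      qed simp
    qed
    finally show ?thesis .
  qed
  also have "... = ennreal ((1 / 4) ^ b) * (\<integral>\<^sup>+x. (\<Prod>j<b. ennreal (f j x)) \<partial>P)"
    by (rule nn_integral_cmult) (use f_measP in measurable)
  also have "... \<le> ennreal ((1 / 4) ^ b) * ennreal (2 ^ b)" by (intro mult_left_mono prod) simp
  also have "... = ennreal ((1 / 2) ^ b)" by (simp add: ennreal_mult'[symmetric] power_mult_distrib[symmetric])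
  finally show "emeasure P ?E \<le> ennreal ((1 / 2) ^ b)" .
qed

context mra_truth
begin

text \<open>Real and imaginary part are averaged separately, each with variance at most
  \<open>chaos\<close>; this is the factor 2.\<close>

lemma bhat_chebyshev:
  assumes J: "finite J" "J \<noteq> {}" and p: "p \<in> all_pairs K" and d: "0 < d"
  shows "emeasure (PJ J) {x \<in> space (PJ J). d \<le> cmod (bhat J x p - triple (cplx \<theta>) p)}
    \<le> ennreal (2 * chaos / (real (card J) * d^2))"
proof -
  let ?M = "PJ J"
  define n where "n = real (card J)"
  have n: "0 < n" unfolding n_def using J by (simp add: card_gt_0_iff)
  note v = all_pairs_valid[OF p]
  have ot: "(\<integral>\<^sup>+y. ennreal ((cmod (triple (cplx y) p))^2) \<partial>obs_law K \<sigma> \<theta>) \<le> ennreal chaos"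
    "integrable (obs_law K \<sigma> \<theta>) (\<lambda>y. triple (cplx y) p)" "(\<integral>y. triple (cplx y) p \<partial>obs_law K \<sigma> \<theta>) = triple (cplx \<theta>) p"
    using obs_triple[OF A_bound B_bound, of p \<sigma>] v by auto
  have m[measurable]: "(\<lambda>y. triple (cplx y) p) \<in> borel_measurable (obs_law K \<sigma> \<theta>)" using ot(2) by simp
  have Re: "(\<integral>\<^sup>+x. ennreal (((\<Sum>m\<in>J. Re (triple (cplx (x m)) p)) / n - Re (triple (cplx \<theta>) p))^2) \<partial>?M) \<le> ennreal (chaos / n)"
    unfolding n_def
  proof (rule nn_integral_PiM_average_error_le[OF prob_space_obs_law J _ _ _ chaos_nonneg])
    show "(\<integral>y. Re (triple (cplx y) p) \<partial>obs_law K \<sigma> \<theta>) = Re (triple (cplx \<theta>) p)"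
      unfolding ot(3)[symmetric] by (rule integral_Re[OF ot(2)])
    have "(Re z)^2 \<le> (cmod z)^2" for z unfolding cmod_power2 by simp
    then show "(\<integral>\<^sup>+y. ennreal ((Re (triple (cplx y) p))^2) \<partial>obs_law K \<sigma> \<theta>) \<le> ennreal chaos"
      by (intro order_trans[OF nn_integral_mono ot(1)] ennreal_leI)
  qed measurable
  have Im: "(\<integral>\<^sup>+x. ennreal (((\<Sum>m\<in>J. Im (triple (cplx (x m)) p)) / n - Im (triple (cplx \<theta>) p))^2) \<partial>?M) \<le> ennreal (chaos / n)"
    unfolding n_def
  proof (rule nn_integral_PiM_average_error_le[OF prob_space_obs_law J _ _ _ chaos_nonneg])
    show "(\<integral>y. Im (triple (cplx y) p) \<partial>obs_law K \<sigma> \<theta>) = Im (triple (cplx \<theta>) p)"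
      unfolding ot(3)[symmetric] by (rule integral_Im[OF ot(2)])
    have "(Im z)^2 \<le> (cmod z)^2" for z unfolding cmod_power2 by simp
    then show "(\<integral>\<^sup>+y. ennreal ((Im (triple (cplx y) p))^2) \<partial>obs_law K \<sigma> \<theta>) \<le> ennreal chaos"
      by (intro order_trans[OF nn_integral_mono ot(1)] ennreal_leI)
  qed measurable
  have [measurable]: "(\<lambda>x. bhat J x p) \<in> borel_measurable ?M" unfolding bhat_def by measurable
  have sq: "ennreal ((cmod (bhat J x p - triple (cplx \<theta>) p))^2)
      = ennreal (((\<Sum>m\<in>J. Re (triple (cplx (x m)) p)) / n - Re (triple (cplx \<theta>) p))^2)
      + ennreal (((\<Sum>m\<in>J. Im (triple (cplx (x m)) p)) / n - Im (triple (cplx \<theta>) p))^2)" for x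
  proof -
    have "bhat J x p = (\<Sum>m\<in>J. triple (cplx (x m)) p) / complex_of_real n" by (simp add: bhat_def n_def)
    then have "Re (bhat J x p) = (\<Sum>m\<in>J. Re (triple (cplx (x m)) p)) / n"
      "Im (bhat J x p) = (\<Sum>m\<in>J. Im (triple (cplx (x m)) p)) / n"
      by (simp_all only: Re_divide_of_real Im_divide_of_real Re_sum Im_sum)
    then show ?thesis unfolding cmod_power2 by (simp add: ennreal_plus[symmetric] del: ennreal_plus)
  qed
  have "(\<integral>\<^sup>+x. ennreal ((cmod (bhat J x p - triple (cplx \<theta>) p))^2) \<partial>?M) \<le> ennreal (chaos / n) + ennreal (chaos / n)"
    unfolding sq by (subst nn_integral_add) (use Re Im in \<open>auto intro!: add_mono\<close>)
  also have "... = ennreal (2 * chaos / n)" using chaos_nonneg n by (simp add: ennreal_plus[symmetric] del: ennreal_plus)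
  finally have second: "(\<integral>\<^sup>+x. ennreal ((cmod (bhat J x p - triple (cplx \<theta>) p))^2) \<partial>?M) \<le> ennreal (2 * chaos / n)" .
  have "emeasure ?M {x \<in> space ?M. d \<le> cmod (bhat J x p - triple (cplx \<theta>) p)}
      \<le> emeasure ?M {x \<in> space ?M. 1 \<le> ennreal (1 / d^2) * ennreal ((cmod (bhat J x p - triple (cplx \<theta>) p))^2)}"
  proof (rule emeasure_mono)
    show "{x \<in> space ?M. d \<le> cmod (bhat J x p - triple (cplx \<theta>) p)}
      \<subseteq> {x \<in> space ?M. 1 \<le> ennreal (1 / d^2) * ennreal ((cmod (bhat J x p - triple (cplx \<theta>) p))^2)}"
    proof safe
      fix x assume "d \<le> cmod (bhat J x p - triple (cplx \<theta>) p)"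
      then have "d^2 \<le> (cmod (bhat J x p - triple (cplx \<theta>) p))^2" using d by (intro power_mono) auto
      then have "1 \<le> 1 / d^2 * (cmod (bhat J x p - triple (cplx \<theta>) p))^2" using d by (simp add: field_simps)
      then have "ennreal 1 \<le> ennreal (1 / d^2 * (cmod (bhat J x p - triple (cplx \<theta>) p))^2)" by (rule ennreal_leI)
      then show "1 \<le> ennreal (1 / d^2) * ennreal ((cmod (bhat J x p - triple (cplx \<theta>) p))^2)"
        by (simp add: ennreal_mult'[symmetric])
    qed
  qed measurable
  also have "... \<le> ennreal (1 / d^2) * (\<integral>\<^sup>+x. ennreal ((cmod (bhat J x p - triple (cplx \<theta>) p))^2) * indicator (space ?M) x \<partial>?M)"
  proof -
    have "{x \<in> space ?M. 1 \<le> ennreal (1 / d^2) * ennreal ((cmod (bhat J x p - triple (cplx \<theta>) p))^2)}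
      = {x \<in> space ?M. 1 \<le> ennreal (1 / d^2) * ennreal ((cmod (bhat J x p - triple (cplx \<theta>) p))^2)} \<inter> space ?M" by auto
    show ?thesis by (rule nn_integral_Markov_inequality) measurable
  qed
  also have "(\<integral>\<^sup>+x. ennreal ((cmod (bhat J x p - triple (cplx \<theta>) p))^2) * indicator (space ?M) x \<partial>?M)
      = (\<integral>\<^sup>+x. ennreal ((cmod (bhat J x p - triple (cplx \<theta>) p))^2) \<partial>?M)" by (intro nn_integral_cong) auto
  also have "ennreal (1 / d^2) * ... \<le> ennreal (1 / d^2) * ennreal (2 * chaos / n)" by (intro mult_left_mono second) simp
  also have "... = ennreal (2 * chaos / (n * d^2))" by (simp add: ennreal_mult'[symmetric] mult.commute)
  finally show ?thesis unfolding n_def .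
qed

lemma triple_norm: "cmod (triple (cplx \<theta>) p) = ampl_triple (amplitude \<theta>) p"
  by (simp add: triple_def norm_mult cmod_cplx ampl_triple_def)

lemma triple_norm_ge:
  assumes p: "p \<in> all_pairs K"
  shows "(c_lo * \<kappa> K) ^ 3 \<le> cmod (triple (cplx \<theta>) p)"
proof -
  note v = all_pairs_valid[OF p]
  have a: "c_lo * \<kappa> K \<le> amplitude \<theta> k" if "k \<in> {1..K}" for k
  proof -
    have "c_lo * \<kappa> K \<le> c_lo * \<kappa> k" using \<kappa>_ge[of k] that c_lo by (intro mult_left_mono) auto
    then show ?thesis using \<theta>[OF that] by linarith
  qed
  have "(c_lo * \<kappa> K) ^ 3 = c_lo * \<kappa> K * (c_lo * \<kappa> K) * (c_lo * \<kappa> K)" by (simp add: eval_nat_numeral)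
  also have "... \<le> amplitude \<theta> (fst p) * amplitude \<theta> (snd p) * amplitude \<theta> (fst p + snd p)"
    using v a c_lo \<kappa>K_pos ampl_nonneg by (intro mult_mono mult_nonneg_nonneg) auto
  finally show ?thesis unfolding triple_norm ampl_triple_def .
qed

definition block_far :: "nat => nat \<times> nat => nat => (nat => rvec) => bool" where
  "block_far n p j x \<longleftrightarrow> 1 / 60 < cmod (sgn (bhat (block n j) x p) - sgn (triple (cplx \<theta>) p))"

text \<open>The true entry has modulus \<open>B\<close> at least
  \<open>(c_lo * \<kappa> K) ^ 3\<close>, so a direction that is off by \<open>1 / 60\<close>
  requires a deviation of \<open>B / 120\<close>. The number 460800 is 2 times 16 times the square
  of 120 and brings Chebyshev's bound to \<open>1 / 16\<close> per block. The union over pairs costs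
  \<open>(real K)^2\<close>.\<close>

lemma pilot_failure:
  fixes n b :: nat
  assumes n: "1 \<le> n" and n_ge: "460800 * moment_const c_hi c0 S * \<sigma> ^ 6 / (c_lo * \<kappa> K) ^ 6 \<le> real n"
  defines "P \<equiv> PiM {1..b * n} (\<lambda>_. obs_law K \<sigma> \<theta>)"
  shows "{x \<in> space P. \<exists>p\<in>all_pairs K. b \<le> 2 * card {j \<in> {..<b}. block_far n p j x}} \<in> sets P"
    and "emeasure P {x \<in> space P. \<exists>p\<in>all_pairs K. b \<le> 2 * card {j \<in> {..<b}. block_far n p j x}}
      \<le> ennreal ((real K)^2 * (1 / 2) ^ b)"
proof -
  have ck: "0 < c_lo * \<kappa> K" using c_lo \<kappa>K_pos by simp
  have single: "{x \<in> space P. b \<le> 2 * card {j \<in> {..<b}. block_far n p j x}} \<in> sets P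
    \<and> emeasure P {x \<in> space P. b \<le> 2 * card {j \<in> {..<b}. block_far n p j x}} \<le> ennreal ((1 / 2) ^ b)"
    if p: "p \<in> all_pairs K" for p
  proof -
    note v = all_pairs_valid[OF p]
    have [measurable]: "(\<lambda>y. triple (cplx y) p) \<in> borel_measurable (obs_law K \<sigma> \<theta>)"
      using measurable_triple_vec[of p K] v by (simp add: measurable_cong_sets[OF sets_obs_law refl])
    have meas: "Measurable.pred (PiM (block n j) (\<lambda>_. obs_law K \<sigma> \<theta>)) (block_far n p j)" for j
    proof -
      have [measurable]: "(\<lambda>x. bhat (block n j) x p) \<in> borel_measurable (PiM (block n j) (\<lambda>_. obs_law K \<sigma> \<theta>))"
        unfolding bhat_def by measurable
      have [measurable]: "(sgn :: complex => complex) \<in> borel_measurable borel" unfolding sgn_eq[abs_def] by measurable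
      show ?thesis unfolding block_far_def[abs_def] by measurable
    qed
    have local: "block_far n p j (restrict x (block n j)) = block_far n p j x" for j x by (simp add: block_far_def bhat_def)
    have prob: "emeasure (PiM (block n j) (\<lambda>_. obs_law K \<sigma> \<theta>))
        {x \<in> space (PiM (block n j) (\<lambda>_. obs_law K \<sigma> \<theta>)). block_far n p j x} \<le> ennreal (1 / 16)" for j
    proof -
      let ?M = "PiM (block n j) (\<lambda>_. obs_law K \<sigma> \<theta>)"
      have J: "finite (block n j)" "block n j \<noteq> {}" using n by (auto simp: block_def)
      define B where "B = cmod (triple (cplx \<theta>) p)"
      have B: "(c_lo * \<kappa> K) ^ 3 \<le> B" unfolding B_def by (rule triple_norm_ge[OF p])
      have B0: "0 < B" using B zero_less_power[OF ck, of 3] by linarith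
      have [measurable]: "(\<lambda>x. bhat (block n j) x p) \<in> borel_measurable ?M" unfolding bhat_def by measurable
      have "emeasure ?M {x \<in> space ?M. block_far n p j x}
        \<le> emeasure ?M {x \<in> space ?M. B / 120 \<le> cmod (bhat (block n j) x p - triple (cplx \<theta>) p)}"
      proof (rule emeasure_mono)
        show "{x \<in> space ?M. block_far n p j x} \<subseteq> {x \<in> space ?M. B / 120 \<le> cmod (bhat (block n j) x p - triple (cplx \<theta>) p)}"
        proof safe
          fix x assume "block_far n p j x"
          moreover have "cmod (sgn (bhat (block n j) x p) - sgn (triple (cplx \<theta>) p))
              \<le> 2 * cmod (bhat (block n j) x p - triple (cplx \<theta>) p) / B"
            unfolding B_def by (rule cmod_sgn_diff_le) (use B0 in \<open>auto simp: B_def\<close>)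
          ultimately have "1 / 60 < 2 * cmod (bhat (block n j) x p - triple (cplx \<theta>) p) / B" unfolding block_far_def by linarith
          then show "B / 120 \<le> cmod (bhat (block n j) x p - triple (cplx \<theta>) p)" using B0 by (simp add: field_simps)
        qed
      qed measurable
      also have "... \<le> ennreal (2 * chaos / (real (card (block n j)) * (B / 120)^2))"
        by (rule bhat_chebyshev[OF J p]) (use B0 in simp)
      also have "... \<le> ennreal (1 / 16)"
      proof (rule ennreal_leI)
        have "((c_lo * \<kappa> K) ^ 3)^2 \<le> B^2" using B ck by (intro power_mono) auto
        then have B6: "(c_lo * \<kappa> K) ^ 6 \<le> B^2" by simp
        have "460800 * (moment_const c_hi c0 S * \<sigma> ^ 6) \<le> real n * (c_lo * \<kappa> K) ^ 6"
          using n_ge pos_divide_le_eq[OF zero_less_power[OF ck, of 6]] by (simp add: mult.assoc)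
        then have "460800 * chaos \<le> real n * (c_lo * \<kappa> K) ^ 6" using chaos_le by linarith
        also have "... \<le> real n * B^2" using B6 by (intro mult_left_mono) auto
        finally have "460800 * chaos \<le> real n * B^2" .
        then show "2 * chaos / (real (card (block n j)) * (B / 120)^2) \<le> 1 / 16"
          using B0 n by (simp add: block_props power_divide field_simps)
      qed
      finally show ?thesis .
    qed
    note maj = majority_of_independent_blocks[where bad="block_far n p" and M="obs_law K \<sigma> \<theta>" and n=n and b=b]
    show ?thesis unfolding P_def by (intro conjI maj prob_space_obs_law n meas local prob)
  qed
  have eq: "{x \<in> space P. \<exists>p\<in>all_pairs K. b \<le> 2 * card {j \<in> {..<b}. block_far n p j x}}
    = (\<Union>p\<in>all_pairs K. {x \<in> space P. b \<le> 2 * card {j \<in> {..<b}. block_far n p j x}})" by auto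
  show "{x \<in> space P. \<exists>p\<in>all_pairs K. b \<le> 2 * card {j \<in> {..<b}. block_far n p j x}} \<in> sets P"
    unfolding eq by (rule sets.finite_UN[OF finite_all_pairs conjunct1[OF single]])
  have "emeasure P (\<Union>p\<in>all_pairs K. {x \<in> space P. b \<le> 2 * card {j \<in> {..<b}. block_far n p j x}})
    \<le> (\<Sum>p\<in>all_pairs K. emeasure P {x \<in> space P. b \<le> 2 * card {j \<in> {..<b}. block_far n p j x}})"
    by (rule emeasure_subadditive_finite[OF finite_all_pairs]) (use conjunct1[OF single] in blast)
  also have "... \<le> (\<Sum>p\<in>all_pairs K. ennreal ((1 / 2) ^ b))" by (intro sum_mono conjunct2[OF single])
  also have "... = ennreal (real (card (all_pairs K)) * (1 / 2) ^ b)"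
    by (simp add: ennreal_mult'[symmetric] ennreal_of_nat_eq_real_of_nat)
  also have "... \<le> ennreal ((real K)^2 * (1 / 2) ^ b)"
  proof (intro ennreal_leI mult_right_mono)
    show "real (card (all_pairs K)) \<le> (real K)^2" using card_all_pairs[of K] of_nat_mono[of "card (all_pairs K)" "K^2"] by simp
  qed simp
  finally show "emeasure P {x \<in> space P. \<exists>p\<in>all_pairs K. b \<le> 2 * card {j \<in> {..<b}. block_far n p j x}}
      \<le> ennreal ((real K)^2 * (1 / 2) ^ b)" unfolding eq .
qed

end

section \<open>Loss in complex coordinates, finite grids and the measurable estimator\<close>

lemma L2_set_rot_eq: "(L2_set (\<lambda>i. v i - rot K \<alpha> \<theta> i) (coords K))^2 = (\<Sum>k=1..K. (cmod (cplx v k - rotated \<alpha> \<theta> k))^2)"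
proof -
  have "(L2_set (\<lambda>i. v i - rot K \<alpha> \<theta> i) (coords K))^2 = (\<Sum>i\<in>coords K. (v i - rot K \<alpha> \<theta> i)^2)"
    unfolding L2_set_def by (rule real_sqrt_pow2) (intro sum_nonneg; simp)
  also have "... = (\<Sum>k=1..K. \<Sum>j\<in>{1, 2}. (v (k, j) - rot K \<alpha> \<theta> (k, j))^2)"
    unfolding coords_def sum.cartesian_product by (simp add: case_prod_unfold)
  also have "... = (\<Sum>k=1..K. (cmod (cplx v k - rotated \<alpha> \<theta> k))^2)"
  proof (intro sum.cong refl)
    fix k assume k: "k \<in> {1..K}"
    show "(\<Sum>j\<in>{1, 2}. (v (k, j) - rot K \<alpha> \<theta> (k, j))^2) = (cmod (cplx v k - rotated \<alpha> \<theta> k))^2"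
      unfolding cplx_rot[OF k, symmetric] by (simp add: cplx_def cmod_power2)
  qed
  finally show ?thesis .
qed

lemma loss_le_angle:
  assumes "\<alpha> \<in> angles"
  shows "loss K v \<theta> \<le> (\<Sum>k=1..K. (cmod (cplx v k - rotated \<alpha> \<theta> k))^2)"
  unfolding loss_def L2_set_rot_eq by (rule cINF_lower[OF _ assms]) (auto intro!: bdd_belowI2[of _ 0] sum_nonneg)

text \<open>The angle is reduced modulo \<open>2 * pi\<close>, which integer frequencies do not
  notice.\<close>

lemma loss_le: "loss K v \<theta> \<le> (\<Sum>k=1..K. (cmod (cplx v k - rotated t \<theta> k))^2)"
proof -
  define m where "m = \<lfloor>(t + pi) / (2 * pi)\<rfloor>"
  define \<alpha> where "\<alpha> = t - 2 * pi * of_int m"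
  have "of_int m \<le> (t + pi) / (2 * pi)" "(t + pi) / (2 * pi) < of_int m + 1" unfolding m_def by linarith+
  then have "2 * pi * of_int m \<le> t + pi" "t + pi < 2 * pi * of_int m + 2 * pi" by (simp_all add: field_simps)
  then have \<alpha>: "\<alpha> \<in> angles" unfolding angles_def \<alpha>_def by simp
  have "rotated \<alpha> \<theta> k = rotated t \<theta> k" for k
  proof -
    have "real k * \<alpha> = real k * t - 2 * pi * of_int (int k * m)" by (simp add: \<alpha>_def algebra_simps)
    then have "cis (real k * \<alpha>) = cis (real k * t)"
      by (simp only:) (simp add: complex_eq_iff cos_diff sin_diff sin_int_2pin cos_int_2pin del: of_int_mult)
    then show ?thesis by (simp add: rotated_def)
  qed
  then show ?thesis using loss_le_angle[OF \<alpha>, of K v \<theta>] by simp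
qed

lemma loss_attained_cmod: "\<exists>\<alpha>\<in>angles. loss K v \<theta> = (\<Sum>k=1..K. (cmod (cplx v k - rotated \<alpha> \<theta> k))^2)"
  using loss_attained[of K v \<theta>] unfolding L2_set_rot_eq .

text \<open>The infimum runs over uncountably many angles. By continuity, a strict inequality at the
  minimiser persists at nearby rational angles, so the sublevel sets are countable unions.\<close>

lemma measurable_loss: "(\<lambda>v. loss K v \<theta>) \<in> borel_measurable (vec_space K)"
proof (rule borel_measurableI_less)
  fix c :: real
  define q where "q v \<alpha> = (\<Sum>k=1..K. (cmod (cplx v k - rotated \<alpha> \<theta> k))^2)" for v \<alpha>
  have q_meas: "(\<lambda>v. q v \<alpha>) \<in> borel_measurable (vec_space K)" for \<alpha> unfolding q_def
    by (intro borel_measurable_sum borel_measurable_power measurable_compose[OF _ borel_measurable_norm]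
        borel_measurable_diff measurable_cplx_vec borel_measurable_const)
  have "loss K v \<theta> < c \<longleftrightarrow> (\<exists>\<alpha>\<in>angles \<inter> \<rat>. q v \<alpha> < c)" for v
  proof
    assume "loss K v \<theta> < c"
    moreover obtain a where a: "a \<in> angles" "loss K v \<theta> = q v a" using loss_attained_cmod[of K v \<theta>] unfolding q_def by blast
    ultimately have "q v a < c" by simp
    moreover have "isCont (q v) a" unfolding q_def rotated_def cis.ctr Complex_eq by (intro continuous_intros)
    ultimately have "\<forall>\<^sub>F x in at a. q v x < c" unfolding isCont_def by (rule order_tendstoD(2)[rotated])
    then obtain d where d: "0 < d" "\<And>x. x \<noteq> a ==> dist x a < d ==> q v x < c" unfolding eventually_at by auto
    \<comment> \<open>The minimiser may be the left end point \<open>- pi\<close> but never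
      \<open>pi\<close>, so there is always room on its right.\<close>
    have "a < min (a + d) pi" using a d by (auto simp: angles_def)
    then obtain x where x: "x \<in> \<rat>" "a < x" "x < min (a + d) pi" using Rats_dense_in_real by blast
    then have "q v x < c" by (intro d(2)) (auto simp: dist_real_def)
    moreover have "x \<in> angles" using x a by (auto simp: angles_def)
    ultimately show "\<exists>\<alpha>\<in>angles \<inter> \<rat>. q v \<alpha> < c" using x by blast
  next
    assume "\<exists>\<alpha>\<in>angles \<inter> \<rat>. q v \<alpha> < c"
    then obtain a where a: "a \<in> angles" "q v a < c" by auto
    then show "loss K v \<theta> < c" using loss_le_angle[OF a(1), of K v \<theta>] unfolding q_def by linarith
  qed
  then have "{v \<in> space (vec_space K). loss K v \<theta> < c} = (\<Union>\<alpha>\<in>angles \<inter> \<rat>. {v \<in> space (vec_space K). q v \<alpha> < c})" by auto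
  also have "... \<in> sets (vec_space K)"
    using q_meas by (intro sets.countable_UN'') (auto intro: countable_rat countable_subset[OF Int_lower2] simp: borel_measurable_iff_less)
  finally show "{v \<in> space (vec_space K). loss K v \<theta> < c} \<in> sets (vec_space K)" .
qed

text \<open>The estimator searches finite grids enumerated by natural numbers: the least index with
  a measurable property is measurable, while an exact minimiser over a continuum would call for a
  measurable selection.\<close>

lemma grid_exists:
  fixes R h :: real
  assumes R: "0 < R" and h: "0 < h"
  shows "\<exists>(f :: nat => nat => real) n. (\<forall>i<n. \<forall>k\<in>{1..K}. \<bar>f i k\<bar> \<le> R) \<and>
    (\<forall>u. (\<forall>k\<in>{1..K}. \<bar>u k\<bar> \<le> R) \<longrightarrow> (\<exists>i<n. \<forall>k\<in>{1..K}. \<bar>f i k - u k\<bar> \<le> h))"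
proof -
  obtain M :: nat where M: "R / h < real M" using reals_Archimedean2 by blast
  have M0: "0 < real M" using M R h by (intro less_trans[OF _ M]) simp
  have RM: "R / real M \<le> h" using M h M0 by (simp add: field_simps)
  define g where "g = (\<lambda>j :: int. R * of_int j / real M) ` {- int M..int M}"
  have g_bound: "\<bar>x\<bar> \<le> R" if x: "x \<in> g" for x
  proof -
    obtain j where j: "x = R * of_int j / real M" "- int M \<le> j" "j \<le> int M" using x unfolding g_def by fastforce
    have "\<bar>of_int j :: real\<bar> \<le> real M" using j by (simp add: abs_le_iff)
    then have "R * \<bar>of_int j\<bar> \<le> R * real M" using R by (intro mult_left_mono) auto
    then show ?thesis using M0 R by (simp add: j(1) abs_mult field_simps)
  qed
  have g_dense: "\<exists>x\<in>g. \<bar>x - u\<bar> \<le> h" if u: "\<bar>u\<bar> \<le> R" for u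
  proof -
    define j where "j = \<lfloor>u * real M / R\<rfloor>"
    have j: "of_int j \<le> u * real M / R" "u * real M / R < of_int j + 1" unfolding j_def by linarith+
    have "u * real M / R \<le> real M" "- real M \<le> u * real M / R"
    proof -
      have "u * real M \<le> R * real M" "- R * real M \<le> u * real M" using u M0 by (intro mult_right_mono; simp)+
      then show "u * real M / R \<le> real M" "- real M \<le> u * real M / R" using R by (simp_all add: field_simps)
    qed
    then have "j \<le> int M" "- int M \<le> j" unfolding j_def by (simp_all add: floor_le_iff le_floor_iff)
    then have "R * of_int j / real M \<in> g" by (auto simp: g_def)
    moreover have "\<bar>R * of_int j / real M - u\<bar> \<le> R / real M"
    proof -
      have "of_int j * R \<le> u * real M" using j(1) R by (simp add: pos_le_divide_eq)
      then have "R * of_int j / real M \<le> u" using M0 by (simp add: pos_divide_le_eq mult.commute)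
      moreover have "u * real M < (of_int j + 1) * R" using j(2) R by (simp add: pos_divide_less_eq)
      then have "u < (of_int j + 1) * R / real M" using M0 by (simp add: pos_less_divide_eq)
      ultimately show ?thesis by (simp add: algebra_simps add_divide_distrib abs_if)
    qed
    ultimately show ?thesis using RM by (meson order_trans)
  qed
  define F where "F = (\<Pi>\<^sub>E k\<in>{1..K}. g)"
  have "finite F" unfolding F_def by (intro finite_PiE) (auto simp: g_def)
  then obtain f where f: "bij_betw f {0..<card F} F" using ex_bij_betw_nat_finite by blast
  show ?thesis
  proof (rule exI[of _ f], rule exI[of _ "card F"], intro conjI allI impI ballI)
    fix i k assume "i < card F" "k \<in> {1..K}"
    then have "f i \<in> F" using f by (auto simp: bij_betw_def)
    then show "\<bar>f i k\<bar> \<le> R" using \<open>k \<in> {1..K}\<close> by (intro g_bound) (auto simp: F_def)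
  next
    fix u :: "nat => real" assume u: "\<forall>k\<in>{1..K}. \<bar>u k\<bar> \<le> R"
    define w where "w k = (SOME x. x \<in> g \<and> \<bar>x - u k\<bar> \<le> h)" for k
    have w: "w k \<in> g \<and> \<bar>w k - u k\<bar> \<le> h" if "k \<in> {1..K}" for k unfolding w_def by (rule someI_ex) (use g_dense u that in blast)
    have "restrict w {1..K} \<in> F" using w by (auto simp: F_def)
    then obtain i where i: "i < card F" "f i = restrict w {1..K}" using f by (metis atLeastLessThan_iff bij_betw_def imageE)
    then show "\<exists>i<card F. \<forall>k\<in>{1..K}. \<bar>f i k - u k\<bar> \<le> h" using w by (intro exI[of _ i]) auto
  qed
qed

text \<open>The threshold \<open>1 / 30\<close> leaves \<open>1 / 60\<close> for the error of a
  block and \<open>1 / 60\<close> for the distance of the true phases from the grid.\<close>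

definition pilot_ok :: "nat => nat => nat => (nat => real) => (nat \<times> nat => nat => complex) => bool" where
  "pilot_ok K n b \<psi> B \<longleftrightarrow> (\<forall>p\<in>all_pairs K. 2 * card {j \<in> {..<b}. 1 / 30 < cmod (sgn (B p j) - cis (coboundary \<psi> p))} < b)"

text \<open>Two majorities meet. In a common block the pilot and the truth are both close to the
  same empirical direction.\<close>

lemma majority_pigeonhole:
  assumes "2 * card {j \<in> {..<b}. P j} < b" "2 * card {j \<in> {..<b}. Q j} < b"
  shows "\<exists>j<b. \<not> P j \<and> \<not> Q j"
proof (rule ccontr)
  assume "\<not> ?thesis"
  then have "{..<b} \<subseteq> {j \<in> {..<b}. P j} \<union> {j \<in> {..<b}. Q j}" by auto
  then have "card {..<b} \<le> card ({j \<in> {..<b}. P j} \<union> {j \<in> {..<b}. Q j})" by (intro card_mono) auto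
  also have "... \<le> card {j \<in> {..<b}. P j} + card {j \<in> {..<b}. Q j}" by (rule card_Un_le)
  finally show False using assms by simp
qed

context mra_scales
begin

text \<open>If no grid point passes the vote, the index is unspecified. With a sufficiently fine
  grid this happens only on the failure event, where the crude bound on the loss is used.\<close>

definition pilot_index :: "(nat => nat => real) => nat => nat => nat => (nat => rvec) => nat" where
  "pilot_index \<Psi> G n b y = (LEAST i. i < G \<and> pilot_ok K n b (\<Psi> i) (\<lambda>p j. bhat (block n j) y p))"

definition phase_index :: "(nat => nat => real) => nat => nat set => (nat => real) => (nat => rvec) => nat" where
  "phase_index U H J \<psi> y = (LEAST i. i < H \<and> (\<forall>j<H. phase_criterion J y \<psi> (U i) \<le> phase_criterion J y \<psi> (U j)))"

definition estimate :: "(nat => nat => real) => nat => (nat => nat => real) => nat => nat => nat => nat set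
    => (nat => rvec) => rvec" where "estimate \<Psi> G U H n b J y = (\<lambda>(k, j)\<in>coords K.
     let i = pilot_index \<Psi> G n b y; \<phi> = \<Psi> i k + U (phase_index U H J (\<Psi> i) y) k in rhat J y k * (if j = 1 then cos \<phi> else sin \<phi>))"

lemma cplx_estimate:
  assumes "k \<in> {1..K}"
  shows "cplx (estimate \<Psi> G U H n b J y) k = of_real (rhat J y k)
    * cis (\<Psi> (pilot_index \<Psi> G n b y) k + U (phase_index U H J (\<Psi> (pilot_index \<Psi> G n b y)) y) k)"
proof -
  have "(k, 1) \<in> coords K" "(k, 2) \<in> coords K" using assms by (auto simp: coords_def)
  then show ?thesis by (simp add: cplx_def estimate_def Let_def complex_eq_iff)
qed

lemma measurable_bhat:
  assumes J: "J \<subseteq> I" and p: "p \<in> all_pairs K"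
  shows "(\<lambda>y. bhat J y p) \<in> borel_measurable (PiM I (\<lambda>_. vec_space K))"
proof -
  have "(\<lambda>y. triple (cplx (y m)) p) \<in> borel_measurable (PiM I (\<lambda>_. vec_space K))" if "m \<in> J" for m
  proof -
    have comp: "(\<lambda>y. y m) \<in> PiM I (\<lambda>_. vec_space K) \<rightarrow>\<^sub>M vec_space K"
      using measurable_component_singleton[of m I "\<lambda>_. vec_space K"] that J by auto
    show ?thesis by (rule measurable_compose[OF comp measurable_triple_vec]) (use all_pairs_valid[OF p] in auto)
  qed
  then show ?thesis unfolding bhat_def by (intro borel_measurable_divide borel_measurable_sum borel_measurable_const)
qed

lemma measurable_rhat_vec:
  assumes J: "J \<subseteq> I" and k: "k \<in> {1..K}"
  shows "(\<lambda>y. rhat J y k) \<in> borel_measurable (PiM I (\<lambda>_. vec_space K))"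
proof -
  have "(\<lambda>y. cplx (y m) k) \<in> borel_measurable (PiM I (\<lambda>_. vec_space K))" if "m \<in> J" for m
  proof -
    have comp: "(\<lambda>y. y m) \<in> PiM I (\<lambda>_. vec_space K) \<rightarrow>\<^sub>M vec_space K"
      using measurable_component_singleton[of m I "\<lambda>_. vec_space K"] that J by auto
    show ?thesis by (rule measurable_compose[OF comp measurable_cplx_vec[OF k]])
  qed
  then have "(\<lambda>y. phat J y k) \<in> borel_measurable (PiM I (\<lambda>_. vec_space K))" unfolding phat_def
    by (intro borel_measurable_divide borel_measurable_sum borel_measurable_const borel_measurable_power
        measurable_compose[OF _ borel_measurable_norm])
  then show ?thesis unfolding rhat_def by measurable
qed

lemma measurable_pilot_index:
  assumes I: "\<And>j. j < b ==> block n j \<subseteq> I"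
  shows "pilot_index \<Psi> G n b \<in> PiM I (\<lambda>_. vec_space K) \<rightarrow>\<^sub>M count_space UNIV"
proof -
  let ?M = "PiM I (\<lambda>_. vec_space K)"
  have far: "Measurable.pred ?M (\<lambda>y. 1 / 30 < cmod (sgn (bhat (block n j) y p) - cis (coboundary \<psi> p)))"
    if "j < b" "p \<in> all_pairs K" for j p \<psi>
  proof -
    have [measurable]: "(\<lambda>y. bhat (block n j) y p) \<in> borel_measurable ?M" by (rule measurable_bhat[OF I[OF that(1)] that(2)])
    have [measurable]: "(sgn :: complex => complex) \<in> borel_measurable borel" unfolding sgn_eq[abs_def] by measurable
    show ?thesis by measurable
  qed
  have card: "Measurable.pred ?M (\<lambda>y. 2 * card {j \<in> {..<b}. 1 / 30 < cmod (sgn (bhat (block n j) y p) - cis (coboundary \<psi> p))} < b)"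
    if p: "p \<in> all_pairs K" for p \<psi>
  proof -
    have card_eq: "card {j \<in> {..<b}. 1 / 30 < cmod (sgn (bhat (block n j) y p) - cis (coboundary \<psi> p))}
      = (\<Sum>j<b. if 1 / 30 < cmod (sgn (bhat (block n j) y p) - cis (coboundary \<psi> p)) then 1 else 0)" for y
      by (simp add: sum.If_cases Int_def)
    have m: "(\<lambda>y. \<Sum>j<b. if 1 / 30 < cmod (sgn (bhat (block n j) y p) - cis (coboundary \<psi> p)) then 1 else 0 :: nat)
        \<in> ?M \<rightarrow>\<^sub>M count_space UNIV" by (intro measurable_sum_nat measurable_If) (use far p in \<open>auto simp: pred_def\<close>)
    show ?thesis unfolding card_eq by (rule measurable_compose[OF m, of "\<lambda>c. 2 * c < b"]) simp
  qed
  show ?thesis unfolding pilot_index_def[abs_def] pilot_ok_def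
    by (intro measurable_Least pred_intros_logic pred_intros_finite finite_all_pairs card) auto
qed

lemma measurable_phase_index:
  assumes J: "J \<subseteq> I"
  shows "phase_index U H J \<psi> \<in> PiM I (\<lambda>_. vec_space K) \<rightarrow>\<^sub>M count_space UNIV"
proof -
  let ?M = "PiM I (\<lambda>_. vec_space K)"
  have sub: "p \<in> all_pairs K" if "p \<in> high_pairs K" for p using that by (auto simp: high_pairs_def all_pairs_def)
  have crit: "(\<lambda>y. phase_criterion J y \<psi> u) \<in> borel_measurable ?M" for u unfolding phase_criterion_def ampl_triple_def
    by (intro borel_measurable_sum borel_measurable_times borel_measurable_diff borel_measurable_const
        borel_measurable_uminus measurable_rhat_vec[OF J] measurable_compose[OF _ borel_measurable_Im]
        measurable_bhat[OF J] sub) (auto simp: high_pairs_def)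
  have le: "Measurable.pred ?M (\<lambda>y. phase_criterion J y \<psi> u \<le> phase_criterion J y \<psi> v)" for u v
    unfolding pred_def by (rule borel_measurable_le[OF crit crit])
  have fin: "Measurable.pred ?M (\<lambda>y. \<forall>j\<in>{..<H}. phase_criterion J y \<psi> u \<le> phase_criterion J y \<psi> (U j))" for u
    by (rule pred_intros_finite(3)) (auto intro: le)
  have eq: "(\<forall>j<H. P j) \<longleftrightarrow> (\<forall>j\<in>{..<H}. P j)" for P by auto
  show ?thesis unfolding phase_index_def[abs_def] eq by (intro measurable_Least pred_intros_logic fin) auto
qed

text \<open>The pilot index and the phase index take countably many values, so they can be held
  fixed one after the other; the second is measurable for each value of the first.\<close>

lemma measurable_estimate:
  assumes I: "\<And>q. q < b ==> block n q \<subseteq> I" and J: "J \<subseteq> I"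
  shows "estimate \<Psi> G U H n b J \<in> PiM I (\<lambda>_. vec_space K) \<rightarrow>\<^sub>M vec_space K"
proof -
  let ?M = "PiM I (\<lambda>_. vec_space K)"
  have c: "(\<lambda>y. rhat J y k * (if j = 1 then cos (\<Psi> (pilot_index \<Psi> G n b y) k + U (phase_index U H J (\<Psi> (pilot_index \<Psi> G n b y)) y) k)
      else sin (\<Psi> (pilot_index \<Psi> G n b y) k + U (phase_index U H J (\<Psi> (pilot_index \<Psi> G n b y)) y) k))) \<in> borel_measurable ?M"
    if k: "k \<in> {1..K}" for k and j :: nat
  proof (rule measurable_compose_countable[OF _ measurable_pilot_index[OF I]])
    fix i
    show "(\<lambda>y. rhat J y k * (if j = 1 then cos (\<Psi> i k + U (phase_index U H J (\<Psi> i) y) k)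
      else sin (\<Psi> i k + U (phase_index U H J (\<Psi> i) y) k))) \<in> borel_measurable ?M"
    proof (rule measurable_compose_countable[OF _ measurable_phase_index[OF J]])
      fix l
      show "(\<lambda>y. rhat J y k * (if j = 1 then cos (\<Psi> i k + U l k) else sin (\<Psi> i k + U l k))) \<in> borel_measurable ?M"
        by (intro borel_measurable_times measurable_rhat_vec[OF J k] borel_measurable_const)
    qed
  qed
  show ?thesis unfolding vec_space_def[of K, symmetric]
  proof -
    have "(\<lambda>y. \<lambda>p\<in>coords K. rhat J y (fst p) * (if snd p = 1
        then cos (\<Psi> (pilot_index \<Psi> G n b y) (fst p) + U (phase_index U H J (\<Psi> (pilot_index \<Psi> G n b y)) y) (fst p))
        else sin (\<Psi> (pilot_index \<Psi> G n b y) (fst p) + U (phase_index U H J (\<Psi> (pilot_index \<Psi> G n b y)) y) (fst p))))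
      \<in> ?M \<rightarrow>\<^sub>M (\<Pi>\<^sub>M i\<in>coords K. borel)" by (rule measurable_restrict, rule c) (auto simp: coords_def)
    then show "estimate \<Psi> G U H n b J \<in> ?M \<rightarrow>\<^sub>M vec_space K"
      unfolding estimate_def[abs_def] Let_def case_prod_unfold vec_space_def[of K] .
  qed
qed

lemma bhat_cong: "(\<And>m. m \<in> J ==> y m = y' m) ==> bhat J y p = bhat J y' p"
  unfolding bhat_def by (intro arg_cong2[where f="(/)"] sum.cong) auto

lemma phat_cong: "(\<And>m. m \<in> J ==> y m = y' m) ==> phat J y k = phat J y' k"
  unfolding phat_def by (intro arg_cong2[where f="(/)"] sum.cong) auto

lemma rhat_cong: "(\<And>m. m \<in> J ==> y m = y' m) ==> rhat J y k = rhat J y' k"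
  unfolding rhat_def by (subst phat_cong[of J y y']) auto

end

section \<open>Correctness of the pilot and risk of the estimator\<close>

context mra_truth
begin

lemma sgn_triple:
  assumes p: "p \<in> all_pairs K" and \<phi>: "\<And>k. k \<in> {1..K} ==> cplx \<theta> k = of_real (amplitude \<theta> k) * cis (\<phi> k)"
  shows "sgn (triple (cplx \<theta>) p) = cis (coboundary \<phi> p)"
proof -
  note v = all_pairs_valid[OF p]
  have ck: "0 < c_lo * \<kappa> K" using c_lo \<kappa>K_pos by simp
  have "0 < cmod (triple (cplx \<theta>) p)" using triple_norm_ge[OF p] zero_less_power[OF ck, of 3] by linarith
  then have a: "0 < ampl_triple (amplitude \<theta>) p" unfolding triple_norm .
  have "triple (cplx \<theta>) p = of_real (ampl_triple (amplitude \<theta>) p) * (cis (\<phi> (fst p)) * cis (\<phi> (snd p)) * cis (- \<phi> (fst p + snd p)))"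
    using v by (simp add: triple_def \<phi> ampl_triple_def cis_cnj)
  also have "... = of_real (ampl_triple (amplitude \<theta>) p) * cis (coboundary \<phi> p)" by (simp add: cis_mult coboundary_def)
  finally show ?thesis using a by (simp add: sgn_mult sgn_of_real sgn_eq norm_mult)
qed

text \<open>A grid point within \<open>1 / 180\<close> of the true phases has its coboundary within
  \<open>1 / 60\<close>, hence passes the vote, so an admissible index exists. For every pair some
  block then lies within \<open>1 / 30\<close> of the selected pilot and within
  \<open>1 / 60\<close> of the truth. Together this is \<open>1 / 20\<close>, the tolerance of
  \<open>phase_alignment\<close>.\<close>

lemma pilot_correct:
  assumes good: "\<And>p. p \<in> all_pairs K ==> 2 * card {j \<in> {..<b}. block_far n p j y} < b"
    and grid: "\<And>u. (\<forall>k\<in>{1..K}. \<bar>u k\<bar> \<le> pi) ==> \<exists>i<G. \<forall>k\<in>{1..K}. \<bar>\<Psi> i k - u k\<bar> \<le> 1 / 180"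
  defines "\<psi> \<equiv> \<Psi> (pilot_index \<Psi> G n b y)"
  shows "\<exists>\<alpha> u'. \<forall>k\<in>{1..K}. \<bar>u' k\<bar> \<le> 3 / 10 \<and> rotated \<alpha> \<theta> k = of_real (amplitude \<theta> k) * cis (\<psi> k + u' k)"
proof -
  define \<phi> where "\<phi> k = Arg (cplx \<theta> k)" for k
  have \<phi>: "cplx \<theta> k = of_real (amplitude \<theta> k) * cis (\<phi> k)" for k
    unfolding \<phi>_def cmod_cplx[symmetric] by (cases "cplx \<theta> k = 0") (auto simp: cis_Arg sgn_eq)
  have "\<forall>k\<in>{1..K}. \<bar>\<phi> k\<bar> \<le> pi" unfolding \<phi>_def using Arg_bounded by (auto simp: abs_le_iff less_imp_le minus_le_iff)
  then obtain i where i: "i < G" "\<forall>k\<in>{1..K}. \<bar>\<Psi> i k - \<phi> k\<bar> \<le> 1 / 180" using grid by blast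
  have i_ok: "pilot_ok K n b (\<Psi> i) (\<lambda>p j. bhat (block n j) y p)" unfolding pilot_ok_def
  proof
    fix p assume p: "p \<in> all_pairs K"
    note v = all_pairs_valid[OF p]
    have "\<bar>coboundary (\<Psi> i) p - coboundary \<phi> p\<bar> \<le> 1 / 60"
    proof -
      have "\<bar>\<Psi> i (fst p) - \<phi> (fst p)\<bar> \<le> 1 / 180" "\<bar>\<Psi> i (snd p) - \<phi> (snd p)\<bar> \<le> 1 / 180"
        "\<bar>\<Psi> i (fst p + snd p) - \<phi> (fst p + snd p)\<bar> \<le> 1 / 180" using i(2) v by auto
      then show ?thesis unfolding coboundary_def by linarith
    qed
    then have c: "cmod (cis (coboundary (\<Psi> i) p) - cis (coboundary \<phi> p)) \<le> 1 / 60" using cmod_cis_diff_le order_trans by blast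
    have "{j \<in> {..<b}. 1 / 30 < cmod (sgn (bhat (block n j) y p) - cis (coboundary (\<Psi> i) p))} \<subseteq> {j \<in> {..<b}. block_far n p j y}"
    proof safe
      fix j assume f: "1 / 30 < cmod (sgn (bhat (block n j) y p) - cis (coboundary (\<Psi> i) p))"
      have "cmod (sgn (bhat (block n j) y p) - cis (coboundary (\<Psi> i) p))
          \<le> cmod (sgn (bhat (block n j) y p) - cis (coboundary \<phi> p)) + cmod (cis (coboundary (\<Psi> i) p) - cis (coboundary \<phi> p))"
        using norm_triangle_ineq4[of "sgn (bhat (block n j) y p) - cis (coboundary \<phi> p)"
            "cis (coboundary (\<Psi> i) p) - cis (coboundary \<phi> p)"] by simp
      then show "block_far n p j y" using c f unfolding block_far_def sgn_triple[OF p \<phi>] by linarith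
    qed
    then have "card {j \<in> {..<b}. 1 / 30 < cmod (sgn (bhat (block n j) y p) - cis (coboundary (\<Psi> i) p))}
        \<le> card {j \<in> {..<b}. block_far n p j y}" by (intro card_mono) auto
    then show "2 * card {j \<in> {..<b}. 1 / 30 < cmod (sgn (bhat (block n j) y p) - cis (coboundary (\<Psi> i) p))} < b"
      using good[OF p] by linarith
  qed
  have ok: "pilot_ok K n b \<psi> (\<lambda>p j. bhat (block n j) y p)" unfolding \<psi>_def pilot_index_def
    using LeastI[of "\<lambda>i. i < G \<and> pilot_ok K n b (\<Psi> i) (\<lambda>p j. bhat (block n j) y p)" i] i(1) i_ok by blast
  define d where "d k = \<phi> k - \<psi> k" for k
  have "\<exists>\<alpha> u'. \<forall>k\<in>{1..K}. \<bar>u' k\<bar> \<le> 3 / 10 \<and> cis (u' k) = cis (d k + real k * \<alpha>)"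
  proof (rule phase_alignment)
    fix k l :: nat assume kl: "1 \<le> k" "1 \<le> l" "k + l \<le> K"
    then have p: "(k, l) \<in> all_pairs K" by (simp add: all_pairs_def)
    obtain j where j: "j < b" "\<not> 1 / 30 < cmod (sgn (bhat (block n j) y (k, l)) - cis (coboundary \<psi> (k, l)))"
      "\<not> block_far n (k, l) j y" using majority_pigeonhole[OF ok[unfolded pilot_ok_def, rule_format, OF p] good[OF p]] by blast
    let ?z = "sgn (bhat (block n j) y (k, l))" and ?a = "cis (coboundary \<psi> (k, l))" and ?b = "cis (coboundary \<phi> (k, l))"
    have "cmod (?b - ?a) \<le> cmod (?z - ?a) + cmod (?z - ?b)" using norm_triangle_ineq4[of "?z - ?a" "?z - ?b"] by simp
    then have ba: "cmod (?b - ?a) \<le> 1 / 20" using j(2,3) unfolding block_far_def sgn_triple[OF p \<phi>] by linarith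
    have e: "coboundary \<phi> (k, l) = (d k + d l - d (k + l)) + coboundary \<psi> (k, l)" by (simp add: d_def coboundary_def)
    have "?b - ?a = (cis (d k + d l - d (k + l)) - 1) * ?a" unfolding e cis_mult[symmetric] by (simp add: algebra_simps)
    then have "cmod (?b - ?a) = cmod (cis (d k + d l - d (k + l)) - 1)" by (simp add: norm_mult)
    then show "cmod (cis (d k + d l - d (k + l)) - 1) \<le> 1 / 20" using ba by simp
  qed
  then obtain \<alpha> u' where u': "\<And>k. k \<in> {1..K} ==> \<bar>u' k\<bar> \<le> 3 / 10 \<and> cis (u' k) = cis (d k + real k * \<alpha>)" by blast
  have "rotated \<alpha> \<theta> k = of_real (amplitude \<theta> k) * cis (\<psi> k + u' k)" if "k \<in> {1..K}" for k
  proof -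
    have e: "\<psi> k + (d k + real k * \<alpha>) = real k * \<alpha> + \<phi> k" by (simp add: d_def)
    have "cis (\<psi> k + u' k) = cis (\<psi> k) * cis (d k + real k * \<alpha>)" using u'[OF that] by (simp add: cis_mult[symmetric])
    also have "... = cis (real k * \<alpha>) * cis (\<phi> k)" unfolding cis_mult e ..
    finally show ?thesis by (simp add: rotated_def \<phi>[of k] mult_ac)
  qed
  then show ?thesis using u' by blast
qed

end

context mra_truth
begin

text \<open>Clamped and true amplitudes are at most \<open>c_hi * \<kappa> k\<close> whatever the
  data. This is the price of a failed pilot.\<close>

lemma loss_bound_any: "loss K (estimate \<Psi> G U H n b J y) \<theta> \<le> 4 * c_hi^2 * (S * (real K * (\<kappa> K)^2))"
proof -
  have "loss K (estimate \<Psi> G U H n b J y) \<theta>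
      \<le> (\<Sum>k=1..K. (cmod (cplx (estimate \<Psi> G U H n b J y) k - rotated 0 \<theta> k))^2)" by (rule loss_le)
  also have "... \<le> (\<Sum>k=1..K. 4 * c_hi^2 * (\<kappa> k)^2)"
  proof (rule sum_mono)
    fix k assume k: "k \<in> {1..K}"
    have pos: "0 < c_lo * \<kappa> k" using \<kappa>_pos[of k] k c_lo by simp
    have "cmod (cplx (estimate \<Psi> G U H n b J y) k - rotated 0 \<theta> k) \<le> \<bar>rhat J y k\<bar> + amplitude \<theta> k"
      by (rule order_trans[OF norm_triangle_ineq4]) (simp add: cplx_estimate[OF k] norm_mult cmod_cplx)
    also have "... \<le> 2 * (c_hi * \<kappa> k)" using rhat_bounds[of k J y] \<theta>[OF k] k pos by auto
    finally have "(cmod (cplx (estimate \<Psi> G U H n b J y) k - rotated 0 \<theta> k))^2 \<le> (2 * (c_hi * \<kappa> k))^2" by (rule power_mono) simp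
    then show "(cmod (cplx (estimate \<Psi> G U H n b J y) k - rotated 0 \<theta> k))^2 \<le> 4 * c_hi^2 * (\<kappa> k)^2"
      by (simp add: power_mult_distrib)
  qed
  also have "... = 4 * c_hi^2 * (\<Sum>k=1..K. (\<kappa> k)^2)" by (simp add: sum_distrib_left)
  also have "... \<le> 4 * c_hi^2 * (S * (real K * (\<kappa> K)^2))" using \<kappa>_sum by (intro mult_left_mono) (auto simp: mult.assoc)
  finally show ?thesis .
qed

definition refined_bound :: "real => nat set => (nat => real) => (nat => rvec) => real" where
  "refined_bound h J \<psi> y = 3 * (\<Sum>k=1..K. (rhat J y k - amplitude \<theta> k)^2)
      + 3 * c_hi^2 * (32 * gap_const / c_lo ^ 6 * (gap_const * (\<Sum>j=1..K. (score_error J y \<psi> \<theta> j)^2 / (\<kappa> j)^2)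
          + 2 * (\<Sum>p\<in>high_pairs K. (ampl_triple (amplitude \<theta>) p - ampl_triple (rhat J y) p)^2)
          + 18 * c_hi ^ 6 * (real K)^2 * h^2) + real K * h^2)"

lemma refined_bound_cong:
  assumes "\<And>m. m \<in> J ==> y m = y' m"
  shows "refined_bound h J \<psi> y = refined_bound h J \<psi> y'"
  unfolding refined_bound_def score_error_def ampl_triple_def
    rhat_cong[OF assms, of J "\<lambda>m. m", simplified] bhat_cong[OF assms, of J "\<lambda>m. m", simplified] ..

lemma loss_bound_good:
  assumes good: "\<And>p. p \<in> all_pairs K ==> 2 * card {q \<in> {..<b}. block_far n p q y} < b"
    and gridP: "\<And>u. (\<forall>k\<in>{1..K}. \<bar>u k\<bar> \<le> pi) ==> \<exists>i<G. \<forall>k\<in>{1..K}. \<bar>\<Psi> i k - u k\<bar> \<le> 1 / 180"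
    and gridU: "\<And>u. (\<forall>k\<in>{1..K}. \<bar>u k\<bar> \<le> 3 / 10) ==> \<exists>i<H. \<forall>k\<in>{1..K}. \<bar>U i k - u k\<bar> \<le> h"
    and boundU: "\<And>i k. i < H ==> k \<in> {1..K} ==> \<bar>U i k\<bar> \<le> 3 / 10"
  shows "loss K (estimate \<Psi> G U H n b J y) \<theta> \<le> refined_bound h J (\<Psi> (pilot_index \<Psi> G n b y)) y"
proof -
  define \<psi> where "\<psi> = \<Psi> (pilot_index \<Psi> G n b y)"
  obtain \<alpha> u' where u': "\<And>k. k \<in> {1..K} ==> \<bar>u' k\<bar> \<le> 3 / 10"
    "\<And>k. k \<in> {1..K} ==> rotated \<alpha> \<theta> k = of_real (amplitude \<theta> k) * cis (\<psi> k + u' k)"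
    using pilot_correct[OF good gridP] unfolding \<psi>_def by blast
  obtain i0 where i0: "i0 < H" "\<And>k. k \<in> {1..K} ==> \<bar>U i0 k - u' k\<bar> \<le> h" using gridU u'(1) by blast
  define l where "l = phase_index U H J \<psi> y"
  have ex: "\<exists>i. i < H \<and> (\<forall>j<H. phase_criterion J y \<psi> (U i) \<le> phase_criterion J y \<psi> (U j))"
  proof -
    let ?f = "\<lambda>i. phase_criterion J y \<psi> (U i)"
    have ne: "finite {..<H}" "{..<H} \<noteq> {}" using i0(1) by auto
    have "Min (?f ` {..<H}) \<in> ?f ` {..<H}" using ne by (intro Min_in) auto
    then obtain i where "i < H" "?f i = Min (?f ` {..<H})" by auto
    then show ?thesis using ne by (intro exI[of _ i]) auto
  qed
  have l: "l < H \<and> (\<forall>j<H. phase_criterion J y \<psi> (U l) \<le> phase_criterion J y \<psi> (U j))"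
    unfolding l_def phase_index_def by (rule LeastI_ex[OF ex])
  have "\<exists>t. (\<Sum>k=1..K. (cmod (of_real (rhat J y k) * cis (\<psi> k + U l k) - rotated t \<theta> k))^2) \<le> refined_bound h J \<psi> y"
    unfolding refined_bound_def by (rule refinement_error[OF \<theta> u'(2) u'(1)]) (use l i0 boundU in auto)
  then obtain t where t: "(\<Sum>k=1..K. (cmod (of_real (rhat J y k) * cis (\<psi> k + U l k) - rotated t \<theta> k))^2) \<le> refined_bound h J \<psi> y"
    by blast
  have "loss K (estimate \<Psi> G U H n b J y) \<theta> \<le> (\<Sum>k=1..K. (cmod (cplx (estimate \<Psi> G U H n b J y) k - rotated t \<theta> k))^2)"
    by (rule loss_le)
  also have "... = (\<Sum>k=1..K. (cmod (of_real (rhat J y k) * cis (\<psi> k + U l k) - rotated t \<theta> k))^2)"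
    by (intro sum.cong refl) (simp add: cplx_estimate \<psi>_def l_def)
  also note t
  finally show ?thesis unfolding \<psi>_def .
qed

text \<open>The sample is split into the pilot observations \<open>I\<close> and the rest
  \<open>J\<close>, integrated one after the other. With the former held fixed, the pilot phases are
  constants and the refinement bound applies; on the failure set the crude bound is multiplied by
  its probability.\<close>

lemma estimate_risk:
  fixes n b N :: nat
  assumes n: "1 \<le> n" and n_ge: "460800 * moment_const c_hi c0 S * \<sigma> ^ 6 / (c_lo * \<kappa> K) ^ 6 \<le> real n"
    and bn: "b * n < N" and mesh: "real K * h^2 \<le> \<sigma> ^ 6 / real (N - b * n)"
    and gridP: "\<And>u. (\<forall>k\<in>{1..K}. \<bar>u k\<bar> \<le> pi) ==> \<exists>i<G. \<forall>k\<in>{1..K}. \<bar>\<Psi> i k - u k\<bar> \<le> 1 / 180"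
    and gridU: "\<And>u. (\<forall>k\<in>{1..K}. \<bar>u k\<bar> \<le> 3 / 10) ==> \<exists>i<H. \<forall>k\<in>{1..K}. \<bar>U i k - u k\<bar> \<le> h"
    and boundU: "\<And>i k. i < H ==> k \<in> {1..K} ==> \<bar>U i k\<bar> \<le> 3 / 10"
  shows "risk K N \<sigma> (estimate \<Psi> G U H n b {b * n + 1..N}) \<theta>
    \<le> ennreal (refine_const c_lo c_hi c0 S * (\<sigma> ^ 6 / (real (N - b * n) * (\<kappa> K) ^ 4))
        + 4 * c_hi^2 * (S * (real K * (\<kappa> K)^2)) * ((real K)^2 * (1 / 2) ^ b))"
proof -
  define I where "I = {1..b * n}"
  define J where "J = {b * n + 1..N}"
  define e where "e = estimate \<Psi> G U H n b J"
  let ?O = "\<lambda>_ :: nat. obs_law K \<sigma> \<theta>"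
  let ?PI = "PiM I ?O" and ?PJ = "PiM J ?O"
  interpret O: prob_space "obs_law K \<sigma> \<theta>" by (rule prob_space_obs_law)
  interpret pp: product_sigma_finite ?O by standard
  interpret PI: prob_space ?PI by (intro prob_space_PiM prob_space_obs_law)
  interpret PJ: prob_space ?PJ by (intro prob_space_PiM prob_space_obs_law)
  have IJ: "I \<inter> J = {}" "finite I" "finite J" "{1..N} = I \<union> J" "J \<noteq> {}" "card J = N - b * n" using bn by (auto simp: I_def J_def)
  define C where "C = 4 * c_hi^2 * (S * (real K * (\<kappa> K)^2))"
  define r where "r = refine_const c_lo c_hi c0 S * (\<sigma> ^ 6 / (real (N - b * n) * (\<kappa> K) ^ 4))"
  have C0: "0 \<le> C" unfolding C_def using S_ge_1 by simp
  have f: "(\<lambda>y. ennreal (loss K (e y) \<theta>)) \<in> borel_measurable (PiM (I \<union> J) ?O)"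
  proof -
    have "e \<in> PiM (I \<union> J) (\<lambda>_. vec_space K) \<rightarrow>\<^sub>M vec_space K"
      unfolding e_def by (rule measurable_estimate) (use block_subset I_def in auto)
    from measurable_compose[OF measurable_compose[OF this measurable_loss] measurable_ennreal]
    have "(\<lambda>y. ennreal (loss K (e y) \<theta>)) \<in> borel_measurable (PiM (I \<union> J) (\<lambda>_. vec_space K))" .
    moreover have "sets (PiM (I \<union> J) (\<lambda>_. vec_space K)) = sets (PiM (I \<union> J) ?O)"
      by (intro sets_PiM_cong) (auto simp: sets_obs_law)
    ultimately show ?thesis using measurable_cong_sets by blast
  qed
  define bad where "bad = {x \<in> space ?PI. \<exists>p\<in>all_pairs K. b \<le> 2 * card {j \<in> {..<b}. block_far n p j x}}"
  have bad: "bad \<in> sets ?PI" "emeasure ?PI bad \<le> ennreal ((real K)^2 * (1 / 2) ^ b)"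
    unfolding bad_def I_def by (rule pilot_failure[OF n n_ge])+
  have inner: "(\<integral>\<^sup>+y. ennreal (loss K (e (merge I J (x, y))) \<theta>) \<partial>?PJ) \<le> ennreal r + ennreal C * indicator bad x"
    if x: "x \<in> space ?PI" for x
  proof (cases "x \<in> bad")
    case True
    have "(\<integral>\<^sup>+y. ennreal (loss K (e (merge I J (x, y))) \<theta>) \<partial>?PJ) \<le> (\<integral>\<^sup>+y. ennreal C \<partial>?PJ)"
      unfolding e_def C_def by (intro nn_integral_mono ennreal_leI loss_bound_any)
    also have "... = ennreal C" by (simp add: PJ.emeasure_space_1)
    also have "... \<le> ennreal r + ennreal C" by simp
    finally show ?thesis using True by simp
  next
    case False
    have onI: "merge I J (x, y) m = x m" if "m \<in> I" for y m using that by (simp add: merge_def)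
    have onJ: "merge I J (x, y) m = y m" if "m \<in> J" for y m using that IJ(1) by (auto simp: merge_def)
    have bx: "bhat (block n j) (merge I J (x, y)) p = bhat (block n j) x p" if "j < b" for y j p
      by (rule bhat_cong) (use onI block_subset[OF that, of n] I_def in auto)
    have far: "block_far n p j (merge I J (x, y)) = block_far n p j x" if "j < b" for y j p unfolding block_far_def bx[OF that] ..
    define \<psi> where "\<psi> = \<Psi> (pilot_index \<Psi> G n b x)"
    have set1: "{j \<in> {..<b}. 1 / 30 < cmod (sgn (bhat (block n j) (merge I J (x, y)) p) - w)}
      = {j \<in> {..<b}. 1 / 30 < cmod (sgn (bhat (block n j) x p) - w)}" for y p w
      by (intro Collect_cong conj_cong refl) (simp add: bx)
    \<comment> \<open>The pilot reads only the coordinates in \<open>I\<close> of the merged sample,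
      so it is constant in the inner integral.\<close>
    have pil: "pilot_index \<Psi> G n b (merge I J (x, y)) = pilot_index \<Psi> G n b x" for y
      unfolding pilot_index_def pilot_ok_def set1 ..
    have "loss K (e (merge I J (x, y))) \<theta> \<le> refined_bound h J \<psi> y" for y
    proof -
      have g: "2 * card {j \<in> {..<b}. block_far n p j (merge I J (x, y))} < b" if "p \<in> all_pairs K" for p
      proof -
        have "{j \<in> {..<b}. block_far n p j (merge I J (x, y))} = {j \<in> {..<b}. block_far n p j x}"
          by (intro Collect_cong conj_cong refl) (simp add: far)
        then show ?thesis using False x that unfolding bad_def by (auto simp: not_le)
      qed
      have "loss K (e (merge I J (x, y))) \<theta> \<le> refined_bound h J (\<Psi> (pilot_index \<Psi> G n b (merge I J (x, y)))) (merge I J (x, y))"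
        unfolding e_def by (rule loss_bound_good[OF g gridP gridU boundU])
      also have "... = refined_bound h J \<psi> y" unfolding pil \<psi>_def by (rule refined_bound_cong) (rule onJ)
      finally show ?thesis .
    qed
    then have "(\<integral>\<^sup>+y. ennreal (loss K (e (merge I J (x, y))) \<theta>) \<partial>?PJ) \<le> (\<integral>\<^sup>+y. ennreal (refined_bound h J \<psi> y) \<partial>?PJ)"
      by (intro nn_integral_mono ennreal_leI)
    also have "... \<le> ennreal r" unfolding refined_bound_def r_def IJ(6)[symmetric]
      by (rule refinement_risk[OF IJ(3) IJ(5)]) (use mesh IJ(6) in simp)
    also have "... \<le> ennreal r + ennreal C * indicator bad x" by simp
    finally show ?thesis .
  qed
  have "risk K N \<sigma> e \<theta> = (\<integral>\<^sup>+y. ennreal (loss K (e y) \<theta>) \<partial>PiM (I \<union> J) ?O)" unfolding risk_def sample_law_def IJ(4) ..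
  also have "... = (\<integral>\<^sup>+x. \<integral>\<^sup>+y. ennreal (loss K (e (merge I J (x, y))) \<theta>) \<partial>?PJ \<partial>?PI)"
    by (rule pp.product_nn_integral_fold[OF IJ(1-3) f])
  also have "... \<le> (\<integral>\<^sup>+x. ennreal r + ennreal C * indicator bad x \<partial>?PI)" by (rule nn_integral_mono) (rule inner)
  also have "... = ennreal r + ennreal C * emeasure ?PI bad"
    using bad(1) by (subst nn_integral_add) (auto simp: PI.emeasure_space_1 nn_integral_cmult_indicator)
  also have "... \<le> ennreal r + ennreal C * ennreal ((real K)^2 * (1 / 2) ^ b)" by (intro add_left_mono mult_left_mono bad(2)) simp
  also have "... = ennreal (r + C * ((real K)^2 * (1 / 2) ^ b))"
  proof -
    have "0 \<le> refine_const c_lo c_hi c0 S"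
      unfolding refine_const_def using power_const_nonneg moment_const_nonneg S_ge_1 c0 c_lo by auto
    then have "0 \<le> r" unfolding r_def by simp
    then show ?thesis using C0 by (simp add: ennreal_mult' ennreal_plus)
  qed
  finally show ?thesis unfolding e_def J_def r_def C_def .
qed

end

section \<open>Choice of the block sizes and the upper rate\<close>

context mra_scales
begin

lemma minimax_upper:
  fixes n b N :: nat
  assumes n: "1 \<le> n" and n_ge: "460800 * moment_const c_hi c0 S * \<sigma> ^ 6 / (c_lo * \<kappa> K) ^ 6 \<le> real n"
    and bn: "b * n < N"
    and \<Theta>: "\<And>\<theta> k. \<theta> \<in> \<Theta> ==> k \<in> {1..K} ==> c_lo * \<kappa> k \<le> amplitude \<theta> k \<and> amplitude \<theta> k \<le> c_hi * \<kappa> k"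
  shows "minimax_risk K N \<sigma> \<Theta> \<le> ennreal (refine_const c_lo c_hi c0 S * (\<sigma> ^ 6 / (real (N - b * n) * (\<kappa> K) ^ 4))
        + 4 * c_hi^2 * (S * (real K * (\<kappa> K)^2)) * ((real K)^2 * (1 / 2) ^ b))"
proof -
  \<comment> \<open>The mesh contribution \<open>real K * h^2\<close> becomes exactly
    \<open>\<sigma> ^ 6\<close> divided by the number of observations left for the
    refinement.\<close>
  define h where "h = sqrt (\<sigma> ^ 6 / real (N - b * n) / real K)"
  have pos: "0 < \<sigma> ^ 6 / real (N - b * n) / real K"
  proof -
    have "0 < real (N - b * n)" using bn by (simp only: of_nat_0_less_iff zero_less_diff)
    then show ?thesis using \<sigma> K by (intro divide_pos_pos zero_less_power) linarith+
  qed
  then have h: "0 < h" unfolding h_def by simp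
  have mesh: "real K * h^2 \<le> \<sigma> ^ 6 / real (N - b * n)" using pos K unfolding h_def by simp
  obtain \<Psi> :: "nat => nat => real" and G where P: "\<And>u. (\<forall>k\<in>{1..K}. \<bar>u k\<bar> \<le> pi) ==> \<exists>i<G. \<forall>k\<in>{1..K}. \<bar>\<Psi> i k - u k\<bar> \<le> 1 / 180"
    using grid_exists[of pi "1 / 180" K] pi_gt_zero by auto
  obtain U :: "nat => nat => real" and H where U: "\<And>i k. i < H ==> k \<in> {1..K} ==> \<bar>U i k\<bar> \<le> 3 / 10"
    "\<And>u. (\<forall>k\<in>{1..K}. \<bar>u k\<bar> \<le> 3 / 10) ==> \<exists>i<H. \<forall>k\<in>{1..K}. \<bar>U i k - u k\<bar> \<le> h"
  proof -
    have "(0 :: real) < 3 / 10" by simp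
    from grid_exists[OF this h, of K] show ?thesis using that by blast
  qed
  let ?e = "estimate \<Psi> G U H n b {b * n + 1..N}"
  have mem: "?e \<in> estimators K N" unfolding estimators_def
  proof (rule measurable_estimate)
    show "block n j \<subseteq> {1..N}" if "j < b" for j using block_subset[OF that, of n] bn by auto
  qed auto
  have "minimax_risk K N \<sigma> \<Theta> \<le> (SUP \<theta>\<in>\<Theta>. risk K N \<sigma> ?e \<theta>)" unfolding minimax_risk_def by (rule INF_lower[OF mem])
  also have "... \<le> ennreal (refine_const c_lo c_hi c0 S * (\<sigma> ^ 6 / (real (N - b * n) * (\<kappa> K) ^ 4))
        + 4 * c_hi^2 * (S * (real K * (\<kappa> K)^2)) * ((real K)^2 * (1 / 2) ^ b))"
  proof (rule SUP_least)
    fix \<theta> assume "\<theta> \<in> \<Theta>"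
    then interpret mra_truth K \<kappa> c_lo c_hi c0 S \<sigma> \<theta> by unfold_locales (rule \<Theta>)
    show "risk K N \<sigma> ?e \<theta> \<le> ennreal (refine_const c_lo c_hi c0 S * (\<sigma> ^ 6 / (real (N - b * n) * (\<kappa> K) ^ 4))
        + 4 * c_hi^2 * (S * (real K * (\<kappa> K)^2)) * ((real K)^2 * (1 / 2) ^ b))"
      by (rule estimate_risk[OF n n_ge bn mesh P U(2) U(1)])
  qed
  finally show ?thesis .
qed

end

context mra_scales
begin

text \<open>The first entry is what Chebyshev's inequality requires of a block. The second keeps the
  real block length at least 1, so that rounding up at most doubles it.\<close>

definition block_const :: real where "block_const = max (460800 * moment_const c_hi c0 S / c_lo ^ 6) (1 / c0 ^ 3)"

text \<open>The failure probability decays at rate \<open>ln 2 / (4 * block_const)\<close> in the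
  sample size measured in units of \<open>\<sigma> ^ 6 / (\<kappa> K) ^ 6\<close>. This threshold
  makes the exponent at least \<open>6 * ln (real K)\<close>.\<close>

definition upper_threshold :: real where "upper_threshold = 24 * block_const / ln 2"

definition upper_const :: real where "upper_const = 2 * refine_const c_lo c_hi c0 S + 64 * c_hi^2 * S * block_const / ln 2"

lemma block_const_pos: "0 < block_const"
  unfolding block_const_def using c0 by (simp add: less_max_iff_disj)

lemma refine_const_nonneg: "0 \<le> refine_const c_lo c_hi c0 S"
proof -
  have "0 \<le> moment_const c_hi c0 S"
    unfolding moment_const_def Let_def using c0 S_ge_1 by (intro add_nonneg_nonneg mult_nonneg_nonneg) auto
  then show ?thesis unfolding refine_const_def power_const_def using S_ge_1 c0 c_lo by auto
qed

lemma upper_const_pos: "0 < upper_const"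
  unfolding upper_const_def using refine_const_nonneg c_lo c_hi S_ge_1 block_const_pos
  by (intro add_nonneg_pos mult_nonneg_nonneg divide_pos_pos mult_pos_pos) auto

text \<open>Blocks have length proportional to \<open>\<sigma> ^ 6 / (\<kappa> K) ^ 6\<close>, and
  at most half of the sample goes to the pilot. One half of the exponent in the failure probability
  outweighs \<open>real K ^ 3\<close>; the other half is bounded by a multiple of
  \<open>1 / t\<close>, which has the order of the rate.\<close>

lemma minimax_upper_rate:
  assumes N: "1 \<le> N" and large: "upper_threshold * (\<sigma> ^ 6 / (\<kappa> K) ^ 6) * ln (real K) \<le> real N"
    and \<Theta>: "\<And>\<theta> k. \<theta> \<in> \<Theta> ==> k \<in> {1..K} ==> c_lo * \<kappa> k \<le> amplitude \<theta> k \<and> amplitude \<theta> k \<le> c_hi * \<kappa> k"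
  shows "minimax_risk K N \<sigma> \<Theta> \<le> ennreal (upper_const * (\<sigma> ^ 6 / (real N * (\<kappa> K) ^ 4)))"
proof -
  define T where "T = \<sigma> ^ 6 / (\<kappa> K) ^ 6"
  have \<kappa>K: "0 < \<kappa> K" "\<kappa> K \<le> 1" using \<kappa>K_pos \<kappa>_le_1[of K] K by auto
  have T0: "0 < T" unfolding T_def using \<sigma> \<kappa>K by simp
  have T: "c0 ^ 3 \<le> T"
  proof -
    have "c0 ^ 3 \<le> (\<sigma>^2) ^ 3" using c0_le_noise c0 by (intro power_mono) auto
    also have "... = \<sigma> ^ 6" by simp
    also have "... \<le> T" unfolding T_def using \<sigma> \<kappa>K by (simp add: pos_le_divide_eq power_le_one mult_left_le)
    finally show ?thesis .
  qed
  define n where "n = nat \<lceil>block_const * T\<rceil>"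
  have bT: "1 \<le> block_const * T"
  proof -
    have "1 = 1 / c0 ^ 3 * c0 ^ 3" using c0 by simp
    also have "... \<le> block_const * T" using T c0 block_const_pos by (intro mult_mono) (auto simp: block_const_def)
    finally show ?thesis .
  qed
  have n_lo: "block_const * T \<le> real n" unfolding n_def using bT by linarith
  have n_hi: "real n \<le> 2 * (block_const * T)" unfolding n_def using bT ceiling_correct[of "block_const * T"] by linarith
  have n1: "1 \<le> n" using n_lo bT by linarith
  have n_ge: "460800 * moment_const c_hi c0 S * \<sigma> ^ 6 / (c_lo * \<kappa> K) ^ 6 \<le> real n"
  proof -
    have "460800 * moment_const c_hi c0 S * \<sigma> ^ 6 / (c_lo * \<kappa> K) ^ 6 = 460800 * moment_const c_hi c0 S / c_lo ^ 6 * T"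
      by (simp add: T_def power_mult_distrib)
    also have "... \<le> block_const * T" unfolding block_const_def using T0 by (intro mult_right_mono) auto
    finally show ?thesis using n_lo by linarith
  qed
  \<comment> \<open>The pilot takes at most half of the observations; the refinement then loses no
    more than a factor 2.\<close>
  define b where "b = N div (2 * n)"
  have "2 * n * b \<le> N" unfolding b_def by simp
  then have bn2: "2 * (b * n) \<le> N" by (simp add: mult_ac)
  then have bn: "b * n < N" using N by linarith
  have half: "real N / 2 \<le> real (N - b * n)"
  proof -
    have "2 * real (b * n) \<le> real N" using of_nat_mono[OF bn2, where 'a=real] by simp
    moreover have "real (N - b * n) = real N - real (b * n)" using bn by (intro of_nat_diff) simp
    ultimately show ?thesis by linarith
  qed
  define t where "t = real N / T"
  have t0: "0 < t" unfolding t_def using N T0 by simp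
  have b_ge: "t / (4 * block_const) - 1 \<le> real b"
  proof -
    have "N < 2 * n + 2 * n * (N div (2 * n))" by (rule dividend_less_times_div) (use n1 in simp)
    then have "real N < real (2 * n + 2 * n * b)" unfolding b_def by (simp only: of_nat_less_iff)
    then have "real N < 2 * real n * (real b + 1)" by (simp add: algebra_simps)
    also have "... \<le> 2 * (2 * (block_const * T)) * (real b + 1)" by (intro mult_right_mono) (use n_hi in linarith)+
    finally show ?thesis unfolding t_def using T0 block_const_pos by (simp add: field_simps)
  qed
  define lam where "lam = ln 2 / (4 * block_const)"
  have lam: "0 < lam" unfolding lam_def using block_const_pos by simp
  \<comment> \<open>Rounding down in \<open>b\<close> loses at most one block, hence the factor
    2.\<close>
  have pow: "(1 / 2 :: real) ^ b \<le> 2 * exp (- (lam * t))"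
  proof -
    have "(1 / 2 :: real) ^ b = exp (- (ln 2 * real b))"
      by (simp add: exp_minus power_divide inverse_eq_divide exp_of_nat2_mult[symmetric] mult.commute[of "ln 2"] exp_of_nat_mult)
    also have "... \<le> exp (ln 2 - lam * t)"
    proof -
      have "ln 2 * (t / (4 * block_const) - 1) \<le> ln 2 * real b" by (intro mult_left_mono b_ge) simp
      then show ?thesis unfolding lam_def by (simp add: algebra_simps)
    qed
    also have "... = 2 * exp (- (lam * t))" by (simp add: exp_diff exp_minus field_simps)
    finally show ?thesis .
  qed
  have Kp: "0 < real K" using K by simp
  have "6 * ln (real K) \<le> lam * t"
  proof -
    have "upper_threshold * ln (real K) \<le> t"
      using large T0 unfolding t_def T_def[symmetric] by (simp add: pos_le_divide_eq mult_ac)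
    then have "lam * (upper_threshold * ln (real K)) \<le> lam * t" using lam by (intro mult_left_mono) auto
    moreover have "lam * upper_threshold = 6" unfolding lam_def upper_threshold_def using block_const_pos by simp
    ultimately show ?thesis by (simp add: mult.assoc[symmetric])
  qed
  \<comment> \<open>Two powers of \<open>K\<close> come from the union over pairs and one from the
    crude bound on the loss.\<close>
  then have K3: "real K ^ 3 * exp (- (lam * t / 2)) \<le> 1"
  proof -
    assume a: "6 * ln (real K) \<le> lam * t"
    have e3: "real K ^ 3 = exp (3 * ln (real K))" using Kp by (simp add: exp_of_nat_mult[of 3 "ln (real K)", simplified])
    have "real K ^ 3 * exp (- (lam * t / 2)) = exp (3 * ln (real K) + - (lam * t / 2))" by (simp only: e3 exp_add)
    also have "... \<le> exp 0" using a by (subst exp_le_cancel_iff) simp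
    finally show ?thesis by simp
  qed
  have t_exp: "t * exp (- (lam * t / 2)) \<le> 2 / lam"
  proof -
    have "lam * t / 2 \<le> exp (lam * t / 2)" using exp_ge_add_one_self[of "lam * t / 2"] by linarith
    then have "lam * t / 2 * exp (- (lam * t / 2)) \<le> exp (lam * t / 2) * exp (- (lam * t / 2))" by (rule mult_right_mono) simp
    then have "lam * t / 2 * exp (- (lam * t / 2)) \<le> 1" by (simp add: exp_minus)
    then show ?thesis using lam by (simp add: field_simps)
  qed
  have rate: "\<sigma> ^ 6 / (real N * (\<kappa> K) ^ 4) = (\<kappa> K)^2 / t"
    unfolding t_def T_def using \<kappa>K N \<sigma> by (simp add: field_simps eval_nat_numeral)
  have fail: "real K ^ 3 * (1 / 2) ^ b \<le> 4 / lam / t"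
  proof -
    have "real K ^ 3 * (1 / 2) ^ b \<le> real K ^ 3 * (2 * exp (- (lam * t)))" by (intro mult_left_mono pow) simp
    also have "exp (- (lam * t)) = exp (- (lam * t / 2)) * exp (- (lam * t / 2))" by (simp add: exp_add[symmetric])
    also have "real K ^ 3 * (2 * (exp (- (lam * t / 2)) * exp (- (lam * t / 2)))) = (real K ^ 3 * exp (- (lam * t / 2))) * (2 * exp (- (lam * t / 2)))"
      by simp
    also have "... \<le> 1 * (2 * exp (- (lam * t / 2)))" by (intro mult_right_mono K3) simp
    also have "... \<le> 4 / lam / t"
    proof -
      have "exp (- (lam * t / 2)) \<le> 2 / lam / t" using t_exp t0 by (simp only: pos_le_divide_eq mult.commute)
      moreover have "2 * (2 / lam / t) = 4 / lam / t" by simp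
      ultimately show ?thesis by linarith
    qed
    finally show ?thesis .
  qed
  let ?A = "refine_const c_lo c_hi c0 S * (\<sigma> ^ 6 / (real (N - b * n) * (\<kappa> K) ^ 4))" and ?B = "4 * c_hi^2 * (S * (real K * (\<kappa> K)^2)) * ((real K)^2 * (1 / 2) ^ b)"
  have "minimax_risk K N \<sigma> \<Theta> \<le> ennreal (?A
        + ?B)" by (rule minimax_upper[OF n1 n_ge bn \<Theta>])
  also have "... \<le> ennreal (upper_const * (\<sigma> ^ 6 / (real N * (\<kappa> K) ^ 4)))"
  proof (rule ennreal_leI)
    have aux: "x \<le> y ==> y = z ==> v \<le> w ==> x + v \<le> z + w" for x y z v w :: real by simp
    define m where "m = real (N - b * n)"
    have "real N / 2 \<le> m" using half unfolding m_def .
    moreover have "0 < real N / 2" using N by simp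
    ultimately have "\<sigma> ^ 6 / (m * (\<kappa> K) ^ 4) \<le> \<sigma> ^ 6 / (real N / 2 * (\<kappa> K) ^ 4)"
      using \<kappa>K \<sigma> by (intro divide_left_mono mult_right_mono mult_pos_pos) auto
    also have "... = 2 * (\<sigma> ^ 6 / (real N * (\<kappa> K) ^ 4))" by simp
    finally have "\<sigma> ^ 6 / (real (N - b * n) * (\<kappa> K) ^ 4) \<le> 2 * (\<sigma> ^ 6 / (real N * (\<kappa> K) ^ 4))" unfolding m_def .
    then have "?A
        \<le> refine_const c_lo c_hi c0 S * (2 * (\<sigma> ^ 6 / (real N * (\<kappa> K) ^ 4)))" by (intro mult_left_mono refine_const_nonneg)
    moreover have "refine_const c_lo c_hi c0 S * (2 * (\<sigma> ^ 6 / (real N * (\<kappa> K) ^ 4)))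
        = 2 * refine_const c_lo c_hi c0 S * (\<sigma> ^ 6 / (real N * (\<kappa> K) ^ 4))" by simp
    moreover have "?B
        \<le> 64 * c_hi^2 * S * block_const / ln 2 * (\<sigma> ^ 6 / (real N * (\<kappa> K) ^ 4))"
    proof -
      have "?B
        = 4 * c_hi^2 * S * (\<kappa> K)^2 * (real K ^ 3 * (1 / 2) ^ b)" by (simp add: eval_nat_numeral mult_ac)
      also have "... \<le> 4 * c_hi^2 * S * (\<kappa> K)^2 * (4 / lam / t)" using S_ge_1 by (intro mult_left_mono fail) auto
      also have "... = 64 * c_hi^2 * S * block_const / ln 2 * ((\<kappa> K)^2 / t)"
        unfolding lam_def using block_const_pos t0 by (simp add: field_simps)
      finally show ?thesis unfolding rate .
    qed
    ultimately show "?A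
        + ?B \<le> upper_const * (\<sigma> ^ 6 / (real N * (\<kappa> K) ^ 4))"
      unfolding upper_const_def distrib_right by (rule aux)
  qed
  finally show ?thesis .
qed

end

section \<open>Averages over a uniform angle\<close>

lemma emeasure_angles: "emeasure lborel angles = ennreal (2 * pi)"
  by (simp add: angles_def)

lemma sets_angles [measurable]: "angles \<in> sets borel"
  by (simp add: angles_def)

lemma nn_integral_uniform_angle:
  assumes "f \<in> borel_measurable borel"
  shows "(\<integral>\<^sup>+t. f t \<partial>uniform_angle) = (\<integral>\<^sup>+t. f t * indicator angles t \<partial>lborel) / ennreal (2 * pi)"
  using assms by (subst nn_integral_uniform_measure) (auto simp: emeasure_angles)

lemma nn_integral_uniform_angle_shift_pos:
  fixes f :: "real => ennreal"
  assumes f[measurable]: "f \<in> borel_measurable borel" and per: "\<And>t. f (t + 2 * pi) = f t"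
    and s: "0 \<le> s" "s \<le> 2 * pi"
  shows "(\<integral>\<^sup>+t. f (t - s) \<partial>uniform_angle) = (\<integral>\<^sup>+t. f t \<partial>uniform_angle)"
proof -
  have "(\<integral>\<^sup>+t. f (t - s) * indicator angles t \<partial>lborel) = (\<integral>\<^sup>+t. f t * indicator {-pi - s..<pi - s} t \<partial>lborel)"
    by (subst nn_integral_real_affine[where c=1 and t=s]) (auto simp: angles_def intro!: nn_integral_cong split: split_indicator)
  also have "... = (\<integral>\<^sup>+t. f t * indicator {-pi - s..<-pi} t + f t * indicator {-pi..<pi - s} t \<partial>lborel)"
    using s by (intro nn_integral_cong) (auto split: split_indicator)
  also have "... = (\<integral>\<^sup>+t. f t * indicator {-pi - s..<-pi} t \<partial>lborel) + (\<integral>\<^sup>+t. f t * indicator {-pi..<pi - s} t \<partial>lborel)"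
    by (rule nn_integral_add) auto
  also have "(\<integral>\<^sup>+t. f t * indicator {-pi - s..<-pi} t \<partial>lborel) = (\<integral>\<^sup>+t. f (t + 2 * pi) * indicator {pi - s..<pi} (t + 2 * pi) \<partial>lborel)"
    unfolding per by (intro nn_integral_cong) (auto split: split_indicator)
  also have "... = (\<integral>\<^sup>+t. f t * indicator {pi - s..<pi} t \<partial>lborel)"
    by (subst (2) nn_integral_real_affine[where c=1 and t="2 * pi"]) (auto simp: add.commute)
  also have "... + (\<integral>\<^sup>+t. f t * indicator {-pi..<pi - s} t \<partial>lborel)
      = (\<integral>\<^sup>+t. f t * indicator {pi - s..<pi} t + f t * indicator {-pi..<pi - s} t \<partial>lborel)"
    by (rule nn_integral_add[symmetric]) auto
  also have "... = (\<integral>\<^sup>+t. f t * indicator angles t \<partial>lborel)"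
    using s by (intro nn_integral_cong) (auto simp: angles_def split: split_indicator)
  finally show ?thesis by (subst (1 2) nn_integral_uniform_angle) auto
qed

lemma nn_integral_uniform_angle_shift:
  fixes f :: "real => ennreal"
  assumes f[measurable]: "f \<in> borel_measurable borel" and per: "\<And>t. f (t + 2 * pi) = f t"
    and s: "\<bar>s\<bar> \<le> 2 * pi"
  shows "(\<integral>\<^sup>+t. f (t - s) \<partial>uniform_angle) = (\<integral>\<^sup>+t. f t \<partial>uniform_angle)"
proof (cases "0 \<le> s")
  case True
  then show ?thesis using nn_integral_uniform_angle_shift_pos[OF f per] s by simp
next
  case False
  have "f (t - s) = f (t - (s + 2 * pi))" for t using per[of "t - (s + 2 * pi)"] by simp
  then show ?thesis using nn_integral_uniform_angle_shift_pos[OF f per, of "s + 2 * pi"] s False by simp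
qed

lemma nn_integral_uniform_angle_reflect:
  fixes f :: "real => ennreal"
  assumes f[measurable]: "f \<in> borel_measurable borel"
  shows "(\<integral>\<^sup>+t. f (- t) \<partial>uniform_angle) = (\<integral>\<^sup>+t. f t \<partial>uniform_angle)"
proof -
  have "(\<integral>\<^sup>+t. f (- t) * indicator angles t \<partial>lborel) = (\<integral>\<^sup>+t. f t * indicator {-pi<..pi} t \<partial>lborel)"
    by (subst nn_integral_real_affine[where c="-1" and t=0])
      (auto simp: angles_def intro!: nn_integral_cong split: split_indicator)
  also have "... = (\<integral>\<^sup>+t. f t * indicator angles t \<partial>lborel)"
  proof (rule nn_integral_cong_AE)
    show "AE t in lborel. f t * indicator {-pi<..pi} t = f t * indicator angles t"
      using AE_lborel_singleton[of pi] AE_lborel_singleton[of "-pi"]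
      by eventually_elim (auto simp: angles_def split: split_indicator)
  qed
  finally show ?thesis by (subst (1 2) nn_integral_uniform_angle) auto
qed

definition angle_mean :: "(real => real) => real" where "angle_mean f = (\<integral>t. f t \<partial>uniform_angle)"

definition bounded_borel :: "(real => real) => bool" where "bounded_borel f \<longleftrightarrow> f \<in> borel_measurable borel \<and> (\<exists>C. \<forall>t. \<bar>f t\<bar> \<le> C)"

lemma bounded_borelI: "f \<in> borel_measurable borel ==> (\<And>t. \<bar>f t\<bar> \<le> C) ==> bounded_borel f"
  unfolding bounded_borel_def by blast

lemma integrable_bounded_borel:
  assumes "bounded_borel f"
  shows "integrable uniform_angle f"
proof -
  interpret prob_space uniform_angle by (rule prob_space_uniform_angles)
  obtain C where "\<And>t. \<bar>f t\<bar> \<le> C" "f \<in> borel_measurable borel" using assms unfolding bounded_borel_def by blast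
  then show ?thesis by (intro integrable_const_bound[of _ C]) auto
qed

lemma bounded_borel_intros: "bounded_borel (\<lambda>_. c)" "bounded_borel f ==> bounded_borel g ==> bounded_borel (\<lambda>t. f t + g t)"
  "bounded_borel f ==> bounded_borel g ==> bounded_borel (\<lambda>t. f t - g t)"
  "bounded_borel f ==> bounded_borel g ==> bounded_borel (\<lambda>t. f t * g t)" "bounded_borel f ==> bounded_borel (\<lambda>t. f t ^ n)"
  "bounded_borel f ==> bounded_borel (\<lambda>t. exp (f t))" "bounded_borel (\<lambda>t. cos (a * t + c))" "bounded_borel (\<lambda>t. sin (a * t + c))"
proof -
  assume f: "bounded_borel f"
  then obtain C where C: "\<And>t. \<bar>f t\<bar> \<le> C" and [measurable]: "f \<in> borel_measurable borel" unfolding bounded_borel_def by blast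
  have C0: "0 \<le> C" using C[of 0] by linarith
  show "bounded_borel (\<lambda>t. f t ^ n)" by (rule bounded_borelI[of _ "C ^ n"]) (auto simp: power_abs intro!: power_mono C)
  show "bounded_borel (\<lambda>t. exp (f t))" by (rule bounded_borelI[of _ "exp C"]) (use C in \<open>auto intro: order_trans[OF abs_ge_self]\<close>)
  {
    assume g: "bounded_borel g"
    then obtain D where D: "\<And>t. \<bar>g t\<bar> \<le> D" and [measurable]: "g \<in> borel_measurable borel" unfolding bounded_borel_def by blast
    show "bounded_borel (\<lambda>t. f t + g t)"
      by (rule bounded_borelI[of _ "C + D"]) (use C D in \<open>auto intro!: order_trans[OF abs_triangle_ineq] add_mono\<close>)
    show "bounded_borel (\<lambda>t. f t - g t)"
      by (rule bounded_borelI[of _ "C + D"]) (use C D in \<open>auto intro!: order_trans[OF abs_triangle_ineq4] add_mono\<close>)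
    show "bounded_borel (\<lambda>t. f t * g t)"
      by (rule bounded_borelI[of _ "C * D"]) (use C D C0 in \<open>auto simp: abs_mult intro!: mult_mono\<close>)
  }
next
  show "bounded_borel (\<lambda>_. c)" by (rule bounded_borelI[of _ "\<bar>c\<bar>"]) auto
  show "bounded_borel (\<lambda>t. cos (a * t + c))" by (rule bounded_borelI[of _ 1]) auto
  show "bounded_borel (\<lambda>t. sin (a * t + c))" by (rule bounded_borelI[of _ 1]) auto
qed

lemma bounded_borel_sum: "(\<And>k. k \<in> F ==> bounded_borel (f k)) ==> bounded_borel (\<lambda>t. \<Sum>k\<in>F. f k t)"
  by (induction F rule: infinite_finite_induct) (auto intro: bounded_borel_intros)

lemma angle_mean_add: "bounded_borel f ==> bounded_borel g ==> angle_mean (\<lambda>t. f t + g t) = angle_mean f + angle_mean g"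
  and angle_mean_diff: "bounded_borel f ==> bounded_borel g ==> angle_mean (\<lambda>t. f t - g t) = angle_mean f - angle_mean g"
  and angle_mean_cmult: "angle_mean (\<lambda>t. c * f t) = c * angle_mean f"
  unfolding angle_mean_def by (auto simp: integrable_bounded_borel)

lemma angle_mean_sum: "(\<And>k. k \<in> F ==> bounded_borel (f k)) ==> angle_mean (\<lambda>t. \<Sum>k\<in>F. f k t) = (\<Sum>k\<in>F. angle_mean (f k))"
  unfolding angle_mean_def by (rule Bochner_Integration.integral_sum) (rule integrable_bounded_borel)

lemma angle_mean_const: "angle_mean (\<lambda>_. c) = c"
proof -
  interpret prob_space uniform_angle by (rule prob_space_uniform_angles)
  show ?thesis unfolding angle_mean_def using prob_space by simp
qed

lemma angle_mean_mono: "bounded_borel f ==> bounded_borel g ==> (\<And>t. f t \<le> g t) ==> angle_mean f \<le> angle_mean g"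
  unfolding angle_mean_def by (intro integral_mono integrable_bounded_borel)

lemma ennreal_angle_mean:
  assumes "bounded_borel f" "\<And>t. 0 \<le> f t"
  shows "ennreal (angle_mean f) = (\<integral>\<^sup>+t. ennreal (f t) \<partial>uniform_angle)"
  unfolding angle_mean_def by (rule nn_integral_eq_integral[symmetric]) (use assms integrable_bounded_borel in auto)

text \<open>Adding a constant makes a bounded function nonnegative. An identity between nonnegative
  integrals then carries over to the means, and the constant cancels.\<close>

lemma angle_mean_transform:
  assumes f: "bounded_borel f" and g: "bounded_borel (\<lambda>t. f (T t))"
    and eq: "\<And>C. (\<integral>\<^sup>+t. ennreal (f (T t) + C) \<partial>uniform_angle) = (\<integral>\<^sup>+t. ennreal (f t + C) \<partial>uniform_angle)"
  shows "angle_mean (\<lambda>t. f (T t)) = angle_mean f"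
proof -
  obtain C where C: "\<And>t. \<bar>f t\<bar> \<le> C" using f unfolding bounded_borel_def by blast
  have nn: "0 \<le> f t + C" for t using C[of t] by linarith
  have m: "angle_mean (\<lambda>t. f t + C) = angle_mean f + C" "angle_mean (\<lambda>t. f (T t) + C) = angle_mean (\<lambda>t. f (T t)) + C"
    using f g by (simp_all add: angle_mean_add bounded_borel_intros angle_mean_const)
  have "ennreal (angle_mean (\<lambda>t. f (T t) + C)) = ennreal (angle_mean (\<lambda>t. f t + C))"
    using f g by (subst (1 2) ennreal_angle_mean) (auto intro: bounded_borel_intros nn eq)
  moreover have "0 \<le> angle_mean (\<lambda>t. f t + C)" "0 \<le> angle_mean (\<lambda>t. f (T t) + C)"
    unfolding angle_mean_def by (rule Bochner_Integration.integral_nonneg, rule nn)+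
  ultimately show ?thesis using m by simp
qed

lemma angle_mean_shift:
  assumes f: "bounded_borel f" and per: "\<And>t. f (t + 2 * pi) = f t" and s: "\<bar>s\<bar> \<le> 2 * pi"
  shows "angle_mean (\<lambda>t. f (t - s)) = angle_mean f"
proof (rule angle_mean_transform[where T="\<lambda>t. t - s", OF f])
  have [measurable]: "f \<in> borel_measurable borel" using f by (simp add: bounded_borel_def)
  obtain C where C: "\<And>t. \<bar>f t\<bar> \<le> C" using f unfolding bounded_borel_def by blast
  show "bounded_borel (\<lambda>t. f (t - s))" by (rule bounded_borelI[of _ C]) (auto intro: C)
  show "(\<integral>\<^sup>+t. ennreal (f (t - s) + C) \<partial>uniform_angle) = (\<integral>\<^sup>+t. ennreal (f t + C) \<partial>uniform_angle)" for C
    by (rule nn_integral_uniform_angle_shift[where f="\<lambda>t. ennreal (f t + C)"]) (use per s in auto)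
qed

lemma angle_mean_reflect:
  assumes f: "bounded_borel f"
  shows "angle_mean (\<lambda>t. f (- t)) = angle_mean f"
proof (rule angle_mean_transform[where T=uminus, OF f])
  have [measurable]: "f \<in> borel_measurable borel" using f by (simp add: bounded_borel_def)
  obtain C where C: "\<And>t. \<bar>f t\<bar> \<le> C" using f unfolding bounded_borel_def by blast
  show "bounded_borel (\<lambda>t. f (- t))" by (rule bounded_borelI[of _ C]) (auto intro: C)
  show "(\<integral>\<^sup>+t. ennreal (f (- t) + C) \<partial>uniform_angle) = (\<integral>\<^sup>+t. ennreal (f t + C) \<partial>uniform_angle)" for C
    by (rule nn_integral_uniform_angle_reflect[where f="\<lambda>t. ennreal (f t + C)"]) auto
qed

lemma cos_int_periodic: "cos (of_int n * (t + 2 * pi) + c) = cos (of_int n * t + c)"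
proof -
  have "of_int n * (t + 2 * pi) + c = (of_int n * t + c) + 2 * pi * of_int n" by (simp add: algebra_simps)
  then show ?thesis by (simp only: cos_add sin_int_2pin cos_int_2pin) simp
qed

text \<open>A shift by \<open>pi / n\<close> changes the sign, so the mean is its own
  negative.\<close>

lemma angle_mean_cos:
  fixes n :: int
  assumes "n \<noteq> 0"
  shows "angle_mean (\<lambda>t. cos (of_int n * t + c)) = 0"
proof -
  define s where "s = pi / of_int n"
  have s: "\<bar>s\<bar> \<le> 2 * pi"
  proof -
    have "1 \<le> \<bar>of_int n :: real\<bar>" using assms by linarith
    then have "pi \<le> 2 * pi * \<bar>of_int n\<bar>" using pi_ge_zero mult_left_mono[of 1 "\<bar>of_int n :: real\<bar>" "2 * pi"] by linarith
    then show ?thesis unfolding s_def using assms by (simp add: abs_mult field_simps)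
  qed
  have "angle_mean (\<lambda>t. cos (of_int n * (t - s) + c)) = angle_mean (\<lambda>t. cos (of_int n * t + c))"
    by (rule angle_mean_shift[where f="\<lambda>t. cos (of_int n * t + c)"]) (auto intro: bounded_borel_intros s cos_int_periodic)
  moreover have "cos (of_int n * (t - s) + c) = (-1) * cos (of_int n * t + c)" for t
  proof -
    have "of_int n * (t - s) + c = (of_int n * t + c) - pi" using assms by (simp add: s_def field_simps)
    then show ?thesis by (simp only: cos_diff cos_pi sin_pi)
  qed
  ultimately show ?thesis using angle_mean_cmult[of "-1" "\<lambda>t. cos (of_int n * t + c)"] by simp
qed

section \<open>Fourier coefficients of powers and exponentials of a cosine sum\<close>

definition trig_sum :: "nat set => (nat => real) => real => real" where "trig_sum F a t = (\<Sum>k\<in>F. a k * cos (real k * t))"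

text \<open>For nonnegative coefficients with sum \<open>A\<close> this is \<open>A ^ m\<close>
  times the probability that a random walk is at \<open>n\<close> after \<open>m\<close> steps,
  where a step has size \<open>k\<close> with probability \<open>a k / A\<close> and a random
  sign.\<close>

definition fourier_coeff :: "nat set => (nat => real) => nat => int => real" where
  "fourier_coeff F a m n = angle_mean (\<lambda>t. trig_sum F a t ^ m * cos (of_int n * t))"

lemma bounded_borel_cos: "bounded_borel (\<lambda>t. cos (a * t))" "bounded_borel (\<lambda>t. sin (a * t))"
  using bounded_borel_intros(7,8)[of a 0] by simp_all

lemma bounded_borel_trig_sum: "bounded_borel (trig_sum F a)"
  unfolding trig_sum_def[abs_def] by (intro bounded_borel_sum bounded_borel_intros bounded_borel_cos)

lemma trig_sum_abs_le:
  assumes "\<And>k. k \<in> F ==> 0 \<le> a k"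
  shows "\<bar>trig_sum F a t\<bar> \<le> (\<Sum>k\<in>F. a k)"
  unfolding trig_sum_def by (rule order_trans[OF sum_abs]) (use assms in \<open>auto simp: abs_mult intro!: sum_mono mult_left_le\<close>)

text \<open>The product formula for cosines, which is one step of the random walk.\<close>

lemma fourier_coeff_Suc: "fourier_coeff F a (Suc m) n
    = (\<Sum>k\<in>F. a k / 2 * (fourier_coeff F a m (n + int k) + fourier_coeff F a m (n - int k)))"
proof -
  have "trig_sum F a t ^ Suc m * cos (of_int n * t)
    = (\<Sum>k\<in>F. a k / 2 * (trig_sum F a t ^ m * cos (of_int (n + int k) * t) + trig_sum F a t ^ m * cos (of_int (n - int k) * t)))" for t
  proof -
    have pr: "a k / 2 * (P * cos (of_int (n + int k) * t) + P * cos (of_int (n - int k) * t))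
        = P * (a k * cos (real k * t)) * cos (of_int n * t)" for k P
    proof -
      have "cos (of_int (n + int k) * t) + cos (of_int (n - int k) * t) = 2 * cos (of_int n * t) * cos (real k * t)"
        by (simp add: cos_add cos_diff distrib_right left_diff_distrib)
      then have "P * (cos (of_int (n + int k) * t) + cos (of_int (n - int k) * t)) = P * (2 * cos (of_int n * t) * cos (real k * t))"
        by simp
      then show ?thesis by (simp add: algebra_simps)
    qed
    show ?thesis unfolding pr sum_distrib_right[symmetric] sum_distrib_left[symmetric] by (simp add: trig_sum_def mult_ac)
  qed
  then have "fourier_coeff F a (Suc m) n = angle_mean (\<lambda>t. \<Sum>k\<in>F. a k / 2 * (trig_sum F a t ^ m * cos (of_int (n + int k) * t)
      + trig_sum F a t ^ m * cos (of_int (n - int k) * t)))" unfolding fourier_coeff_def by (simp only:)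
  also have "... = (\<Sum>k\<in>F. angle_mean (\<lambda>t. a k / 2 * (trig_sum F a t ^ m * cos (of_int (n + int k) * t)
      + trig_sum F a t ^ m * cos (of_int (n - int k) * t))))"
    by (rule angle_mean_sum) (intro bounded_borel_intros bounded_borel_cos bounded_borel_trig_sum)
  also have "... = (\<Sum>k\<in>F. a k / 2 * (fourier_coeff F a m (n + int k) + fourier_coeff F a m (n - int k)))"
    unfolding fourier_coeff_def by (intro sum.cong refl, subst angle_mean_cmult, subst angle_mean_add)
      (intro bounded_borel_intros bounded_borel_cos bounded_borel_trig_sum refl)+
  finally show ?thesis .
qed

lemma fourier_coeff_0: "fourier_coeff F a 0 n = of_bool (n = 0)"
  using angle_mean_cos[of n 0] by (cases "n = 0") (simp_all add: fourier_coeff_def angle_mean_const)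

context
  fixes F :: "nat set" and a :: "nat => real" and M :: real
  assumes F: "finite F" and a: "\<And>k. k \<in> F ==> 0 \<le> a k" and M: "\<And>k. k \<in> F ==> real k * a k \<le> M" and M0: "0 \<le> M"
begin

lemma mass_nonneg: "0 \<le> (\<Sum>k\<in>F. a k)" by (intro sum_nonneg a)

lemma fourier_coeff_nonneg: "0 \<le> fourier_coeff F a m n"
  by (induction m arbitrary: n) (auto simp: fourier_coeff_0 fourier_coeff_Suc a intro!: sum_nonneg mult_nonneg_nonneg add_nonneg_nonneg)

lemma fourier_coeff_sum_le: "finite X ==> (\<Sum>n\<in>X. fourier_coeff F a m n) \<le> (\<Sum>k\<in>F. a k) ^ m"
proof (induction m arbitrary: X)
  case 0
  then show ?case by (simp add: fourier_coeff_0 of_bool_def)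
next
  case (Suc m)
  have shift: "(\<Sum>n\<in>X. fourier_coeff F a m (n + d)) \<le> (\<Sum>k\<in>F. a k) ^ m" for d
  proof -
    have "(\<Sum>n\<in>X. fourier_coeff F a m (n + d)) = (\<Sum>n\<in>(\<lambda>n. n + d) ` X. fourier_coeff F a m n)" by (subst sum.reindex) auto
    then show ?thesis using Suc.IH[of "(\<lambda>n. n + d) ` X"] Suc.prems by simp
  qed
  have "(\<Sum>n\<in>X. fourier_coeff F a (Suc m) n)
      = (\<Sum>k\<in>F. a k / 2 * ((\<Sum>n\<in>X. fourier_coeff F a m (n + int k)) + (\<Sum>n\<in>X. fourier_coeff F a m (n + (- int k)))))"
    unfolding fourier_coeff_Suc by (subst sum.swap) (simp only: sum_distrib_left[symmetric] sum.distrib diff_conv_add_uminus)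
  also have "... \<le> (\<Sum>k\<in>F. a k / 2 * ((\<Sum>k\<in>F. a k) ^ m + (\<Sum>k\<in>F. a k) ^ m))"
    by (intro sum_mono mult_left_mono add_mono shift) (use a in auto)
  also have "... = (\<Sum>k\<in>F. a k) ^ Suc m" by (simp add: sum_distrib_right)
  finally show ?case .
qed

text \<open>A walk that ends at \<open>n\<close> has steps of total length at least
  \<open>\<bar>n\<bar>\<close>. Charging this length to one of the \<open>m\<close> steps replaces
  its weight by \<open>real k * a k \<le> M\<close>, and the remaining \<open>m - 1\<close> steps
  have total mass at most \<open>(\<Sum>k\<in>F. a k) ^ (m - 1)\<close>.\<close>

lemma fourier_coeff_decay: "\<bar>of_int n\<bar> * fourier_coeff F a m n \<le> real m * M * (\<Sum>k\<in>F. a k) ^ (m - 1)"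
proof (induction m arbitrary: n)
  case 0
  then show ?case by (simp add: fourier_coeff_0)
next
  case (Suc m)
  let ?A = "\<Sum>k\<in>F. a k" and ?c = "fourier_coeff F a m"
  have t: "\<bar>of_int n\<bar> * ?c (n + d) \<le> real m * M * ?A ^ (m - 1) + \<bar>of_int d\<bar> * ?c (n + d)" for d
  proof -
    have "\<bar>of_int n :: real\<bar> \<le> \<bar>of_int (n + d)\<bar> + \<bar>of_int d\<bar>" by simp
    then have "\<bar>of_int n\<bar> * ?c (n + d) \<le> (\<bar>of_int (n + d)\<bar> + \<bar>of_int d\<bar>) * ?c (n + d)"
      by (rule mult_right_mono) (rule fourier_coeff_nonneg)
    then show ?thesis using Suc[of "n + d"] by (simp add: distrib_right)
  qed
  have "\<bar>of_int n\<bar> * fourier_coeff F a (Suc m) n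
      = (\<Sum>k\<in>F. a k / 2 * (\<bar>of_int n\<bar> * ?c (n + int k) + \<bar>of_int n\<bar> * ?c (n + (- int k))))"
    unfolding fourier_coeff_Suc by (simp add: sum_distrib_left algebra_simps)
  also have "... \<le> (\<Sum>k\<in>F. a k / 2 * ((real m * M * ?A ^ (m - 1) + \<bar>of_int (int k)\<bar> * ?c (n + int k))
      + (real m * M * ?A ^ (m - 1) + \<bar>of_int (- int k)\<bar> * ?c (n + (- int k)))))"
    by (intro sum_mono mult_left_mono add_mono t) (use a in auto)
  also have "... = ?A * (real m * M * ?A ^ (m - 1)) + (\<Sum>k\<in>F. (real k * a k) / 2 * (?c (n + int k) + ?c (n + (- int k))))"
  proof -
    have aux: "a k / 2 * ((P + \<bar>of_int (int k)\<bar> * c) + (P + \<bar>of_int (- int k)\<bar> * c'))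
        = a k * P + (real k * a k) / 2 * (c + c')" for k P c c' by (simp add: algebra_simps)
    show ?thesis unfolding aux sum.distrib sum_distrib_right ..
  qed
  also have "(\<Sum>k\<in>F. (real k * a k) / 2 * (?c (n + int k) + ?c (n + (- int k)))) \<le> (\<Sum>k\<in>F. M / 2 * (?c (n + int k) + ?c (n + (- int k))))"
    by (intro sum_mono mult_right_mono divide_right_mono M add_nonneg_nonneg fourier_coeff_nonneg) auto
  also have "... = M / 2 * ((\<Sum>k\<in>F. ?c (n + int k)) + (\<Sum>k\<in>F. ?c (n + (- int k))))"
    by (simp only: sum_distrib_left[symmetric] sum.distrib)
  also have "... \<le> M / 2 * (?A ^ m + ?A ^ m)"
  proof (intro mult_left_mono add_mono)
    have "(\<Sum>k\<in>F. ?c (n + int k)) = (\<Sum>n\<in>(\<lambda>k. n + int k) ` F. ?c n)" by (subst sum.reindex) (auto simp: inj_on_def)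
    then show "(\<Sum>k\<in>F. ?c (n + int k)) \<le> ?A ^ m" using fourier_coeff_sum_le F by simp
    have "(\<Sum>k\<in>F. ?c (n + (- int k))) = (\<Sum>n\<in>(\<lambda>k. n + (- int k)) ` F. ?c n)" by (subst sum.reindex) (auto simp: inj_on_def)
    then show "(\<Sum>k\<in>F. ?c (n + (- int k))) \<le> ?A ^ m" using fourier_coeff_sum_le F by simp
  qed (use M0 in simp)
  also have "?A * (real m * M * ?A ^ (m - 1)) + M / 2 * (?A ^ m + ?A ^ m) = real (Suc m) * M * ?A ^ (Suc m - 1)"
    by (cases m) (simp_all add: algebra_simps)
  finally show ?case by simp
qed

text \<open>In the exponential series the orders 0 and 1 contain no frequency \<open>k0\<close>,
  because \<open>k0\<close> is positive and not in \<open>F\<close>. From order 2 on, the factor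
  \<open>m\<close> of the decay bound cancels against the factorial and one power of
  \<open>A\<close> is left over. That power lifts the distance between two laws to third order in
  \<open>1 / \<sigma>^2\<close>.\<close>

lemma exp_trig_sum_coefficient:
  assumes k0: "k0 \<notin> F" "1 \<le> k0"
  defines "A \<equiv> \<Sum>k\<in>F. a k"
  shows "angle_mean (\<lambda>t. exp (trig_sum F a t) * cos (real k0 * t)) \<le> M / real k0 * (A * exp A)"
proof -
  have A0: "0 \<le> A" unfolding A_def by (rule mass_nonneg)
  define f where "f m t = trig_sum F a t ^ m * cos (real k0 * t) / fact m" for m t
  define g where "g m = fourier_coeff F a m (int k0) / fact m" for m
  have f_bb: "bounded_borel (f m)" for m
  proof -
    have "bounded_borel (\<lambda>t. trig_sum F a t ^ m * cos (real k0 * t) * (1 / fact m))"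
      by (intro bounded_borel_intros bounded_borel_trig_sum bounded_borel_cos)
    then show ?thesis by (simp add: f_def[abs_def])
  qed
  have f_le: "norm (f m t) \<le> A ^ m / fact m" for m t
  proof -
    have "\<bar>trig_sum F a t\<bar> ^ m * \<bar>cos (real k0 * t)\<bar> \<le> A ^ m * 1"
      unfolding A_def by (intro mult_mono power_mono trig_sum_abs_le) (use a mass_nonneg in auto)
    then show ?thesis by (simp add: f_def abs_mult power_abs divide_right_mono)
  qed
  have sumA: "summable (\<lambda>m. A ^ m / fact m)" using summable_exp[of A] by (simp add: field_simps)
  interpret U: prob_space uniform_angle by (rule prob_space_uniform_angles)
  have sums: "(\<lambda>m. \<integral>t. f m t \<partial>uniform_angle) sums (\<integral>t. (\<Sum>m. f m t) \<partial>uniform_angle)"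
  proof (rule sums_integral)
    show "integrable uniform_angle (f m)" for m by (rule integrable_bounded_borel[OF f_bb])
    show "AE t in uniform_angle. summable (\<lambda>m. norm (f m t))"
      by (intro AE_I2 summable_comparison_test'[OF sumA, of 0]) (use f_le in auto)
    show "summable (\<lambda>m. \<integral>t. norm (f m t) \<partial>uniform_angle)"
    proof (rule summable_comparison_test'[OF sumA, of 0])
      fix m
      have "(\<integral>t. norm (f m t) \<partial>uniform_angle) \<le> (\<integral>t. A ^ m / fact m \<partial>uniform_angle)"
        by (intro integral_mono f_le integrable_norm integrable_bounded_borel[OF f_bb]) auto
      also have "... = A ^ m / fact m" using U.prob_space by simp
      finally show "norm (\<integral>t. norm (f m t) \<partial>uniform_angle) \<le> A ^ m / fact m" by simp
    qed
  qed
  have fg: "(\<integral>t. f m t \<partial>uniform_angle) = g m" for m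
  proof -
    have "f m t = 1 / fact m * (trig_sum F a t ^ m * cos (of_int (int k0) * t))" for t by (simp add: f_def)
    then show ?thesis
      unfolding g_def fourier_coeff_def using angle_mean_cmult[of "1 / fact m" "\<lambda>t. trig_sum F a t ^ m * cos (of_int (int k0) * t)"]
      by (simp add: angle_mean_def)
  qed
  have suminf_f: "(\<Sum>m. f m t) = exp (trig_sum F a t) * cos (real k0 * t)" for t
  proof -
    have "(\<lambda>m. trig_sum F a t ^ m /\<^sub>R fact m * cos (real k0 * t)) sums (exp (trig_sum F a t) * cos (real k0 * t))"
      by (rule sums_mult2[OF exp_converges])
    moreover have "trig_sum F a t ^ m /\<^sub>R fact m * cos (real k0 * t) = f m t" for m by (simp add: f_def divide_inverse mult_ac)
    ultimately show ?thesis by (simp add: sums_iff)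
  qed
  have g_sums: "g sums angle_mean (\<lambda>t. exp (trig_sum F a t) * cos (real k0 * t))"
    using sums unfolding fg suminf_f angle_mean_def .
  have g0: "g 0 = 0" using k0 by (simp add: g_def fourier_coeff_0)
  have g1: "g 1 = 0"
  proof -
    have "fourier_coeff F a (Suc 0) (int k0) = 0" unfolding fourier_coeff_Suc fourier_coeff_0 using k0 by (intro sum.neutral) auto
    then show ?thesis by (simp add: g_def)
  qed
  have g2: "g (m + 2) \<le> M / real k0 * A * (A ^ m / fact m)" for m
  proof -
    have "real k0 * fourier_coeff F a (m + 2) (int k0) \<le> real (m + 2) * M * A ^ (m + 1)"
      using fourier_coeff_decay[of "int k0" "m + 2"] by (simp add: A_def)
    then have "fourier_coeff F a (m + 2) (int k0) \<le> real (m + 2) * M * A ^ (m + 1) / real k0" using k0 by (simp add: field_simps)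
    then have "g (m + 2) \<le> real (m + 2) * M * A ^ (m + 1) / real k0 / fact (m + 2)"
      unfolding g_def by (rule divide_right_mono) simp
    also have "fact (m + 2) = (real (m + 2) * fact (m + 1) :: real)" by simp
    also have "real (m + 2) * M * A ^ (m + 1) / real k0 / (real (m + 2) * fact (m + 1)) = M / real k0 * (A ^ (m + 1) / fact (m + 1))"
      by simp
    also have "... \<le> M / real k0 * (A ^ (m + 1) / fact m)"
      using M0 A0 by (intro mult_left_mono divide_left_mono) (auto simp: fact_mono)
    finally show ?thesis by (simp add: mult_ac)
  qed
  have "(\<lambda>m. g (m + 2)) sums (angle_mean (\<lambda>t. exp (trig_sum F a t) * cos (real k0 * t)) - (\<Sum>i<2. g i))"
    using g_sums sums_iff_shift[of g 2] by simp
  then have s1: "(\<lambda>m. g (m + 2)) sums angle_mean (\<lambda>t. exp (trig_sum F a t) * cos (real k0 * t))"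
    using g0 g1 by (simp add: numeral_2_eq_2)
  have "(\<lambda>m. A ^ m / fact m) sums exp A" using exp_converges[of A] by (simp add: field_simps)
  then have s2: "(\<lambda>m. M / real k0 * A * (A ^ m / fact m)) sums (M / real k0 * A * exp A)" by (rule sums_mult)
  have "angle_mean (\<lambda>t. exp (trig_sum F a t) * cos (real k0 * t)) \<le> M / real k0 * A * exp A"
    by (rule sums_le[OF _ s1 s2]) (rule g2)
  then show ?thesis by (simp add: mult.assoc)
qed

end

section \<open>Effect of shifting the phase of one mode\<close>

lemma abs_exp_minus_one_le: "\<bar>exp x - 1\<bar> \<le> \<bar>x\<bar> * exp \<bar>x\<bar>" for x :: real
proof (cases "0 \<le> x")
  case True
  have "1 - x \<le> exp (- x)" using exp_ge_add_one_self[of "- x"] by simp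
  then have "(1 - x) * exp x \<le> exp (- x) * exp x" by (rule mult_right_mono) simp
  then have "exp x - 1 \<le> x * exp x" by (simp add: exp_minus algebra_simps)
  then show ?thesis using True by simp
next
  case False
  have "1 - exp x \<le> - x" using exp_ge_add_one_self[of x] by linarith
  also have "- x = - x * 1" by simp
  also have "... \<le> - x * exp (- x)" using False by (intro mult_left_mono) auto
  finally show ?thesis using False by simp
qed

lemma second_difference_bound:
  fixes H H' H'' :: "real => real"
  assumes H: "\<And>x. (H has_real_derivative H' x) (at x)" and H': "\<And>x. (H' has_real_derivative H'' x) (at x)"
    and b: "\<And>x. \<bar>H'' x\<bar> \<le> B" and d: "0 \<le> d"
  shows "\<bar>H x - (H (x + d) + H (x - d)) / 2\<bar> \<le> B * d^2"
proof -
  have mvt: "\<exists>z. \<bar>z - x\<bar> \<le> \<bar>e\<bar> \<and> H (x + e) = H x + e * H' z" for e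
  proof (cases "e = 0")
    case False
    show ?thesis
    proof (cases "0 < e")
      case True
      then obtain z where "x < z" "z < x + e" "H (x + e) - H x = (x + e - x) * H' z" using MVT2[of x "x + e" H H'] H by auto
      then show ?thesis by (intro exI[of _ z]) auto
    next
      case F: False
      then obtain z where "x + e < z" "z < x" "H x - H (x + e) = (x - (x + e)) * H' z"
        using MVT2[of "x + e" x H H'] H False by auto
      then show ?thesis by (intro exI[of _ z]) (auto simp: algebra_simps)
    qed
  qed auto
  have lip: "\<bar>H' z - H' y\<bar> \<le> B * \<bar>z - y\<bar>" for z y
  proof -
    have "norm (H' z - H' y) \<le> B * norm (z - y)"
      by (rule field_differentiable_bound[of UNIV H' H'' B]) (use H' b in \<open>auto intro: DERIV_subset\<close>)
    then show ?thesis by simp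
  qed
  obtain z where z: "\<bar>z - x\<bar> \<le> d" "H (x + d) = H x + d * H' z" using mvt[of d] d by auto
  obtain y where y: "\<bar>y - x\<bar> \<le> d" "H (x - d) = H x - d * H' y" using mvt[of "- d"] d by auto
  have B0: "0 \<le> B" using b[of 0] by linarith
  have "H x - (H (x + d) + H (x - d)) / 2 = - d / 2 * (H' z - H' y)" using z y by (simp add: field_simps)
  then have "\<bar>H x - (H (x + d) + H (x - d)) / 2\<bar> = d / 2 * \<bar>H' z - H' y\<bar>" using d by (simp add: abs_mult)
  also have "... \<le> d / 2 * (B * (2 * d))" using d B0 z(1) y(1) by (intro mult_left_mono order_trans[OF lip]) auto
  finally show ?thesis by (simp add: power2_eq_square mult_ac)
qed

text \<open>The term linear in \<open>b\<close> is removed, since it is treated exactly by the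
  Fourier coefficient. What is left has a second derivative of order \<open>b^2\<close>.\<close>

lemma exp_cos_second_difference:
  assumes b: "0 \<le> b" and d: "0 \<le> d"
  defines "H \<equiv> \<lambda>x :: real. exp (b * cos x) - 1 - b * cos x"
  shows "\<bar>H x - (H (x + d) + H (x - d)) / 2\<bar> \<le> 2 * b^2 * exp b * d^2"
proof (rule second_difference_bound[OF _ _ _ d])
  show "(H has_real_derivative - (b * sin x * (exp (b * cos x) - 1))) (at x)" for x
    unfolding H_def by (auto intro!: derivative_eq_intros simp: algebra_simps)
  show "((\<lambda>x. - (b * sin x * (exp (b * cos x) - 1))) has_real_derivative
      (b * sin x)\<^sup>2 * exp (b * cos x) - b * cos x * (exp (b * cos x) - 1)) (at x)" for x
    by (auto intro!: derivative_eq_intros simp: algebra_simps power2_eq_square)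
  show "\<bar>(b * sin x)\<^sup>2 * exp (b * cos x) - b * cos x * (exp (b * cos x) - 1)\<bar> \<le> 2 * b^2 * exp b" for x
  proof -
    have bc: "\<bar>b * cos x\<bar> \<le> b" using b by (simp add: abs_mult mult_left_le)
    have e: "exp (b * cos x) \<le> exp b" using bc by (simp add: abs_le_iff)
    have "\<bar>exp (b * cos x) - 1\<bar> \<le> b * exp b" by (rule order_trans[OF abs_exp_minus_one_le]) (use bc b in \<open>auto intro!: mult_mono\<close>)
    then have "\<bar>b * cos x * (exp (b * cos x) - 1)\<bar> \<le> b * (b * exp b)"
      unfolding abs_mult[of "b * cos x"] using bc b by (intro mult_mono) auto
    moreover have "\<bar>(b * sin x)\<^sup>2 * exp (b * cos x)\<bar> \<le> b^2 * exp b"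
    proof -
      have "(b * sin x)^2 \<le> b^2" using abs_square_le_1[of "sin x"] by (simp add: power_mult_distrib mult_left_le)
      then show ?thesis using e by (simp add: abs_mult mult_mono)
    qed
    moreover have "b * (b * exp b) = b^2 * exp b" by (simp add: power2_eq_square)
    ultimately show ?thesis
      using abs_triangle_ineq4[of "(b * sin x)^2 * exp (b * cos x)" "b * cos x * (exp (b * cos x) - 1)"] by linarith
  qed
qed

text \<open>By reflection the mean is an even function of the shift, so the difference is a second
  difference and quadratic in \<open>d\<close>. Its part linear in \<open>b\<close> is a multiple of
  \<open>cos (real k0 * t)\<close> and meets the Fourier coefficient of the other modes. The
  remainder \<open>w2\<close> has mean zero by translation invariance, so it pairs only with the
  exponential of the other modes minus 1, which is of order \<open>A\<close>.\<close>

theorem exp_trig_sum_phase_shift: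
  fixes F :: "nat set" and a :: "nat => real" and M b d :: real
  assumes F: "finite F" and a: "\<And>k. k \<in> F ==> 0 \<le> a k" and M: "\<And>k. k \<in> F ==> real k * a k \<le> M" and M0: "0 \<le> M"
    and k0: "k0 \<notin> F" "1 \<le> k0" and b: "0 \<le> b" and d: "\<bar>d\<bar> \<le> 1"
  defines "A \<equiv> \<Sum>k\<in>F. a k"
  shows "angle_mean (\<lambda>t. exp (trig_sum F a t + b * cos (real k0 * t)))
      - angle_mean (\<lambda>t. exp (trig_sum F a t + b * cos (real k0 * t + d)))
    \<le> d^2 * (b * (M / real k0) * (A * exp A) + 2 * b^2 * exp b * (A * exp A))"
proof -
  have A0: "0 \<le> A" unfolding A_def by (intro sum_nonneg a)
  have k0r: "0 < real k0" using k0 by simp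
  let ?e = "\<lambda>t. exp (trig_sum F a t)"
  define H where "H x = exp (b * cos x) - 1 - b * cos x" for x :: real
  define c where "c = \<bar>d\<bar>"
  have c: "0 \<le> c" by (simp add: c_def)
  define w2 where "w2 t = H (real k0 * t) - (H (real k0 * t + c) + H (real k0 * t - c)) / 2" for t
  have bbH: "bounded_borel (\<lambda>t. H (real k0 * t + s))" for s unfolding H_def by (intro bounded_borel_intros)
  have bbH0: "bounded_borel (\<lambda>t. H (real k0 * t))" "bounded_borel (\<lambda>t. H (real k0 * t - c))"
    using bbH[of 0] bbH[of "- c"] by simp_all
  have bbw: "bounded_borel w2"
  proof -
    have "bounded_borel (\<lambda>t. H (real k0 * t) - (1 / 2) * (H (real k0 * t + c) + H (real k0 * t - c)))"
      by (intro bounded_borel_intros bbH bbH0)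
    then show ?thesis by (simp add: w2_def[abs_def])
  qed
  note bb = bounded_borel_intros bounded_borel_trig_sum bounded_borel_cos bbw
  have even_trig: "trig_sum F a (- t) = trig_sum F a t" for t by (simp add: trig_sum_def)
  define G where "G s = angle_mean (\<lambda>t. ?e t * exp (b * cos (real k0 * t + s)))" for s
  have G_even: "G (- s) = G s" for s
  proof -
    have "bounded_borel (\<lambda>t. ?e t * exp (b * cos (real k0 * t + s)))" by (intro bb)
    from angle_mean_reflect[OF this] have "angle_mean (\<lambda>t. ?e (- t) * exp (b * cos (real k0 * (- t) + s))) = G s"
      by (simp add: G_def)
    moreover have "?e (- t) * exp (b * cos (real k0 * (- t) + s)) = ?e t * exp (b * cos (real k0 * t + - s))" for t
      using cos_minus[of "real k0 * (- t) + s"] by (simp add: even_trig)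
    ultimately show ?thesis unfolding G_def by simp
  qed
  have G_c: "G d = (G c + G (- c)) / 2" using G_even[of c] G_even[of d] by (cases "0 \<le> d") (auto simp: c_def)
  have split: "exp (b * cos x) - (exp (b * cos (x + c)) + exp (b * cos (x - c))) / 2
      = b * (1 - cos c) * cos x + (H x - (H (x + c) + H (x - c)) / 2)" for x by (simp add: H_def cos_add cos_diff field_simps)
  have "G 0 - G d = G 0 - (1 / 2) * (G c + G (- c))" using G_c by simp
  also have "... = angle_mean (\<lambda>t. ?e t * exp (b * cos (real k0 * t + 0))
      - (1 / 2) * (?e t * exp (b * cos (real k0 * t + c)) + ?e t * exp (b * cos (real k0 * t + - c))))" unfolding G_def
    by (subst angle_mean_diff, (intro bb)+, subst angle_mean_cmult, subst angle_mean_add, (intro bb)+, rule refl)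
  also have "... = angle_mean (\<lambda>t. b * (1 - cos c) * (?e t * cos (real k0 * t)) + ((?e t - 1) * w2 t + w2 t))"
  proof -
    have aux: "e * X - (1 / 2) * (e * Y + e * Z) = e * (X - (Y + Z) / 2)" for e X Y Z :: real by (simp add: field_simps)
    have aux2: "e * (p * q + w) = p * (e * q) + ((e - 1) * w + w)" for e p q w :: real by (simp add: algebra_simps)
    show ?thesis
      unfolding aux using split[of "real k0 * _"] by (simp only: add_0_right diff_conv_add_uminus[symmetric] aux2 w2_def)
  qed
  also have "... = b * (1 - cos c) * angle_mean (\<lambda>t. ?e t * cos (real k0 * t)) + (angle_mean (\<lambda>t. (?e t - 1) * w2 t) + angle_mean w2)"
    by (subst angle_mean_add, (intro bb)+, subst angle_mean_cmult, subst angle_mean_add, (intro bb)+, rule refl)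
  also have "angle_mean w2 = 0"
  proof -
    have per: "H (real k0 * (t + 2 * pi)) = H (real k0 * t)" for t using cos_int_periodic[of "int k0" t 0] by (simp add: H_def)
    have sh: "angle_mean (\<lambda>t. H (real k0 * t + s)) = angle_mean (\<lambda>t. H (real k0 * t))" if "\<bar>s\<bar> \<le> 1" for s
    proof -
      have "\<bar>- s / real k0\<bar> \<le> 2 * pi"
      proof -
        have "\<bar>s\<bar> / real k0 \<le> \<bar>s\<bar>" using k0 by (simp add: divide_le_eq mult_left_le mult_le_cancel_left1)
        then show ?thesis using that pi_gt3 by simp
      qed
      from angle_mean_shift[OF bbH0(1) per this]
      have "angle_mean (\<lambda>t. H (real k0 * (t - - s / real k0))) = angle_mean (\<lambda>t. H (real k0 * t))" .
      moreover have "real k0 * (t - - s / real k0) = real k0 * t + s" for t using k0r by (simp add: field_simps)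
      ultimately show ?thesis by simp
    qed
    have "angle_mean w2 = angle_mean (\<lambda>t. H (real k0 * t) - (1 / 2) * (H (real k0 * t + c) + H (real k0 * t + - c)))"
      by (simp add: w2_def[abs_def])
    also have "... = angle_mean (\<lambda>t. H (real k0 * t)) - (1 / 2) * (angle_mean (\<lambda>t. H (real k0 * t + c)) + angle_mean (\<lambda>t. H (real k0 * t + - c)))"
      by (subst angle_mean_diff, (intro bb bbH bbH0)+, subst angle_mean_cmult, subst angle_mean_add, (intro bbH)+, rule refl)
    finally show ?thesis using sh[of c] sh[of "- c"] d by (simp add: c_def)
  qed
  also have "angle_mean (\<lambda>t. (?e t - 1) * w2 t) \<le> A * exp A * (2 * b^2 * exp b * c^2)"
  proof -
    have "(?e t - 1) * w2 t \<le> A * exp A * (2 * b^2 * exp b * c^2)" for t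
    proof -
      have "\<bar>trig_sum F a t\<bar> \<le> A" unfolding A_def by (rule trig_sum_abs_le) (rule a)
      then have "\<bar>?e t - 1\<bar> \<le> A * exp A" by (intro order_trans[OF abs_exp_minus_one_le] mult_mono) (use A0 in auto)
      moreover have "\<bar>w2 t\<bar> \<le> 2 * b^2 * exp b * c^2" unfolding w2_def H_def by (rule exp_cos_second_difference[OF b c])
      ultimately have "\<bar>(?e t - 1) * w2 t\<bar> \<le> A * exp A * (2 * b^2 * exp b * c^2)"
        unfolding abs_mult using A0 by (intro mult_mono) auto
      then show ?thesis by linarith
    qed
    then have "angle_mean (\<lambda>t. (?e t - 1) * w2 t) \<le> angle_mean (\<lambda>_. A * exp A * (2 * b^2 * exp b * c^2))"
      by (intro angle_mean_mono bb)
    then show ?thesis by (simp add: angle_mean_const)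
  qed
  also have "b * (1 - cos c) * angle_mean (\<lambda>t. ?e t * cos (real k0 * t)) \<le> b * (1 - cos c) * (M / real k0 * (A * exp A))"
    unfolding A_def using exp_trig_sum_coefficient[OF F a M M0 k0] b by (intro mult_left_mono) auto
  also have "... \<le> b * c^2 * (M / real k0 * (A * exp A))"
  proof (intro mult_right_mono mult_left_mono)
    have "cos c = 1 - 2 * (sin (c / 2))^2" using cos_double_sin[of "c / 2"] by simp
    moreover have "(sin (c / 2))^2 \<le> (c / 2)^2" by (rule abs_le_square_iff[THEN iffD1, OF abs_sin_x_le_abs_x])
    moreover have "(c / 2)^2 = c^2 / 4" by (simp add: power_divide)
    ultimately show "1 - cos c \<le> c^2" using zero_le_power2[of c] by linarith
  qed (use b M0 A0 in auto)
  finally have "G 0 - G d \<le> b * c^2 * (M / real k0 * (A * exp A)) + (A * exp A * (2 * b^2 * exp b * c^2) + 0)" by simp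
  also have "... = d^2 * (b * (M / real k0) * (A * exp A) + 2 * b^2 * exp b * (A * exp A))" by (simp add: c_def algebra_simps)
  finally show ?thesis by (simp add: G_def exp_add)
qed

section \<open>Likelihood ratios\<close>

lemma PiM_density:
  fixes f :: "'i => 'a => ennreal"
  assumes I: "finite I" and M: "\<And>i. prob_space (M i)" and f: "\<And>i. f i \<in> borel_measurable (M i)"
    and D: "\<And>i. prob_space (density (M i) (f i))"
  shows "PiM I (\<lambda>i. density (M i) (f i)) = density (PiM I M) (\<lambda>x. \<Prod>i\<in>I. f i (x i))"
proof -
  interpret M: product_sigma_finite M by (simp add: product_sigma_finite_def M prob_space_imp_sigma_finite)
  interpret D: product_sigma_finite "\<lambda>i. density (M i) (f i)"
    by (simp add: product_sigma_finite_def D prob_space_imp_sigma_finite)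
  note f[measurable]
  show ?thesis
  proof (rule D.PiM_eqI[symmetric, OF I])
    show "sets (density (PiM I M) (\<lambda>x. \<Prod>i\<in>I. f i (x i))) = sets (PiM I (\<lambda>i. density (M i) (f i)))" by (auto intro!: sets_PiM_cong)
    fix A assume "\<And>i. i \<in> I ==> A i \<in> sets (density (M i) (f i))"
    then have A[measurable]: "\<And>i. i \<in> I ==> A i \<in> sets (M i)" by simp
    have meas: "(\<lambda>x. \<Prod>i\<in>I. f i (x i)) \<in> borel_measurable (PiM I M)" using I by measurable
    have "emeasure (density (PiM I M) (\<lambda>x. \<Prod>i\<in>I. f i (x i))) (Pi\<^sub>E I A)
        = (\<integral>\<^sup>+x. (\<Prod>i\<in>I. f i (x i)) * indicator (Pi\<^sub>E I A) x \<partial>PiM I M)"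
      by (rule emeasure_density[OF meas]) (use A I in \<open>auto intro: sets_PiM_I_finite\<close>)
    also have "... = (\<integral>\<^sup>+x. (\<Prod>i\<in>I. f i (x i) * indicator (A i) (x i)) \<partial>PiM I M)"
    proof (rule nn_integral_cong)
      fix x assume x: "x \<in> space (PiM I M)"
      show "(\<Prod>i\<in>I. f i (x i)) * indicator (Pi\<^sub>E I A) x = (\<Prod>i\<in>I. f i (x i) * indicator (A i) (x i))"
      proof (cases "\<forall>i\<in>I. x i \<in> A i")
        case True
        then have "x \<in> Pi\<^sub>E I A" using x by (auto simp: space_PiM PiE_def)
        then show ?thesis using True by simp
      next
        case False
        then have "x \<notin> Pi\<^sub>E I A" by auto
        moreover obtain i where "i \<in> I" "x i \<notin> A i" using False by blast
        then have "(\<Prod>i\<in>I. f i (x i) * indicator (A i) (x i)) = 0" by (intro prod_zero[OF I] bexI[of _ i]) auto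
        ultimately show ?thesis by simp
      qed
    qed
    also have "... = (\<Prod>i\<in>I. \<integral>\<^sup>+x. f i x * indicator (A i) x \<partial>M i)" using A by (intro M.product_nn_integral_prod I) measurable
    also have "... = (\<Prod>i\<in>I. emeasure (density (M i) (f i)) (A i))" using A by (intro prod.cong refl) (simp add: emeasure_density)
    finally show "emeasure (density (PiM I M) (\<lambda>x. \<Prod>i\<in>I. f i (x i))) (Pi\<^sub>E I A) = (\<Prod>i\<in>I. emeasure (density (M i) (f i)) (A i))" .
  qed
qed

lemma PiM_distr:
  fixes g :: "'i => 'a => 'b"
  assumes I: "finite I" and M: "\<And>i. prob_space (M i)" and g: "\<And>i. g i \<in> M i \<rightarrow>\<^sub>M N i"
  shows "PiM I (\<lambda>i. distr (M i) (N i) (g i)) = distr (PiM I M) (PiM I N) (\<lambda>x. \<lambda>i\<in>I. g i (x i))"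
proof -
  have D: "prob_space (distr (M i) (N i) (g i))" for i by (rule prob_space.prob_space_distr[OF M g])
  interpret M: product_sigma_finite M by (simp add: product_sigma_finite_def M prob_space_imp_sigma_finite)
  interpret D: product_sigma_finite "\<lambda>i. distr (M i) (N i) (g i)"
    by (simp add: product_sigma_finite_def D prob_space_imp_sigma_finite)
  note g[measurable]
  have meas: "(\<lambda>x. \<lambda>i\<in>I. g i (x i)) \<in> PiM I M \<rightarrow>\<^sub>M PiM I N" by measurable
  show ?thesis
  proof (rule D.PiM_eqI[symmetric, OF I])
    show "sets (distr (PiM I M) (PiM I N) (\<lambda>x. \<lambda>i\<in>I. g i (x i))) = sets (PiM I (\<lambda>i. distr (M i) (N i) (g i)))"
      by (auto intro!: sets_PiM_cong)
    fix A assume "\<And>i. i \<in> I ==> A i \<in> sets (distr (M i) (N i) (g i))"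
    then have A[measurable]: "\<And>i. i \<in> I ==> A i \<in> sets (N i)" by simp
    have "emeasure (distr (PiM I M) (PiM I N) (\<lambda>x. \<lambda>i\<in>I. g i (x i))) (Pi\<^sub>E I A)
        = emeasure (PiM I M) ((\<lambda>x. \<lambda>i\<in>I. g i (x i)) -` Pi\<^sub>E I A \<inter> space (PiM I M))"
      by (rule emeasure_distr[OF meas]) (use A I in \<open>auto intro: sets_PiM_I_finite\<close>)
    also have "(\<lambda>x. \<lambda>i\<in>I. g i (x i)) -` Pi\<^sub>E I A \<inter> space (PiM I M) = Pi\<^sub>E I (\<lambda>i. g i -` A i \<inter> space (M i))"
      by (auto simp: space_PiM PiE_def Pi_def extensional_def)
    also have "emeasure (PiM I M) ... = (\<Prod>i\<in>I. emeasure (M i) (g i -` A i \<inter> space (M i)))"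
      using A by (intro M.emeasure_PiM I) measurable
    also have "... = (\<Prod>i\<in>I. emeasure (distr (M i) (N i) (g i)) (A i))"
      using A by (intro prod.cong refl) (simp add: emeasure_distr)
    finally show "emeasure (distr (PiM I M) (PiM I N) (\<lambda>x. \<lambda>i\<in>I. g i (x i))) (Pi\<^sub>E I A)
      = (\<Prod>i\<in>I. emeasure (distr (M i) (N i) (g i)) (A i))" .
  qed
qed

lemma std_normal_shift:
  "distr std_normal_distribution borel ((+) h) = density std_normal_distribution (\<lambda>x. ennreal (exp (h * x - h^2 / 2)))"
proof -
  have "distr std_normal_distribution borel ((+) h) = density lborel (\<lambda>x. ennreal (std_normal_density (x - h)))"
    using density_distr[of "\<lambda>x. ennreal (std_normal_density (x - h))" borel "(+) h" lborel] by (simp add: lborel_distr_plus)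
  also have "... = density lborel (\<lambda>x. ennreal (std_normal_density x) * ennreal (exp (h * x - h^2 / 2)))"
  proof (intro density_cong AE_I2)
    fix x :: real
    have "- (x - h)\<^sup>2 / 2 = - x\<^sup>2 / 2 + (h * x - h^2 / 2)" by (simp add: power2_eq_square algebra_simps diff_divide_distrib add_divide_distrib)
    then have "std_normal_density (x - h) = std_normal_density x * exp (h * x - h^2 / 2)"
      unfolding std_normal_density_def by (simp only: exp_add mult.assoc)
    then show "ennreal (std_normal_density (x - h)) = ennreal (std_normal_density x) * ennreal (exp (h * x - h^2 / 2))"
      by (simp add: ennreal_mult)
  qed simp_all
  also have "... = density std_normal_distribution (\<lambda>x. ennreal (exp (h * x - h^2 / 2)))"
    by (rule density_density_eq[symmetric]) auto
  finally show ?thesis .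
qed

definition dotp :: "nat => rvec => rvec => real" where "dotp K v w = (\<Sum>i\<in>coords K. v i * w i)"

lemma measurable_dotp: "dotp K v \<in> borel_measurable (vec_space K)"
  unfolding dotp_def[abs_def] vec_space_def
  by (intro borel_measurable_sum borel_measurable_times borel_measurable_const measurable_component_singleton)

lemma dotp_cplx: "dotp K v w = (\<Sum>k=1..K. Re (cplx v k * cnj (cplx w k)))"
proof -
  have "dotp K v w = (\<Sum>k=1..K. \<Sum>j\<in>{1, 2}. v (k, j) * w (k, j))"
    unfolding coords_def dotp_def sum.cartesian_product by (simp add: case_prod_unfold)
  then show ?thesis by (simp add: cplx_def)
qed

text \<open>The Cameron-Martin formula in finite dimension, assembled from the one-dimensional shift
  over the coordinates.\<close>

theorem gaussian_noise_shift:
  assumes f[measurable]: "f \<in> borel_measurable (vec_space K)"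
  shows "(\<integral>\<^sup>+z. f (\<lambda>i\<in>coords K. h i + z i) \<partial>gaussian_noise K)
    = (\<integral>\<^sup>+z. f z * ennreal (exp (dotp K h z - dotp K h h / 2)) \<partial>gaussian_noise K)"
proof -
  let ?P = "\<lambda>i::nat \<times> nat. std_normal_distribution"
  have P: "prob_space std_normal_distribution" by (rule prob_space_std_normal)
  have fm: "f \<in> borel_measurable (PiM (coords K) ?P)"
    using f sets_gaussian_noise[of K] by (simp add: gaussian_noise_def cong: measurable_cong_sets)
  have D: "prob_space (density std_normal_distribution (\<lambda>x. ennreal (exp (h i * x - (h i)^2 / 2))))" for i
    unfolding std_normal_shift[symmetric] by (rule prob_space.prob_space_distr[OF P]) simp
  have eq: "distr (gaussian_noise K) (PiM (coords K) (\<lambda>_. borel)) (\<lambda>x. \<lambda>i\<in>coords K. h i + x i)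
      = density (gaussian_noise K) (\<lambda>x. \<Prod>i\<in>coords K. ennreal (exp (h i * x i - (h i)^2 / 2)))" unfolding gaussian_noise_def
    by (subst PiM_density[OF finite_coords P _ D, symmetric], simp,
        subst PiM_distr[OF finite_coords P, symmetric], simp, simp add: std_normal_shift)
  have "(\<integral>\<^sup>+z. f (\<lambda>i\<in>coords K. h i + z i) \<partial>gaussian_noise K)
      = (\<integral>\<^sup>+y. f y \<partial>distr (gaussian_noise K) (PiM (coords K) (\<lambda>_. borel)) (\<lambda>x. \<lambda>i\<in>coords K. h i + x i))"
    using f unfolding gaussian_noise_def vec_space_def by (subst nn_integral_distr) auto
  also have "... = (\<integral>\<^sup>+x. (\<Prod>i\<in>coords K. ennreal (exp (h i * x i - (h i)^2 / 2))) * f x \<partial>gaussian_noise K)" unfolding eq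
  proof (rule nn_integral_density)
    show "(\<lambda>x. \<Prod>i\<in>coords K. ennreal (exp (h i * x i - (h i)^2 / 2))) \<in> borel_measurable (gaussian_noise K)"
      unfolding gaussian_noise_def by measurable
  qed (use fm gaussian_noise_def in simp)
  also have "... = (\<integral>\<^sup>+x. f x * ennreal (exp (dotp K h x - dotp K h h / 2)) \<partial>gaussian_noise K)"
  proof (intro nn_integral_cong)
    fix x
    have "(\<Prod>i\<in>coords K. ennreal (exp (h i * x i - (h i)^2 / 2))) = ennreal (exp (\<Sum>i\<in>coords K. h i * x i - (h i)^2 / 2))"
      by (subst prod_ennreal) (auto simp: exp_sum finite_coords)
    also have "(\<Sum>i\<in>coords K. h i * x i - (h i)^2 / 2) = dotp K h x - dotp K h h / 2"
      by (simp add: dotp_def sum_subtractf sum_divide_distrib power2_eq_square)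
    finally show "(\<Prod>i\<in>coords K. ennreal (exp (h i * x i - (h i)^2 / 2))) * f x
        = f x * ennreal (exp (dotp K h x - dotp K h h / 2))" by (simp add: mult.commute)
  qed
  finally show ?thesis .
qed

lemma gaussian_noise_exp: "(\<integral>\<^sup>+z. ennreal (exp (dotp K h z - c)) \<partial>gaussian_noise K) = ennreal (exp (dotp K h h / 2 - c))"
proof -
  interpret G: prob_space "gaussian_noise K" by (rule prob_space_gaussian_noise)
  have m: "(\<lambda>z. ennreal (exp (dotp K h z - dotp K h h / 2))) \<in> borel_measurable (gaussian_noise K)"
    using measurable_dotp[of K h] by measurable
  have "(\<integral>\<^sup>+z. ennreal (exp (dotp K h z - c)) \<partial>gaussian_noise K)
      = (\<integral>\<^sup>+z. ennreal (exp (dotp K h h / 2 - c)) * ennreal (exp (dotp K h z - dotp K h h / 2)) \<partial>gaussian_noise K)"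
    by (intro nn_integral_cong) (simp add: ennreal_mult[symmetric] exp_add[symmetric])
  also have "... = ennreal (exp (dotp K h h / 2 - c)) * (\<integral>\<^sup>+z. 1 * ennreal (exp (dotp K h z - dotp K h h / 2)) \<partial>gaussian_noise K)"
    using m by (simp add: nn_integral_cmult)
  also have "(\<integral>\<^sup>+z. 1 * ennreal (exp (dotp K h z - dotp K h h / 2)) \<partial>gaussian_noise K) = 1"
    by (subst gaussian_noise_shift[symmetric]) (auto simp: G.emeasure_space_1)
  finally show ?thesis by simp
qed

lemma dotp_self: "dotp K \<theta> \<theta> = (\<Sum>k=1..K. (amplitude \<theta> k)^2)"
  unfolding dotp_cplx cmod_cplx[symmetric] by (intro sum.cong refl) (simp only: complex_norm_square[symmetric] Re_complex_of_real)

lemma dotp_rot_self: "dotp K (rot K \<alpha> \<theta>) (rot K \<alpha> \<theta>) = dotp K \<theta> \<theta>"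
  unfolding dotp_self cmod_cplx[symmetric] by (intro sum.cong refl) (simp only: cplx_rot cmod_rotated)

lemma bounded_borel_rot: "bounded_borel (\<lambda>\<alpha>. rot K \<alpha> \<theta> i)"
  and angle_mean_rot: "i \<in> coords K ==> angle_mean (\<lambda>\<alpha>. rot K \<alpha> \<theta> i) = 0"
proof -
  obtain k j where i: "i = (k, j)" by (cases i)
  define a where "a = (if i \<in> coords K then \<theta> (k, if j = 1 then 1 else 2) else 0)"
  define b where "b = (if j = 1 then \<theta> (k, 2) else - \<theta> (k, 1))"
  have b1: "bounded_borel (\<lambda>\<alpha>. a * cos (real k * \<alpha>) - b * cos (real k * \<alpha> + (- pi / 2)))"
    by (intro bounded_borel_intros bounded_borel_cos)
  have eq: "rot K \<alpha> \<theta> i = a * cos (real k * \<alpha>) - b * cos (real k * \<alpha> + (- pi / 2))" if "i \<in> coords K" for \<alpha>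
    using that unfolding rot_def i a_def b_def by (simp add: cos_diff)
  show "bounded_borel (\<lambda>\<alpha>. rot K \<alpha> \<theta> i)"
  proof (cases "i \<in> coords K")
    case True
    show ?thesis unfolding eq[OF True] by (rule b1)
  qed (simp add: rot_def bounded_borel_intros)
  assume i': "i \<in> coords K"
  then have k: "int k \<noteq> 0" by (simp add: i coords_def)
  have "angle_mean (\<lambda>\<alpha>. a * cos (real k * \<alpha>) - b * cos (real k * \<alpha> + (- pi / 2)))
      = a * angle_mean (\<lambda>\<alpha>. cos (real k * \<alpha>)) - b * angle_mean (\<lambda>\<alpha>. cos (real k * \<alpha> + (- pi / 2)))"
    by (subst angle_mean_diff) (intro bounded_borel_intros bounded_borel_cos | simp only: angle_mean_cmult)+
  also have "... = 0" using angle_mean_cos[OF k, of 0] angle_mean_cos[OF k, of "- pi / 2"] by simp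
  finally show "angle_mean (\<lambda>\<alpha>. rot K \<alpha> \<theta> i) = 0" unfolding eq[OF i'] .
qed

definition lik_exp :: "nat => real => rvec => real => rvec => real" where
  "lik_exp K \<sigma> \<theta> \<alpha> y = dotp K (rot K \<alpha> \<theta>) y / \<sigma>^2 - dotp K \<theta> \<theta> / (2 * \<sigma>^2)"

text \<open>The density of one observation with respect to pure noise, as
  \<open>obs_law_density\<close> shows: the Gaussian shift density averaged over the
  rotation.\<close>

definition lik :: "nat => real => rvec => rvec => real" where "lik K \<sigma> \<theta> y = angle_mean (\<lambda>\<alpha>. exp (lik_exp K \<sigma> \<theta> \<alpha> y))"

definition noise_law :: "nat => real => rvec measure" where
  "noise_law K \<sigma> = distr (gaussian_noise K) (vec_space K) (\<lambda>z. \<lambda>i\<in>coords K. \<sigma> * z i)"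

lemma measurable_scale: "(\<lambda>z. \<lambda>i\<in>coords K. (\<sigma>::real) * z i) \<in> gaussian_noise K \<rightarrow>\<^sub>M vec_space K"
  unfolding gaussian_noise_def vec_space_def by measurable

lemma sets_noise_law [measurable_cong]: "sets (noise_law K \<sigma>) = sets (vec_space K)"
  by (simp add: noise_law_def)

lemma prob_space_noise_law: "prob_space (noise_law K \<sigma>)"
  unfolding noise_law_def by (rule prob_space.prob_space_distr[OF prob_space_gaussian_noise measurable_scale])

lemma nn_integral_noise_law: "f \<in> borel_measurable (vec_space K) ==>
    (\<integral>\<^sup>+y. f y \<partial>noise_law K \<sigma>) = (\<integral>\<^sup>+z. f (\<lambda>i\<in>coords K. \<sigma> * z i) \<partial>gaussian_noise K)"
  unfolding noise_law_def by (rule nn_integral_distr[OF measurable_scale]) simp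

lemma bounded_borel_lik_exp: "bounded_borel (\<lambda>\<alpha>. lik_exp K \<sigma> \<theta> \<alpha> y)"
proof -
  have "bounded_borel (\<lambda>\<alpha>. (\<Sum>i\<in>coords K. rot K \<alpha> \<theta> i * y i) * (1 / \<sigma>^2) - dotp K \<theta> \<theta> / (2 * \<sigma>^2))"
    by (intro bounded_borel_sum bounded_borel_intros bounded_borel_rot)
  then show ?thesis by (simp add: lik_exp_def dotp_def)
qed

lemma measurable_lik_exp_angle: "(\<lambda>\<alpha>. ennreal (exp (lik_exp K \<sigma> \<theta> \<alpha> y))) \<in> borel_measurable uniform_angle"
proof -
  have [measurable]: "(\<lambda>\<alpha>. exp (lik_exp K \<sigma> \<theta> \<alpha> y)) \<in> borel_measurable borel"
    using bounded_borel_intros(6)[OF bounded_borel_lik_exp[of K \<sigma> \<theta> y]] unfolding bounded_borel_def by blast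
  show ?thesis by measurable
qed

text \<open>Jensen's inequality in the form \<open>1 + x \<le> exp x\<close>: the part of the
  exponent that depends on \<open>y\<close> has mean zero over the rotation, since all frequencies
  are positive. The bound is uniform in \<open>y\<close> and lets pure noise replace the true law in
  a chi-square integral.\<close>

lemma lik_ge: "exp (- (dotp K \<theta> \<theta> / (2 * \<sigma>^2))) \<le> lik K \<sigma> \<theta> y"
proof -
  define R where "R = dotp K \<theta> \<theta> / (2 * \<sigma>^2)"
  define X where "X \<alpha> = (\<Sum>i\<in>coords K. y i / \<sigma>^2 * rot K \<alpha> \<theta> i)" for \<alpha>
  have bX: "bounded_borel X" unfolding X_def[abs_def] by (intro bounded_borel_sum bounded_borel_intros bounded_borel_rot)
  have e: "lik_exp K \<sigma> \<theta> \<alpha> y = X \<alpha> - R" for \<alpha> by (simp add: lik_exp_def X_def R_def dotp_def sum_divide_distrib mult.commute)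
  have "angle_mean X = (\<Sum>i\<in>coords K. angle_mean (\<lambda>\<alpha>. y i / \<sigma>^2 * rot K \<alpha> \<theta> i))"
    unfolding X_def[abs_def] by (rule angle_mean_sum) (intro bounded_borel_intros bounded_borel_rot)
  also have "... = 0" by (intro sum.neutral ballI, subst angle_mean_cmult) (simp add: angle_mean_rot)
  finally have X0: "angle_mean X = 0" .
  have "exp (- R) = angle_mean (\<lambda>\<alpha>. exp (- R) * (1 + X \<alpha>))"
    using bX by (simp add: angle_mean_cmult angle_mean_add bounded_borel_intros angle_mean_const X0)
  also have "... \<le> angle_mean (\<lambda>\<alpha>. exp (X \<alpha> - R))"
  proof (rule angle_mean_mono)
    show "exp (- R) * (1 + X \<alpha>) \<le> exp (X \<alpha> - R)" for \<alpha>
      using mult_left_mono[OF exp_ge_add_one_self[of "X \<alpha>"], of "exp (- R)"] by (simp add: exp_add[symmetric])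
  qed (intro bounded_borel_intros bX)+
  finally show ?thesis unfolding lik_def e R_def .
qed

lemma lik_pos: "0 < lik K \<sigma> \<theta> y"
  by (rule less_le_trans[OF _ lik_ge]) simp

lemma ennreal_lik: "ennreal (lik K \<sigma> \<theta> y) = (\<integral>\<^sup>+\<alpha>. ennreal (exp (lik_exp K \<sigma> \<theta> \<alpha> y)) \<partial>uniform_angle)"
  unfolding lik_def by (intro ennreal_angle_mean bounded_borel_intros bounded_borel_lik_exp) simp

lemma measurable_lik_exp_pair: "(\<lambda>x. lik_exp K \<sigma> \<theta> (fst x) (snd x)) \<in> borel_measurable (uniform_angle \<Otimes>\<^sub>M noise_law K \<sigma>)"
proof -
  note borel_measurable_rot[measurable]
  have "(\<lambda>x. lik_exp K \<sigma> \<theta> (fst x) (snd x)) \<in> borel_measurable (borel \<Otimes>\<^sub>M (\<Pi>\<^sub>M i\<in>coords K. borel))"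
    unfolding lik_exp_def dotp_def by measurable
  moreover have "sets (uniform_angle \<Otimes>\<^sub>M noise_law K \<sigma>) = sets (borel \<Otimes>\<^sub>M (\<Pi>\<^sub>M i\<in>coords K. borel))"
    by (intro sets_pair_measure_cong) (auto simp: sets_noise_law vec_space_def)
  ultimately show ?thesis using measurable_cong_sets by blast
qed

lemma measurable_lik_exp: "lik_exp K \<sigma> \<theta> \<alpha> \<in> borel_measurable (vec_space K)"
  unfolding lik_exp_def[abs_def] using measurable_dotp[of K "rot K \<alpha> \<theta>"] by measurable

lemma measurable_lik: "lik K \<sigma> \<theta> \<in> borel_measurable (vec_space K)"
proof -
  interpret U: prob_space uniform_angle by (rule prob_space_uniform_angles)
  have [measurable]: "(\<lambda>x. lik_exp K \<sigma> \<theta> (snd x) (fst x)) \<in> borel_measurable (noise_law K \<sigma> \<Otimes>\<^sub>M uniform_angle)"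
    using measurable_pair_swap[OF measurable_lik_exp_pair[of K \<sigma> \<theta>]] by (simp add: case_prod_unfold)
  have "(\<lambda>y. \<integral>\<^sup>+\<alpha>. ennreal (exp (lik_exp K \<sigma> \<theta> \<alpha> y)) \<partial>uniform_angle) \<in> borel_measurable (noise_law K \<sigma>)"
    by (rule U.borel_measurable_nn_integral) (simp add: case_prod_unfold)
  then have "(\<lambda>y. enn2real (ennreal (lik K \<sigma> \<theta> y))) \<in> borel_measurable (noise_law K \<sigma>)" unfolding ennreal_lik by measurable
  moreover have "enn2real (ennreal (lik K \<sigma> \<theta> y)) = lik K \<sigma> \<theta> y" for y using lik_pos[of K \<sigma> \<theta> y] by simp
  ultimately show ?thesis by (simp add: measurable_cong_sets[OF sets_noise_law refl])
qed

theorem obs_law_density: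
  assumes \<sigma>: "0 < \<sigma>"
  shows "obs_law K \<sigma> \<theta> = density (noise_law K \<sigma>) (\<lambda>y. ennreal (lik K \<sigma> \<theta> y))"
proof (rule measure_eqI)
  fix A assume "A \<in> sets (obs_law K \<sigma> \<theta>)"
  then have A[measurable]: "A \<in> sets (vec_space K)" by (simp add: sets_obs_law)
  interpret U: prob_space uniform_angle by (rule prob_space_uniform_angles)
  interpret N: prob_space "noise_law K \<sigma>" by (rule prob_space_noise_law)
  interpret P: pair_sigma_finite uniform_angle "noise_law K \<sigma>" ..
  note measurable_lik_exp_pair[measurable] measurable_lik_exp[measurable] measurable_lik[measurable]
  have "emeasure (obs_law K \<sigma> \<theta>) A = (\<integral>\<^sup>+y. indicator A y \<partial>obs_law K \<sigma> \<theta>)" by (simp add: sets_obs_law)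
  also have "... = (\<integral>\<^sup>+\<alpha>. \<integral>\<^sup>+z. indicator A (obs_map K \<sigma> \<theta> \<alpha> z) \<partial>gaussian_noise K \<partial>uniform_angle)"
    by (rule nn_integral_obs_law) measurable
  also have "... = (\<integral>\<^sup>+\<alpha>. \<integral>\<^sup>+y. indicator A y * ennreal (exp (lik_exp K \<sigma> \<theta> \<alpha> y)) \<partial>noise_law K \<sigma> \<partial>uniform_angle)"
  proof (intro nn_integral_cong)
    fix \<alpha>
    let ?sc = "\<lambda>z. \<lambda>i\<in>coords K. \<sigma> * z i" and ?h = "\<lambda>i. rot K \<alpha> \<theta> i / \<sigma>"
    have sc: "?sc \<in> vec_space K \<rightarrow>\<^sub>M vec_space K"
      using measurable_scale[of \<sigma> K] by (simp add: measurable_cong_sets[OF sets_gaussian_noise refl])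
    have "obs_map K \<sigma> \<theta> \<alpha> z = ?sc (\<lambda>i\<in>coords K. ?h i + z i)" for z
      unfolding obs_map_def using \<sigma> by (intro restrict_ext) (simp add: distrib_left)
    then have "(\<integral>\<^sup>+z. indicator A (obs_map K \<sigma> \<theta> \<alpha> z) \<partial>gaussian_noise K)
        = (\<integral>\<^sup>+z. indicator A (?sc z) * ennreal (exp (dotp K ?h z - dotp K ?h ?h / 2)) \<partial>gaussian_noise K)"
      using gaussian_noise_shift[of "\<lambda>z. indicator A (?sc z)" K ?h] sc by simp
    also have "... = (\<integral>\<^sup>+z. indicator A (?sc z) * ennreal (exp (lik_exp K \<sigma> \<theta> \<alpha> (?sc z))) \<partial>gaussian_noise K)"
    proof -
      have "dotp K ?h ?h / 2 = dotp K (rot K \<alpha> \<theta>) (rot K \<alpha> \<theta>) / (2 * \<sigma>^2)"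
        unfolding dotp_def by (simp add: sum_divide_distrib power2_eq_square mult_ac)
      moreover have "dotp K ?h z = dotp K (rot K \<alpha> \<theta>) (?sc z) / \<sigma>^2" for z
        unfolding dotp_def sum_divide_distrib using \<sigma> by (intro sum.cong refl) (simp add: power2_eq_square)
      ultimately show ?thesis unfolding lik_exp_def by (simp only: dotp_rot_self)
    qed
    also have "... = (\<integral>\<^sup>+y. indicator A y * ennreal (exp (lik_exp K \<sigma> \<theta> \<alpha> y)) \<partial>noise_law K \<sigma>)"
      by (rule nn_integral_noise_law[symmetric]) measurable
    finally show "(\<integral>\<^sup>+z. indicator A (obs_map K \<sigma> \<theta> \<alpha> z) \<partial>gaussian_noise K)
        = (\<integral>\<^sup>+y. indicator A y * ennreal (exp (lik_exp K \<sigma> \<theta> \<alpha> y)) \<partial>noise_law K \<sigma>)" .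
  qed
  also have "... = (\<integral>\<^sup>+y. \<integral>\<^sup>+\<alpha>. indicator A y * ennreal (exp (lik_exp K \<sigma> \<theta> \<alpha> y)) \<partial>uniform_angle \<partial>noise_law K \<sigma>)"
    by (rule P.Fubini'[symmetric]) (simp add: case_prod_unfold)
  also have "... = (\<integral>\<^sup>+y. ennreal (lik K \<sigma> \<theta> y) * indicator A y \<partial>noise_law K \<sigma>)" unfolding ennreal_lik
    by (intro nn_integral_cong) (subst nn_integral_cmult; simp add: measurable_lik_exp_angle mult.commute)
  also have "... = emeasure (density (noise_law K \<sigma>) (\<lambda>y. ennreal (lik K \<sigma> \<theta> y))) A"
    by (rule emeasure_density[symmetric]) (auto simp: sets_noise_law)
  finally show "emeasure (obs_law K \<sigma> \<theta>) A = emeasure (density (noise_law K \<sigma>) (\<lambda>y. ennreal (lik K \<sigma> \<theta> y))) A" .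
qed (simp add: sets_obs_law sets_noise_law)

text \<open>After exchanging the integrals, the Gaussian exponential moment of the sum of two shifts
  cancels the two squared norms and leaves the inner product.\<close>

theorem lik_product_moment:
  assumes \<sigma>: "0 < \<sigma>"
  shows "(\<integral>\<^sup>+y. ennreal (lik K \<sigma> \<theta> y) * ennreal (lik K \<sigma> \<theta>' y) \<partial>noise_law K \<sigma>)
    = (\<integral>\<^sup>+\<alpha>. \<integral>\<^sup>+\<alpha>'. ennreal (exp (dotp K (rot K \<alpha> \<theta>) (rot K \<alpha>' \<theta>') / \<sigma>^2)) \<partial>uniform_angle \<partial>uniform_angle)"
proof -
  interpret U: prob_space uniform_angle by (rule prob_space_uniform_angles)
  interpret N: prob_space "noise_law K \<sigma>" by (rule prob_space_noise_law)
  interpret P: pair_sigma_finite uniform_angle "noise_law K \<sigma>" ..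
  note measurable_lik_exp_pair[measurable] measurable_lik_exp[measurable] measurable_lik[measurable]
  let ?E = "\<lambda>\<theta> \<alpha> y. ennreal (exp (lik_exp K \<sigma> \<theta> \<alpha> y))"
  have "(\<integral>\<^sup>+y. ennreal (lik K \<sigma> \<theta> y) * ennreal (lik K \<sigma> \<theta>' y) \<partial>noise_law K \<sigma>)
      = (\<integral>\<^sup>+y. \<integral>\<^sup>+\<alpha>. ?E \<theta> \<alpha> y * ennreal (lik K \<sigma> \<theta>' y) \<partial>uniform_angle \<partial>noise_law K \<sigma>)"
    by (subst ennreal_lik) (simp add: nn_integral_multc measurable_lik_exp_angle)
  also have "... = (\<integral>\<^sup>+\<alpha>. \<integral>\<^sup>+y. ?E \<theta> \<alpha> y * ennreal (lik K \<sigma> \<theta>' y) \<partial>noise_law K \<sigma> \<partial>uniform_angle)"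
    by (rule P.Fubini') (simp add: case_prod_unfold)
  also have "... = (\<integral>\<^sup>+\<alpha>. \<integral>\<^sup>+\<alpha>'. \<integral>\<^sup>+y. ?E \<theta> \<alpha> y * ?E \<theta>' \<alpha>' y \<partial>noise_law K \<sigma> \<partial>uniform_angle \<partial>uniform_angle)"
  proof (intro nn_integral_cong)
    fix \<alpha>
    have "(\<integral>\<^sup>+y. ?E \<theta> \<alpha> y * ennreal (lik K \<sigma> \<theta>' y) \<partial>noise_law K \<sigma>)
        = (\<integral>\<^sup>+y. \<integral>\<^sup>+\<alpha>'. ?E \<theta> \<alpha> y * ?E \<theta>' \<alpha>' y \<partial>uniform_angle \<partial>noise_law K \<sigma>)"
      by (subst ennreal_lik) (simp add: nn_integral_cmult measurable_lik_exp_angle)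
    also have "... = (\<integral>\<^sup>+\<alpha>'. \<integral>\<^sup>+y. ?E \<theta> \<alpha> y * ?E \<theta>' \<alpha>' y \<partial>noise_law K \<sigma> \<partial>uniform_angle)"
      by (rule P.Fubini') (simp add: case_prod_unfold)
    finally show "(\<integral>\<^sup>+y. ?E \<theta> \<alpha> y * ennreal (lik K \<sigma> \<theta>' y) \<partial>noise_law K \<sigma>)
        = (\<integral>\<^sup>+\<alpha>'. \<integral>\<^sup>+y. ?E \<theta> \<alpha> y * ?E \<theta>' \<alpha>' y \<partial>noise_law K \<sigma> \<partial>uniform_angle)" .
  qed
  also have "... = (\<integral>\<^sup>+\<alpha>. \<integral>\<^sup>+\<alpha>'. ennreal (exp (dotp K (rot K \<alpha> \<theta>) (rot K \<alpha>' \<theta>') / \<sigma>^2)) \<partial>uniform_angle \<partial>uniform_angle)"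
  proof (intro nn_integral_cong)
    fix \<alpha> \<alpha>'
    define a where "a = rot K \<alpha> \<theta>"
    define a' where "a' = rot K \<alpha>' \<theta>'"
    define c where "c = dotp K a a / (2 * \<sigma>^2) + dotp K a' a' / (2 * \<sigma>^2)"
    let ?h = "\<lambda>i. (a i + a' i) / \<sigma>"
    have m: "(\<lambda>y. ?E \<theta> \<alpha> y * ?E \<theta>' \<alpha>' y) \<in> borel_measurable (vec_space K)" by measurable
    have "(\<integral>\<^sup>+y. ?E \<theta> \<alpha> y * ?E \<theta>' \<alpha>' y \<partial>noise_law K \<sigma>)
        = (\<integral>\<^sup>+z. ?E \<theta> \<alpha> (\<lambda>i\<in>coords K. \<sigma> * z i) * ?E \<theta>' \<alpha>' (\<lambda>i\<in>coords K. \<sigma> * z i) \<partial>gaussian_noise K)"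
      by (rule nn_integral_noise_law[OF m])
    also have "... = (\<integral>\<^sup>+z. ennreal (exp (dotp K ?h z - c)) \<partial>gaussian_noise K)"
    proof (intro nn_integral_cong)
      fix z :: rvec
      have "dotp K b (\<lambda>i\<in>coords K. \<sigma> * z i) / \<sigma>^2 = dotp K (\<lambda>i. b i / \<sigma>) z" for b
        unfolding dotp_def sum_divide_distrib using \<sigma> by (intro sum.cong refl) (simp add: power2_eq_square)
      moreover have "dotp K ?h z = dotp K (\<lambda>i. a i / \<sigma>) z + dotp K (\<lambda>i. a' i / \<sigma>) z"
        unfolding dotp_def by (simp add: sum.distrib add_divide_distrib distrib_right)
      ultimately have "lik_exp K \<sigma> \<theta> \<alpha> (\<lambda>i\<in>coords K. \<sigma> * z i) + lik_exp K \<sigma> \<theta>' \<alpha>' (\<lambda>i\<in>coords K. \<sigma> * z i) = dotp K ?h z - c"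
        unfolding lik_exp_def c_def a_def a'_def dotp_rot_self by simp
      then show "?E \<theta> \<alpha> (\<lambda>i\<in>coords K. \<sigma> * z i) * ?E \<theta>' \<alpha>' (\<lambda>i\<in>coords K. \<sigma> * z i) = ennreal (exp (dotp K ?h z - c))"
        by (simp add: ennreal_mult[symmetric] exp_add[symmetric])
    qed
    also have "... = ennreal (exp (dotp K ?h ?h / 2 - c))" by (rule gaussian_noise_exp)
    also have "dotp K ?h ?h / 2 - c = dotp K a a' / \<sigma>^2"
    proof -
      have "dotp K ?h ?h = (dotp K a a + 2 * dotp K a a' + dotp K a' a') / \<sigma>^2"
        unfolding dotp_def sum_distrib_left sum.distrib[symmetric] sum_divide_distrib
        by (intro sum.cong refl) (simp add: power2_eq_square field_simps)
      then show ?thesis unfolding c_def by (simp add: add_divide_distrib)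
    qed
    finally show "(\<integral>\<^sup>+y. ?E \<theta> \<alpha> y * ?E \<theta>' \<alpha>' y \<partial>noise_law K \<sigma>) = ennreal (exp (dotp K (rot K \<alpha> \<theta>) (rot K \<alpha>' \<theta>') / \<sigma>^2))"
      unfolding a_def a'_def .
  qed
  finally show ?thesis .
qed

text \<open>Reflection and translation remove the outer angle. The inner identity is asserted almost
  everywhere, because the translation lemma covers shifts of at most \<open>2 * pi\<close>.\<close>

lemma nn_integral_angle_difference:
  fixes f :: "real => ennreal"
  assumes f[measurable]: "f \<in> borel_measurable borel" and per: "\<And>t. f (t + 2 * pi) = f t"
  shows "(\<integral>\<^sup>+\<alpha>. \<integral>\<^sup>+\<alpha>'. f (\<alpha> - \<alpha>') \<partial>uniform_angle \<partial>uniform_angle) = (\<integral>\<^sup>+t. f t \<partial>uniform_angle)"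
proof -
  interpret U: prob_space uniform_angle by (rule prob_space_uniform_angles)
  have "AE \<alpha> in uniform_angle. (\<integral>\<^sup>+\<alpha>'. f (\<alpha> - \<alpha>') \<partial>uniform_angle) = (\<integral>\<^sup>+t. f t \<partial>uniform_angle)"
  proof (rule AE_uniform_measureI)
    show "AE \<alpha> in lborel. \<alpha> \<in> angles \<longrightarrow> (\<integral>\<^sup>+\<alpha>'. f (\<alpha> - \<alpha>') \<partial>uniform_angle) = (\<integral>\<^sup>+t. f t \<partial>uniform_angle)"
    proof (intro AE_I2 impI)
      fix \<alpha> assume "\<alpha> \<in> angles"
      then have s: "\<bar>- \<alpha>\<bar> \<le> 2 * pi" using pi_ge_zero by (auto simp: angles_def abs_le_iff)
      have "(\<integral>\<^sup>+\<alpha>'. f (\<alpha> - \<alpha>') \<partial>uniform_angle) = (\<integral>\<^sup>+t. f (t - (- \<alpha>)) \<partial>uniform_angle)"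
        using nn_integral_uniform_angle_reflect[of "\<lambda>t. f (t - (- \<alpha>))"] by (simp add: add.commute)
      also have "... = (\<integral>\<^sup>+t. f t \<partial>uniform_angle)" by (rule nn_integral_uniform_angle_shift[OF f per s])
      finally show "(\<integral>\<^sup>+\<alpha>'. f (\<alpha> - \<alpha>') \<partial>uniform_angle) = (\<integral>\<^sup>+t. f t \<partial>uniform_angle)" .
    qed
  qed (simp add: angles_def)
  then have "(\<integral>\<^sup>+\<alpha>. \<integral>\<^sup>+\<alpha>'. f (\<alpha> - \<alpha>') \<partial>uniform_angle \<partial>uniform_angle) = (\<integral>\<^sup>+\<alpha>. (\<integral>\<^sup>+t. f t \<partial>uniform_angle) \<partial>uniform_angle)"
    by (rule nn_integral_cong_AE)
  then show ?thesis using U.emeasure_space_1 by simp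
qed

section \<open>Chi-square distance under a shift of one phase\<close>

definition phase_kernel :: "nat => (nat => real) => (nat => real) => real => real" where
  "phase_kernel K a u t = exp (\<Sum>k=1..K. a k * cos (real k * t + u k))"

lemma bounded_borel_phase_kernel: "bounded_borel (phase_kernel K a u)"
  unfolding phase_kernel_def[abs_def] by (intro bounded_borel_intros bounded_borel_sum)

text \<open>For equal amplitudes, the inner product of two rotated signals depends only on the
  difference of the angles and on the differences of the phases.\<close>

lemma lik_product_phase:
  assumes \<sigma>: "0 < \<sigma>"
    and p: "\<And>k. k \<in> {1..K} ==> cplx \<theta> k = of_real (r k) * cis (p k)"
    and q: "\<And>k. k \<in> {1..K} ==> cplx \<theta>' k = of_real (r k) * cis (q k)"
  shows "(\<integral>\<^sup>+y. ennreal (lik K \<sigma> \<theta> y) * ennreal (lik K \<sigma> \<theta>' y) \<partial>noise_law K \<sigma>)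
    = ennreal (angle_mean (phase_kernel K (\<lambda>k. (r k)^2 / \<sigma>^2) (\<lambda>k. p k - q k)))"
proof -
  let ?f = "phase_kernel K (\<lambda>k. (r k)^2 / \<sigma>^2) (\<lambda>k. p k - q k)"
  have e: "exp (dotp K (rot K \<alpha> \<theta>) (rot K \<alpha>' \<theta>') / \<sigma>^2) = ?f (\<alpha> - \<alpha>')" for \<alpha> \<alpha>'
  proof -
    have "Re (cplx (rot K \<alpha> \<theta>) k * cnj (cplx (rot K \<alpha>' \<theta>') k)) = (r k)^2 * cos (real k * (\<alpha> - \<alpha>') + (p k - q k))"
      if k: "k \<in> {1..K}" for k
    proof -
      have "cplx (rot K \<alpha> \<theta>) k * cnj (cplx (rot K \<alpha>' \<theta>') k)
          = of_real ((r k)^2) * (cis (real k * \<alpha>) * cis (p k) * (cis (- (real k * \<alpha>')) * cis (- q k)))"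
        unfolding cplx_rot[OF k] rotated_def p[OF k] q[OF k] by (simp add: cis_cnj power2_eq_square)
      also have "... = of_real ((r k)^2) * cis (real k * (\<alpha> - \<alpha>') + (p k - q k))" unfolding cis_mult by (simp add: algebra_simps)
      finally show ?thesis by (simp only: Re_complex_of_real complex_scaleR scaleR_conv_of_real[symmetric] scaleR_complex.sel cis.sel)
    qed
    then show ?thesis unfolding phase_kernel_def dotp_cplx sum_divide_distrib by simp
  qed
  have per: "?f (t + 2 * pi) = ?f t" for t unfolding phase_kernel_def using cos_int_periodic[of "int k" t for k] by simp
  have "(\<integral>\<^sup>+y. ennreal (lik K \<sigma> \<theta> y) * ennreal (lik K \<sigma> \<theta>' y) \<partial>noise_law K \<sigma>)
      = (\<integral>\<^sup>+\<alpha>. \<integral>\<^sup>+\<alpha>'. ennreal (?f (\<alpha> - \<alpha>')) \<partial>uniform_angle \<partial>uniform_angle)" unfolding lik_product_moment[OF \<sigma>] e ..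
  also have "... = (\<integral>\<^sup>+t. ennreal (?f t) \<partial>uniform_angle)" by (rule nn_integral_angle_difference[where f="\<lambda>t. ennreal (?f t)"])
      (use bounded_borel_phase_kernel[of K "\<lambda>k. (r k)^2 / \<sigma>^2" "\<lambda>k. p k - q k"] per in \<open>auto simp: bounded_borel_def\<close>)
  also have "... = ennreal (angle_mean ?f)"
    by (rule ennreal_angle_mean[symmetric, OF bounded_borel_phase_kernel]) (simp add: phase_kernel_def)
  finally show ?thesis .
qed

lemma nn_integral_lik: "0 < \<sigma> ==> (\<integral>\<^sup>+y. ennreal (lik K \<sigma> \<theta> y) \<partial>noise_law K \<sigma>) = 1"
  using prob_space.emeasure_space_1[OF prob_space_obs_law[of K \<sigma> \<theta>]] measurable_lik[of K \<sigma> \<theta>]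
  by (simp add: obs_law_density emeasure_density measurable_cong_sets[OF sets_noise_law refl] cong: nn_integral_cong_simp)

text \<open>The left-hand side equals \<open>2 * g + (g - f)^2 / f\<close>. Keeping \<open>f\<close>
  on the left avoids subtraction once the inequality is integrated in the extended nonnegative
  reals.\<close>

lemma ratio_square_le:
  fixes f g c :: real
  assumes c: "0 < c" and f: "c \<le> f"
  shows "g^2 / f + f \<le> 2 * g + (1 / c) * (g - f)^2"
proof -
  have "g^2 / f + f = 2 * g + (g - f)^2 / f" using c f by (simp add: field_simps power2_eq_square)
  also have "(g - f)^2 / f \<le> (g - f)^2 / c" using c f by (intro divide_left_mono mult_pos_pos) auto
  finally show ?thesis by simp
qed

text \<open>The moment exceeds 1 by the integral of \<open>(g - f)^2 / f\<close>. The pointwise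
  lower bound on \<open>f\<close> replaces the denominator by a constant, and the remaining squared
  distance under pure noise is \<open>F + G - 2 * H\<close>.\<close>

lemma lik_ratio_moment:
  assumes \<sigma>: "0 < \<sigma>"
    and ff: "(\<integral>\<^sup>+y. ennreal (lik K \<sigma> \<theta> y) * ennreal (lik K \<sigma> \<theta> y) \<partial>noise_law K \<sigma>) = ennreal F"
    and gg: "(\<integral>\<^sup>+y. ennreal (lik K \<sigma> \<theta>' y) * ennreal (lik K \<sigma> \<theta>' y) \<partial>noise_law K \<sigma>) = ennreal G"
    and fg: "(\<integral>\<^sup>+y. ennreal (lik K \<sigma> \<theta> y) * ennreal (lik K \<sigma> \<theta>' y) \<partial>noise_law K \<sigma>) = ennreal H"
    and nonneg: "0 \<le> F" "0 \<le> G" "0 \<le> H"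
  shows "(\<integral>\<^sup>+y. ennreal ((lik K \<sigma> \<theta>' y)^2 / lik K \<sigma> \<theta> y) \<partial>noise_law K \<sigma>)
    \<le> ennreal (1 + exp (dotp K \<theta> \<theta> / (2 * \<sigma>^2)) * (F + G - 2 * H))"
proof -
  define f where "f = lik K \<sigma> \<theta>"
  define g where "g = lik K \<sigma> \<theta>'"
  define N where "N = noise_law K \<sigma>"
  define R where "R = dotp K \<theta> \<theta> / (2 * \<sigma>^2)"
  have pos: "0 < f y" "0 < g y" "exp (- R) \<le> f y" for y unfolding f_def g_def R_def by (simp_all add: lik_pos lik_ge)
  have [measurable]: "f \<in> borel_measurable N" "g \<in> borel_measurable N"
    unfolding f_def g_def N_def using measurable_lik by (simp_all add: measurable_cong_sets[OF sets_noise_law refl])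
  have one: "(\<integral>\<^sup>+y. ennreal (f y) \<partial>N) = 1" "(\<integral>\<^sup>+y. ennreal (g y) \<partial>N) = 1"
    unfolding f_def g_def N_def by (simp_all add: nn_integral_lik \<sigma>)
  define D where "D = (\<integral>\<^sup>+y. ennreal ((g y - f y)^2) \<partial>N)"
  \<comment> \<open>The mixed term stays on the left, so that all quantities are sums of nonnegative
    integrals.\<close>
  have DH: "D + ennreal (2 * H) = ennreal (F + G)"
  proof -
    have "D + ennreal (2 * H) = (\<integral>\<^sup>+y. ennreal ((g y - f y)^2) + ennreal 2 * (ennreal (f y) * ennreal (g y)) \<partial>N)"
      unfolding D_def ennreal_mult'[of 2 H, simplified]
      using fg nonneg by (subst nn_integral_add) (auto simp: nn_integral_cmult f_def[symmetric] g_def[symmetric] N_def[symmetric] ennreal_mult)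
    also have "... = (\<integral>\<^sup>+y. ennreal (f y) * ennreal (f y) + ennreal (g y) * ennreal (g y) \<partial>N)"
    proof (intro nn_integral_cong)
      fix y
      have "0 \<le> f y" "0 \<le> g y" using pos[of y] by auto
      then have "ennreal ((g y - f y)^2) + ennreal 2 * (ennreal (f y) * ennreal (g y)) = ennreal ((g y - f y)^2 + 2 * (f y * g y))"
        "ennreal (f y) * ennreal (f y) + ennreal (g y) * ennreal (g y) = ennreal (f y * f y + g y * g y)"
        by (simp_all only: ennreal_mult[symmetric] ennreal_plus[symmetric] mult_nonneg_nonneg zero_le_power2 zero_le_numeral)
      moreover have "(g y - f y)^2 + 2 * (f y * g y) = f y * f y + g y * g y" by (simp add: power2_eq_square algebra_simps)
      ultimately show "ennreal ((g y - f y)^2) + ennreal 2 * (ennreal (f y) * ennreal (g y))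
          = ennreal (f y) * ennreal (f y) + ennreal (g y) * ennreal (g y)" by simp
    qed
    also have "... = ennreal (F + G)"
      using ff gg nonneg by (subst nn_integral_add) (auto simp: f_def[symmetric] g_def[symmetric] N_def[symmetric])
    finally show ?thesis .
  qed
  have "D \<noteq> \<top>" using DH by (auto simp: top_add)
  then obtain d where d: "D = ennreal d" "0 \<le> d" by (cases D) auto
  have dH: "d = F + G - 2 * H" using DH nonneg d by (simp add: ennreal_plus[symmetric] del: ennreal_plus)
  define X where "X = (\<integral>\<^sup>+y. ennreal ((g y)^2 / f y) \<partial>N)"
  have "X + 1 = (\<integral>\<^sup>+y. ennreal ((g y)^2 / f y) + ennreal (f y) \<partial>N)"
    unfolding X_def one(1)[symmetric] by (rule nn_integral_add[symmetric]) auto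
  also have "... \<le> (\<integral>\<^sup>+y. ennreal 2 * ennreal (g y) + ennreal (exp R) * ennreal ((g y - f y)^2) \<partial>N)"
  proof (intro nn_integral_mono)
    fix y
    have "1 / exp (- R) = exp R" by (simp add: exp_minus inverse_eq_divide)
    moreover have "(g y)^2 / f y + f y \<le> 2 * g y + (1 / exp (- R)) * (g y - f y)^2" by (rule ratio_square_le[OF _ pos(3)]) simp
    ultimately have "ennreal ((g y)^2 / f y + f y) \<le> ennreal (2 * g y + exp R * (g y - f y)^2)" by (intro ennreal_leI) (simp only:)
    then show "ennreal ((g y)^2 / f y) + ennreal (f y) \<le> ennreal 2 * ennreal (g y) + ennreal (exp R) * ennreal ((g y - f y)^2)"
      using pos[of y] by (simp add: ennreal_mult)
  qed
  also have "... = ennreal 2 * 1 + ennreal (exp R) * D"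
    unfolding D_def one(2)[symmetric] by (simp add: nn_integral_add nn_integral_cmult)
  also have "... = ennreal (2 + exp R * d)" unfolding d by (simp add: ennreal_mult d(2))
  finally have le: "X + 1 \<le> ennreal (2 + exp R * d)" .
  then have "X \<noteq> \<top>" by (auto simp: top_add top_unique)
  then obtain x where x: "X = ennreal x" "0 \<le> x" by (cases X) auto
  have "ennreal (x + 1) \<le> ennreal (2 + exp R * d)" using le x by simp
  then have "x \<le> 1 + exp R * d" by (subst (asm) ennreal_le_iff) (use d(2) in auto)
  then show ?thesis unfolding X_def[symmetric, unfolded f_def g_def N_def] x(1) dH R_def by (rule ennreal_leI)
qed

text \<open>Both second moments have vanishing phase differences and thus agree, while in the mixed
  moment only the mode \<open>k0\<close> is shifted. Hence \<open>F + G - 2 * H\<close> is twice the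
  gap bounded in \<open>exp_trig_sum_phase_shift\<close>, with all other modes in the cosine
  sum.\<close>

theorem phase_shift_ratio_moment:
  fixes r p q :: "nat => real" and M :: real
  assumes \<sigma>: "0 < \<sigma>"
    and p: "\<And>k. k \<in> {1..K} ==> cplx \<theta> k = of_real (r k) * cis (p k)"
    and q: "\<And>k. k \<in> {1..K} ==> cplx \<theta>' k = of_real (r k) * cis (q k)"
    and k0: "k0 \<in> {1..K}" and eq: "\<And>k. k \<in> {1..K} ==> k \<noteq> k0 ==> q k = p k"
    and d: "\<bar>p k0 - q k0\<bar> \<le> 1" and M: "\<And>k. k \<in> {1..K} ==> real k * ((r k)^2 / \<sigma>^2) \<le> M"
  defines "A \<equiv> \<Sum>k=1..K. (r k)^2 / \<sigma>^2" and "b \<equiv> (r k0)\<^sup>2 / \<sigma>^2"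
  shows "(\<integral>\<^sup>+y. ennreal ((lik K \<sigma> \<theta>' y)^2 / lik K \<sigma> \<theta> y) \<partial>noise_law K \<sigma>)
    \<le> ennreal (1 + 4 * exp (2 * A) * A * (p k0 - q k0)^2 * (b * (M / real k0) + b^2))"
proof -
  define a where "a k = (r k)^2 / \<sigma>^2" for k
  define F where "F = {1..K} - {k0}"
  define A1 where "A1 = (\<Sum>k\<in>F. a k)"
  define \<delta> where "\<delta> = p k0 - q k0"
  define G where "G u = angle_mean (phase_kernel K a u)" for u
  have a0: "0 \<le> a k" for k by (simp add: a_def)
  have b0: "0 \<le> b" by (simp add: b_def)
  have A1_0: "0 \<le> A1" unfolding A1_def by (intro sum_nonneg a0)
  have A: "A = b + A1" unfolding A_def A1_def F_def b_def a_def using k0 by (intro sum.remove) auto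
  have M0: "0 \<le> M" by (rule order_trans[OF _ M[OF k0]]) simp
  have G_pos: "0 \<le> G u" for u
    unfolding G_def angle_mean_def by (intro Bochner_Integration.integral_nonneg) (simp add: phase_kernel_def)
  have kernel: "phase_kernel K a u = (\<lambda>t. exp (trig_sum F a t + b * cos (real k0 * t + u k0)))"
    if u: "\<And>k. k \<in> {1..K} ==> k \<noteq> k0 ==> u k = 0" for u
  proof
    fix t
    have "(\<Sum>k=1..K. a k * cos (real k * t + u k)) = b * cos (real k0 * t + u k0) + (\<Sum>k\<in>F. a k * cos (real k * t + u k))"
      unfolding F_def b_def a_def[symmetric] using k0 by (intro sum.remove) auto
    also have "(\<Sum>k\<in>F. a k * cos (real k * t + u k)) = trig_sum F a t"
      unfolding trig_sum_def F_def by (intro sum.cong refl) (simp add: u)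
    finally show "phase_kernel K a u t = exp (trig_sum F a t + b * cos (real k0 * t + u k0))"
      by (simp add: phase_kernel_def add.commute)
  qed
  have "G (\<lambda>_. 0) - G (\<lambda>k. p k - q k) \<le> \<delta>^2 * (b * (M / real k0) * (A1 * exp A1) + 2 * b^2 * exp b * (A1 * exp A1))"
  proof -
    have "angle_mean (\<lambda>t. exp (trig_sum F a t + b * cos (real k0 * t)))
        - angle_mean (\<lambda>t. exp (trig_sum F a t + b * cos (real k0 * t + \<delta>)))
      \<le> \<delta>^2 * (b * (M / real k0) * (A1 * exp A1) + 2 * b^2 * exp b * (A1 * exp A1))" unfolding A1_def
      by (rule exp_trig_sum_phase_shift) (use k0 M M0 b0 d in \<open>auto simp: F_def a_def \<delta>_def\<close>)
    moreover have "G (\<lambda>_. 0) = angle_mean (\<lambda>t. exp (trig_sum F a t + b * cos (real k0 * t)))"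
      unfolding G_def by (subst kernel) auto
    moreover have "G (\<lambda>k. p k - q k) = angle_mean (\<lambda>t. exp (trig_sum F a t + b * cos (real k0 * t + \<delta>)))"
      unfolding G_def \<delta>_def by (subst kernel) (auto simp: eq)
    ultimately show ?thesis by simp
  qed
  \<comment> \<open>The total \<open>A\<close> includes the mode \<open>k0\<close>, so
    \<open>exp b * exp A1 = exp A\<close> absorbs the exponential of the single mode.\<close>
  also have "... \<le> 2 * A * exp A * \<delta>^2 * (b * (M / real k0) + b^2)"
  proof -
    have 1: "A1 * exp A1 \<le> A * exp A" using A A1_0 b0 by (intro mult_mono) auto
    have 2: "exp b * (A1 * exp A1) \<le> A * exp A" using A A1_0 b0 mult_right_mono[of A1 A "exp A"] by (simp add: exp_add mult_ac)
    have X0: "0 \<le> b * (M / real k0)" using b0 M0 by simp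
    have A0: "0 \<le> A * exp A" using A A1_0 b0 by simp
    have "b * (M / real k0) * (A1 * exp A1) \<le> b * (M / real k0) * (A * exp A)" by (intro mult_left_mono 1 X0)
    moreover have "2 * b^2 * (exp b * (A1 * exp A1)) \<le> 2 * b^2 * (A * exp A)" by (intro mult_left_mono 2) simp
    moreover have "0 \<le> b * (M / real k0) * (A * exp A)" by (intro mult_nonneg_nonneg X0 A0)
    moreover have "x1 \<le> x2 ==> 2 * s * y1 \<le> 2 * s * y2 ==> 0 \<le> x2 ==> x1 + 2 * s * y1 \<le> 2 * (x2 + s * y2)" for x1 x2 s y1 y2 :: real
      by simp
    ultimately have "b * (M / real k0) * (A1 * exp A1) + 2 * b^2 * (exp b * (A1 * exp A1))
        \<le> 2 * (b * (M / real k0) * (A * exp A) + b^2 * (A * exp A))" by blast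
    also have "... = 2 * (A * exp A) * (b * (M / real k0) + b^2)" by (simp only: distrib_left mult_ac)
    also have "2 * b^2 * (exp b * (A1 * exp A1)) = 2 * b^2 * exp b * (A1 * exp A1)" by simp
    finally have "b * (M / real k0) * (A1 * exp A1) + 2 * b^2 * exp b * (A1 * exp A1) \<le> 2 * (A * exp A) * (b * (M / real k0) + b^2)" .
    from mult_left_mono[OF this zero_le_power2[of \<delta>]] show ?thesis by (simp only: mult_ac)
  qed
  finally have gap: "G (\<lambda>_. 0) - G (\<lambda>k. p k - q k) \<le> 2 * A * exp A * \<delta>^2 * (b * (M / real k0) + b^2)" .
  have R: "dotp K \<theta> \<theta> / (2 * \<sigma>^2) = A / 2" unfolding dotp_self A_def sum_divide_distrib
    by (intro sum.cong refl) (simp add: cmod_cplx[symmetric] p norm_mult)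
  have "(\<integral>\<^sup>+y. ennreal ((lik K \<sigma> \<theta>' y)^2 / lik K \<sigma> \<theta> y) \<partial>noise_law K \<sigma>)
      \<le> ennreal (1 + exp (dotp K \<theta> \<theta> / (2 * \<sigma>^2)) * (G (\<lambda>_. 0) + G (\<lambda>_. 0) - 2 * G (\<lambda>k. p k - q k)))"
    using lik_product_phase[OF \<sigma> p p] lik_product_phase[OF \<sigma> q q] lik_product_phase[OF \<sigma> p q]
    by (intro lik_ratio_moment \<sigma> G_pos) (simp_all add: G_def a_def[abs_def])
  also have "... \<le> ennreal (1 + 4 * exp (2 * A) * A * (p k0 - q k0)^2 * (b * (M / real k0) + b^2))"
  proof (rule ennreal_leI)
    define Y where "Y = A * \<delta>^2 * (b * (M / real k0) + b^2)"
    have Y0: "0 \<le> Y" unfolding Y_def using A A1_0 b0 M0 by simp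
    have "exp (A / 2) * (G (\<lambda>_. 0) + G (\<lambda>_. 0) - 2 * G (\<lambda>k. p k - q k)) \<le> exp (A / 2) * (4 * exp A * Y)"
    proof (rule mult_left_mono)
      have "2 * (2 * A * exp A * \<delta>^2 * (b * (M / real k0) + b^2)) = 4 * exp A * Y" by (simp add: Y_def)
      then show "G (\<lambda>_. 0) + G (\<lambda>_. 0) - 2 * G (\<lambda>k. p k - q k) \<le> 4 * exp A * Y" using gap by linarith
    qed simp
    also have "... = exp (A / 2 + A) * (4 * Y)" by (simp only: exp_add mult_ac)
    also have "... \<le> exp (2 * A) * (4 * Y)" using Y0 A A1_0 b0 by (intro mult_right_mono) auto
    finally show "1 + exp (dotp K \<theta> \<theta> / (2 * \<sigma>^2)) * (G (\<lambda>_. 0) + G (\<lambda>_. 0) - 2 * G (\<lambda>k. p k - q k))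
        \<le> 1 + 4 * exp (2 * A) * A * (p k0 - q k0)^2 * (b * (M / real k0) + b^2)" unfolding R Y_def \<delta>_def by (simp add: mult_ac)
  qed
  finally show ?thesis .
qed

section \<open>Testing between two product laws\<close>

text \<open>The ratio moments multiply to at most \<open>(1 + 1 / N) ^ N\<close>, hence at most 3.
  From \<open>G \<le> 3 * F + G^2 / (12 * F)\<close> it follows that the second law gives
  \<open>A\<close> at most three times the mass under the first, plus \<open>1 / 4\<close>. As that
  mass is also at most 1, the two errors cannot sum to less than \<open>1 / 4\<close>.\<close>

theorem product_two_point:
  fixes f g :: "'a => real"
  assumes \<nu>: "prob_space \<nu>" and f[measurable]: "f \<in> borel_measurable \<nu>" and g[measurable]: "g \<in> borel_measurable \<nu>"
    and pos: "\<And>y. 0 < f y" "\<And>y. 0 < g y"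
    and P: "prob_space (density \<nu> (\<lambda>y. ennreal (f y)))" and Q: "prob_space (density \<nu> (\<lambda>y. ennreal (g y)))"
    and ratio: "(\<integral>\<^sup>+y. ennreal ((g y)^2 / f y) \<partial>\<nu>) \<le> ennreal (1 + 1 / real N)" and N: "1 \<le> N"
    and A: "A \<in> sets (PiM {1..N} (\<lambda>_. \<nu>))"
  defines "P' \<equiv> PiM {1..N} (\<lambda>_::nat. density \<nu> (\<lambda>y. ennreal (f y)))" and "Q' \<equiv> PiM {1..N} (\<lambda>_::nat. density \<nu> (\<lambda>y. ennreal (g y)))"
  shows "1 / 4 \<le> measure P' A + measure Q' (space Q' - A)"
proof -
  define \<Omega> where "\<Omega> = PiM {1..N} (\<lambda>_::nat. \<nu>)"
  define F where "F x = (\<Prod>i\<in>{1..N}. f (x i))" for x :: "nat => 'a"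
  define G where "G x = (\<Prod>i\<in>{1..N}. g (x i))" for x :: "nat => 'a"
  interpret S: product_sigma_finite "\<lambda>_::nat. \<nu>" by (simp add: product_sigma_finite_def \<nu> prob_space_imp_sigma_finite)
  have F_pos: "0 < F x" "0 < G x" for x unfolding F_def G_def by (intro prod_pos; simp add: pos)+
  have [measurable]: "F \<in> borel_measurable \<Omega>" "G \<in> borel_measurable \<Omega>" unfolding F_def[abs_def] G_def[abs_def] \<Omega>_def by measurable
  have A'[measurable]: "A \<in> sets \<Omega>" using A by (simp add: \<Omega>_def)
  have P': "P' = density \<Omega> (\<lambda>x. ennreal (F x))" unfolding P'_def \<Omega>_def F_def prod_ennreal[symmetric, OF less_imp_le[OF pos(1)]]
    by (rule PiM_density) (auto intro: \<nu> P)
  have Q': "Q' = density \<Omega> (\<lambda>x. ennreal (G x))" unfolding Q'_def \<Omega>_def G_def prod_ennreal[symmetric, OF less_imp_le[OF pos(2)]]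
    by (rule PiM_density) (auto intro: \<nu> Q)
  interpret P: prob_space P' unfolding P'_def by (intro prob_space_PiM P)
  interpret Q: prob_space Q' unfolding Q'_def by (intro prob_space_PiM Q)
  have "(\<integral>\<^sup>+x. ennreal ((G x)^2 / F x) \<partial>\<Omega>) = (\<integral>\<^sup>+x. (\<Prod>i\<in>{1..N}. ennreal ((g (x i))^2 / f (x i))) \<partial>\<Omega>)"
    using pos by (intro nn_integral_cong) (simp add: prod_ennreal F_def G_def prod_power_distrib[symmetric] prod_dividef less_imp_le)
  also have "... = (\<Prod>i\<in>{1..N}. \<integral>\<^sup>+y. ennreal ((g y)^2 / f y) \<partial>\<nu>)" unfolding \<Omega>_def by (rule S.product_nn_integral_prod) auto
  also have "... \<le> (\<Prod>i\<in>{1..N}. ennreal (1 + 1 / real N))"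
  proof -
    have "x ^ n \<le> y ^ n" if "x \<le> y" for x y :: ennreal and n by (induction n) (auto intro: mult_mono that)
    then show ?thesis using ratio by simp
  qed
  also have "... \<le> ennreal 3"
  proof -
    have "(1 + 1 / real N) ^ N \<le> exp (1 / real N) ^ N" by (intro power_mono exp_ge_add_one_self) simp
    also have "... = exp 1" using N by (simp add: exp_of_nat_mult[symmetric])
    also have "... \<le> 3" by (rule exp_le)
    finally show ?thesis by (simp add: ennreal_power ennreal_leI del: ennreal_numeral ennreal_plus)
  qed
  finally have E: "(\<integral>\<^sup>+x. ennreal ((G x)^2 / F x) \<partial>\<Omega>) \<le> ennreal 3" .
  have "emeasure Q' A = (\<integral>\<^sup>+x. ennreal (G x) * indicator A x \<partial>\<Omega>)" unfolding Q' by (rule emeasure_density) measurable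
  also have "... \<le> (\<integral>\<^sup>+x. ennreal 3 * (ennreal (F x) * indicator A x) + ennreal (1 / 12) * ennreal ((G x)^2 / F x) \<partial>\<Omega>)"
  proof (intro nn_integral_mono)
    fix x
    \<comment> \<open>The source of the weights 3 and \<open>1 / 12\<close>; the latter times the
      moment bound 3 is \<open>1 / 4\<close>.\<close>
    have "0 \<le> (6 * F x - G x)^2" by simp
    then have "12 * (F x * G x) \<le> 36 * (F x * F x) + G x * G x" by (simp add: power2_eq_square algebra_simps)
    then have "G x \<le> 3 * F x + 1 / 12 * ((G x)^2 / F x)" using F_pos[of x] by (simp add: field_simps power2_eq_square)
    then have "ennreal (G x) \<le> ennreal (3 * F x + 1 / 12 * ((G x)^2 / F x))" by (rule ennreal_leI)
    also have "... = ennreal 3 * ennreal (F x) + ennreal (1 / 12) * ennreal ((G x)^2 / F x)"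
      using F_pos(1)[of x] by (simp only: ennreal_plus ennreal_mult mult_nonneg_nonneg divide_nonneg_pos zero_le_power2
          zero_le_numeral less_imp_le zero_le_divide_1_iff)
    finally show "ennreal (G x) * indicator A x \<le> ennreal 3 * (ennreal (F x) * indicator A x) + ennreal (1 / 12) * ennreal ((G x)^2 / F x)"
      by (auto split: split_indicator)
  qed
  also have "... = ennreal 3 * emeasure P' A + ennreal (1 / 12) * (\<integral>\<^sup>+x. ennreal ((G x)^2 / F x) \<partial>\<Omega>)"
    unfolding P' by (subst emeasure_density) (auto simp: nn_integral_add nn_integral_cmult)
  also have "... \<le> ennreal 3 * emeasure P' A + ennreal (1 / 12) * ennreal 3" by (intro add_left_mono mult_left_mono E) simp
  also have "... = ennreal (3 * measure P' A + 1 / 4)"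
    unfolding P.emeasure_eq_measure by (subst ennreal_plus) (auto simp: ennreal_mult[symmetric] simp del: ennreal_numeral)
  finally have "measure Q' A \<le> 3 * measure P' A + 1 / 4" unfolding Q.emeasure_eq_measure by (subst (asm) ennreal_le_iff) auto
  moreover have "measure Q' (space Q' - A) = 1 - measure Q' A" by (rule Q.prob_compl) (simp add: Q')
  moreover have "0 \<le> measure P' A" "measure Q' A \<le> 1" by simp_all
  ultimately show ?thesis by linarith
qed

section \<open>Lower bound\<close>

text \<open>The chord has length \<open>2 * sin y\<close> with \<open>y = \<bar>x\<bar> / 2\<close>,
  and sine has slope at least \<open>1 / 2\<close> on \<open>[0, 1 / 2]\<close>.\<close>

lemma cmod_cis_minus_one_ge:
  assumes x: "\<bar>x\<bar> \<le> 1"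
  shows "x^2 / 4 \<le> (cmod (cis x - 1))^2"
proof -
  define y where "y = \<bar>x\<bar> / 2"
  have y: "0 \<le> y" "y \<le> 1 / 2" using x by (auto simp: y_def)
  have "y / 2 \<le> sin y"
  proof (cases "y = 0")
    case False
    then have y0: "0 < y" using y by simp
    obtain z where z: "0 < z" "z < y" "sin y - sin 0 = (y - 0) * cos z" using MVT2[OF y0, of sin cos] by (auto intro: DERIV_sin)
    have "cos (pi / 3) \<le> cos z" using z y pi_gt3 by (intro cos_monotone_0_pi_le) auto
    then have "y * (1 / 2) \<le> y * cos z" using y by (intro mult_left_mono) (auto simp: cos_60)
    then show ?thesis using z by simp
  qed simp
  then have "(y / 2)^2 \<le> (sin y)^2" using y by (intro power_mono) auto
  moreover have "(cmod (cis x - 1))^2 = 4 * (sin y)^2"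
  proof -
    have "(cmod (cis x - 1))^2 = 2 - 2 * cos \<bar>x\<bar>"
      using sin_cos_squared_add[of x] unfolding cmod_power2 by (simp add: power2_eq_square algebra_simps)
    also have "\<bar>x\<bar> = 2 * y" by (simp add: y_def)
    finally show ?thesis using cos_double_sin[of y] by simp
  qed
  moreover have "4 * (y / 2)^2 = x^2 / 4" by (simp add: y_def power_divide)
  ultimately show ?thesis by linarith
qed

text \<open>The rounding in the lower end keeps both halves of any \<open>k \<le> K\<close>, rounded
  down or up, out of the set.\<close>

definition high_freqs :: "nat => nat set" where "high_freqs K = {(K + 1) div 2<..K}"

lemma high_freqs_subset: "high_freqs K \<subseteq> {1..K}"
  by (auto simp: high_freqs_def)

lemma finite_high_freqs: "finite (high_freqs K)"
  by (simp add: high_freqs_def)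

lemma card_high_freqs: "2 \<le> K ==> real K / 3 \<le> real (card (high_freqs K))"
proof -
  assume K: "2 \<le> K"
  have "card (high_freqs K) = K - (K + 1) div 2" by (simp add: high_freqs_def)
  moreover have "K \<le> 3 * (K - (K + 1) div 2)" using K by linarith
  ultimately show ?thesis by simp
qed

lemma sum_two_to_one_le:
  fixes Y :: "nat => real"
  assumes Y: "\<And>k. 0 \<le> Y k" and F: "finite F" and g: "g ` F \<subseteq> {1..K}"
    and two: "\<And>j. \<exists>a b. {k \<in> F. g k = j} \<subseteq> {a, b}"
  shows "(\<Sum>k\<in>F. Y (g k)) \<le> 2 * (\<Sum>k=1..K. Y k)"
proof -
  have c: "real (card {k \<in> F. g k = j}) \<le> 2" for j
  proof -
    obtain a b where "{k \<in> F. g k = j} \<subseteq> {a, b}" using two by blast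
    then have "card {k \<in> F. g k = j} \<le> card {a, b}" by (intro card_mono) auto
    also have "... \<le> 2" by (cases "a = b") auto
    finally show ?thesis by simp
  qed
  have "(\<Sum>k\<in>F. Y (g k)) = (\<Sum>j=1..K. of_nat (card {k \<in> F. g k = j}) * Y j)" by (rule sum_fun_comp[OF F _ g]) simp
  also have "... \<le> (\<Sum>j=1..K. 2 * Y j)" by (intro sum_mono mult_right_mono c Y)
  finally show ?thesis by (simp add: sum_distrib_left)
qed

text \<open>A rotation cannot undo a phase perturbation of the high frequencies: it would have to move one of
  \<open>k\<close>, \<open>k div 2\<close> and \<open>(k + 1) div 2\<close>, and the latter two are unperturbed.\<close>

lemma phase_separation:
  fixes w v :: "nat => real"
  assumes w: "\<And>k. k \<in> {1..K} ==> W \<le> w k" and W: "0 \<le> W"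
    and v0: "\<And>k. k \<notin> high_freqs K ==> v k = 0" and v1: "\<And>k. \<bar>v k\<bar> \<le> 1"
  shows "W / 60 * (\<Sum>k\<in>high_freqs K. (v k)^2) \<le> (\<Sum>k=1..K. w k * (cmod (cis (real k * t + v k) - 1))^2)"
proof -
  define X where "X k = cmod (cis (real k * t + v k) - 1)" for k
  define F where "F = high_freqs K"
  have F: "finite F" "F \<subseteq> {1..K}" unfolding F_def by (rule finite_high_freqs high_freqs_subset)+
  have each: "(v k)^2 / 4 \<le> 3 * ((X k)^2 + (X (k div 2))^2 + (X ((k + 1) div 2))^2)" if k: "k \<in> F" for k
  proof -
    have "k div 2 + (k + 1) div 2 = k" by linarith
    then have ab: "real k = real (k div 2) + real ((k + 1) div 2)" by (metis of_nat_add)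
    have z: "v (k div 2) = 0" "v ((k + 1) div 2) = 0" using k by (intro v0; auto simp: F_def high_freqs_def)+
    let ?x = "cis (real k * t + v k)" and ?y = "cis (real (k div 2) * t)" and ?z = "cis (real ((k + 1) div 2) * t)"
    have "cis (v k) * (?y * ?z) = ?x" unfolding cis_mult ab by (simp add: algebra_simps)
    then have e: "(cis (v k) - 1) * (?y * ?z) = (?x - 1) - (?y - 1) * ?z - (?z - 1)" by (simp add: algebra_simps)
    have "cmod (cis (v k) - 1) = cmod ((cis (v k) - 1) * (?y * ?z))" by (simp add: norm_mult)
    also have "... \<le> cmod (?x - 1) + cmod ((?y - 1) * ?z) + cmod (?z - 1)"
      unfolding e by (intro order_trans[OF norm_triangle_ineq4] add_mono order.refl norm_triangle_ineq4)
    also have "... = X k + X (k div 2) + X ((k + 1) div 2)" unfolding X_def z by (simp add: norm_mult)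
    finally have "(cmod (cis (v k) - 1))^2 \<le> (X k + X (k div 2) + X ((k + 1) div 2))^2" by (intro power_mono) auto
    also have "... \<le> 3 * ((X k)^2 + (X (k div 2))^2 + (X ((k + 1) div 2))^2)"
      by (rule order_trans[OF power2_sum3_le]) (simp add: distrib_left)
    finally show ?thesis using cmod_cis_minus_one_ge[OF v1[of k]] by linarith
  qed
  have "(\<Sum>k\<in>F. (X k)^2) \<le> (\<Sum>k=1..K. (X k)^2)" using F by (intro sum_mono2) auto
  moreover have "(\<Sum>k\<in>F. (X (k div 2))^2) \<le> 2 * (\<Sum>k=1..K. (X k)^2)"
  proof (rule sum_two_to_one_le[where Y="\<lambda>k. (X k)^2", OF _ F(1)])
    show "\<exists>a b. {k \<in> F. k div 2 = j} \<subseteq> {a, b}" for j by (rule exI[of _ "2 * j"], rule exI[of _ "2 * j + 1"]) auto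
  qed (auto simp: F_def high_freqs_def)
  moreover have "(\<Sum>k\<in>F. (X ((k + 1) div 2))^2) \<le> 2 * (\<Sum>k=1..K. (X k)^2)"
  proof (rule sum_two_to_one_le[where Y="\<lambda>k. (X k)^2", OF _ F(1)])
    show "\<exists>a b. {k \<in> F. (k + 1) div 2 = j} \<subseteq> {a, b}" for j by (rule exI[of _ "2 * j"], rule exI[of _ "2 * j - 1"]) auto
  qed (auto simp: F_def high_freqs_def)
  \<comment> \<open>The three sums contribute 1 + 2 + 2 = 5; with the factor 3 of the squared
    triangle inequality and the 4 of the chord bound this makes 60.\<close>
  ultimately have "(\<Sum>k\<in>F. (X k)^2 + (X (k div 2))^2 + (X ((k + 1) div 2))^2) \<le> 5 * (\<Sum>k=1..K. (X k)^2)"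
    unfolding sum.distrib by linarith
  moreover have "(\<Sum>k\<in>F. (v k)^2 / 4) \<le> (\<Sum>k\<in>F. 3 * ((X k)^2 + (X (k div 2))^2 + (X ((k + 1) div 2))^2))" by (intro sum_mono each)
  ultimately have "(\<Sum>k\<in>F. (v k)^2) / 60 \<le> (\<Sum>k=1..K. (X k)^2)"
    unfolding sum_distrib_left[symmetric] sum_divide_distrib[symmetric] by linarith
  then have "W * ((\<Sum>k\<in>F. (v k)^2) / 60) \<le> W * (\<Sum>k=1..K. (X k)^2)" using W by (rule mult_left_mono)
  also have "... \<le> (\<Sum>k=1..K. w k * (X k)^2)" unfolding sum_distrib_left by (intro sum_mono mult_right_mono w) auto
  finally show ?thesis unfolding X_def F_def by simp
qed

text \<open>Each signal is taken at its own best angle, and the two are compared through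
  \<open>x\<close>. Only the difference of the two angles survives; it is the witness
  \<open>t\<close>.\<close>

lemma loss_sum_ge:
  assumes p: "\<And>k. k \<in> {1..K} ==> cplx \<theta> k = of_real (r k) * cis (p k)"
    and q: "\<And>k. k \<in> {1..K} ==> cplx \<theta>' k = of_real (r k) * cis (q k)"
  shows "\<exists>t. (\<Sum>k=1..K. (r k)^2 * (cmod (cis (real k * t + (p k - q k)) - 1))^2) \<le> 2 * (loss K x \<theta> + loss K x \<theta>')"
proof -
  obtain \<alpha> \<alpha>' where a: "loss K x \<theta> = (\<Sum>k=1..K. (cmod (cplx x k - rotated \<alpha> \<theta> k))^2)"
    "loss K x \<theta>' = (\<Sum>k=1..K. (cmod (cplx x k - rotated \<alpha>' \<theta>' k))^2)" using loss_attained_cmod by meson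
  have "(r k)^2 * (cmod (cis (real k * (\<alpha> - \<alpha>') + (p k - q k)) - 1))^2
      \<le> 2 * ((cmod (cplx x k - rotated \<alpha> \<theta> k))^2 + (cmod (cplx x k - rotated \<alpha>' \<theta>' k))^2)" if k: "k \<in> {1..K}" for k
  proof -
    let ?z = "cis (real k * \<alpha>' + q k)"
    have "rotated \<alpha> \<theta> k = of_real (r k) * (cis (real k * (\<alpha> - \<alpha>') + (p k - q k)) * ?z)" "rotated \<alpha>' \<theta>' k = of_real (r k) * ?z"
      unfolding rotated_def p[OF k] q[OF k] mult.left_commute[of "cis _" "of_real _"] cis_mult by (simp_all add: algebra_simps)
    then have "rotated \<alpha> \<theta> k - rotated \<alpha>' \<theta>' k = of_real (r k) * ((cis (real k * (\<alpha> - \<alpha>') + (p k - q k)) - 1) * ?z)"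
      by (simp add: algebra_simps)
    then have "(r k)^2 * (cmod (cis (real k * (\<alpha> - \<alpha>') + (p k - q k)) - 1))^2
        = (cmod ((cplx x k - rotated \<alpha>' \<theta>' k) - (cplx x k - rotated \<alpha> \<theta> k)))^2" by (simp add: norm_mult power_mult_distrib)
    also have "... \<le> (cmod (cplx x k - rotated \<alpha>' \<theta>' k) + cmod (cplx x k - rotated \<alpha> \<theta> k))^2"
      by (intro power_mono norm_triangle_ineq4) simp
    also have "... \<le> 2 * (cmod (cplx x k - rotated \<alpha>' \<theta>' k))^2 + 2 * (cmod (cplx x k - rotated \<alpha> \<theta> k))^2" by (rule order_trans[OF power2_sum2_le]) simp
    finally show ?thesis by simp
  qed
  then have "(\<Sum>k=1..K. (r k)^2 * (cmod (cis (real k * (\<alpha> - \<alpha>') + (p k - q k)) - 1))^2)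
      \<le> (\<Sum>k=1..K. 2 * ((cmod (cplx x k - rotated \<alpha> \<theta> k))^2 + (cmod (cplx x k - rotated \<alpha>' \<theta>' k))^2))" by (rule sum_mono)
  then show ?thesis unfolding a by (intro exI[of _ "\<alpha> - \<alpha>'"]) (simp add: sum_distrib_left sum.distrib)
qed

text \<open>The worst vertex is at least as bad as the average one. In the average over all
  vertices, those that differ only in \<open>k\<close> are paired, and each pair contributes at
  least \<open>h\<close>.\<close>

lemma assouad_average:
  fixes e :: "'a set => 'a => real"
  assumes F: "finite F" and c: "0 \<le> c"
    and pair: "\<And>k \<tau>. k \<in> F ==> \<tau> \<subseteq> F - {k} ==> h \<le> e \<tau> k + e (insert k \<tau>) k"
    and le: "\<And>\<tau>. \<tau> \<subseteq> F ==> c * (\<Sum>k\<in>F. e \<tau> k) \<le> x"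
  shows "c * (h * real (card F) / 2) \<le> x"
proof -
  define n where "n = (2::real) ^ card F"
  have k: "h * n / 2 \<le> (\<Sum>\<tau>\<in>Pow F. e \<tau> k)" if k: "k \<in> F" for k
  proof -
    have Pow: "Pow F = Pow (F - {k}) \<union> insert k ` Pow (F - {k})" using Pow_insert[of k "F - {k}"] k by (simp add: insert_absorb)
    have "(\<Sum>\<tau>\<in>Pow F. e \<tau> k) = (\<Sum>\<tau>\<in>Pow (F - {k}). e \<tau> k) + (\<Sum>\<tau>\<in>insert k ` Pow (F - {k}). e \<tau> k)"
      unfolding Pow using F by (intro sum.union_disjoint) auto
    also have "(\<Sum>\<tau>\<in>insert k ` Pow (F - {k}). e \<tau> k) = (\<Sum>\<tau>\<in>Pow (F - {k}). e (insert k \<tau>) k)"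
      by (subst sum.reindex) (auto simp: inj_on_def)
    also have "(\<Sum>\<tau>\<in>Pow (F - {k}). e \<tau> k) + ... = (\<Sum>\<tau>\<in>Pow (F - {k}). e \<tau> k + e (insert k \<tau>) k)" by (rule sum.distrib[symmetric])
    also have "... \<ge> (\<Sum>\<tau>\<in>Pow (F - {k}). h)" using k by (intro sum_mono pair) auto
    also have "(\<Sum>\<tau>\<in>Pow (F - {k}). h) = h * n / 2"
    proof -
      have "card F = Suc (card (F - {k}))" by (rule card.remove[OF F k])
      then show ?thesis using F by (simp add: n_def card_Pow)
    qed
    finally show ?thesis .
  qed
  have "n * (c * (h * real (card F) / 2)) = c * (\<Sum>k\<in>F. h * n / 2)" by simp
  also have "... \<le> c * (\<Sum>k\<in>F. \<Sum>\<tau>\<in>Pow F. e \<tau> k)" by (intro mult_left_mono sum_mono k c)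
  also have "... = (\<Sum>\<tau>\<in>Pow F. c * (\<Sum>k\<in>F. e \<tau> k))" by (subst sum.swap) (simp add: sum_distrib_left)
  also have "... \<le> (\<Sum>\<tau>\<in>Pow F. x)" by (intro sum_mono le) auto
  also have "... = n * x" using F by (simp add: n_def card_Pow)
  finally show ?thesis by (simp add: n_def)
qed

section \<open>The cube of phase perturbations and the lower rate\<close>

definition phase_vector :: "nat => (nat => real) => (nat => real) => rvec" where
  "phase_vector K r u = (\<lambda>(k, j)\<in>coords K. r k * (if j = 1 then cos (u k) else sin (u k)))"

lemma cplx_phase_vector: "k \<in> {1..K} ==> cplx (phase_vector K r u) k = of_real (r k) * cis (u k)"
  by (simp add: cplx_def phase_vector_def coords_def complex_eq_iff)

lemma phase_vector_extensional: "phase_vector K r u \<in> coords K \<rightarrow>\<^sub>E UNIV"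
  by (simp add: phase_vector_def PiE_def)

context mra_scales
begin

text \<open>Here 96 is 4 times 24, with 24 from \<open>b * (M / real k0) + b^2\<close>, and the
  exponential bounds that of twice the total signal-to-noise ratio.\<close>

definition chi_const :: real where "chi_const = 96 * S * c_lo ^ 6 * exp (2 * (c_lo^2 * S / c0))"

text \<open>It keeps the perturbation at most 1; dividing by \<open>ln 2\<close> compensates the
  logarithm, as \<open>K \<ge> 2\<close>.\<close>

definition lower_threshold :: real where "lower_threshold = 1 / (chi_const * ln 2)"

text \<open>The number 5760 is 240 times 24: 240 from the cost of one wrong coordinate, 24 from a
  cube of dimension at least \<open>K / 3\<close> and the factor \<open>1 / 8\<close> of the
  averaging.\<close>

definition lower_const :: real where "lower_const = c_lo^2 / (5760 * chi_const)"

lemma chi_const_pos: "0 < chi_const"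
  unfolding chi_const_def using S_ge_1 c_lo by simp

text \<open>In terms of \<open>s = real K * (\<kappa> K)^2 / \<sigma>^2\<close>, the total
  \<open>A\<close> is of order \<open>s\<close>, while the single mode \<open>b\<close> and the
  decay bound \<open>M / real k0\<close> are of order \<open>s / K\<close>. Their product is of
  order \<open>s ^ 3 / K^2\<close>. The monotonicity of \<open>real k * (\<kappa> k)^2\<close>
  supplies \<open>M\<close>, and a high \<open>k0\<close> makes \<open>\<kappa> k0\<close>
  comparable with \<open>\<kappa> K\<close>.\<close>

lemma perturbation_ratio_moment:
  fixes p q :: "nat => real"
  assumes \<kappa>_freq: "\<And>k. k \<in> {1..K} ==> real k * (\<kappa> k)^2 \<le> real K * (\<kappa> K)^2"
    and k0: "k0 \<in> high_freqs K" and eq: "\<And>k. k \<noteq> k0 ==> q k = p k" and d: "\<bar>p k0 - q k0\<bar> \<le> 1"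
  shows "(\<integral>\<^sup>+y. ennreal ((lik K \<sigma> (phase_vector K (\<lambda>k. c_lo * \<kappa> k) q) y)^2 / lik K \<sigma> (phase_vector K (\<lambda>k. c_lo * \<kappa> k) p) y) \<partial>noise_law K \<sigma>)
    \<le> ennreal (1 + chi_const * (p k0 - q k0)^2 * (real K * (\<kappa> K) ^ 6 / \<sigma> ^ 6))"
proof -
  define s where "s = real K * (\<kappa> K)^2 / \<sigma>^2"
  define M where "M = c_lo^2 * s"
  define A where "A = (\<Sum>k=1..K. (c_lo * \<kappa> k)^2 / \<sigma>^2)"
  define b where "b = (c_lo * \<kappa> k0)^2 / \<sigma>^2"
  define d2 where "d2 = (p k0 - q k0)^2"
  have K0: "0 < real K" using K by simp
  have k0': "k0 \<in> {1..K}" "K < 2 * k0" using k0 by (auto simp: high_freqs_def)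
  have s0: "0 \<le> s" by (simp add: s_def)
  have s1: "s \<le> 1 / c0" unfolding s_def using noise c0 \<sigma> by (simp add: field_simps)
  have M_bound: "real k * ((c_lo * \<kappa> k)^2 / \<sigma>^2) \<le> M" if "k \<in> {1..K}" for k
  proof -
    have "c_lo^2 * (real k * (\<kappa> k)^2) / \<sigma>^2 \<le> c_lo^2 * (real K * (\<kappa> K)^2) / \<sigma>^2"
      by (intro divide_right_mono mult_left_mono \<kappa>_freq that) auto
    then show ?thesis by (simp add: M_def s_def power_mult_distrib mult_ac)
  qed
  have A_bound: "A \<le> c_lo^2 * S * s"
  proof -
    have "A = c_lo^2 * (\<Sum>k=1..K. (\<kappa> k)^2) / \<sigma>^2"
      unfolding A_def sum_distrib_left sum_divide_distrib by (simp add: power_mult_distrib)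
    also have "... \<le> c_lo^2 * (S * real K * (\<kappa> K)^2) / \<sigma>^2" by (intro divide_right_mono mult_left_mono \<kappa>_sum) auto
    finally show ?thesis by (simp add: s_def mult_ac)
  qed
  have A0: "0 \<le> A" unfolding A_def by (intro sum_nonneg) simp
  have A_bound': "A \<le> c_lo^2 * S / c0" using A_bound mult_left_mono[OF s1, of "c_lo^2 * S"] S_ge_1 by simp
  have b0: "0 \<le> b" by (simp add: b_def)
  have b_bound: "b \<le> 4 * c_lo^2 * (s / real K)"
  proof -
    have "\<kappa> k0 \<le> 2 * \<kappa> K" using k0' by (intro \<kappa>_high) auto
    then have "(\<kappa> k0)^2 \<le> (2 * \<kappa> K)^2" using \<kappa>_pos[of k0] k0' by (intro power_mono) auto
    then have "c_lo^2 * (\<kappa> k0)^2 / \<sigma>^2 \<le> c_lo^2 * (2 * \<kappa> K)^2 / \<sigma>^2" by (intro divide_right_mono mult_left_mono) auto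
    then show ?thesis using K0 by (simp add: b_def s_def power_mult_distrib mult_ac)
  qed
  have M0: "0 \<le> M" using s0 by (simp add: M_def)
  have Mk: "M / real k0 \<le> 2 * c_lo^2 * (s / real K)"
  proof -
    have "M * real K \<le> M * (2 * real k0)" using k0' M0 by (intro mult_left_mono) auto
    then have "M / real k0 \<le> 2 * M / real K" using K0 k0' by (simp add: field_simps)
    then show ?thesis by (simp add: M_def)
  qed
  have X: "b * (M / real k0) + b^2 \<le> 24 * c_lo ^ 4 * (s / real K)^2"
  proof -
    have "b * (M / real k0) \<le> (4 * c_lo^2 * (s / real K)) * (2 * c_lo^2 * (s / real K))"
      using b0 M0 s0 by (intro mult_mono b_bound Mk) auto
    moreover have "b * b \<le> (4 * c_lo^2 * (s / real K)) * (4 * c_lo^2 * (s / real K))"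
      using b0 s0 by (intro mult_mono b_bound) auto
    moreover have "(4 * x * z) * (2 * x * z) + (4 * x * z) * (4 * x * z) = 24 * (x * x) * (z * z)" for x z :: real by simp
    moreover have "c_lo^2 * c_lo^2 = c_lo ^ 4" by simp
    ultimately show ?thesis unfolding power2_eq_square[of b] power2_eq_square[of "s / real K"] by (metis add_mono)
  qed
  have X0: "0 \<le> b * (M / real k0) + b^2" using b0 M0 by simp
  have "(\<integral>\<^sup>+y. ennreal ((lik K \<sigma> (phase_vector K (\<lambda>k. c_lo * \<kappa> k) q) y)^2 / lik K \<sigma> (phase_vector K (\<lambda>k. c_lo * \<kappa> k) p) y) \<partial>noise_law K \<sigma>)
      \<le> ennreal (1 + 4 * exp (2 * A) * A * d2 * (b * (M / real k0) + b^2))" unfolding A_def b_def d2_def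
    by (rule phase_shift_ratio_moment) (intro \<sigma> cplx_phase_vector k0'(1) eq d M_bound | assumption)+
  also have "... \<le> ennreal (1 + chi_const * d2 * (real K * (\<kappa> K) ^ 6 / \<sigma> ^ 6))"
  proof (intro ennreal_leI add_left_mono)
    have "4 * exp (2 * A) * A * d2 * (b * (M / real k0) + b^2)
        \<le> 4 * exp (2 * (c_lo^2 * S / c0)) * (c_lo^2 * S * s) * d2 * (24 * c_lo ^ 4 * (s / real K)^2)"
      using A_bound A_bound' A0 X X0 s0 S_ge_1 by (intro mult_mono) (auto simp: d2_def)
    also have "... = chi_const * d2 * (s ^ 3 / (real K)^2)" by (simp add: chi_const_def eval_nat_numeral power_divide)
    also have "s ^ 3 / (real K)^2 = real K * (\<kappa> K) ^ 6 / \<sigma> ^ 6"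
      unfolding s_def using K0 \<sigma> by (simp add: power_divide power_mult_distrib eval_nat_numeral)
    finally show "4 * exp (2 * A) * A * d2 * (b * (M / real k0) + b^2) \<le> chi_const * d2 * (real K * (\<kappa> K) ^ 6 / \<sigma> ^ 6)" .
  qed
  finally show ?thesis unfolding d2_def .
qed

text \<open>An estimate is decoded to the vertex of the cube nearest in loss. Every wrongly decoded
  coordinate costs at least \<open>c\<close>, and a single coordinate cannot be tested reliably from
  \<open>N\<close> observations, so on average a fixed fraction of the coordinates is wrong.\<close>

theorem minimax_lower_rate:
  assumes \<kappa>_freq: "\<And>k. k \<in> {1..K} ==> real k * (\<kappa> k)^2 \<le> real K * (\<kappa> K)^2"
    and N: "1 \<le> N" and large: "lower_threshold * (\<sigma> ^ 6 / (\<kappa> K) ^ 6) * ln (real K) \<le> real N"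
    and \<Theta>: "\<And>\<theta>. \<theta> \<in> coords K \<rightarrow>\<^sub>E UNIV ==> (\<And>k. k \<in> {1..K} ==> amplitude \<theta> k = c_lo * \<kappa> k) ==> \<theta> \<in> \<Theta>"
  shows "ennreal (lower_const * (\<sigma> ^ 6 / (real N * (\<kappa> K) ^ 4))) \<le> minimax_risk K N \<sigma> \<Theta>"
  unfolding minimax_risk_def
proof (rule INF_greatest)
  fix est assume "est \<in> estimators K N"
  then have est: "est \<in> (\<Pi>\<^sub>M m\<in>{1..N}. vec_space K) \<rightarrow>\<^sub>M vec_space K" by (simp add: estimators_def)
  define F where "F = high_freqs K"
  define \<delta> where "\<delta> = sqrt (\<sigma> ^ 6 / (chi_const * real N * real K * (\<kappa> K) ^ 6))"
  define u where "u \<tau> k = (if k \<in> \<tau> then \<delta> else 0)" for \<tau> and k :: nat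
  define \<theta> where "\<theta> \<tau> = phase_vector K (\<lambda>k. c_lo * \<kappa> k) (u \<tau>)" for \<tau>
  \<comment> \<open>The factor 240 is 60 from the separation, 2 from the comparison of the losses at
    two vertices, and 2 from passing to the nearest vertex.\<close>
  define c where "c = c_lo^2 * (\<kappa> K)^2 * \<delta>^2 / 240"
  define \<Omega> where "\<Omega> = (\<Pi>\<^sub>M m\<in>{1..N}. vec_space K)"
  have N0: "0 < real N" "0 < real K" using N K by auto
  have \<delta>_sq: "\<delta>^2 = \<sigma> ^ 6 / (chi_const * real N * real K * (\<kappa> K) ^ 6)"
    unfolding \<delta>_def using chi_const_pos \<sigma> \<kappa>K_pos by (intro real_sqrt_pow2) simp
  have \<delta>0: "0 \<le> \<delta>" unfolding \<delta>_def using chi_const_pos \<sigma> \<kappa>K_pos by simp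
  have \<delta>1: "\<delta> \<le> 1"
  proof -
    define T where "T = \<sigma> ^ 6 / (\<kappa> K) ^ 6"
    have T0: "0 < T" unfolding T_def using \<sigma> \<kappa>K_pos by simp
    have "ln 2 \<le> ln (real K)" using K by simp
    then have "T * ln 2 \<le> T * ln (real K)" using T0 by (intro mult_left_mono) auto
    also have "... \<le> real N * (chi_const * ln 2)"
      using large chi_const_pos unfolding lower_threshold_def T_def[symmetric] by (simp add: field_simps)
    finally have "T \<le> chi_const * real N" by (simp add: mult_ac)
    also have "... \<le> chi_const * real N * real K" using K chi_const_pos N0 mult_left_mono[of 1 "real K" "chi_const * real N"] by simp
    finally have "T / (chi_const * real N * real K) \<le> 1" using chi_const_pos N0 by (simp add: divide_le_eq_1)
    then have "\<delta>^2 \<le> 1^2" unfolding \<delta>_sq T_def by (simp add: mult_ac)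
    then show ?thesis by (rule power2_le_imp_le) simp
  qed
  have F: "finite F" "F \<subseteq> {1..K}" unfolding F_def by (rule finite_high_freqs high_freqs_subset)+
  have \<theta>_cplx: "k \<in> {1..K} ==> cplx (\<theta> \<tau>) k = of_real (c_lo * \<kappa> k) * cis (u \<tau> k)" for k \<tau>
    unfolding \<theta>_def by (rule cplx_phase_vector)
  have \<theta>_mem: "\<theta> \<tau> \<in> \<Theta>" for \<tau>
  proof (rule \<Theta>)
    show "\<theta> \<tau> \<in> coords K \<rightarrow>\<^sub>E UNIV" unfolding \<theta>_def by (rule phase_vector_extensional)
    show "amplitude (\<theta> \<tau>) k = c_lo * \<kappa> k" if "k \<in> {1..K}" for k
      unfolding cmod_cplx[symmetric] \<theta>_cplx[OF that] using c_lo \<kappa>_pos[of k] that by (simp add: norm_mult)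
  qed
  have separation: "2 * c * real (card {k \<in> F. (k \<in> \<tau>) \<noteq> (k \<in> \<tau>')}) \<le> loss K v (\<theta> \<tau>) + loss K v (\<theta> \<tau>')"
    if \<tau>: "\<tau> \<subseteq> F" "\<tau>' \<subseteq> F" for v \<tau> \<tau>'
  proof -
    obtain t where t: "(\<Sum>k=1..K. (c_lo * \<kappa> k)^2 * (cmod (cis (real k * t + (u \<tau> k - u \<tau>' k)) - 1))^2)
        \<le> 2 * (loss K v (\<theta> \<tau>) + loss K v (\<theta> \<tau>'))" using loss_sum_ge[OF \<theta>_cplx \<theta>_cplx] by blast
    have "(\<Sum>k\<in>F. (u \<tau> k - u \<tau>' k)^2) = (\<Sum>k\<in>F. if (k \<in> \<tau>) \<noteq> (k \<in> \<tau>') then \<delta>^2 else 0)" by (intro sum.cong refl) (auto simp: u_def)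
    also have "... = \<delta>^2 * real (card {k \<in> F. (k \<in> \<tau>) \<noteq> (k \<in> \<tau>')})" using F(1) by (simp add: sum.If_cases Int_def conj_commute)
    finally have card: "(\<Sum>k\<in>F. (u \<tau> k - u \<tau>' k)^2) = \<delta>^2 * real (card {k \<in> F. (k \<in> \<tau>) \<noteq> (k \<in> \<tau>')})" .
    have "(c_lo * \<kappa> K)^2 / 60 * (\<Sum>k\<in>F. (u \<tau> k - u \<tau>' k)^2)
        \<le> (\<Sum>k=1..K. (c_lo * \<kappa> k)^2 * (cmod (cis (real k * t + (u \<tau> k - u \<tau>' k)) - 1))^2)" unfolding F_def
    proof (rule phase_separation)
      show "(c_lo * \<kappa> K)^2 \<le> (c_lo * \<kappa> k)^2" if "k \<in> {1..K}" for k
        using that \<kappa>_ge[of k] c_lo \<kappa>K_pos by (intro power_mono mult_left_mono) auto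
      show "k \<notin> high_freqs K ==> u \<tau> k - u \<tau>' k = 0" for k using \<tau> by (auto simp: u_def F_def)
      show "\<bar>u \<tau> k - u \<tau>' k\<bar> \<le> 1" for k using \<delta>0 \<delta>1 by (auto simp: u_def)
    qed simp
    also note t
    finally show ?thesis unfolding card by (simp add: c_def power_mult_distrib mult_ac)
  qed
  obtain E where E: "bij_betw E {0..<card (Pow F)} (Pow F)" using ex_bij_betw_nat_finite[of "Pow F"] F by blast
  define n where "n = card (Pow F)"
  \<comment> \<open>The vertices are enumerated and the least index with minimal loss is taken,
    which makes the decoding measurable.\<close>
  define idx where "idx v = (LEAST i. i < n \<and> (\<forall>j<n. loss K v (\<theta> (E i)) \<le> loss K v (\<theta> (E j))))" for v
  have n0: "0 < n" unfolding n_def using F by (simp add: card_Pow)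
  have idx: "idx v < n \<and> (\<forall>j<n. loss K v (\<theta> (E (idx v))) \<le> loss K v (\<theta> (E j)))" for v unfolding idx_def
  proof (rule LeastI_ex)
    have "\<exists>i\<in>{..<n}. \<forall>j\<in>{..<n}. loss K v (\<theta> (E i)) \<le> loss K v (\<theta> (E j))"
      using ex_is_arg_min_if_finite[of "{..<n}" "\<lambda>i. loss K v (\<theta> (E i))"] n0 by (auto simp: is_arg_min_linorder)
    then show "\<exists>i. i < n \<and> (\<forall>j<n. loss K v (\<theta> (E i)) \<le> loss K v (\<theta> (E j)))" by auto
  qed
  define A where "A k = {y \<in> space \<Omega>. k \<in> E (idx (est y))}" for k
  have A_meas: "A k \<in> sets \<Omega>" for k
  proof -
    have le: "Measurable.pred (vec_space K) (\<lambda>v. loss K v a \<le> loss K v b)" for a b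
      unfolding pred_def by (intro borel_measurable_le measurable_loss)
    have "idx \<in> vec_space K \<rightarrow>\<^sub>M count_space UNIV"
      unfolding idx_def[abs_def] by (intro measurable_Least pred_intros_logic pred_intros_countable le) simp_all
    then have "(\<lambda>y. idx (est y)) \<in> \<Omega> \<rightarrow>\<^sub>M count_space UNIV" unfolding \<Omega>_def by (rule measurable_compose[OF est])
    then have "(\<lambda>y. idx (est y)) -` {i. k \<in> E i} \<inter> space \<Omega> \<in> sets \<Omega>" by (rule measurable_sets) simp
    also have "(\<lambda>y. idx (est y)) -` {i. k \<in> E i} \<inter> space \<Omega> = A k" by (auto simp: A_def)
    finally show ?thesis .
  qed
  have E_mem: "E (idx v) \<subseteq> F" for v using E idx[of v] unfolding n_def by (auto simp: bij_betw_def)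
  have loss_ge: "c * real (card {k \<in> F. (k \<in> \<tau>) \<noteq> (k \<in> E (idx v))}) \<le> loss K v (\<theta> \<tau>)" if \<tau>: "\<tau> \<subseteq> F" for \<tau> v
  proof -
    obtain j where "j < n" "E j = \<tau>" using E \<tau> unfolding n_def by (auto simp: bij_betw_def image_iff set_eq_iff) (metis E PowI atLeastLessThan_iff bij_betw_def imageE)
    then have "loss K v (\<theta> (E (idx v))) \<le> loss K v (\<theta> \<tau>)" using idx[of v] by auto
    then show ?thesis using separation[OF \<tau> E_mem, of v v] by linarith
  qed
  define err where "err \<tau> k = (if k \<in> \<tau> then space \<Omega> - A k else A k)" for \<tau> k
  define Pr where "Pr \<tau> = sample_law K N \<sigma> (\<theta> \<tau>)" for \<tau>
  have sets_Pr: "sets (Pr \<tau>) = sets \<Omega>" for \<tau> unfolding Pr_def sample_law_def \<Omega>_def by (intro sets_PiM_cong refl sets_obs_law)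
  have space_Pr: "space (Pr \<tau>) = space \<Omega>" for \<tau> by (rule sets_eq_imp_space_eq[OF sets_Pr])
  have prob_Pr: "prob_space (Pr \<tau>)" for \<tau> unfolding Pr_def sample_law_def by (intro prob_space_PiM prob_space_obs_law)
  have err_meas: "err \<tau> k \<in> sets (Pr \<tau>')" for \<tau> \<tau>' k unfolding err_def sets_Pr using A_meas by auto
  have c0: "0 \<le> c" by (simp add: c_def)
  have risk_ge: "ennreal (c * (\<Sum>k\<in>F. measure (Pr \<tau>) (err \<tau> k))) \<le> risk K N \<sigma> est (\<theta> \<tau>)" if \<tau>: "\<tau> \<subseteq> F" for \<tau>
  proof -
    interpret P: prob_space "Pr \<tau>" by (rule prob_Pr)
    have "ennreal (c * (\<Sum>k\<in>F. measure (Pr \<tau>) (err \<tau> k))) = (\<Sum>k\<in>F. ennreal c * emeasure (Pr \<tau>) (err \<tau> k))"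
      unfolding P.emeasure_eq_measure by (simp add: sum_distrib_left ennreal_mult[symmetric] c0 sum_ennreal)
    also have "... = (\<integral>\<^sup>+y. (\<Sum>k\<in>F. ennreal c * indicator (err \<tau> k) y) \<partial>Pr \<tau>)"
      using err_meas by (subst nn_integral_sum) (auto simp: nn_integral_cmult_indicator)
    also have "... \<le> (\<integral>\<^sup>+y. ennreal (loss K (est y) (\<theta> \<tau>)) \<partial>Pr \<tau>)"
    proof (intro nn_integral_mono)
      fix y assume "y \<in> space (Pr \<tau>)"
      then have y: "y \<in> space \<Omega>" by (simp add: space_Pr)
      have "(\<Sum>k\<in>F. ennreal c * indicator (err \<tau> k) y) = (\<Sum>k\<in>F. ennreal (if (k \<in> \<tau>) \<noteq> (k \<in> E (idx (est y))) then c else 0))"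
        using y by (intro sum.cong refl) (auto simp: err_def A_def)
      also have "... = ennreal (c * real (card {k \<in> F. (k \<in> \<tau>) \<noteq> (k \<in> E (idx (est y)))}))"
        using F(1) c0 by (simp add: sum_ennreal sum.If_cases Int_def conj_commute mult.commute)
      also have "... \<le> ennreal (loss K (est y) (\<theta> \<tau>))" by (intro ennreal_leI loss_ge \<tau>)
      finally show "(\<Sum>k\<in>F. ennreal c * indicator (err \<tau> k) y) \<le> ennreal (loss K (est y) (\<theta> \<tau>))" .
    qed
    finally show ?thesis unfolding risk_def Pr_def .
  qed
  have pair: "1 / 4 \<le> measure (Pr \<tau>) (err \<tau> k) + measure (Pr (insert k \<tau>)) (err (insert k \<tau>) k)"
    if k: "k \<in> F" and \<tau>: "\<tau> \<subseteq> F - {k}" for k \<tau>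
  proof -
    let ?f = "lik K \<sigma> (\<theta> \<tau>)" and ?g = "lik K \<sigma> (\<theta> (insert k \<tau>))"
    have Pr_eq: "Pr \<tau>' = PiM {1..N} (\<lambda>_. density (noise_law K \<sigma>) (\<lambda>y. ennreal (lik K \<sigma> (\<theta> \<tau>') y)))" for \<tau>'
      unfolding Pr_def sample_law_def obs_law_density[OF \<sigma>] ..
    have k\<tau>: "k \<notin> \<tau>" using \<tau> by auto
    have "(\<integral>\<^sup>+y. ennreal ((?g y)^2 / ?f y) \<partial>noise_law K \<sigma>)
        \<le> ennreal (1 + chi_const * (u \<tau> k - u (insert k \<tau>) k)^2 * (real K * (\<kappa> K) ^ 6 / \<sigma> ^ 6))" unfolding \<theta>_def
      by (rule perturbation_ratio_moment[OF \<kappa>_freq]) (use k \<delta>0 \<delta>1 in \<open>auto simp: F_def u_def\<close>)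
    also have "chi_const * (u \<tau> k - u (insert k \<tau>) k)^2 * (real K * (\<kappa> K) ^ 6 / \<sigma> ^ 6) = 1 / real N"
    proof -
      have "(u \<tau> k - u (insert k \<tau>) k)^2 = \<delta>^2" using k\<tau> by (simp add: u_def)
      then show ?thesis unfolding \<delta>_sq using chi_const_pos N0 \<sigma> \<kappa>K_pos by simp
    qed
    finally have ratio: "(\<integral>\<^sup>+y. ennreal ((?g y)^2 / ?f y) \<partial>noise_law K \<sigma>) \<le> ennreal (1 + 1 / real N)" .
    have "1 / 4 \<le> measure (Pr \<tau>) (A k) + measure (Pr (insert k \<tau>)) (space (Pr (insert k \<tau>)) - A k)" unfolding Pr_eq
    proof (rule product_two_point[OF prob_space_noise_law _ _ lik_pos lik_pos _ _ ratio N])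
      show "lik K \<sigma> \<theta>' \<in> borel_measurable (noise_law K \<sigma>)" "lik K \<sigma> \<theta>' \<in> borel_measurable (noise_law K \<sigma>)" for \<theta>'
        using measurable_lik by (simp_all add: measurable_cong_sets[OF sets_noise_law refl])
      show "prob_space (density (noise_law K \<sigma>) (\<lambda>y. ennreal (lik K \<sigma> \<theta>' y)))"
        "prob_space (density (noise_law K \<sigma>) (\<lambda>y. ennreal (lik K \<sigma> \<theta>' y)))" for \<theta>'
        unfolding obs_law_density[OF \<sigma>, symmetric] by (rule prob_space_obs_law)+
      have "sets (PiM {1..N} (\<lambda>_. noise_law K \<sigma>)) = sets \<Omega>" unfolding \<Omega>_def by (intro sets_PiM_cong refl sets_noise_law)
      then show "A k \<in> sets (PiM {1..N} (\<lambda>_. noise_law K \<sigma>))" using A_meas by simp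
    qed
    then show ?thesis using k\<tau> by (simp add: err_def space_Pr)
  qed
  \<comment> \<open>An infinite supremum leaves nothing to prove; otherwise it is a real number, and
    the averaging over the cube takes place in the reals.\<close>
  show "ennreal (lower_const * (\<sigma> ^ 6 / (real N * (\<kappa> K) ^ 4))) \<le> (SUP \<theta>\<in>\<Theta>. risk K N \<sigma> est \<theta>)"
  proof (cases "SUP \<theta>\<in>\<Theta>. risk K N \<sigma> est \<theta>")
    case (real x)
    have "c * (\<Sum>k\<in>F. measure (Pr \<tau>) (err \<tau> k)) \<le> x" if "\<tau> \<subseteq> F" for \<tau>
    proof -
      have "ennreal (c * (\<Sum>k\<in>F. measure (Pr \<tau>) (err \<tau> k))) \<le> (SUP \<theta>\<in>\<Theta>. risk K N \<sigma> est \<theta>)"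
        by (rule order_trans[OF risk_ge[OF that]]) (rule SUP_upper[OF \<theta>_mem])
      then show ?thesis using real by (simp add: ennreal_le_iff)
    qed
    with pair have avg: "c * (1 / 4 * real (card F) / 2) \<le> x"
      by (intro assouad_average[where e="\<lambda>\<tau> k. measure (Pr \<tau>) (err \<tau> k)"] F(1) c0)
    have "lower_const * (\<sigma> ^ 6 / (real N * (\<kappa> K) ^ 4)) = c * (real K / 24)"
      unfolding c_def \<delta>_sq lower_const_def using chi_const_pos N0 \<kappa>K_pos by (simp add: field_simps eval_nat_numeral)
    also have "... \<le> c * (1 / 4 * real (card F) / 2)"
      using card_high_freqs[OF K] unfolding F_def by (intro mult_left_mono c0) simp
    also note avg
    finally show ?thesis unfolding real(2) by (rule ennreal_leI)
  next
    case top
    show ?thesis unfolding top by (rule top_greatest)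
  qed
qed

end

section \<open>Power-law scales and the choice of the constants\<close>

text \<open>Comparison with the integral, as a telescoping sum by the mean value theorem. With
  \<open>s = 2 * \<beta>\<close> it is the origin of \<open>S\<close>.\<close>

lemma sum_powr_le:
  fixes s :: real
  assumes s: "0 \<le> s" "s < 1"
  shows "(\<Sum>k=1..n. real k powr (- s)) \<le> real n powr (1 - s) / (1 - s)"
proof (induction n)
  case (Suc n)
  have "real (Suc n) powr (- s) \<le> (real (Suc n) powr (1 - s) - real n powr (1 - s)) / (1 - s)"
  proof (cases "n = 0")
    case True
    then show ?thesis using s by (simp add: le_divide_eq)
  next
    case False
    have "\<exists>z. real n < z \<and> z < real (Suc n) \<and>
        real (Suc n) powr (1 - s) - real n powr (1 - s) = (real (Suc n) - real n) * ((1 - s) * z powr (1 - s - 1))"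
      using False s by (intro MVT2) (auto intro!: derivative_eq_intros)
    then obtain z where z: "real n < z" "z < real (Suc n)"
      "real (Suc n) powr (1 - s) - real n powr (1 - s) = (1 - s) * z powr (- s)" by auto
    have "real (Suc n) powr (- s) \<le> z powr (- s)" using z s by (intro powr_mono2') auto
    then show ?thesis unfolding z(3) using s by simp
  qed
  then show ?case using Suc.IH by (simp add: diff_divide_distrib)
qed simp

theorem theorem2p1:
  fixes \<beta> c_lo c_hi c0 :: real
  assumes "0 \<le> \<beta>" and "\<beta> < 1 / 2"
    and "0 < c_lo" and "c_lo \<le> c_hi"
    and "0 < c0"
  shows "\<exists>C0 c C :: real. 0 < C0 \<and> 0 < c \<and> 0 < C \<and>
    (\<forall>(K :: nat) (\<sigma> :: real) (N :: nat).
       2 \<le> K \<longrightarrow> 0 < \<sigma> \<longrightarrow> 1 \<le> N \<longrightarrow>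
       c0 * real K powr (1 - 2 * \<beta>) \<le> \<sigma>\<^sup>2 \<longrightarrow>
       C0 * real K powr (6 * \<beta>) * \<sigma> ^ 6 * ln (real K) \<le> real N \<longrightarrow>
         ennreal (c * (real K powr (4 * \<beta>) * \<sigma> ^ 6 / real N))
           \<le> minimax_risk K N \<sigma> (param_space K \<beta> c_lo c_hi) \<and>
         minimax_risk K N \<sigma> (param_space K \<beta> c_lo c_hi)
           \<le> ennreal (C * (real K powr (4 * \<beta>) * \<sigma> ^ 6 / real N)))"
proof -
  define S where "S = 1 / (1 - 2 * \<beta>)"
  define \<kappa> where "\<kappa> k = real k powr (- \<beta>)" for k :: nat
  \<comment> \<open>These constants of the locale depend only on the amplitude bounds,
    \<open>c0\<close> and \<open>S\<close>, not on \<open>K\<close>, \<open>\<sigma>\<close> or the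
    scales. They can therefore be fixed before \<open>K\<close>, \<open>\<sigma>\<close> and
    \<open>N\<close> are chosen.\<close>
  define U L where "U = mra_scales.upper_threshold c_lo c_hi c0 S" and "L = mra_scales.lower_threshold c_lo c0 S"
  define c C where "c = mra_scales.lower_const c_lo c0 S" and "C = mra_scales.upper_const c_lo c_hi c0 S"
  have sq: "(\<kappa> k)^2 = real k powr (- (2 * \<beta>))" for k unfolding \<kappa>_def by (simp add: power2_eq_square powr_add[symmetric])
  have Ksq: "real k * (\<kappa> k)^2 = real k powr (1 - 2 * \<beta>)" for k
    unfolding sq by (cases "k = 0") (auto simp: powr_diff powr_minus divide_inverse)
  have scales: "mra_scales K \<kappa> c_lo c_hi c0 S \<sigma>"
    if K: "2 \<le> K" and \<sigma>: "0 < \<sigma>" and noise: "c0 * real K powr (1 - 2 * \<beta>) \<le> \<sigma>^2" for K \<sigma>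
  proof
    show "2 \<le> K" "0 < c_lo" "c_lo \<le> c_hi" "0 < c0" "0 < \<sigma>" by fact+
    show "0 < \<kappa> k" if "1 \<le> k" for k using that by (simp add: \<kappa>_def)
    show "\<kappa> l \<le> \<kappa> k" if "1 \<le> k" "k \<le> l" for k l unfolding \<kappa>_def using that assms(1) by (intro powr_mono2') auto
    show "\<kappa> k \<le> 1" if "1 \<le> k" for k unfolding \<kappa>_def using that assms(1) powr_mono2'[of "- \<beta>" 1 "real k"] by simp
    show "\<kappa> k \<le> 2 * \<kappa> K" if "K < 4 * k" "k \<le> K" for k
    proof -
      have "\<kappa> k \<le> (real K / 4) powr (- \<beta>)" unfolding \<kappa>_def using that K assms(1) by (intro powr_mono2') auto
      also have "... = 4 powr \<beta> * \<kappa> K" unfolding \<kappa>_def using K by (simp add: powr_divide powr_minus field_simps)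
      also have "... \<le> 4 powr (1 / 2) * \<kappa> K" using assms(2) by (intro mult_right_mono powr_mono) (auto simp: \<kappa>_def)
      also have "(4 :: real) powr (1 / 2) = 2" by (simp add: powr_half_sqrt)
      finally show ?thesis .
    qed
    show "(\<Sum>k=1..K. (\<kappa> k)^2) \<le> S * real K * (\<kappa> K)^2"
      using sum_powr_le[of "2 * \<beta>" K] assms(1,2) unfolding mult.assoc Ksq unfolding sq S_def by simp
    show "1 \<le> real K * (\<kappa> K)^2" unfolding Ksq using K assms(2) by (intro ge_one_powr_ge_zero) auto
    show "c0 * (real K * (\<kappa> K)^2) \<le> \<sigma>^2" unfolding Ksq by (rule noise)
  qed
  \<comment> \<open>Positivity of the constants is a fact of the locale and requires some instance:
    \<open>K = 2\<close> with the smallest admissible noise.\<close>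
  have two: "mra_scales 2 \<kappa> c_lo c_hi c0 S (sqrt (c0 * 2 powr (1 - 2 * \<beta>)))" using assms(5) by (intro scales) auto
  have pos: "0 < U" "0 < L" "0 < c" "0 < C"
  proof -
    interpret mra_scales 2 \<kappa> c_lo c_hi c0 S "sqrt (c0 * 2 powr (1 - 2 * \<beta>))" by (rule two)
    show "0 < U" unfolding U_def upper_threshold_def using block_const_pos by simp
    show "0 < L" unfolding L_def lower_threshold_def using chi_const_pos by simp
    show "0 < c" unfolding c_def lower_const_def using chi_const_pos c_lo by simp
    show "0 < C" unfolding C_def by (rule upper_const_pos)
  qed
  show ?thesis
  proof (rule exI[of _ "max U L"], rule exI[of _ c], rule exI[of _ C], intro conjI allI impI)
    show "0 < max U L" "0 < c" "0 < C" using pos by auto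
    fix K :: nat and \<sigma> :: real and N :: nat
    assume K: "2 \<le> K" and \<sigma>: "0 < \<sigma>" and N: "1 \<le> N" and noise: "c0 * real K powr (1 - 2 * \<beta>) \<le> \<sigma>^2"
      and large: "max U L * real K powr (6 * \<beta>) * \<sigma> ^ 6 * ln (real K) \<le> real N"
    interpret mra_scales K \<kappa> c_lo c_hi c0 S \<sigma> by (rule scales[OF K \<sigma> noise])
    have K0: "0 < real K" using K by simp
    have pw: "inverse ((\<kappa> K) ^ m) = real K powr (real m * \<beta>)" for m
      unfolding \<kappa>_def powr_minus power_inverse[symmetric] using K0 by (simp add: powr_power mult.commute)
    have p6: "\<sigma> ^ 6 / (\<kappa> K) ^ 6 = real K powr (6 * \<beta>) * \<sigma> ^ 6"
      and p4: "\<sigma> ^ 6 / (real N * (\<kappa> K) ^ 4) = real K powr (4 * \<beta>) * \<sigma> ^ 6 / real N"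
      using pw[of 6] pw[of 4] by (simp_all add: divide_inverse mult_ac)
    have threshold: "x * (\<sigma> ^ 6 / (\<kappa> K) ^ 6) * ln (real K) \<le> real N" if "x \<le> max U L" for x
    proof -
      have "x * (real K powr (6 * \<beta>) * \<sigma> ^ 6 * ln (real K)) \<le> max U L * (real K powr (6 * \<beta>) * \<sigma> ^ 6 * ln (real K))"
        using that K \<sigma> by (intro mult_right_mono) auto
      then show ?thesis unfolding p6 using large by (simp add: mult.assoc)
    qed
    show "ennreal (c * (real K powr (4 * \<beta>) * \<sigma> ^ 6 / real N)) \<le> minimax_risk K N \<sigma> (param_space K \<beta> c_lo c_hi)"
      unfolding c_def p4[symmetric]
    proof (rule minimax_lower_rate[OF _ N])
      show "real k * (\<kappa> k)^2 \<le> real K * (\<kappa> K)^2" if "k \<in> {1..K}" for k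
        unfolding Ksq using that assms(2) by (intro powr_mono2) auto
      show "lower_threshold * (\<sigma> ^ 6 / (\<kappa> K) ^ 6) * ln (real K) \<le> real N" by (rule threshold) (simp add: L_def)
      \<comment> \<open>The cube of the lower bound uses signals of minimal amplitude, which
        \<open>c_lo \<le> c_hi\<close> places in the parameter space.\<close>
      show "\<theta> \<in> param_space K \<beta> c_lo c_hi" if "\<theta> \<in> coords K \<rightarrow>\<^sub>E UNIV" "\<And>k. k \<in> {1..K} ==> amplitude \<theta> k = c_lo * \<kappa> k" for \<theta>
        using that c_hi by (auto simp: param_space_def \<kappa>_def intro!: mult_right_mono)
    qed
    show "minimax_risk K N \<sigma> (param_space K \<beta> c_lo c_hi) \<le> ennreal (C * (real K powr (4 * \<beta>) * \<sigma> ^ 6 / real N))"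
      unfolding C_def p4[symmetric]
    proof (rule minimax_upper_rate[OF N])
      show "upper_threshold * (\<sigma> ^ 6 / (\<kappa> K) ^ 6) * ln (real K) \<le> real N" by (rule threshold) (simp add: U_def)
      show "c_lo * \<kappa> k \<le> amplitude \<theta> k \<and> amplitude \<theta> k \<le> c_hi * \<kappa> k" if "\<theta> \<in> param_space K \<beta> c_lo c_hi" "k \<in> {1..K}" for \<theta> k
        using that by (simp add: param_space_def \<kappa>_def)
    qed
  qed
qed

end
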